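(* Let $s\ge1$ and let $\mathcal{T}$ be a homogeneous differential equation on $\mathrm{Imm}\,T^s_nX$, locally $\mathcal{T}=\mathcal{T}_Adx^A$. Then in every chart $\rho^s_n(W^s)$ there exist smooth real functions $T_\sigma$ ($\sigma=1,\dots,m$) such that on $W^s$ $$\mathcal{T}_\sigma=\det(\mathbf{x})\,T_\sigma\circ\rho^s_n,\qquad \mathcal{T}_i=-\det(\mathbf{x})\,\big(y^\sigma_iT_\sigma\big)\circ\rho^s_n .$$ As a consequence, for two overlapping charts of $X$ one has on $\rho^s_n(W^s\cap\bar W^s)$ $$T_\sigma=\mathcal{J}\,P^\nu_\sigma\,\bar T_\nu,$$ and there is a well-defined class $[T]\in\Omega^s_{n+1}(PX)/\Omega^s_{n+1(c)}(PX)$ such that locally $$T=T_\sigma\,\omega^\sigma\wedge\theta_0,\qquad\theta_0=dx^1\wedge\dots\wedge dx^n$$ (i.e. on overlaps the local forms $T_\sigma\omega^\sigma\wedge\theta_0$ and $\bar T_\sigma\bar\omega^\sigma\wedge\bar\theta_0$ differ by a strongly contact form).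
   Context: Velocities. $X$ is a smooth manifold of dimension $N=n+m$, $n\ge 1$. $T^s_nX$ is the manifold of $(s,n)$-velocities, i.e. $s$-jets $j^s_0\gamma$ at $0$ of smooth maps $\gamma$ from a neighbourhood of $0\in\mathbb{R}^n$ to $X$; $\mathrm{Imm}\,T^s_nX$ is the open subset of regular velocities (jets of immersions). A chart $(V,(x^A))$ of $X$ induces coordinates $x^A_{j_1,\dots,j_k}(j^s_0\gamma)=\partial^k(x^A\circ\gamma)/\partial t^{j_1}\cdots\partial t^{j_k}|_0$, $0\le k\le s$, symmetric in the lower indices. For an immersion $\gamma$, $j^s\gamma$ is the map $t\mapsto j^s_0(u\mapsto\gamma(t+u))$. Group and quotient. $L^s_n$ is the group of $s$-jets at $0$ of local diffeomorphisms of $\mathbb{R}^n$ fixing $0$; it acts on the right on $T^s_nX$ by $\phi_a(j^s_0\gamma)=j^s_0\gamma\cdot a=j^s_0(\gamma\circ\alpha)$, $a=j^s_0\alpha$; $\det(a)$ is the Jacobian determinant of $\alpha$ at $0$. $P^s_nX=\mathrm{Imm}\,T^s_nX/L^s_n$, with projection $\rho^s_n$ (a smooth principal bundle). Differential equation on $T^s_nX$ (or $\mathrm{Imm}\,T^s_nX$): a $1$-form $\mathcal{T}$ which in the induced charts has the form $\mathcal{T}=\mathcal{T}_Adx^A$, $\mathcal{T}_A$ smooth functions of the $x^B_J$, $|J|\le s$. It is homogeneous if $(\phi_a)^*\mathcal{T}=\det(a)\mathcal{T}$ for all $a\in L^s_n$ and $(j^s\gamma)^*\mathcal{T}=0$ for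 every immersion $\gamma$ into $X$. Charts. Split the coordinates of a chart of $X$ (in any way) into $x^i$ ($i=1,\dots,n$) and $x^\sigma$ ($\sigma=1,\dots,m$). $W^s$ is the set of regular velocities over $V$ with $\det(\mathbf{x}):=\det(x^i_j)\ne0$; there $(z^i_j)$ is the inverse matrix of $(x^i_j)$ and $y^\sigma=x^\sigma$, $y^\sigma_{i_1,\dots,i_k}=z^j_{i_1}d_jy^\sigma_{i_2,\dots,i_k}$, where $d_j$ is the formal (total) derivative, $d_jx^A_J=x^A_{jJ}$. The $y^\sigma_I$ are symmetric in $I$ and $L^s_n$-invariant, and $(x^i,y^\sigma_I)_{|I|\le s}$ are coordinates on $\rho^s_n(W^s)$. $\Delta_\nu=\partial/\partial y^\nu$ and, on functions of $(x^i,y^\sigma)$, $D_i=\frac{\partial}{\partial x^i}+y^\sigma_i\Delta_\sigma$. Objects of a second chart are barred. On overlaps: $\mathcal{J}=\det(D_i\bar x^j)$ and $P^\sigma_\nu=\Delta_\nu\bar y^\sigma-\bar y^\sigma_i\,\Delta_\nu\bar x^i$. Forms. $\Omega^s_q(PX)$ is the space of smooth $q$-forms on $P^s_nX$. $\omega^\sigma_J=dy^\sigma_J-y^\sigma_{iJ}dx^i$, $|J|\le s-1$; $\omega^\sigma=\omega^\sigma_\emptyset$. For $q>n$, $\Omega^s_{q(c)}(PX)$ is the space of strongly contact $q$-forms: those which in the charts above are sums of terms $\omega^{\sigma_1}_{J_1}\wedge\dots\wedge\omega^{\sigma_p}_{J_p}\wedge d\omega^{\nu_1}_{I_1}\wedge\dots\wedge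 d\omega^{\nu_l}_{I_l}\wedge\Phi$ with $p+l=q-n+1$, $|J_a|\le s-1$, $|I_b|=s-1$ and $\Phi$ an arbitrary form of the appropriate degree (this condition does not depend on the chart). *)

theory Defs
  imports "HOL-Analysis.Analysis" "HOL-Library.Multiset" "HOL-Combinatorics.Permutations"
begin

section \<open>Smooth maps\<close>

text \<open>On an open set \<open>S\<close> of a finite-dimensional space this is the usual class \<open>C^k\<close>.\<close>

primrec Ck_on :: "nat \<Rightarrow> 'a::real_normed_vector set \<Rightarrow> ('a \<Rightarrow> 'b::real_normed_vector) \<Rightarrow> bool" where
  "Ck_on 0 S f \<longleftrightarrow> continuous_on S f"
| "Ck_on (Suc k) S f \<longleftrightarrow>
     (\<forall>x\<in>S. f differentiable (at x)) \<and> (\<forall>v. Ck_on k S (\<lambda>x. frechet_derivative f (at x) v))"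

definition smooth_on :: "'a::real_normed_vector set \<Rightarrow> ('a \<Rightarrow> 'b::real_normed_vector) \<Rightarrow> bool" where
  "smooth_on S f \<longleftrightarrow> (\<forall>k. Ck_on k S f)"

definition partial :: "'k::finite \<Rightarrow> (real^'k \<Rightarrow> real) \<Rightarrow> real^'k \<Rightarrow> real" where
  "partial k f z = frechet_derivative f (at z) (axis k 1)"

primrec partials :: "'k::finite list \<Rightarrow> (real^'k \<Rightarrow> real) \<Rightarrow> real^'k \<Rightarrow> real" where
  "partials [] f = f"
| "partials (j # J) f = partial j (partials J f)"

section \<open>Charts and smooth structures\<close>

type_synonym ('p, 'e) chart = "'p set \<times> ('p \<Rightarrow> 'e)"

definition is_chart :: "('x::topological_space, 'e::euclidean_space) chart \<Rightarrow> bool" where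
  "is_chart c \<longleftrightarrow> open (fst c) \<and> open (snd c ` fst c) \<and>
     homeomorphism (fst c) (snd c ` fst c) (snd c) (inv_into (fst c) (snd c))"

definition transition :: "('p, 'e) chart \<Rightarrow> ('p, 'f) chart \<Rightarrow> 'e \<Rightarrow> 'f" where
  "transition c c' = snd c' \<circ> inv_into (fst c) (snd c)"

definition smoothly_compatible ::
    "('p, 'e::euclidean_space) chart \<Rightarrow> ('p, 'e) chart \<Rightarrow> bool" where
  "smoothly_compatible c c' \<longleftrightarrow>
     smooth_on (snd c ` (fst c \<inter> fst c')) (transition c c') \<and>
     smooth_on (snd c' ` (fst c \<inter> fst c')) (transition c' c)"

text \<open>
  A smooth structure is a maximal atlas. Below, \<open>X\<close> is a second countable Hausdorff space and its
  charts take values in \<open>real^('n + 'm)\<close>: the components \<open>Inl i\<close> are the coordinates \<open>x^i\<close>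
  (\<open>i = 1, ..., n\<close>) and the components \<open>Inr \<sigma>\<close> the coordinates \<open>x^\<sigma>\<close> (\<open>\<sigma> = 1, ..., m\<close>).
  As a maximal atlas is closed under permuting the components of its charts, letting a
  chart range over the atlas also lets the splitting of its coordinates range over all splittings.
\<close>

definition smooth_structure :: "('x::topological_space, 'e::euclidean_space) chart set \<Rightarrow> bool" where
  "smooth_structure \<A> \<longleftrightarrow>
     (\<forall>c\<in>\<A>. is_chart c) \<and> (\<Union>c\<in>\<A>. fst c) = UNIV \<and>
     (\<forall>c\<in>\<A>. \<forall>c'\<in>\<A>. smoothly_compatible c c') \<and>
     (\<forall>c. is_chart c \<and> (\<forall>c'\<in>\<A>. smoothly_compatible c c') \<longrightarrow> c \<in> \<A>)"

definition smooth_fun_on :: "('p, 'e::euclidean_space) chart \<Rightarrow> ('p \<Rightarrow> real) \<Rightarrow> bool" where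
  "smooth_fun_on c f \<longleftrightarrow> smooth_on (snd c ` fst c) (f \<circ> inv_into (fst c) (snd c))"

section \<open>Differential forms\<close>

text \<open>
  A \<open>q\<close>-form on an open set of \<open>'e\<close> is evaluated on a point and a sequence of vectors, of which only
  the entries \<open>0, ..., q - 1\<close> matter.
\<close>

type_synonym 'e eform = "'e \<Rightarrow> (nat \<Rightarrow> 'e) \<Rightarrow> real"

definition smooth_form :: "nat \<Rightarrow> 'e::euclidean_space set \<Rightarrow> 'e eform \<Rightarrow> bool" where
  "smooth_form q S \<omega> \<longleftrightarrow>
     (\<forall>z\<in>S. (\<forall>v w. (\<forall>i<q. v i = w i) \<longrightarrow> \<omega> z v = \<omega> z w) \<and>
            (\<forall>i<q. \<forall>v. linear (\<lambda>x. \<omega> z (v(i := x)))) \<and>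
            (\<forall>i<q. \<forall>j<q. \<forall>v. i \<noteq> j \<and> v i = v j \<longrightarrow> \<omega> z v = 0)) \<and>
     (\<forall>v. smooth_on S (\<lambda>z. \<omega> z v))"

text \<open>Here \<open>\<alpha>\<close> has degree \<open>p\<close> and \<open>\<beta>\<close> has degree \<open>q\<close>.\<close>

definition wedge :: "nat \<Rightarrow> nat \<Rightarrow> 'e eform \<Rightarrow> 'e eform \<Rightarrow> 'e eform" where
  "wedge p q \<alpha> \<beta> z v =
     (\<Sum>\<pi> | \<pi> permutes {..<p + q}.
        of_int (sign \<pi>) * \<alpha> z (\<lambda>i. v (\<pi> i)) * \<beta> z (\<lambda>i. v (\<pi> (p + i)))) / (fact p * fact q)"

text \<open>The wedge product of a list of forms which all have degree \<open>d\<close>.\<close>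

primrec wedge_list :: "nat \<Rightarrow> 'e eform list \<Rightarrow> 'e eform" where
  "wedge_list d [] = (\<lambda>z v. 1)"
| "wedge_list d (\<alpha> # \<alpha>s) = wedge d (d * length \<alpha>s) \<alpha> (wedge_list d \<alpha>s)"

text \<open>The exterior derivative of a form of degree \<open>q\<close>.\<close>

definition ext_d :: "nat \<Rightarrow> 'e::euclidean_space eform \<Rightarrow> 'e eform" where
  "ext_d q \<omega> z v =
     (\<Sum>i\<le>q. (-1) ^ i *
        frechet_derivative (\<lambda>u. \<omega> u (\<lambda>k. if k < i then v k else v (Suc k))) (at z) (v i))"

definition pull_form ::
    "('e::euclidean_space \<Rightarrow> 'f::euclidean_space) \<Rightarrow> 'f eform \<Rightarrow> 'e eform" where
  "pull_form F \<omega> z v = \<omega> (F z) (\<lambda>i. frechet_derivative F (at z) (v i))"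

definition dcoord :: "'k::finite \<Rightarrow> (real^'k) eform" where
  "dcoord k z v = v 0 $ k"

text \<open>
  A form on a manifold is given by its expressions in the charts of an atlas. The relation
  \<open>is_pullback \<C> \<D> F \<eta> \<omega>\<close> says \<open>\<eta> = F\<^sup>* \<omega>\<close> for a map \<open>F\<close> between manifolds with atlases \<open>\<C>\<close>, \<open>\<D>\<close>;
  for \<open>F\<close> the identity it is the transformation law of a form under change of chart.
\<close>

type_synonym ('p, 'e) mform = "('p, 'e) chart \<Rightarrow> 'e eform"

definition is_pullback ::
    "('p, 'e::euclidean_space) chart set \<Rightarrow> ('q, 'f::euclidean_space) chart set \<Rightarrow> ('p \<Rightarrow> 'q) \<Rightarrow>
     ('p, 'e) mform \<Rightarrow> ('q, 'f) mform \<Rightarrow> bool" where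
  "is_pullback \<C> \<D> F \<eta> \<omega> \<longleftrightarrow>
     (\<forall>c\<in>\<C>. \<forall>d\<in>\<D>. \<forall>p\<in>fst c. F p \<in> fst d \<longrightarrow>
        \<eta> c (snd c p) = pull_form (snd d \<circ> F \<circ> inv_into (fst c) (snd c)) (\<omega> d) (snd c p))"

definition mforms :: "('p, 'e::euclidean_space) chart set \<Rightarrow> nat \<Rightarrow> ('p, 'e) mform set" where
  "mforms \<C> q =
     {\<omega>. (\<forall>c\<in>\<C>. smooth_form q (snd c ` fst c) (\<omega> c)) \<and> is_pullback \<C> \<C> id \<omega> \<omega>}"

section \<open>Multi-indices\<close>

text \<open>
  Multi-indices \<open>J\<close> with \<open>\<bar>J\<bar> \<le> s\<close>, where the order \<open>s \<ge> 1\<close> is the cardinality of the type \<open>'s\<close>.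
\<close>

typedef ('n, 's) midx = "{J :: 'n multiset. size J \<le> CARD('s)}"
  by (rule exI[of _ "{#}"]) simp

instance midx :: (finite, type) finite
proof
  have "finite (\<Union>k\<le>CARD('b). mset ` {xs :: 'a list. set xs \<subseteq> UNIV \<and> length xs = k})"
    by (intro finite_UN_I finite_imageI finite_lists_length_eq) auto
  moreover have "{J :: 'a multiset. size J \<le> CARD('b)}
      \<subseteq> (\<Union>k\<le>CARD('b). mset ` {xs :: 'a list. set xs \<subseteq> UNIV \<and> length xs = k})"
  proof
    fix J :: "'a multiset" assume J: "J \<in> {J. size J \<le> CARD('b)}"
    obtain xs where "J = mset xs" using ex_mset by metis
    with J show "J \<in> (\<Union>k\<le>CARD('b). mset ` {xs :: 'a list. set xs \<subseteq> UNIV \<and> length xs = k})"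
      by auto
  qed
  ultimately have "finite {J :: 'a multiset. size J \<le> CARD('b)}"
    by (rule finite_subset[rotated])
  then have "finite (range (Rep_midx :: ('a, 'b) midx \<Rightarrow> 'a multiset))"
    using type_definition.Rep_range[OF type_definition_midx] by metis
  then show "finite (UNIV :: ('a, 'b) midx set)"
    using Rep_midx_inject by (intro finite_imageD[of Rep_midx]) (auto intro: injI)
qed

definition midx_size :: "('n, 's) midx \<Rightarrow> nat" where
  "midx_size J = size (Rep_midx J)"

definition midx_empty :: "('n, 's) midx" where
  "midx_empty = Abs_midx {#}"

text \<open>The multi-index \<open>jJ\<close>; only meaningful for \<open>\<bar>J\<bar> \<le> s - 1\<close>.\<close>

definition midx_add :: "'n \<Rightarrow> ('n, 's) midx \<Rightarrow> ('n, 's) midx" where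
  "midx_add j J = Abs_midx (add_mset j (Rep_midx J))"

definition midx_list :: "('n::linorder, 's) midx \<Rightarrow> 'n list" where
  "midx_list J = sorted_list_of_multiset (Rep_midx J)"

section \<open>Velocities\<close>

definition smooth_map_on ::
    "('x::topological_space, 'e::euclidean_space) chart set \<Rightarrow> (real^'n) set \<Rightarrow>
     (real^'n::finite \<Rightarrow> 'x) \<Rightarrow> bool" where
  "smooth_map_on \<A> U \<gamma> \<longleftrightarrow> open U \<and> continuous_on U \<gamma> \<and>
     (\<forall>c\<in>\<A>. smooth_on {t\<in>U. \<gamma> t \<in> fst c} (snd c \<circ> \<gamma>))"

definition immersion_on ::
    "('x::topological_space, 'e::euclidean_space) chart set \<Rightarrow> (real^'n) set \<Rightarrow>
     (real^'n::finite \<Rightarrow> 'x) \<Rightarrow> bool" where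
  "immersion_on \<A> U \<gamma> \<longleftrightarrow> smooth_map_on \<A> U \<gamma> \<and>
     (\<forall>t\<in>U. \<forall>c\<in>\<A>. \<gamma> t \<in> fst c \<longrightarrow> inj (frechet_derivative (snd c \<circ> \<gamma>) (at t)))"

text \<open>
  The jet \<open>j\<^sup>s\<^sub>0\<gamma>\<close> is the set of all maps which are smooth near \<open>0\<close> and agree with \<open>\<gamma>\<close> to order \<open>s\<close>
  at \<open>0\<close>.
\<close>

type_synonym ('n, 'x) velocity = "(real^'n \<Rightarrow> 'x) set"

definition jet ::
    "('x::topological_space, real^'a::finite) chart set \<Rightarrow> nat \<Rightarrow> (real^'n::finite \<Rightarrow> 'x) \<Rightarrow>
     ('n, 'x) velocity" where
  "jet \<A> s \<gamma> = {\<delta>. (\<exists>U. 0 \<in> U \<and> smooth_map_on \<A> U \<delta>) \<and> \<delta> 0 = \<gamma> 0 \<and>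
     (\<forall>c\<in>\<A>. \<gamma> 0 \<in> fst c \<longrightarrow> (\<forall>A J. length J \<le> s \<longrightarrow>
        partials J (\<lambda>t. snd c (\<delta> t) $ A) 0 = partials J (\<lambda>t. snd c (\<gamma> t) $ A) 0))}"

definition regular_velocities ::
    "('x::topological_space, real^'a::finite) chart set \<Rightarrow> nat \<Rightarrow> ('n::finite, 'x) velocity set" where
  "regular_velocities \<A> s = {jet \<A> s \<gamma> |\<gamma>. \<exists>U. 0 \<in> U \<and> immersion_on \<A> U \<gamma>}"

definition prolong ::
    "('x::topological_space, real^'a::finite) chart set \<Rightarrow> nat \<Rightarrow> (real^'n::finite \<Rightarrow> 'x) \<Rightarrow>
     real^'n \<Rightarrow> ('n, 'x) velocity" where
  "prolong \<A> s \<gamma> t = jet \<A> s (\<lambda>u. \<gamma> (t + u))"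

definition base_point :: "('n::finite, 'x) velocity \<Rightarrow> 'x" where
  "base_point v = (SOME \<gamma>. \<gamma> \<in> v) 0"

definition vel_coord ::
    "('x \<Rightarrow> real^'a::finite) \<Rightarrow> 'a \<Rightarrow> 'n::finite list \<Rightarrow> ('n, 'x) velocity \<Rightarrow> real" where
  "vel_coord \<phi> A J v = partials J (\<lambda>t. \<phi> ((SOME \<gamma>. \<gamma> \<in> v) t) $ A) 0"

text \<open>The chart of the manifold of regular velocities induced by a chart of \<open>X\<close>.\<close>

definition vel_chart ::
    "('x::topological_space, real^'a::finite) chart set \<Rightarrow> ('x, real^'a) chart \<Rightarrow>
     (('n::{finite,linorder}, 'x) velocity, real^('a \<times> ('n, 's) midx)) chart" where
  "vel_chart \<A> c = ({v \<in> regular_velocities \<A> CARD('s). base_point v \<in> fst c},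
     (\<lambda>v. \<chi> k. vel_coord (snd c) (fst k) (midx_list (snd k)) v))"

definition vel_atlas ::
    "('x::topological_space, real^'a::finite) chart set \<Rightarrow>
     (('n::{finite,linorder}, 'x) velocity, real^('a \<times> ('n, 's) midx)) chart set" where
  "vel_atlas \<A> = vel_chart \<A> ` \<A>"

section \<open>The differential group and the quotient\<close>

definition local_diffeo :: "(real^'n::finite \<Rightarrow> real^'n) \<Rightarrow> bool" where
  "local_diffeo \<alpha> \<longleftrightarrow> \<alpha> 0 = 0 \<and>
     (\<exists>U. open U \<and> 0 \<in> U \<and> open (\<alpha> ` U) \<and> inj_on \<alpha> U \<and>
        smooth_on U \<alpha> \<and> smooth_on (\<alpha> ` U) (inv_into U \<alpha>))"

definition group_jet :: "nat \<Rightarrow> (real^'n::finite \<Rightarrow> real^'n) \<Rightarrow> (real^'n \<Rightarrow> real^'n) set" where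
  "group_jet s \<alpha> = {\<beta>. (\<exists>U. open U \<and> 0 \<in> U \<and> smooth_on U \<beta>) \<and>
     (\<forall>i J. length J \<le> s \<longrightarrow> partials J (\<lambda>t. \<beta> t $ i) 0 = partials J (\<lambda>t. \<alpha> t $ i) 0)}"

definition diff_group :: "nat \<Rightarrow> (real^'n::finite \<Rightarrow> real^'n) set set" where
  "diff_group s = {group_jet s \<alpha> |\<alpha>. local_diffeo \<alpha>}"

definition jet_det :: "(real^'n::finite \<Rightarrow> real^'n) set \<Rightarrow> real" where
  "jet_det a = det (matrix (frechet_derivative (SOME \<alpha>. \<alpha> \<in> a) (at 0)))"

text \<open>
  The right action \<open>\<phi>\<^sub>a v = v \<cdot> a\<close>. All the jets in the union coincide, since the composite jet does
  not depend on the representatives.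
\<close>

definition act ::
    "('x::topological_space, real^'a::finite) chart set \<Rightarrow> nat \<Rightarrow> (real^'n::finite \<Rightarrow> real^'n) set \<Rightarrow>
     ('n, 'x) velocity \<Rightarrow> ('n, 'x) velocity" where
  "act \<A> s a v = (\<Union>\<gamma>\<in>v. \<Union>\<alpha>\<in>a. jet \<A> s (\<gamma> \<circ> \<alpha>))"

definition rho ::
    "('x::topological_space, real^'a::finite) chart set \<Rightarrow> nat \<Rightarrow> ('n::finite, 'x) velocity \<Rightarrow>
     ('n, 'x) velocity set" where
  "rho \<A> s v = (\<lambda>a. act \<A> s a v) ` diff_group s"

section \<open>Homogeneous differential equations\<close>

text \<open>The component \<open>\<T>\<^sub>A\<close>, i.e. the value on \<open>\<partial>/\<partial>x^A\<close>, as a function of the coordinates.\<close>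

definition component ::
    "(('n::{finite,linorder}, 'x) velocity, real^('a::finite \<times> ('n, 's) midx)) mform \<Rightarrow>
     (('n, 'x) velocity, real^('a \<times> ('n, 's) midx)) chart \<Rightarrow> 'a \<Rightarrow>
     real^('a \<times> ('n, 's) midx) \<Rightarrow> real" where
  "component \<T> d A z = \<T> d z (\<lambda>_. axis (A, midx_empty) 1)"

definition differential_equation ::
    "('x::topological_space, real^'a::finite) chart set \<Rightarrow>
     (('n::{finite,linorder}, 'x) velocity, real^('a \<times> ('n, 's) midx)) mform \<Rightarrow> bool" where
  "differential_equation \<A> \<T> \<longleftrightarrow> \<T> \<in> mforms (vel_atlas \<A>) 1 \<and>
     (\<forall>d\<in>vel_atlas \<A>.
        (\<forall>A. smooth_on (snd d ` fst d) (component \<T> d A)) \<and>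
        (\<forall>z\<in>snd d ` fst d. \<forall>v.
           \<T> d z v = (\<Sum>A\<in>UNIV. component \<T> d A z * dcoord (A, midx_empty) z v)))"

definition homogeneous ::
    "('x::topological_space, real^'a::finite) chart set \<Rightarrow>
     (('n::{finite,linorder}, 'x) velocity, real^('a \<times> ('n, 's) midx)) mform \<Rightarrow> bool" where
  "homogeneous \<A> \<T> \<longleftrightarrow>
     (\<forall>a\<in>diff_group CARD('s).
        is_pullback (vel_atlas \<A>) (vel_atlas \<A>) (act \<A> CARD('s) a)
          (\<lambda>d z v. jet_det a * \<T> d z v) \<T>) \<and>
     (\<forall>U \<gamma>. immersion_on \<A> U \<gamma> \<longrightarrow>
        is_pullback {(U, id)} (vel_atlas \<A>) (prolong \<A> CARD('s) \<gamma>) (\<lambda>d z v. 0) \<T>)"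

section \<open>Adapted charts on the quotient\<close>

text \<open>\<open>x_matrix\<close> is the matrix \<open>(x^i\<^sub>j)\<close> with row index \<open>i\<close>; its inverse is \<open>(z^i\<^sub>j)\<close>.\<close>

definition x_matrix :: "real^(('n::finite + 'm::finite) \<times> ('n, 's) midx) \<Rightarrow> real^'n^'n" where
  "x_matrix z = (\<chi> i j. z $ (Inl i, midx_add j midx_empty))"

definition det_x :: "('x \<Rightarrow> real^('n::finite + 'm::finite)) \<Rightarrow> ('n, 'x) velocity \<Rightarrow> real" where
  "det_x \<phi> v = det (\<chi> i j. vel_coord \<phi> (Inl i) [j] v)"

definition adapted ::
    "('x::topological_space, real^('n::finite + 'm::finite)) chart set \<Rightarrow> nat \<Rightarrow>
     ('x, real^('n + 'm)) chart \<Rightarrow> ('n, 'x) velocity set" where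
  "adapted \<A> s c =
     {v \<in> regular_velocities \<A> s. base_point v \<in> fst c \<and> det_x (snd c) v \<noteq> 0}"

text \<open>
  The formal derivative \<open>d\<^sub>j f = \<Sum> x^A\<^sub>j\<^sub>J \<partial>f/\<partial>x^A\<^sub>J\<close> of a function \<open>f\<close> of the coordinates of order
  at most \<open>s - 1\<close>.
\<close>

definition formal_deriv ::
    "'n::finite \<Rightarrow> (real^('a::finite \<times> ('n, 's) midx) \<Rightarrow> real) \<Rightarrow>
     real^('a \<times> ('n, 's) midx) \<Rightarrow> real" where
  "formal_deriv j f z =
     (\<Sum>(A, J) | midx_size J < CARD('s). z $ (A, midx_add j J) * partial (A, J) f z)"

primrec y_coord ::
    "'m::finite \<Rightarrow> 'n::finite list \<Rightarrow> real^(('n + 'm) \<times> ('n, 's) midx) \<Rightarrow> real" where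
  "y_coord \<sigma> [] = (\<lambda>z. z $ (Inr \<sigma>, midx_empty))"
| "y_coord \<sigma> (i # I) =
     (\<lambda>z. \<Sum>j\<in>UNIV. matrix_inv (x_matrix z) $ j $ i * formal_deriv j (y_coord \<sigma> I) z)"

text \<open>
  The chart \<open>\<rho>(W\<^sup>s)\<close> with coordinates \<open>x^i\<close> (index \<open>Inl i\<close>) and \<open>y^\<sigma>\<^sub>I\<close> (index \<open>Inr (\<sigma>, I)\<close>). The
  coordinates of an orbit are computed from any of its elements, by invariance.
\<close>

definition quot_chart ::
    "'s itself \<Rightarrow> ('x::topological_space, real^('n::{finite,linorder} + 'm::finite)) chart set \<Rightarrow>
     ('x, real^('n + 'm)) chart \<Rightarrow>
     (('n, 'x) velocity set, real^('n + 'm \<times> ('n, 's) midx)) chart" where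
  "quot_chart TYPE('s) \<A> c = (rho \<A> CARD('s) ` adapted \<A> CARD('s) c,
     (\<lambda>p. let v = (SOME v. v \<in> p);
              z = (\<chi> k. vel_coord (snd c) (fst k) (midx_list (snd k)) v)
                  :: real^(('n + 'm) \<times> ('n, 's) midx)
          in \<chi> k. case k of Inl i \<Rightarrow> z $ (Inl i, midx_empty)
                          | Inr (\<sigma>, I) \<Rightarrow> y_coord \<sigma> (midx_list I) z))"

definition quot_atlas ::
    "'s itself \<Rightarrow> ('x::topological_space, real^('n::{finite,linorder} + 'm::finite)) chart set \<Rightarrow>
     (('n, 'x) velocity set, real^('n + 'm \<times> ('n, 's) midx)) chart set" where
  "quot_atlas TYPE('s) \<A> = quot_chart TYPE('s) \<A> ` \<A>"

definition y_first :: "real^('n::finite + 'm::finite \<times> ('n, 's) midx) \<Rightarrow> 'm \<Rightarrow> 'n \<Rightarrow> real" where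
  "y_first z \<sigma> i = z $ Inr (\<sigma>, midx_add i midx_empty)"

definition xy_part ::
    "real^('n::finite + 'm::finite \<times> ('n, 's) midx) \<Rightarrow> real^('n + 'm)" where
  "xy_part z = (\<chi> k. case k of Inl i \<Rightarrow> z $ Inl i | Inr \<sigma> \<Rightarrow> z $ Inr (\<sigma>, midx_empty))"

text \<open>\<open>\<Delta>\<^sub>\<nu> f\<close> and \<open>D\<^sub>i f\<close> for a function \<open>f\<close> of \<open>(x^i, y^\<sigma>)\<close>, evaluated at a point of the quotient.\<close>

definition Delta ::
    "'m::finite \<Rightarrow> (real^('n::finite + 'm) \<Rightarrow> real) \<Rightarrow>
     real^('n + 'm \<times> ('n, 's) midx) \<Rightarrow> real" where
  "Delta \<nu> f z = partial (Inr \<nu>) f (xy_part z)"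

definition Dtot ::
    "'n::finite \<Rightarrow> (real^('n + 'm::finite) \<Rightarrow> real) \<Rightarrow>
     real^('n + 'm \<times> ('n, 's) midx) \<Rightarrow> real" where
  "Dtot i f z = partial (Inl i) f (xy_part z) + (\<Sum>\<sigma>\<in>UNIV. y_first z \<sigma> i * Delta \<sigma> f z)"

text \<open>
  \<open>\<J> = det (D\<^sub>i x'^j)\<close> and \<open>P^\<sigma>\<^sub>\<nu> = \<Delta>\<^sub>\<nu> y'^\<sigma> - y'^\<sigma>\<^sub>i \<Delta>\<^sub>\<nu> x'^i\<close> for a pair of charts of \<open>X\<close>; \<open>z\<close> and \<open>z'\<close>
  are the coordinates of one point in the two charts of the quotient.
\<close>

definition jac_factor ::
    "('x, real^('n::finite + 'm::finite)) chart \<Rightarrow> ('x, real^('n + 'm)) chart \<Rightarrow>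
     real^('n + 'm \<times> ('n, 's) midx) \<Rightarrow> real" where
  "jac_factor c c' z = det (\<chi> i j. Dtot i (\<lambda>u. transition c c' u $ Inl j) z)"

definition P_factor ::
    "('x, real^('n::finite + 'm::finite)) chart \<Rightarrow> ('x, real^('n + 'm)) chart \<Rightarrow> 'm \<Rightarrow> 'm \<Rightarrow>
     real^('n + 'm \<times> ('n, 's) midx) \<Rightarrow> real^('n + 'm \<times> ('n, 's) midx) \<Rightarrow> real" where
  "P_factor c c' \<sigma> \<nu> z z' = Delta \<nu> (\<lambda>u. transition c c' u $ Inr \<sigma>) z
     - (\<Sum>i\<in>UNIV. y_first z' \<sigma> i * Delta \<nu> (\<lambda>u. transition c c' u $ Inl i) z)"

section \<open>Strongly contact forms\<close>

definition contact ::
    "'m::finite \<Rightarrow> ('n::finite, 's) midx \<Rightarrow> (real^('n + 'm \<times> ('n, 's) midx)) eform" where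
  "contact \<sigma> J z v = dcoord (Inr (\<sigma>, J)) z v
     - (\<Sum>i\<in>UNIV. z $ Inr (\<sigma>, midx_add i J) * dcoord (Inl i) z v)"

text \<open>\<open>\<theta>\<^sub>0\<close> is the product of the \<open>dx^i\<close> in increasing order of \<open>i\<close>.\<close>

definition theta0 :: "(real^('n::{finite,linorder} + 'm::finite \<times> ('n, 's) midx)) eform" where
  "theta0 = wedge_list 1 (map (\<lambda>i. dcoord (Inl i)) (sorted_list_of_set (UNIV :: 'n set)))"

definition contact_term ::
    "nat \<Rightarrow> (real^('n::finite + 'm::finite \<times> ('n, 's) midx)) set \<Rightarrow>
     (real^('n + 'm \<times> ('n, 's) midx)) eform \<Rightarrow> bool" where
  "contact_term q S \<eta> \<longleftrightarrow>
     (\<exists>(Js :: ('m \<times> ('n, 's) midx) list) (Is :: ('m \<times> ('n, 's) midx) list) r \<Phi>.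
        length Js + length Is + CARD('n) = q + 1 \<and>
        length Js + 2 * length Is + r = q \<and>
        (\<forall>(\<sigma>, J)\<in>set Js. midx_size J \<le> CARD('s) - 1) \<and>
        (\<forall>(\<nu>, I)\<in>set Is. midx_size I = CARD('s) - 1) \<and>
        smooth_form r S \<Phi> \<and>
        \<eta> = wedge (length Js) (2 * length Is + r)
              (wedge_list 1 (map (\<lambda>(\<sigma>, J). contact \<sigma> J) Js))
              (wedge (2 * length Is) r
                (wedge_list 2 (map (\<lambda>(\<nu>, I). ext_d 1 (contact \<nu> I)) Is)) \<Phi>))"

text \<open>Used for \<open>q > n\<close> and \<open>S\<close> an open set in the coordinate space of an adapted chart.\<close>

definition strongly_contact ::
    "nat \<Rightarrow> (real^('n::finite + 'm::finite \<times> ('n, 's) midx)) set \<Rightarrow>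
     (real^('n + 'm \<times> ('n, 's) midx)) eform \<Rightarrow> bool" where
  "strongly_contact q S \<omega> \<longleftrightarrow>
     (\<exists>ts. (\<forall>\<eta>\<in>set ts. contact_term q S \<eta>) \<and> (\<forall>z\<in>S. \<forall>v. \<omega> z v = (\<Sum>\<eta>\<leftarrow>ts. \<eta> z v)))"

definition contact_forms ::
    "'s itself \<Rightarrow> ('x::topological_space, real^('n::{finite,linorder} + 'm::finite)) chart set \<Rightarrow> nat \<Rightarrow>
     (('n, 'x) velocity set, real^('n + 'm \<times> ('n, 's) midx)) mform set" where
  "contact_forms TYPE('s) \<A> q = {\<omega> \<in> mforms (quot_atlas TYPE('s) \<A>) q.
     \<forall>d\<in>quot_atlas TYPE('s) \<A>. strongly_contact q (snd d ` fst d) (\<omega> d)}"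

definition contact_rel ::
    "'s itself \<Rightarrow> ('x::topological_space, real^('n::{finite,linorder} + 'm::finite)) chart set \<Rightarrow> nat \<Rightarrow>
     (('n, 'x) velocity set, real^('n + 'm \<times> ('n, 's) midx)) mform rel" where
  "contact_rel TYPE('s) \<A> q = {(\<omega>, \<eta>).
     \<omega> \<in> mforms (quot_atlas TYPE('s) \<A>) q \<and> \<eta> \<in> mforms (quot_atlas TYPE('s) \<A>) q \<and>
     (\<lambda>d z v. \<omega> d z v - \<eta> d z v) \<in> contact_forms TYPE('s) \<A> q}"

text \<open>\<open>T\<^sub>\<sigma> \<omega>^\<sigma> \<and> \<theta>\<^sub>0\<close> in the coordinates of the chart \<open>d\<close> of the quotient.\<close>

definition local_T ::
    "(('n::{finite,linorder}, 'x) velocity set, real^('n + 'm::finite \<times> ('n, 's) midx)) chart \<Rightarrow>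
     ('m \<Rightarrow> ('n, 'x) velocity set \<Rightarrow> real) \<Rightarrow> (real^('n + 'm \<times> ('n, 's) midx)) eform" where
  "local_T d T z v =
     (\<Sum>\<sigma>\<in>UNIV. T \<sigma> (inv_into (fst d) (snd d) z) *
        wedge 1 CARD('n) (contact \<sigma> midx_empty) theta0 z v)"

end

theory Submission
  imports Defs
begin

text \<open>
  A regular velocity over an adapted chart is \<open>g \<cdot> a\<close> with \<open>g\<close> the jet of a graph. Pulling back along prolonged
  immersions gives \<open>\<T>\<^sub>A x^A\<^sub>i = 0\<close>, which expresses \<open>\<T>\<^sub>i\<close> by the \<open>\<T>\<^sub>\<sigma>\<close>, and homogeneity under the group says that
  \<open>\<T>\<^sub>\<sigma> / det (x)\<close> is constant on the orbits. The transformation law of \<open>T\<^sub>\<sigma>\<close> is that of the components \<open>\<T>\<^sub>\<sigma>\<close> divided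
  by that of \<open>det (x)\<close>.

  An \<open>(n+1)\<close>-form that vanishes as soon as \<open>n\<close> of its arguments are annihilated by all \<open>\<omega>^\<sigma>\<close> is a sum of multiples
  of the products \<open>\<omega>^\<sigma> \<and> \<omega>^\<tau>\<close>, hence strongly contact; this gives the comparison of the local forms. For a global representative,
  choose a Riemannian metric on \<open>X\<close>: the orthogonal projection of \<open>T X\<close> to the contact element spanned by the \<open>D\<^sub>i\<close>
  replaces each \<open>dx^i\<close> in \<open>\<theta>\<^sub>0\<close> by the \<open>i\<close>-th coordinate of the projection. The resulting \<open>n\<close>-form changes by the factor
  \<open>\<J>\<close> exactly, so that \<open>T\<^sub>\<sigma> \<omega>^\<sigma>\<close> times it is a form on the quotient.
\<close>

section \<open>Calculus of smooth maps\<close>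

text \<open>A form on the quotient is a compatible family of expressions in all charts, while the
  local forms agree only up to contact forms, so the class needs an honest global representative.
  Choosing a metric on \<open>X\<close>, instead of gluing forms on the quotient, confines
  compactness, Lindelof coverings and local finiteness to \<open>X\<close>, where Hausdorff and
  second countable are assumed. Replacing \<open>theta0\<close> by the projected product alters
  nothing on vectors annihilated by the \<omega>^\<sigma>, and nothing else is seen by the criterion
  for strongly contact forms.

  No chain rule of higher order is written out. Velocities are handled through representatives
  \<gamma>, whose jet coordinates are differentiated in the parameter; formal derivatives turn the
  results into smooth functions of the coordinates. Over an adapted chart the quotient is
  parametrised by the polynomial graphs \<open>graph_map q\<close>: each orbit contains the jet of
  exactly one of them, the jet depends smoothly on \<open>q\<close>, and there det (x) = 1, so
  T_\<sigma> is \<T>_\<sigma> restricted to these jets and its smoothness is immediate.\<close>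

lemma Ck_on_cong:
  assumes "open S" "\<And>x. x \<in> S \<Longrightarrow> f x = g x" "Ck_on k S f"
  shows "Ck_on k S g"
  using assms(2,3)
proof (induction k arbitrary: f g)
  case 0
  then show ?case using continuous_on_cong by (metis Ck_on.simps(1))
next
  case (Suc k)
  have *: "(g has_derivative frechet_derivative f (at x)) (at x)" if "x \<in> S" for x
    using has_derivative_transform_within_open[OF _ \<open>open S\<close> that, of f _ UNIV g] Suc.prems that
    by (metis Ck_on.simps(2) frechet_derivative_works)
  then have eq: "frechet_derivative g (at x) = frechet_derivative f (at x)" if "x \<in> S" for x
    using that frechet_derivative_at by metis
  have "Ck_on k S (\<lambda>x. frechet_derivative g (at x) v)" for v
    by (rule Suc.IH[where f = "\<lambda>x. frechet_derivative f (at x) v"]) (use Suc.prems in \<open>auto simp: eq\<close>)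
  with * show ?case by (auto simp: differentiable_def)
qed

text \<open>The definition speaks of \<open>frechet_derivative\<close>, which is a choice operator;
  by uniqueness of derivatives any formula for the derivative may be supplied instead.\<close>

lemma Ck_on_SucI:
  assumes "open S" "\<And>x. x \<in> S \<Longrightarrow> (f has_derivative f' x) (at x)" "\<And>v. Ck_on k S (\<lambda>x. f' x v)"
  shows "Ck_on (Suc k) S f"
proof -
  have "frechet_derivative f (at x) = f' x" if "x \<in> S" for x
    using assms(2)[OF that] frechet_derivative_at by metis
  with assms show ?thesis
    by (auto simp: differentiable_def intro: Ck_on_cong[OF \<open>open S\<close>])
qed

lemma Ck_on_SucD: "Ck_on (Suc k) S f \<Longrightarrow> Ck_on k S f"
proof (induction k arbitrary: f)
  case 0
  then show ?case
    by (auto intro!: differentiable_imp_continuous_on differentiable_at_imp_differentiable_on)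
qed auto

lemma Ck_on_subset: "Ck_on k S f \<Longrightarrow> T \<subseteq> S \<Longrightarrow> Ck_on k T f"
  by (induction k arbitrary: f) (auto intro: continuous_on_subset)

lemma Ck_on_const: "open S \<Longrightarrow> Ck_on k S (\<lambda>_. c)"
proof (induction k arbitrary: c)
  case (Suc k)
  then show ?case by (intro Ck_on_SucI[where f' = "\<lambda>_ _. 0"]) auto
qed auto

lemma Ck_on_linear:
  assumes "open S" "bounded_linear f"
  shows "Ck_on k S f"
proof (cases k)
  case 0
  then show ?thesis using assms by (auto intro: linear_continuous_on)
next
  case (Suc l)
  show ?thesis
    unfolding Suc using assms
    by (intro Ck_on_SucI[where f' = "\<lambda>_. f"] Ck_on_const bounded_linear_imp_has_derivative)
qed

lemma Ck_on_add:
  assumes "open S" "Ck_on k S f" "Ck_on k S g"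
  shows "Ck_on k S (\<lambda>x. f x + g x)"
  using assms(2,3)
proof (induction k arbitrary: f g)
  case 0
  then show ?case by (auto intro: continuous_on_add)
next
  case (Suc k)
  then show ?case
    by (intro Ck_on_SucI[where f' = "\<lambda>x v. frechet_derivative f (at x) v + frechet_derivative g (at x) v"])
      (auto simp: assms intro!: has_derivative_add frechet_derivative_works[THEN iffD1])
qed

lemma Ck_on_bilinear:
  assumes "bounded_bilinear p" "open S" "Ck_on k S f" "Ck_on k S g"
  shows "Ck_on k S (\<lambda>x. p (f x) (g x))"
  using assms(3,4)
proof (induction k arbitrary: f g)
  case 0
  then show ?case using bounded_bilinear.continuous_on[OF assms(1)] by auto
next
  case (Suc k)
  note IH = Suc.IH
  have f: "Ck_on k S f" and g: "Ck_on k S g" using Suc.prems Ck_on_SucD by blast+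
  show ?case
  proof (rule Ck_on_SucI[where f' = "\<lambda>x v. p (f x) (frechet_derivative g (at x) v) +
      p (frechet_derivative f (at x) v) (g x)"])
    fix x assume "x \<in> S"
    then show "((\<lambda>x. p (f x) (g x)) has_derivative
         (\<lambda>v. p (f x) (frechet_derivative g (at x) v) + p (frechet_derivative f (at x) v) (g x))) (at x)"
      using Suc.prems by (intro bounded_bilinear.FDERIV[OF assms(1)] frechet_derivative_works[THEN iffD1]) auto
  next
    fix v
    show "Ck_on k S (\<lambda>x. p (f x) (frechet_derivative g (at x) v) + p (frechet_derivative f (at x) v) (g x))"
      using Suc.prems f g by (intro Ck_on_add IH assms) auto
  qed (rule assms)
qed

lemma Ck_on_sum:
  assumes "open S" "\<And>i. i \<in> I \<Longrightarrow> Ck_on k S (f i)"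
  shows "Ck_on k S (\<lambda>x. \<Sum>i\<in>I. f i x)"
  using assms(2)
  by (induction I rule: infinite_finite_induct) (auto intro: Ck_on_add Ck_on_const assms)

lemma frechet_derivative_compose:
  assumes "f differentiable (at x)" "g differentiable (at (f x))"
  shows "frechet_derivative (\<lambda>x. g (f x)) (at x) v
    = frechet_derivative g (at (f x)) (frechet_derivative f (at x) v)"
    and "(\<lambda>x. g (f x)) differentiable (at x)"
proof -
  have "((\<lambda>x. g (f x)) has_derivative
      (\<lambda>v. frechet_derivative g (at (f x)) (frechet_derivative f (at x) v))) (at x)"
    using assms by (auto simp: frechet_derivative_works intro: has_derivative_compose[of f])
  then show "frechet_derivative (\<lambda>x. g (f x)) (at x) v
      = frechet_derivative g (at (f x)) (frechet_derivative f (at x) v)"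
    and "(\<lambda>x. g (f x)) differentiable (at x)"
    using frechet_derivative_at by (metis, metis differentiable_def)
qed

lemma frechet_derivative_expand:
  fixes f :: "'a::euclidean_space \<Rightarrow> 'b::real_normed_vector"
  assumes "f differentiable (at x)"
  shows "frechet_derivative f (at x) v = (\<Sum>b\<in>Basis. (v \<bullet> b) *\<^sub>R frechet_derivative f (at x) b)"
proof -
  interpret linear "frechet_derivative f (at x)"
    using assms linear_frechet_derivative by blast
  have "frechet_derivative f (at x) v = frechet_derivative f (at x) (\<Sum>b\<in>Basis. (v \<bullet> b) *\<^sub>R b)"
    by (simp add: euclidean_representation)
  then show ?thesis by (simp add: sum scaleR)
qed

text \<open>\<open>Ck_on\<close> only controls derivatives in fixed directions, while in the chain
  rule the direction in which \<open>g\<close> is differentiated moves with \<open>x\<close>.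
  Expanding it in the basis turns the derivative into a sum of products of functions to which the
  induction applies.\<close>

lemma Ck_on_compose:
  fixes f :: "'a::real_normed_vector \<Rightarrow> 'b::euclidean_space" and g :: "'b \<Rightarrow> 'c::real_normed_vector"
  assumes "open S" "open T" "f ` S \<subseteq> T" "Ck_on k S f" "Ck_on k T g"
  shows "Ck_on k S (\<lambda>x. g (f x))"
  using assms(4,5)
proof (induction k arbitrary: g)
  case 0
  then show ?case using assms(3) continuous_on_compose2[of T g S f] by auto
next
  case (Suc k)
  have f: "Ck_on k S f" using Suc.prems Ck_on_SucD by blast
  have in_T: "f x \<in> T" if "x \<in> S" for x using assms(3) that by auto
  show ?case
  proof (rule Ck_on_SucI[where f' = "\<lambda>x v. \<Sum>b\<in>Basis.
      (frechet_derivative f (at x) v \<bullet> b) *\<^sub>R frechet_derivative g (at (f x)) b"])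
    fix x assume x: "x \<in> S"
    then have df: "f differentiable (at x)" and dg: "g differentiable (at (f x))"
      using Suc.prems in_T by auto
    show "((\<lambda>x. g (f x)) has_derivative (\<lambda>v. \<Sum>b\<in>Basis.
      (frechet_derivative f (at x) v \<bullet> b) *\<^sub>R frechet_derivative g (at (f x)) b)) (at x)"
      using frechet_derivative_works[THEN iffD1, OF frechet_derivative_compose(2)[OF df dg]]
      by (simp add: frechet_derivative_compose(1)[OF df dg, abs_def] frechet_derivative_expand[OF dg, symmetric])
  next
    fix v
    show "Ck_on k S (\<lambda>x. \<Sum>b\<in>Basis.
      (frechet_derivative f (at x) v \<bullet> b) *\<^sub>R frechet_derivative g (at (f x)) b)"
    proof (intro Ck_on_sum Ck_on_bilinear[OF bounded_bilinear_scaleR] \<open>open S\<close>)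
      fix b :: 'b
      show "Ck_on k S (\<lambda>x. frechet_derivative f (at x) v \<bullet> b)"
        using Suc.prems by (intro Ck_on_bilinear[OF bounded_bilinear_inner] Ck_on_const \<open>open S\<close>) auto
      show "Ck_on k S (\<lambda>x. frechet_derivative g (at (f x)) b)"
        using Suc.prems by (intro Suc.IH f) auto
    qed
  qed (rule assms)
qed

lemma Ck_on_inverse: "Ck_on k (- {0::real}) inverse"
proof (induction k)
  case 0
  then show ?case by (auto intro: continuous_on_inverse)
next
  case (Suc k)
  have *: "Ck_on k (- {0}) (\<lambda>x::real. - (inverse x * v * inverse x))" for v
    using Ck_on_bilinear[OF bounded_bilinear_mult _ Ck_on_const
        Ck_on_bilinear[OF bounded_bilinear_mult _ Suc Suc], of "- v"]
    by (simp add: open_Compl mult_ac)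
  show ?case
    by (rule Ck_on_SucI[where f' = "\<lambda>x v. - (inverse x * v * inverse x)"])
      (auto intro!: has_derivative_inverse' has_derivative_ident open_Compl *)
qed

lemma Ck_on_local:
  assumes "\<And>x. x \<in> S \<Longrightarrow> \<exists>T. open T \<and> x \<in> T \<and> Ck_on k T f"
  shows "Ck_on k S f"
  using assms
proof (induction k arbitrary: f)
  case 0
  then have "isCont f x" if "x \<in> S" for x
    using that by (metis Ck_on.simps(1) continuous_on_eq_continuous_at)
  then show ?case by (simp add: continuous_at_imp_continuous_on)
next
  case (Suc k)
  have "Ck_on k S (\<lambda>x. frechet_derivative f (at x) v)" for v
    by (rule Suc.IH) (use Suc.prems in fastforce)
  with Suc.prems show ?case by fastforce
qed

lemma smooth_on_cong: "open S \<Longrightarrow> smooth_on S f \<Longrightarrow> (\<And>x. x \<in> S \<Longrightarrow> f x = g x) \<Longrightarrow> smooth_on S g"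
  unfolding smooth_on_def using Ck_on_cong by metis

lemma smooth_on_subset: "smooth_on S f \<Longrightarrow> T \<subseteq> S \<Longrightarrow> smooth_on T f"
  unfolding smooth_on_def using Ck_on_subset by metis

lemma smooth_on_local:
  "(\<And>x. x \<in> S \<Longrightarrow> \<exists>T. open T \<and> x \<in> T \<and> smooth_on T f) \<Longrightarrow> smooth_on S f"
  unfolding smooth_on_def by (rule allI, rule Ck_on_local) metis

lemma smooth_on_continuous: "smooth_on S f \<Longrightarrow> continuous_on S f"
  unfolding smooth_on_def by (metis Ck_on.simps(1))

lemma smooth_on_differentiable: "smooth_on S f \<Longrightarrow> x \<in> S \<Longrightarrow> f differentiable (at x)"
  unfolding smooth_on_def by (metis Ck_on.simps(2))

lemma smooth_on_has_derivative:
  "smooth_on S f \<Longrightarrow> x \<in> S \<Longrightarrow> (f has_derivative frechet_derivative f (at x)) (at x)"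
  using smooth_on_differentiable frechet_derivative_works by blast

lemma smooth_on_deriv: "smooth_on S f \<Longrightarrow> smooth_on S (\<lambda>x. frechet_derivative f (at x) v)"
  unfolding smooth_on_def by (metis Ck_on.simps(2))

lemma smooth_on_const: "open S \<Longrightarrow> smooth_on S (\<lambda>_. c)"
  unfolding smooth_on_def using Ck_on_const by blast

lemma smooth_on_linear: "open S \<Longrightarrow> bounded_linear f \<Longrightarrow> smooth_on S f"
  unfolding smooth_on_def using Ck_on_linear by blast

lemma smooth_on_ident: "open S \<Longrightarrow> smooth_on S (\<lambda>x. x)"
  by (simp add: smooth_on_linear bounded_linear_ident)

lemma smooth_on_add: "open S \<Longrightarrow> smooth_on S f \<Longrightarrow> smooth_on S g \<Longrightarrow> smooth_on S (\<lambda>x. f x + g x)"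
  unfolding smooth_on_def using Ck_on_add by blast

lemma smooth_on_bilinear:
  "bounded_bilinear p \<Longrightarrow> open S \<Longrightarrow> smooth_on S f \<Longrightarrow> smooth_on S g \<Longrightarrow> smooth_on S (\<lambda>x. p (f x) (g x))"
  unfolding smooth_on_def using Ck_on_bilinear by blast

lemmas smooth_on_mult = smooth_on_bilinear[OF bounded_bilinear_mult]
lemmas smooth_on_scaleR = smooth_on_bilinear[OF bounded_bilinear_scaleR]
lemmas smooth_on_inner = smooth_on_bilinear[OF bounded_bilinear_inner]

lemma smooth_on_sum:
  "open S \<Longrightarrow> (\<And>i. i \<in> I \<Longrightarrow> smooth_on S (f i)) \<Longrightarrow> smooth_on S (\<lambda>x. \<Sum>i\<in>I. f i x)"
  unfolding smooth_on_def by (intro allI Ck_on_sum) auto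

lemma smooth_on_compose:
  fixes f :: "'a::real_normed_vector \<Rightarrow> 'b::euclidean_space" and g :: "'b \<Rightarrow> 'c::real_normed_vector"
  shows "open S \<Longrightarrow> open T \<Longrightarrow> f ` S \<subseteq> T \<Longrightarrow> smooth_on S f \<Longrightarrow> smooth_on T g \<Longrightarrow>
    smooth_on S (\<lambda>x. g (f x))"
  unfolding smooth_on_def by (rule allI, rule Ck_on_compose[where T = T]) auto

lemma smooth_on_linear_compose:
  fixes f :: "'a::real_normed_vector \<Rightarrow> 'b::euclidean_space"
  shows "open S \<Longrightarrow> bounded_linear h \<Longrightarrow> smooth_on S f \<Longrightarrow> smooth_on S (\<lambda>x. h (f x))"
  by (rule smooth_on_compose[where T = UNIV]) (auto intro: smooth_on_linear)

lemma smooth_on_minus: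
  "open S \<Longrightarrow> smooth_on S f \<Longrightarrow> smooth_on S (\<lambda>x. - f x)"
  using smooth_on_scaleR[OF _ smooth_on_const[of S "-1"], of f] by simp

lemma smooth_on_diff:
  "open S \<Longrightarrow> smooth_on S f \<Longrightarrow> smooth_on S g \<Longrightarrow> smooth_on S (\<lambda>x. f x - g x)"
  using smooth_on_add[OF _ _ smooth_on_minus, of S f g] by simp

lemma smooth_on_inverse:
  fixes f :: "'a::real_normed_vector \<Rightarrow> real"
  shows "open S \<Longrightarrow> smooth_on S f \<Longrightarrow> (\<And>x. x \<in> S \<Longrightarrow> f x \<noteq> 0) \<Longrightarrow> smooth_on S (\<lambda>x. inverse (f x))"
  by (rule smooth_on_compose[where T = "- {0}"])
    (auto simp: smooth_on_def Ck_on_inverse)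

lemma smooth_on_divide:
  fixes f :: "'a::real_normed_vector \<Rightarrow> real"
  shows "open S \<Longrightarrow> smooth_on S f \<Longrightarrow> smooth_on S g \<Longrightarrow> (\<And>x. x \<in> S \<Longrightarrow> g x \<noteq> 0) \<Longrightarrow>
    smooth_on S (\<lambda>x. f x / g x)"
  unfolding divide_inverse by (intro smooth_on_mult smooth_on_inverse)

lemma smooth_on_prod:
  fixes f :: "'i \<Rightarrow> 'a::real_normed_vector \<Rightarrow> real"
  shows "open S \<Longrightarrow> (\<And>i. i \<in> I \<Longrightarrow> smooth_on S (f i)) \<Longrightarrow> smooth_on S (\<lambda>x. \<Prod>i\<in>I. f i x)"
  by (induction I rule: infinite_finite_induct) (auto intro: smooth_on_const smooth_on_mult)

lemma smooth_on_power:
  fixes f :: "'a::real_normed_vector \<Rightarrow> real"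
  shows "open S \<Longrightarrow> smooth_on S f \<Longrightarrow> smooth_on S (\<lambda>x. f x ^ k)"
  by (induction k) (auto intro: smooth_on_const smooth_on_mult)

lemma smooth_on_nth: "open S \<Longrightarrow> smooth_on S f \<Longrightarrow> smooth_on S (\<lambda>x. f x $ i)"
  for f :: "'a::real_normed_vector \<Rightarrow> real^'k::finite"
  by (rule smooth_on_linear_compose[OF _ bounded_linear_vec_nth])

lemma smooth_on_component: "open S \<Longrightarrow> smooth_on S (\<lambda>z :: real^'k::finite. z $ i)"
  by (intro smooth_on_nth smooth_on_ident)

lemma smooth_on_vec_iff:
  fixes f :: "'a::real_normed_vector \<Rightarrow> real^'k::finite"
  assumes "open S"
  shows "smooth_on S f \<longleftrightarrow> (\<forall>i. smooth_on S (\<lambda>x. f x $ i))"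
proof
  assume "\<forall>i. smooth_on S (\<lambda>x. f x $ i)"
  then have "smooth_on S (\<lambda>x. \<Sum>i\<in>UNIV. (f x $ i) *\<^sub>R axis i (1::real))"
    using assms by (intro smooth_on_sum smooth_on_scaleR smooth_on_const) auto
  moreover have "(\<Sum>i\<in>UNIV. (f x $ i) *\<^sub>R axis i (1::real)) = f x" for x
    by (simp add: vec_eq_iff axis_def if_distrib cong: if_cong)
  ultimately show "smooth_on S f" by simp
qed (use assms smooth_on_nth in auto)

lemma smooth_on_det:
  fixes M :: "'a::real_normed_vector \<Rightarrow> real^'n::finite^'n"
  assumes "open S" "\<And>i j. smooth_on S (\<lambda>x. M x $ i $ j)"
  shows "smooth_on S (\<lambda>x. det (M x))"
  unfolding det_def
  by (intro smooth_on_sum smooth_on_mult smooth_on_const smooth_on_prod assms)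

section \<open>Inverse matrices that depend smoothly on a point\<close>

lemma matrix_inv_mult:
  fixes A :: "real^'n::finite^'n"
  assumes "det A \<noteq> 0"
  shows "A ** matrix_inv A = mat 1" "matrix_inv A ** A = mat 1"
proof -
  have "\<exists>B. A ** B = mat 1 \<and> B ** A = mat 1"
    using assms invertible_det_nz invertible_def by metis
  from someI_ex[OF this] show "A ** matrix_inv A = mat 1" "matrix_inv A ** A = mat 1"
    by (auto simp: matrix_inv_def)
qed

text \<open>Cramer's rule, applied to a column of the identity: it exhibits the entries of the
  inverse as rational functions of the entries, from which smoothness can be read off.\<close>

lemma matrix_inv_nth:
  fixes A :: "real^'n::finite^'n"
  assumes "det A \<noteq> 0"
  shows "matrix_inv A $ k $ l = det (\<chi> i j. if j = k then mat 1 $ i $ l else A $ i $ j) / det A"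
proof -
  have "A ** matrix_inv A = mat 1"
    using assms matrix_inv_mult(1) by blast
  moreover have "A *v column l (matrix_inv A) = column l (A ** matrix_inv A)"
    by (simp add: vec_eq_iff matrix_vector_mult_def column_def matrix_matrix_mult_def)
  ultimately have "A *v column l (matrix_inv A) = column l (mat 1)"
    by simp
  then show ?thesis
    unfolding cramer[OF assms] by (simp add: column_def vec_eq_iff cong: if_cong)
qed

lemma smooth_on_matrix_inv:
  fixes M :: "'a::real_normed_vector \<Rightarrow> real^'n::finite^'n"
  assumes "open S" "\<And>i j. smooth_on S (\<lambda>x. M x $ i $ j)" "\<And>x. x \<in> S \<Longrightarrow> det (M x) \<noteq> 0"
  shows "smooth_on S (\<lambda>x. matrix_inv (M x) $ k $ l)"
proof (rule smooth_on_cong[OF \<open>open S\<close>])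
  show "smooth_on S (\<lambda>x. det (\<chi> i j. if j = k then mat 1 $ i $ l else M x $ i $ j) / det (M x))"
  proof (intro smooth_on_divide smooth_on_det)
    fix i j
    show "smooth_on S (\<lambda>x. (\<chi> i j. if j = k then mat 1 $ i $ l else M x $ i $ j) $ i $ j)"
      using assms by (cases "j = k") (auto intro: smooth_on_const)
  qed (use assms in auto)
qed (simp add: assms matrix_inv_nth)

text \<open>Base point and direction both move; as for compositions, the direction is expanded in
  the basis.\<close>

lemma smooth_on_derivative_at:
  fixes f :: "'b::euclidean_space \<Rightarrow> 'c::real_normed_vector"
  assumes "open S" "open T" "u ` S \<subseteq> T" "smooth_on S u" "smooth_on S w" "smooth_on T f"
  shows "smooth_on S (\<lambda>x. frechet_derivative f (at (u x)) (w x))"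
proof (rule smooth_on_cong[OF \<open>open S\<close>])
  show "smooth_on S (\<lambda>x. \<Sum>b\<in>Basis. (w x \<bullet> b) *\<^sub>R frechet_derivative f (at (u x)) b)"
    using smooth_on_compose[OF assms(1-4) smooth_on_deriv[OF assms(6)]]
    by (intro smooth_on_sum smooth_on_scaleR smooth_on_inner[OF \<open>open S\<close> assms(5)] smooth_on_const \<open>open S\<close>)
qed (use assms in \<open>auto intro!: frechet_derivative_expand[symmetric] smooth_on_differentiable\<close>)

subsection \<open>A flat function\<close>

text \<open>\<open>flat_fn 0\<close> is the usual flat function; the further members of the family are needed for
  an induction on the order of differentiability.\<close>

definition flat_fn :: "nat \<Rightarrow> real \<Rightarrow> real" where
  "flat_fn m x = (if x \<le> 0 then 0 else inverse x ^ m * exp (- inverse x))"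

lemma flat_fn_tendsto: "(flat_fn m \<longlongrightarrow> 0) (at 0)"
proof -
  have "((\<lambda>x::real. inverse x ^ m * exp (- inverse x)) \<longlongrightarrow> 0) (at_right 0)"
  proof -
    have "((\<lambda>y::real. y ^ m / exp y) \<longlongrightarrow> 0) at_top"
      by (rule tendsto_power_div_exp_0)
    from filterlim_compose[OF this filterlim_inverse_at_top_right]
    show ?thesis by (simp add: exp_minus divide_inverse)
  qed
  then have "(flat_fn m \<longlongrightarrow> 0) (at_right 0)"
    by (rule Lim_transform_eventually)
      (auto simp: flat_fn_def eventually_at_right_less intro: eventually_mono[OF eventually_at_right_less])
  moreover have "(flat_fn m \<longlongrightarrow> 0) (at_left 0)"
    by (rule Lim_transform_eventually[of "\<lambda>_. 0"])
      (auto simp: flat_fn_def eventually_at_filter)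
  ultimately show ?thesis by (simp add: filterlim_at_split)
qed

lemma flat_fn_has_derivative:
  "(flat_fn m has_real_derivative flat_fn (m + 2) x - m * flat_fn (m + 1) x) (at x)"
proof -
  consider "x < 0" | "x > 0" | "x = 0" by linarith
  then show ?thesis
  proof cases
    case 1
    have "((\<lambda>_. 0) has_real_derivative 0) (at x)" by simp
    then have "(flat_fn m has_real_derivative 0) (at x)"
      by (rule has_field_derivative_transform_within_open[of _ _ _ "{..<0}"]) (use 1 in \<open>auto simp: flat_fn_def\<close>)
    with 1 show ?thesis by (simp add: flat_fn_def)
  next
    case 2
    have "((\<lambda>x. inverse x ^ m * exp (- inverse x)) has_real_derivative
        flat_fn (m + 2) x - m * flat_fn (m + 1) x) (at x)"
    proof -
      have "((\<lambda>x. inverse x ^ m) has_real_derivative - (m * inverse x ^ Suc m)) (at x)"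
      proof (induction m)
        case (Suc m)
        have "((\<lambda>x. inverse x * inverse x ^ m) has_real_derivative
            - (inverse x * inverse x) * inverse x ^ m + - (m * inverse x ^ Suc m) * inverse x) (at x)"
          using 2 by (intro DERIV_mult Suc) (auto intro!: derivative_eq_intros simp: power2_eq_square)
        then show ?case by (simp add: algebra_simps)
      qed simp
      moreover have "((\<lambda>x. exp (- inverse x)) has_real_derivative
          exp (- inverse x) * (inverse x * inverse x)) (at x)"
        using 2 by (auto intro!: derivative_eq_intros simp: power2_eq_square)
      ultimately have "((\<lambda>x. inverse x ^ m * exp (- inverse x)) has_real_derivative
          - (m * inverse x ^ Suc m) * exp (- inverse x)
          + exp (- inverse x) * (inverse x * inverse x) * inverse x ^ m) (at x)"
        by (rule DERIV_mult)
      with 2 show ?thesis by (simp add: flat_fn_def algebra_simps)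
    qed
    then show ?thesis
      by (rule has_field_derivative_transform_within_open[of _ _ _ "{0<..}"]) (use 2 in \<open>auto simp: flat_fn_def\<close>)
  next
    case 3
    \<comment> \<open>At 0 the difference quotient of \<open>flat_fn m\<close> is
      \<open>flat_fn (Suc m)\<close>, so differentiability there reduces to the limit of the
      latter.\<close>
    have "((\<lambda>h. (flat_fn m (0 + h) - flat_fn m 0) / h) \<longlongrightarrow> 0) (at 0)"
      by (rule Lim_transform_eventually[OF flat_fn_tendsto[of "Suc m"]])
        (auto simp: flat_fn_def eventually_at_filter field_simps)
    with 3 show ?thesis by (simp add: DERIV_def flat_fn_def)
  qed
qed

lemma smooth_flat_fn: "smooth_on UNIV (flat_fn m)"
proof -
  have "Ck_on k UNIV (flat_fn m)" for k
  proof (induction k arbitrary: m)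
    case 0
    have "isCont (flat_fn m) x" for x
      using flat_fn_has_derivative DERIV_isCont by blast
    then show ?case by (simp add: continuous_at_imp_continuous_on)
  next
    case (Suc k)
    have "Ck_on k UNIV (\<lambda>x. flat_fn (m + 2) x * v + (- m * v) * flat_fn (m + 1) x)" for v :: real
      by (intro Ck_on_add Ck_on_bilinear[OF bounded_bilinear_mult] Ck_on_const Suc) auto
    then have "Ck_on k UNIV (\<lambda>x. (flat_fn (m + 2) x - m * flat_fn (m + 1) x) * v)" for v
      by (simp add: algebra_simps)
    then show ?case
      by (rule Ck_on_SucI[OF open_UNIV flat_fn_has_derivative[of m, unfolded has_field_derivative_def]])
  qed
  then show ?thesis by (simp add: smooth_on_def)
qed

lemma flat_fn_pos_iff: "flat_fn 0 x > 0 \<longleftrightarrow> x > 0" and flat_fn_nonneg: "flat_fn 0 x \<ge> 0"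
  by (auto simp: flat_fn_def)

subsection \<open>Symmetry of second derivatives\<close>

lemma has_derivative_along_line:
  fixes f :: "'a::euclidean_space \<Rightarrow> real"
  assumes "smooth_on S f" "x + s *\<^sub>R u + w \<in> S"
  shows "((\<lambda>s. f (x + s *\<^sub>R u + w)) has_real_derivative
    frechet_derivative f (at (x + s *\<^sub>R u + w)) u) (at s)"
proof -
  have "((\<lambda>s. x + s *\<^sub>R u + w) has_derivative (\<lambda>r. r *\<^sub>R u)) (at s)"
    by (auto intro!: derivative_eq_intros)
  from has_derivative_compose[OF this smooth_on_has_derivative[OF assms]]
  show ?thesis
    unfolding has_field_derivative_def
    using linear_frechet_derivative[OF smooth_on_differentiable[OF assms]]
    by (simp add: linear_cmul mult_commute_abs)
qed

text \<open>Two applications of the mean value theorem, first in the direction \<open>u\<close> and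
  then in the direction \<open>v\<close>. The left-hand side is symmetric in \<open>u\<close> and
  \<open>v\<close>, the right-hand side is not; comparing both readings gives the symmetry of second
  derivatives.\<close>

lemma second_difference:
  fixes f :: "'a::euclidean_space \<Rightarrow> real"
  assumes f: "smooth_on S f" and h: "h > 0"
    and S: "\<And>s t. s \<in> {0..h} \<Longrightarrow> t \<in> {0..h} \<Longrightarrow> x + s *\<^sub>R u + t *\<^sub>R v \<in> S"
  shows "\<exists>s\<in>{0..h}. \<exists>t\<in>{0..h}. f (x + h *\<^sub>R u + h *\<^sub>R v) - f (x + h *\<^sub>R u) - f (x + h *\<^sub>R v) + f x
    = h\<^sup>2 * frechet_derivative (\<lambda>y. frechet_derivative f (at y) u) (at (x + s *\<^sub>R u + t *\<^sub>R v)) v"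
proof -
  let ?D = "\<lambda>y. frechet_derivative f (at y) u"
  have S0: "x + s *\<^sub>R u + 0 \<in> S" if "s \<in> {0..h}" for s
    using S[OF that, of 0] h by simp
  obtain s where s: "0 < s" "s < h" and 1:
    "(f (x + h *\<^sub>R u + h *\<^sub>R v) - f (x + h *\<^sub>R u + 0)) - (f (x + 0 *\<^sub>R u + h *\<^sub>R v) - f (x + 0 *\<^sub>R u + 0))
      = (h - 0) * (?D (x + s *\<^sub>R u + h *\<^sub>R v) - ?D (x + s *\<^sub>R u + 0))"
  proof -
    have "((\<lambda>s. f (x + s *\<^sub>R u + h *\<^sub>R v) - f (x + s *\<^sub>R u + 0)) has_real_derivative
        ?D (x + s *\<^sub>R u + h *\<^sub>R v) - ?D (x + s *\<^sub>R u + 0)) (at s)" if "0 \<le> s" "s \<le> h" for s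
      using that h by (intro DERIV_diff has_derivative_along_line[OF f] S S0) auto
    from MVT2[OF h this] that show thesis by blast
  qed
  have D: "smooth_on S ?D" by (rule smooth_on_deriv[OF f])
  have S': "(x + s *\<^sub>R u) + t *\<^sub>R v + 0 \<in> S" if "t \<in> {0..h}" for t
    using S[OF _ that, of s] s by simp
  obtain t where t: "0 < t" "t < h" and 2:
    "?D ((x + s *\<^sub>R u) + h *\<^sub>R v + 0) - ?D ((x + s *\<^sub>R u) + 0 *\<^sub>R v + 0)
      = (h - 0) * frechet_derivative ?D (at ((x + s *\<^sub>R u) + t *\<^sub>R v + 0)) v"
  proof -
    have "((\<lambda>t. ?D ((x + s *\<^sub>R u) + t *\<^sub>R v + 0)) has_real_derivative
        frechet_derivative ?D (at ((x + s *\<^sub>R u) + t *\<^sub>R v + 0)) v) (at t)" if "0 \<le> t" "t \<le> h" for t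
      using that by (intro has_derivative_along_line[OF D] S') auto
    from MVT2[OF h this] that show thesis by blast
  qed
  show ?thesis
    using s t 1 2 by (intro bexI[of _ s] bexI[of _ t]) (auto simp: power2_eq_square algebra_simps)
qed

lemma frechet_derivative_commute:
  fixes f :: "'a::euclidean_space \<Rightarrow> real"
  assumes "open S" and f: "smooth_on S f" and x: "x \<in> S"
  shows "frechet_derivative (\<lambda>y. frechet_derivative f (at y) u) (at x) v
    = frechet_derivative (\<lambda>y. frechet_derivative f (at y) v) (at x) u"
proof (rule ccontr)
  define A where "A u v y = frechet_derivative (\<lambda>y. frechet_derivative f (at y) u) (at y) v" for u v y
  assume "\<not> ?thesis"
  then have e: "dist (A u v x) (A v u x) / 2 > 0" by (simp add: A_def)
  have "isCont (A p q) x" for p q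
    unfolding A_def using smooth_on_continuous[OF smooth_on_deriv[OF smooth_on_deriv[OF f]]] x \<open>open S\<close>
    by (simp add: continuous_on_eq_continuous_at)
  then have "\<exists>d>0. \<forall>y. dist y x < d \<longrightarrow> dist (A p q y) (A p q x) < dist (A u v x) (A v u x) / 2" for p q
    using e unfolding continuous_at_eps_delta by blast
  then obtain d where d: "\<And>p q. d p q > 0"
    "\<And>p q y. dist y x < d p q \<Longrightarrow> dist (A p q y) (A p q x) < dist (A u v x) (A v u x) / 2"
    by metis
  obtain r where r: "r > 0" "ball x r \<subseteq> S"
    using \<open>open S\<close> x open_contains_ball by blast
  \<comment> \<open>With this step size the parallelogram spanned by the multiples of
    \<open>u\<close> and \<open>v\<close> stays inside the ball contained in \<open>S\<close> and so
    close to \<open>x\<close> that both second derivatives move by less than half of their supposed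
    gap. The summand 1 keeps the denominator positive.\<close>
  define h where "h = min r (min (d u v) (d v u)) / (norm u + norm v + 1)"
  have pos: "norm u + norm v + 1 > 0" by (simp add: add_nonneg_pos)
  have h: "h > 0" using r d pos by (simp add: h_def)
  have small: "dist (x + s *\<^sub>R p + t *\<^sub>R q) x < min r (min (d u v) (d v u))"
    if "s \<in> {0..h}" "t \<in> {0..h}" "(p, q) = (u, v) \<or> (p, q) = (v, u)" for s t p q
  proof -
    have "dist (x + s *\<^sub>R p + t *\<^sub>R q) x \<le> s * norm p + t * norm q"
      using that norm_triangle_ineq[of "s *\<^sub>R p" "t *\<^sub>R q"] by (simp add: dist_norm)
    also have "\<dots> \<le> h * norm p + h * norm q"
      using that by (intro add_mono mult_right_mono) auto
    also have "\<dots> < h * (norm u + norm v + 1)"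
      using h that(3) by (auto simp: algebra_simps)
    also have "\<dots> = min r (min (d u v) (d v u))"
      using pos by (simp add: h_def)
    finally show ?thesis .
  qed
  have inS: "x + s *\<^sub>R p + t *\<^sub>R q \<in> S"
    if "s \<in> {0..h}" "t \<in> {0..h}" "(p, q) = (u, v) \<or> (p, q) = (v, u)" for s t p q
    using small[OF that] r(2) by (auto simp: dist_commute)
  obtain s t where 1: "s \<in> {0..h}" "t \<in> {0..h}"
    "f (x + h *\<^sub>R u + h *\<^sub>R v) - f (x + h *\<^sub>R u) - f (x + h *\<^sub>R v) + f x = h\<^sup>2 * A u v (x + s *\<^sub>R u + t *\<^sub>R v)"
    using second_difference[OF f h inS, of u v] unfolding A_def by blast
  obtain s' t' where 2: "s' \<in> {0..h}" "t' \<in> {0..h}"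
    "f (x + h *\<^sub>R v + h *\<^sub>R u) - f (x + h *\<^sub>R v) - f (x + h *\<^sub>R u) + f x = h\<^sup>2 * A v u (x + s' *\<^sub>R v + t' *\<^sub>R u)"
    using second_difference[OF f h inS, of v u] unfolding A_def by blast
  have swap: "x + h *\<^sub>R v + h *\<^sub>R u = x + h *\<^sub>R u + h *\<^sub>R v" by simp
  have "h\<^sup>2 * A u v (x + s *\<^sub>R u + t *\<^sub>R v)
      = f (x + h *\<^sub>R u + h *\<^sub>R v) - f (x + h *\<^sub>R v) - f (x + h *\<^sub>R u) + f x"
    using 1(3) by argo
  also have "\<dots> = h\<^sup>2 * A v u (x + s' *\<^sub>R v + t' *\<^sub>R u)"
    using 2(3) by (simp only: swap)
  finally have "h\<^sup>2 * A u v (x + s *\<^sub>R u + t *\<^sub>R v) = h\<^sup>2 * A v u (x + s' *\<^sub>R v + t' *\<^sub>R u)" .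
  then have "A u v (x + s *\<^sub>R u + t *\<^sub>R v) = A v u (x + s' *\<^sub>R v + t' *\<^sub>R u)"
    using h by simp
  moreover have "dist (A u v (x + s *\<^sub>R u + t *\<^sub>R v)) (A u v x) < dist (A u v x) (A v u x) / 2"
    using small[OF 1(1,2), of u v] by (intro d(2)) auto
  moreover have "dist (A v u (x + s' *\<^sub>R v + t' *\<^sub>R u)) (A v u x) < dist (A u v x) (A v u x) / 2"
    using small[OF 2(1,2), of v u] by (intro d(2)) auto
  ultimately show False
    by (simp add: dist_real_def) argo
qed

subsection \<open>The inverse function theorem for smooth maps\<close>

lemma bounded_linear_frechet_derivative:
  "f differentiable (at x) \<Longrightarrow> bounded_linear (frechet_derivative f (at x))"
  using frechet_derivative_works has_derivative_bounded_linear by blast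

lemma open_nonzero:
  fixes h :: "'a::topological_space \<Rightarrow> real"
  assumes "open U" "continuous_on U h"
  shows "open {x \<in> U. h x \<noteq> 0}"
proof -
  have "{x \<in> U. h x \<noteq> 0} = U \<inter> h -` (- {0})" by auto
  then show ?thesis using continuous_open_preimage[OF assms(2,1), of "- {0}"] by (simp add: open_Compl)
qed

text \<open>The inverse function theorem yields a differentiable inverse \<open>g\<close>, whose
  derivative at \<open>y\<close> is the inverse of the Jacobi matrix at \<open>g y\<close>, a smooth
  function of \<open>g y\<close>. Hence if \<open>g\<close> is of class \<open>C^k\<close>, so are
  its derivatives, and induction on \<open>k\<close> gives smoothness.\<close>

lemma smooth_inverse_function:
  fixes f :: "real^'n::finite \<Rightarrow> real^'n"
  assumes "open U" and f: "smooth_on U f" and "x0 \<in> U"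
    and det: "det (matrix (frechet_derivative f (at x0))) \<noteq> 0"
  obtains U' V g where "open U'" "x0 \<in> U'" "U' \<subseteq> U" "open V" "f x0 \<in> V" "homeomorphism U' V f g" "smooth_on V g"
proof -
  let ?D = "\<lambda>x. frechet_derivative f (at x)"
  have bl: "bounded_linear (?D x)" if "x \<in> U" for x
    using f that smooth_on_differentiable bounded_linear_frechet_derivative by blast
  have app: "blinfun_apply (Blinfun (?D x)) = ?D x" if "x \<in> U" for x
    using bl[OF that] bounded_linear_Blinfun_apply by blast
  have D_eq: "?D x v = matrix (?D x) *v v" if "x \<in> U" for x v
    using matrix_works[of "?D x" v] bounded_linear.linear[OF bl[OF that]] linear_matrix_vector_mul_eq
    by metis
  have 1: "(f has_derivative blinfun_apply (Blinfun (?D x))) (at x)" if "x \<in> U" for x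
    using smooth_on_has_derivative[OF f that] app[OF that] by simp
  have 2: "continuous_on U (\<lambda>x. Blinfun (?D x))"
    by (rule continuous_on_blinfun_componentwise)
      (use smooth_on_continuous[OF smooth_on_deriv[OF f]] in \<open>simp add: app cong: continuous_on_cong\<close>)
  let ?inv = "Blinfun ((*v) (matrix_inv (matrix (?D x0))))"
  have 3: "?inv o\<^sub>L Blinfun (?D x0) = id_blinfun"
    by (rule blinfun_eqI)
      (simp add: app[OF \<open>x0 \<in> U\<close>] D_eq[OF \<open>x0 \<in> U\<close>] matrix_vector_mul_assoc matrix_inv_mult[OF det]
        bounded_linear_Blinfun_apply)
  obtain U' V g g' where g: "open U'" "U' \<subseteq> U" "x0 \<in> U'" "open V" "f x0 \<in> V" "homeomorphism U' V f g"
    "\<And>y. y \<in> V \<Longrightarrow> (g has_derivative (g' y)) (at y)"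
    "\<And>y. y \<in> V \<Longrightarrow> g' y = inv (blinfun_apply (Blinfun (?D (g y))))"
    "\<And>y. y \<in> V \<Longrightarrow> bij (blinfun_apply (Blinfun (?D (g y))))"
    by (rule inverse_function_theorem[OF \<open>open U\<close> 1 2 \<open>x0 \<in> U\<close> 3]) blast+
  let ?M = "\<lambda>x. matrix (?D x)"
  \<comment> \<open>The inverse matrix is a smooth function only where the determinant does not
    vanish; \<open>W\<close> is the open set of these points and contains all values of
    \<open>g\<close>.\<close>
  define W where "W = {x \<in> U. det (?M x) \<noteq> 0}"
  have sm: "smooth_on U (\<lambda>x. ?M x $ i $ j)" for i j
    unfolding matrix_def using smooth_on_nth[OF \<open>open U\<close> smooth_on_deriv[OF f]] by simp
  have "open W"
    unfolding W_def by (rule open_nonzero[OF \<open>open U\<close> smooth_on_continuous[OF smooth_on_det[OF \<open>open U\<close> sm]]])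
  have smW: "smooth_on W (\<lambda>x. matrix_inv (?M x) $ k $ l)" for k l
    by (rule smooth_on_matrix_inv[OF \<open>open W\<close> smooth_on_subset[OF sm]]) (auto simp: W_def)
  have gU: "g y \<in> U" if "y \<in> V" for y
    using g(2,6) that unfolding homeomorphism_def by blast
  have bij: "bij ((*v) (?M (g y)))" if "y \<in> V" for y
  proof -
    have "blinfun_apply (Blinfun (?D (g y))) = (*v) (?M (g y))"
      using app[OF gU[OF that]] D_eq[OF gU[OF that]] by auto
    then show ?thesis using g(9)[OF that] by simp
  qed
  have gW: "g y \<in> W" if "y \<in> V" for y
  proof -
    have "inj (?D (g y))"
      using g(9)[OF that] app[OF gU[OF that]] by (simp add: bij_def)
    then show ?thesis
      using gU[OF that] det_nz_iff_inj[OF bounded_linear.linear[OF bl[OF gU[OF that]]]] by (simp add: W_def)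
  qed
  have g'_eq: "g' y v = (\<chi> k. \<Sum>l\<in>UNIV. matrix_inv (?M (g y)) $ k $ l * v $ l)" if "y \<in> V" for y v
  proof -
    have "g' y v = inv ((*v) (?M (g y))) v"
      using g(8)[OF that] app[OF gU[OF that]] D_eq[OF gU[OF that]] by (metis ext)
    also have "\<dots> = matrix_inv (?M (g y)) *v v"
      using bij[OF that] gW[OF that] matrix_inv_mult(1)[of "?M (g y)"]
      by (intro inv_f_eq) (auto simp: bij_def W_def matrix_vector_mul_assoc)
    finally show ?thesis by (simp add: matrix_vector_mult_def)
  qed
  have "Ck_on k V g" for k
  proof (induction k)
    case 0
    then show ?case using g(6) by (simp add: homeomorphism_def)
  next
    case (Suc k)
    have "Ck_on k V (\<lambda>y. \<Sum>i\<in>UNIV. (\<Sum>l\<in>UNIV. matrix_inv (?M (g y)) $ i $ l * v $ l) *\<^sub>R axis i 1 :: real^'n)" for v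
      using smW gW
      by (intro Ck_on_sum Ck_on_bilinear[OF bounded_bilinear_scaleR] Ck_on_bilinear[OF bounded_bilinear_mult]
          Ck_on_const \<open>open V\<close> Ck_on_compose[OF \<open>open V\<close> \<open>open W\<close> _ Suc, where g = "\<lambda>x. matrix_inv (?M x) $ _ $ _"])
        (auto simp: smooth_on_def)
    moreover have "(\<Sum>i\<in>UNIV. c i *\<^sub>R axis i 1 :: real^'n) = (\<chi> i. c i)" for c
      by (simp add: vec_eq_iff axis_def if_distrib cong: if_cong)
    ultimately have "Ck_on k V (\<lambda>y. g' y v)" for v
      by (auto intro: Ck_on_cong[OF \<open>open V\<close>] simp: g'_eq)
    then show ?case
      using g(7) by (intro Ck_on_SucI[where f' = g'] \<open>open V\<close>)
  qed
  then have "smooth_on V g" by (simp add: smooth_on_def)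
  with g show ?thesis using that by blast
qed

section \<open>Partial derivatives and jets\<close>

lemma partial_eqI: "(f has_derivative f') (at x) \<Longrightarrow> partial k f x = f' (axis k 1)"
  unfolding partial_def using frechet_derivative_at by metis

lemma smooth_on_partial: "smooth_on S f \<Longrightarrow> smooth_on S (partial k f)"
  unfolding partial_def[abs_def] by (rule smooth_on_deriv)

lemma smooth_on_partials: "smooth_on S f \<Longrightarrow> smooth_on S (partials J f)"
  by (induction J) (auto intro: smooth_on_partial)

lemma partial_cong:
  assumes "open S" "x \<in> S" "\<And>y. y \<in> S \<Longrightarrow> f y = g y"
  shows "partial k f x = partial k g x"
proof -
  have "(f has_derivative D) (at x) \<longleftrightarrow> (g has_derivative D) (at x)" for D
    using assms has_derivative_transform_within_open[of f D x UNIV S g]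
      has_derivative_transform_within_open[of g D x UNIV S f] by auto
  then show ?thesis by (simp add: partial_def frechet_derivative_def)
qed

lemma partials_cong:
  assumes "open S" "\<And>y. y \<in> S \<Longrightarrow> f y = g y" "x \<in> S"
  shows "partials J f x = partials J g x"
  using assms(3)
  by (induction J arbitrary: x) (auto intro: partial_cong[OF assms(1)] simp: assms(2))

lemma partial_commute:
  assumes "open S" "smooth_on S f" "x \<in> S"
  shows "partial i (partial j f) x = partial j (partial i f) x"
  using frechet_derivative_commute[OF assms] unfolding partial_def .

lemma partials_append: "partials (I @ J) f = partials I (partials J f)"
  by (induction I) auto

lemma partials_move:
  assumes "open S" "smooth_on S f" "x \<in> S" "j \<in> set J"
  shows "partials J f x = partials (j # remove1 j J) f x"
  using assms(3,4)
proof (induction J arbitrary: x)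
  case (Cons y J)
  show ?case
  proof (cases "j = y")
    case False
    with Cons.prems have "j \<in> set J" by auto
    have "partials (y # J) f x = partial y (partials (j # remove1 j J) f) x"
      using partial_cong[OF assms(1) Cons.prems(1) Cons.IH] \<open>j \<in> set J\<close> by simp
    also have "\<dots> = partial j (partials (y # remove1 j J) f) x"
      using partial_commute[OF assms(1) smooth_on_partials[OF assms(2)] Cons.prems(1)] by simp
    finally show ?thesis using False by simp
  qed simp
qed simp

text \<open>Coordinates are indexed by multisets and computed along sorted lists, whereas recursions
  prepend an index and leave the sorted order; this reconciles the two.\<close>

lemma partials_mset:
  assumes "open S" "smooth_on S f" "x \<in> S" "mset I = mset J"
  shows "partials I f x = partials J f x"
  using assms(3,4)
proof (induction I arbitrary: J x)
  case (Cons i I)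
  then have "i \<in> set J" by (metis list.set_intros(1) mset_eq_setD)
  have "mset I = mset (remove1 i J)" using Cons.prems(2) by (metis mset_remove1 add_mset_remove_trivial mset.simps(2))
  then have "partials (i # I) f x = partials (i # remove1 i J) f x"
    using partial_cong[OF assms(1) Cons.prems(1) Cons.IH] by simp
  then show ?case using partials_move[OF assms(1,2) Cons.prems(1) \<open>i \<in> set J\<close>] by simp
qed simp

lemma partial_linear:
  fixes f g :: "real^'k::finite \<Rightarrow> real"
  assumes "f differentiable (at x)" "g differentiable (at x)"
  shows "partial k (\<lambda>x. f x + g x) x = partial k f x + partial k g x"
    and "partial k (\<lambda>x. c * f x) x = c * partial k f x"
    and "partial k (\<lambda>x. f x * g x) x = f x * partial k g x + partial k f x * g x"
  using partial_eqI[OF has_derivative_add[OF assms[unfolded frechet_derivative_works]]]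
    partial_eqI[OF has_derivative_mult_right[OF assms(1)[unfolded frechet_derivative_works]]]
    partial_eqI[OF has_derivative_mult[OF assms[unfolded frechet_derivative_works]]]
  unfolding partial_def by blast+

lemma partial_sum:
  fixes f :: "'i \<Rightarrow> real^'k::finite \<Rightarrow> real"
  assumes "\<And>i. i \<in> I \<Longrightarrow> f i differentiable (at x)"
  shows "partial k (\<lambda>x. \<Sum>i\<in>I. f i x) x = (\<Sum>i\<in>I. partial k (f i) x)"
proof -
  have "((\<lambda>x. \<Sum>i\<in>I. f i x) has_derivative (\<lambda>v. \<Sum>i\<in>I. frechet_derivative (f i) (at x) v)) (at x)"
    using assms by (intro has_derivative_sum) (simp add: frechet_derivative_works)
  from partial_eqI[OF this] show ?thesis by (simp add: partial_def)
qed

lemma partials_lincomb: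
  fixes f :: "'i \<Rightarrow> real^'k::finite \<Rightarrow> real"
  assumes "open S" "\<And>i. i \<in> I \<Longrightarrow> smooth_on S (f i)" "x \<in> S"
  shows "partials J (\<lambda>x. \<Sum>i\<in>I. c i * f i x) x = (\<Sum>i\<in>I. c i * partials J (f i) x)"
  using assms(3)
proof (induction J arbitrary: x)
  case (Cons j J)
  have sm: "partials J (f i) differentiable (at x)" if "i \<in> I" for i
    using smooth_on_differentiable[OF smooth_on_partials[OF assms(2)[OF that]] Cons.prems] .
  have "partials (j # J) (\<lambda>x. \<Sum>i\<in>I. c i * f i x) x = partial j (\<lambda>x. \<Sum>i\<in>I. c i * partials J (f i) x) x"
    using partial_cong[OF assms(1) Cons.prems Cons.IH] by simp
  also have "\<dots> = (\<Sum>i\<in>I. partial j (\<lambda>x. c i * partials J (f i) x) x)"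
    by (rule partial_sum) (use sm in \<open>auto intro!: differentiable_mult\<close>)
  also have "\<dots> = (\<Sum>i\<in>I. c i * partials (j # J) (f i) x)"
    using sm by (intro sum.cong) (auto intro!: partial_linear(2))
  finally show ?case .
qed simp

lemma partials_translate:
  assumes "open S" "smooth_on S f" "t + u \<in> S"
  shows "partials J (\<lambda>u. f (t + u)) u = partials J f (t + u)"
  using assms(3)
proof (induction J arbitrary: u)
  case (Cons j J)
  have "open ((+) t -` S)" using \<open>open S\<close> by (intro open_vimage continuous_intros)
  then have "partials (j # J) (\<lambda>u. f (t + u)) u = partial j (\<lambda>u. partials J f (t + u)) u"
    using partial_cong[of "(+) t -` S" u "partials J (\<lambda>u. f (t + u))"] Cons by simp
  also have "\<dots> = partials (j # J) f (t + u)"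
  proof -
    have "((+) t has_derivative (\<lambda>h. h)) (at u)" by (auto intro!: derivative_eq_intros)
    from partial_eqI[OF has_derivative_compose[OF this smooth_on_has_derivative[OF smooth_on_partials[OF assms(2)] Cons.prems]]]
    show ?thesis by (simp add: partial_def)
  qed
  finally show ?case .
qed simp

subsection \<open>Polynomials with prescribed derivatives at the origin\<close>

text \<open>Dividing by factorials makes the derivatives at the origin dual to the monomials, so
  that a polynomial with prescribed derivatives has exactly these as coefficients.\<close>

definition monomial :: "'k::finite multiset \<Rightarrow> real^'k \<Rightarrow> real" where
  "monomial M t = (\<Prod>i\<in>UNIV. t $ i ^ count M i / fact (count M i))"

lemma smooth_monomial: "smooth_on UNIV (monomial M)"
  unfolding monomial_def[abs_def] divide_inverse
  by (intro smooth_on_prod smooth_on_mult smooth_on_power smooth_on_component smooth_on_const) auto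

lemma monomial_zero: "monomial M 0 = (if M = {#} then 1 else 0)"
proof (cases "M = {#}")
  case False
  then obtain i where "i \<in># M" by blast
  then show ?thesis
    unfolding monomial_def using False by (auto intro!: prod_zero bexI[of _ i] simp: not_in_iff)
qed (simp add: monomial_def)

lemma partial_monomial:
  "partial j (monomial M) t = (if j \<in># M then monomial (M - {#j#}) t else 0)"
proof -
  let ?g = "\<lambda>M i t. t $ i ^ count M i / fact (count M i) :: real"
  let ?R = "\<lambda>t. \<Prod>i\<in>UNIV - {j}. ?g M i t"
  have split: "monomial N t = ?g N j t * (\<Prod>i\<in>UNIV - {j}. ?g N i t)" for N t
    unfolding monomial_def by (simp add: prod.remove[of _ j])
  have dR: "?R differentiable (at t)"
    unfolding divide_inverse
    by (rule smooth_on_differentiable[OF _ UNIV_I])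
      (intro smooth_on_prod smooth_on_mult smooth_on_power smooth_on_component smooth_on_const; simp)+
  have dg: "?g M j differentiable (at t)"
    unfolding divide_inverse
    by (rule smooth_on_differentiable[OF _ UNIV_I])
      (intro smooth_on_mult smooth_on_power smooth_on_component smooth_on_const; simp)+
  have "partial j ?R t = 0"
  proof -
    have "((\<lambda>s. ?R (t + s *\<^sub>R axis j 1 + 0)) has_real_derivative partial j ?R (t + 0 *\<^sub>R axis j 1 + 0)) (at 0)"
      unfolding partial_def
      by (rule has_derivative_along_line[OF _ UNIV_I]; (unfold divide_inverse)?)
        (intro smooth_on_prod smooth_on_mult smooth_on_power smooth_on_component smooth_on_const; simp)+
    moreover have "?R (t + s *\<^sub>R axis j 1 + 0) = ?R t" for s
      by (rule prod.cong) (auto simp: axis_def)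
    ultimately show ?thesis using DERIV_unique[of "\<lambda>_. ?R t"] by simp
  qed
  moreover have "partial j (?g M j) t = (if j \<in># M then ?g (M - {#j#}) j t else 0)"
  proof (cases "count M j")
    case 0
    then show ?thesis by (simp add: partial_def not_in_iff)
  next
    case (Suc n)
    have "((\<lambda>t :: real^'a. t $ j) has_derivative (\<lambda>v. v $ j)) (at t)"
      by (rule bounded_linear_imp_has_derivative[OF bounded_linear_vec_nth])
    from has_derivative_mult_right[OF has_derivative_power[OF this, of "Suc n"], of "1 / fact (Suc n)"]
    have "((\<lambda>t :: real^'a. t $ j ^ Suc n / fact (Suc n)) has_derivative
        (\<lambda>v. real (Suc n) * v $ j * t $ j ^ n / fact (Suc n))) (at t)"
      by (simp del: of_nat_Suc fact_Suc)
    from partial_eqI[OF this, of j]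
    have "partial j (?g M j) t = (real (Suc n) / fact (Suc n)) * t $ j ^ n"
      using Suc by (simp add: axis_def del: of_nat_Suc fact_Suc)
    also have "real (Suc n) / fact (Suc n) = 1 / fact n"
      by (simp add: fact_Suc del: of_nat_Suc)
    finally have "partial j (?g M j) t = t $ j ^ n / fact n" by simp
    then show ?thesis using Suc by (simp add: not_in_iff[symmetric] count_eq_zero_iff[symmetric])
  qed
  moreover have "(\<Prod>i\<in>UNIV - {j}. ?g (M - {#j#}) i t) = ?R t"
    by (rule prod.cong) auto
  moreover have "partial j (monomial M) t = ?g M j t * partial j ?R t + partial j (?g M j) t * ?R t"
    unfolding split[abs_def] by (rule partial_linear(3)[OF dg dR])
  ultimately show ?thesis by (auto simp: split)
qed

lemma partials_monomial:
  "partials J (monomial M) = (if mset J \<subseteq># M then monomial (M - mset J) else (\<lambda>_. 0))"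
proof (induction J)
  case (Cons j J)
  have "mset (j # J) \<subseteq># M \<longleftrightarrow> mset J \<subseteq># M \<and> j \<in># M - mset J"
  proof (cases "mset J \<subseteq># M")
    case True
    then show ?thesis
      using subset_mset.le_diff_conv2[OF True, of "{#j#}"] by simp
  next
    case False
    then show ?thesis
      by (metis mset.simps(2) add_mset_add_single mset_subset_eq_add_left subset_mset.order_trans)
  qed
  moreover have "partial j (monomial N) = (if j \<in># N then monomial (N - {#j#}) else (\<lambda>_. 0))" for N
    by (auto simp: fun_eq_iff partial_monomial)
  moreover have "partial j (\<lambda>_. 0) = (\<lambda>_. 0)"
    by (auto simp: fun_eq_iff partial_def)
  ultimately show ?case using Cons.IH by simp
qed simp

lemma partials_monomial_zero: "partials J (monomial M) 0 = (if mset J = M then 1 else 0)"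
proof (cases "mset J \<subseteq># M")
  case True
  then have "M - mset J = {#} \<longleftrightarrow> mset J = M"
    using Diff_eq_empty_iff_mset subset_mset.antisym by blast
  with True show ?thesis by (simp add: partials_monomial monomial_zero)
next
  case False
  then show ?thesis by (auto simp: partials_monomial)
qed

subsection \<open>Multi-indices and jet coordinates\<close>

lemma Rep_midx_le: "size (Rep_midx (J :: ('n, 's) midx)) \<le> CARD('s)"
  using Rep_midx[of J] by simp

lemma Rep_midx_empty: "Rep_midx (midx_empty :: ('n, 's) midx) = {#}"
  unfolding midx_empty_def by (rule Abs_midx_inverse) simp

lemma midx_size_empty: "midx_size (midx_empty :: ('n, 's) midx) = 0"
  by (simp add: midx_size_def Rep_midx_empty)

lemma midx_size_eq_0_iff: "midx_size J = 0 \<longleftrightarrow> J = midx_empty"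
  by (metis midx_size_def Rep_midx_empty Rep_midx_inject size_eq_0_iff_empty)

lemma Rep_midx_add:
  "midx_size (J :: ('n, 's) midx) < CARD('s) \<Longrightarrow> Rep_midx (midx_add j J) = add_mset j (Rep_midx J)"
  unfolding midx_add_def midx_size_def by (rule Abs_midx_inverse) simp

lemma midx_size_add:
  "midx_size (J :: ('n, 's) midx) < CARD('s) \<Longrightarrow> midx_size (midx_add j J) = Suc (midx_size J)"
  by (simp add: midx_size_def Rep_midx_add)

lemma midx_size_le: "midx_size (J :: ('n, 's) midx) \<le> CARD('s)"
  using Rep_midx_le by (simp add: midx_size_def)

lemma mset_midx_list: "mset (midx_list J) = Rep_midx J"
  by (simp add: midx_list_def)

lemma length_midx_list: "length (midx_list J) = midx_size J"
  by (metis mset_midx_list size_mset midx_size_def)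

lemma midx_list_empty: "midx_list midx_empty = []"
  by (simp add: midx_list_def Rep_midx_empty)

lemma Rep_midx_single:
  "Rep_midx (midx_add j midx_empty :: ('n, 's::finite) midx) = {#j#}"
  by (subst Rep_midx_add) (auto simp: midx_size_empty Rep_midx_empty)

lemma midx_list_single:
  "midx_list (midx_add j midx_empty :: ('n::linorder, 's::finite) midx) = [j]"
  by (simp add: midx_list_def Rep_midx_single)

definition midx_of :: "'n list \<Rightarrow> ('n, 's) midx" where
  "midx_of L = Abs_midx (mset L)"

lemma Rep_midx_of: "length L \<le> CARD('s) \<Longrightarrow> Rep_midx (midx_of L :: ('n, 's) midx) = mset L"
  unfolding midx_of_def by (rule Abs_midx_inverse) simp

text \<open>The prolongation of \<open>g\<close> in coordinates: as \<open>t\<close> varies it runs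
  through the jets of \<open>g\<close> at all nearby points. Identities between coordinate functions
  are proved along such prolongations, where formal derivatives become ordinary ones.\<close>

definition jet_coords ::
    "(real^'n::{finite,linorder} \<Rightarrow> real^'a::finite) \<Rightarrow> real^'n::{finite,linorder} \<Rightarrow> real^('a \<times> ('n, 's) midx)" where
  "jet_coords g t = (\<chi> k. partials (midx_list (snd k)) (\<lambda>t. g t $ fst k) t)"

lemma smooth_jet_coords: "open U \<Longrightarrow> smooth_on U g \<Longrightarrow> smooth_on U (jet_coords g)"
  unfolding jet_coords_def[abs_def]
  by (simp add: smooth_on_vec_iff smooth_on_partials)

lemma jet_coords_nth:
  assumes "open U" "smooth_on U g" "t \<in> U" "mset L = Rep_midx J"
  shows "jet_coords g t $ (A, J) = partials L (\<lambda>t. g t $ A) t"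
  using partials_mset[OF assms(1) smooth_on_nth[OF assms(1,2)] assms(3), of "midx_list J" L A] assms(4)
  by (simp add: jet_coords_def mset_midx_list)

lemma jet_coords_empty: "jet_coords g t $ (A, midx_empty) = g t $ A"
  by (simp add: jet_coords_def midx_list_empty)

lemma jet_coords_single:
  "(jet_coords g t :: real^('a::finite \<times> ('n::{finite,linorder}, 's::finite) midx)) $ (A, midx_add j midx_empty)
    = partial j (\<lambda>t. g t $ A) t"
  by (simp add: jet_coords_def midx_list_single)

lemma jet_coords_cong:
  assumes "open U" "\<And>t. t \<in> U \<Longrightarrow> g t = h t" "t \<in> U"
  shows "jet_coords g t = jet_coords h t"
proof -
  have "partials L (\<lambda>t. g t $ A) t = partials L (\<lambda>t. h t $ A) t" for L A
    by (rule partials_cong[OF assms(1) _ assms(3)]) (simp add: assms(2))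
  then show ?thesis by (simp add: jet_coords_def)
qed

section \<open>The chain rule in coordinates\<close>

lemma frechet_derivative_axes:
  assumes "(F :: real^'k::finite \<Rightarrow> real) differentiable (at z)"
  shows "frechet_derivative F (at z) w = (\<Sum>k\<in>UNIV. w $ k * partial k F z)"
proof -
  interpret linear "frechet_derivative F (at z)"
    using assms by (rule linear_frechet_derivative)
  have "frechet_derivative F (at z) w = frechet_derivative F (at z) (\<Sum>k\<in>UNIV. (w $ k) *\<^sub>R axis k 1)"
    by (rule arg_cong[where f = "frechet_derivative F (at z)"])
      (simp add: vec_eq_iff axis_def if_distrib cong: if_cong)
  then show ?thesis by (simp add: sum scaleR partial_def)
qed

lemma frechet_derivative_nth:
  assumes "g differentiable (at t)"
  shows "frechet_derivative g (at t) v $ k = frechet_derivative (\<lambda>t. g t $ k) (at t) v"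
    and "(\<lambda>t. g t $ k) differentiable (at t)"
proof -
  have "((\<lambda>t. g t $ k) has_derivative (\<lambda>v. frechet_derivative g (at t) v $ k)) (at t)"
    using bounded_linear.has_derivative[OF bounded_linear_vec_nth] assms frechet_derivative_works by blast
  then show "frechet_derivative g (at t) v $ k = frechet_derivative (\<lambda>t. g t $ k) (at t) v"
    and "(\<lambda>t. g t $ k) differentiable (at t)"
    using frechet_derivative_at by (metis, metis differentiable_def)
qed

lemma partial_component: "partial k (\<lambda>z. z $ l) z = (if k = l then 1 else 0)"
  by (subst partial_eqI[OF bounded_linear_imp_has_derivative[OF bounded_linear_vec_nth]]) (simp add: axis_def)

lemma partial_compose_vec:
  assumes "u differentiable (at t)" "(F :: real^'k::finite \<Rightarrow> real) differentiable (at (u t))"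
  shows "partial j (\<lambda>t. F (u t)) t = (\<Sum>k\<in>UNIV. partial j (\<lambda>t. u t $ k) t * partial k F (u t))"
  unfolding partial_def[of j]
  by (simp add: frechet_derivative_compose[OF assms] frechet_derivative_axes[OF assms(2)]
      frechet_derivative_nth[OF assms(1)])

subsection \<open>Formal derivatives\<close>

text \<open>Along a prolongation the derivative of a coordinate of order below \<open>s\<close> is
  again a coordinate. Those of order \<open>s\<close> would lead to order \<open>s + 1\<close>; the
  assumption \<open>top\<close> makes their terms drop out.\<close>

lemma formal_deriv_chain:
  fixes F :: "real^('a::finite \<times> ('n::{finite,linorder}, 's) midx) \<Rightarrow> real"
  assumes U: "open U" "smooth_on U g" "t \<in> U" and F: "F differentiable (at (jet_coords g t))"
    and top: "\<And>A J. midx_size J = CARD('s) \<Longrightarrow> partial (A, J) F (jet_coords g t) = 0"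
  shows "partial j (\<lambda>t. F (jet_coords g t)) t = formal_deriv j F (jet_coords g t)"
proof -
  have d: "jet_coords g differentiable (at t)"
    using smooth_on_differentiable[OF smooth_jet_coords[OF U(1,2)] U(3)] .
  have "partial j (\<lambda>t. F (jet_coords g t)) t
      = (\<Sum>k\<in>UNIV. partial j (\<lambda>t. jet_coords g t $ k) t * partial k F (jet_coords g t))"
    by (rule partial_compose_vec[OF d F])
  also have "\<dots> = (\<Sum>k | midx_size (snd k) < CARD('s).
      partial j (\<lambda>t. jet_coords g t $ k) t * partial k F (jet_coords g t))"
  proof -
    have "partial k F (jet_coords g t) = 0" if "\<not> midx_size (snd k) < CARD('s)" for k
      using top[of "snd k" "fst k"] that midx_size_le[of "snd k"] by simp
    then show ?thesis by (intro sum.mono_neutral_right) auto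
  qed
  also have "\<dots> = (\<Sum>k | midx_size (snd k) < CARD('s).
      jet_coords g t $ (fst k, midx_add j (snd k)) * partial k F (jet_coords g t))"
  proof (rule sum.cong)
    fix k :: "'a \<times> ('n, 's) midx" assume "k \<in> {k. midx_size (snd k) < CARD('s)}"
    then have "(jet_coords g t :: real^('a \<times> ('n, 's) midx)) $ (fst k, midx_add j (snd k))
        = partials (j # midx_list (snd k)) (\<lambda>t. g t $ fst k) t"
      by (intro jet_coords_nth[OF U]) (simp add: Rep_midx_add mset_midx_list)
    then show "partial j (\<lambda>t. jet_coords g t $ k) t * partial k F (jet_coords g t)
        = jet_coords g t $ (fst k, midx_add j (snd k)) * partial k F (jet_coords g t)"
      by (simp add: jet_coords_def)
  qed simp
  finally show ?thesis by (simp add: formal_deriv_def case_prod_unfold)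
qed

text \<open>An infinitesimal form of depending only on coordinates of order at most
  \<open>k\<close>. It licenses the next formal derivative as long as \<open>k\<close> is below
  \<open>s\<close>.\<close>

definition low_order ::
    "nat \<Rightarrow> (real^('a::finite \<times> ('n::finite, 's) midx)) set \<Rightarrow> (real^('a \<times> ('n, 's) midx) \<Rightarrow> real) \<Rightarrow> bool" where
  "low_order k S F \<longleftrightarrow> (\<forall>z\<in>S. \<forall>A J. k < midx_size J \<longrightarrow> partial (A, J) F z = 0)"

lemma smooth_formal_deriv: "open S \<Longrightarrow> smooth_on S F \<Longrightarrow> smooth_on S (formal_deriv j F)"
  unfolding formal_deriv_def[abs_def] case_prod_unfold
  by (intro smooth_on_sum smooth_on_mult smooth_on_component smooth_on_partial)

lemma low_order_mult:
  assumes "open S" "smooth_on S F" "smooth_on S G" "low_order k S F" "low_order k S G"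
  shows "low_order k S (\<lambda>z. F z * G z)"
  using assms unfolding low_order_def by (auto simp: partial_linear(3) smooth_on_differentiable)

lemma low_order_sum:
  fixes F :: "'i \<Rightarrow> real^('a::finite \<times> ('n::finite, 's) midx) \<Rightarrow> real"
  assumes "open S" "\<And>i. i \<in> I \<Longrightarrow> smooth_on S (F i)" "\<And>i. i \<in> I \<Longrightarrow> low_order k S (F i)"
  shows "low_order k S (\<lambda>z. \<Sum>i\<in>I. F i z)"
  unfolding low_order_def
proof (intro ballI allI impI)
  fix z A and J :: "('n, 's) midx" assume z: "z \<in> S" "k < midx_size J"
  then have "partial (A, J) (\<lambda>z. \<Sum>i\<in>I. F i z) z = (\<Sum>i\<in>I. partial (A, J) (F i) z)"
    using assms(2) by (intro partial_sum smooth_on_differentiable)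
  also have "\<dots> = 0"
    using z assms(3) by (intro sum.neutral) (auto simp: low_order_def)
  finally show "partial (A, J) (\<lambda>z. \<Sum>i\<in>I. F i z) z = 0" .
qed

lemma low_order_mono: "low_order k S F \<Longrightarrow> k \<le> l \<Longrightarrow> low_order l S F"
  by (auto simp: low_order_def)

lemma low_order_partial:
  fixes F :: "real^('a::finite \<times> ('n::finite, 's) midx) \<Rightarrow> real"
  assumes "open S" "smooth_on S F" "low_order k S F"
  shows "low_order k S (partial B F)"
  unfolding low_order_def
proof (intro ballI allI impI)
  fix z A and J :: "('n, 's) midx" assume z: "z \<in> S" "k < midx_size J"
  then have "partial (A, J) (partial B F) z = partial B (\<lambda>_. 0) z"
    unfolding partial_commute[OF assms(1,2) z(1), of "(A, J)"]
    using assms(3) by (intro partial_cong[OF assms(1)]) (auto simp: low_order_def)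
  then show "partial (A, J) (partial B F) z = 0" by (simp add: partial_def)
qed

text \<open>In the product of \<open>x^A_{jJ}\<close> with the derivative of \<open>F\<close> by
  \<open>x^A_J\<close>, the new coordinate has order one more than \<open>J\<close>, and the factor
  beside it vanishes unless \<open>J\<close> has order at most \<open>k\<close>.\<close>

lemma low_order_formal_deriv:
  fixes F :: "real^('a::finite \<times> ('n::finite, 's) midx) \<Rightarrow> real"
  assumes "open S" "smooth_on S F" "low_order k S F"
  shows "low_order (Suc k) S (formal_deriv j F)"
  unfolding formal_deriv_def[abs_def] case_prod_unfold
proof (rule low_order_sum[OF \<open>open S\<close>])
  fix p :: "'a \<times> ('n, 's) midx" assume p: "p \<in> {p. midx_size (snd p) < CARD('s)}"
  have sm: "smooth_on S (\<lambda>z. z $ (fst p, midx_add j (snd p)))" "smooth_on S (partial p F)"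
    using assms by (auto intro: smooth_on_component smooth_on_partial)
  then show "smooth_on S (\<lambda>z. z $ (fst p, midx_add j (snd p)) * partial (fst p, snd p) F z)"
    by (auto intro: smooth_on_mult \<open>open S\<close>)
  show "low_order (Suc k) S (\<lambda>z. z $ (fst p, midx_add j (snd p)) * partial (fst p, snd p) F z)"
    unfolding low_order_def
  proof (intro ballI allI impI)
    fix z B and K :: "('n, 's) midx" assume z: "z \<in> S" "Suc k < midx_size K"
    have "partial (B, K) (partial p F) z = 0"
      using low_order_partial[OF assms] z by (auto simp: low_order_def)
    moreover have "partial (B, K) (\<lambda>z. z $ (fst p, midx_add j (snd p))) z * partial p F z = 0"
    proof (cases "(B, K) = (fst p, midx_add j (snd p))")
      case True
      then have "k < midx_size (snd p)" using z p midx_size_add[of "snd p" j] by auto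
      then have "partial p F z = 0" using assms(3) z(1) unfolding low_order_def by (metis prod.collapse)
      then show ?thesis by simp
    qed (auto simp: partial_component)
    ultimately show "partial (B, K) (\<lambda>z. z $ (fst p, midx_add j (snd p)) * partial (fst p, snd p) F z) z = 0"
      using sm z(1) by (simp add: partial_linear(3) smooth_on_differentiable)
  qed
qed

primrec formal_derivs ::
    "'n::finite list \<Rightarrow> (real^('a::finite \<times> ('n, 's) midx) \<Rightarrow> real) \<Rightarrow> real^('a \<times> ('n, 's) midx) \<Rightarrow> real" where
  "formal_derivs [] F = F"
| "formal_derivs (j # J) F = formal_deriv j (formal_derivs J F)"

lemma smooth_formal_derivs: "open S \<Longrightarrow> smooth_on S F \<Longrightarrow> smooth_on S (formal_derivs J F)"
  by (induction J) (auto intro: smooth_formal_deriv)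

lemma low_order_formal_derivs:
  "open S \<Longrightarrow> smooth_on S F \<Longrightarrow> low_order 0 S F \<Longrightarrow> low_order (length J) S (formal_derivs J F)"
  by (induction J) (auto intro: low_order_formal_deriv smooth_formal_derivs)

lemma partials_jet_coords:
  fixes F :: "real^('a::finite \<times> ('n::{finite,linorder}, 's) midx) \<Rightarrow> real"
  assumes "open S" "smooth_on S F" "low_order 0 S F"
    and U: "open U" "smooth_on U g" and jc: "\<And>t. t \<in> U \<Longrightarrow> jet_coords g t \<in> S"
    and "length J \<le> CARD('s)" "t \<in> U"
  shows "partials J (\<lambda>t. F (jet_coords g t)) t = formal_derivs J F (jet_coords g t)"
  using assms(7,8)
proof (induction J arbitrary: t)
  case (Cons j J)
  have "partials (j # J) (\<lambda>t. F (jet_coords g t)) t = partial j (\<lambda>t. formal_derivs J F (jet_coords g t)) t"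
    using Cons partial_cong[OF U(1) Cons.prems(2), of "partials J (\<lambda>t. F (jet_coords g t))"] by simp
  also have "\<dots> = formal_deriv j (formal_derivs J F) (jet_coords g t)"
    using Cons.prems jc low_order_formal_derivs[OF assms(1-3), of J]
    by (intro formal_deriv_chain[OF U] smooth_on_differentiable[OF smooth_formal_derivs[OF assms(1,2)]])
      (auto simp: low_order_def)
  finally show ?case by simp
qed simp

definition base_coords :: "real^('a::finite \<times> ('n::finite, 's) midx) \<Rightarrow> real^'a" where
  "base_coords z = (\<chi> A. z $ (A, midx_empty))"

lemma base_coords_jet_coords: "base_coords (jet_coords g t) = g t"
  by (simp add: base_coords_def jet_coords_empty vec_eq_iff)

lemma bounded_linear_base_coords: "bounded_linear base_coords"
  by (intro linear_conv_bounded_linear[THEN iffD1] linearI) (auto simp: base_coords_def vec_eq_iff)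

lemma open_base_coords: "open T \<Longrightarrow> open (base_coords -` T)"
  by (intro open_vimage linear_continuous_on bounded_linear_base_coords)

text \<open>For functions such as the inverse of the matrix of first order coordinates, invariance
  under translation in a coordinate direction is plain from the definition, while a formula for the
  derivative would have to be worked out.\<close>

lemma partial_invariant:
  fixes F :: "real^'k::finite \<Rightarrow> real"
  assumes "F differentiable (at z)" "\<And>h. F (z + h *\<^sub>R axis k 1) = F z"
  shows "partial k F z = 0"
proof -
  have "((\<lambda>h. z + h *\<^sub>R axis k 1) has_derivative (\<lambda>h. h *\<^sub>R axis k 1)) (at 0)"
    by (auto intro!: derivative_eq_intros)
  from has_derivative_compose[OF this, of F "frechet_derivative F (at z)"]
  have "((\<lambda>h. F z) has_derivative (\<lambda>h. frechet_derivative F (at z) (h *\<^sub>R axis k 1))) (at 0)"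
    using assms by (simp add: frechet_derivative_works)
  from has_derivative_unique[OF this has_derivative_const]
  have "frechet_derivative F (at z) (1 *\<^sub>R axis k 1) = 0" by metis
  then show ?thesis by (simp add: partial_def)
qed

lemma smooth_base_coords_compose:
  "open T \<Longrightarrow> smooth_on T \<psi> \<Longrightarrow> smooth_on (base_coords -` T) (\<lambda>z. \<psi> (base_coords z))"
  by (rule smooth_on_compose[of _ T]) (auto intro: open_base_coords smooth_on_linear bounded_linear_base_coords)

lemma low_order_base_coords:
  fixes \<psi> :: "real^'a::finite \<Rightarrow> real"
  assumes "open T" "smooth_on T \<psi>"
  shows "low_order 0 (base_coords -` T) (\<lambda>z :: real^('a \<times> ('n::finite, 's) midx). \<psi> (base_coords z))"
  unfolding low_order_def
proof (intro ballI allI impI partial_invariant)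
  fix z :: "real^('a \<times> ('n, 's) midx)" and A h and J :: "('n, 's) midx"
  assume "z \<in> base_coords -` T" and "0 < midx_size J"
  then show "(\<lambda>z. \<psi> (base_coords z)) differentiable at z"
    using smooth_on_differentiable[OF smooth_base_coords_compose[OF assms]] by blast
  have "J \<noteq> midx_empty" using \<open>0 < midx_size J\<close> by (auto simp: midx_size_empty)
  then have "base_coords (z + h *\<^sub>R axis (A, J) 1) = base_coords z"
    by (auto simp: base_coords_def vec_eq_iff axis_def)
  then show "\<psi> (base_coords (z + h *\<^sub>R axis (A, J) 1)) = \<psi> (base_coords z)" by simp
qed

text \<open>The substitute for a chain rule of higher order: the derivatives of \<psi> \<circ> g up
  to order \<open>s\<close> are functions, built from \<psi> alone, of the jet of \<open>g\<close>.
  From this follow both that jets are determined in a single chart and that changes of velocity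
  coordinates are smooth.\<close>

lemma partials_compose:
  fixes \<psi> :: "real^'a::finite \<Rightarrow> real" and g :: "real^'n::{finite,linorder} \<Rightarrow> real^'a"
  assumes "open T" "smooth_on T \<psi>" "open U" "smooth_on U g" "g ` U \<subseteq> T" "length J \<le> CARD('s)" "t \<in> U"
  shows "partials J (\<lambda>t. \<psi> (g t)) t
    = formal_derivs J (\<lambda>z. \<psi> (base_coords z)) (jet_coords g t :: real^('a \<times> ('n, 's) midx))"
  using partials_jet_coords[OF open_base_coords[OF assms(1)] smooth_base_coords_compose[OF assms(1,2)]
      low_order_base_coords[OF assms(1,2)] assms(3,4) _ assms(6,7)] assms(5)
  by (auto simp: base_coords_jet_coords)

subsection \<open>Reparametrisation acts linearly on jets\<close>

text \<open>Operators that send f to a sum of terms c(t) times the K-th derivative of f at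
  \<alpha>(t), with K of length at most \<open>n\<close>. Differentiation in \<open>t\<close> stays
  in the class and raises \<open>n\<close> by one, so every derivative of f \<circ> \<alpha> has
  this shape, with coefficients that are the same for all f.\<close>

inductive jet_op ::
    "(real^'n::finite) set \<Rightarrow> (real^'n::finite \<Rightarrow> real^'k::finite) \<Rightarrow> nat \<Rightarrow>
     ((real^'k::finite \<Rightarrow> real) \<Rightarrow> real^'n::finite \<Rightarrow> real) \<Rightarrow> bool" for U \<alpha> n where
  zero: "jet_op U \<alpha> n (\<lambda>f t. 0)"
| monom: "smooth_on U c \<Longrightarrow> length K \<le> n \<Longrightarrow> jet_op U \<alpha> n (\<lambda>f t. c t * partials K f (\<alpha> t))"
| add: "jet_op U \<alpha> n P \<Longrightarrow> jet_op U \<alpha> n Q \<Longrightarrow> jet_op U \<alpha> n (\<lambda>f t. P f t + Q f t)"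

lemma jet_op_sum:
  "(\<And>i. i \<in> I \<Longrightarrow> jet_op U \<alpha> n (P i)) \<Longrightarrow> jet_op U \<alpha> n (\<lambda>f t. \<Sum>i\<in>I. P i f t)"
  by (induction I rule: infinite_finite_induct) (auto intro: jet_op.intros)

lemma jet_op_partial:
  fixes \<alpha> :: "real^'n::finite \<Rightarrow> real^'k::finite"
  assumes "open U" "smooth_on U \<alpha>" "jet_op U \<alpha> n P"
  shows "\<exists>Q. jet_op U \<alpha> (Suc n) Q \<and> (\<forall>T f t. open T \<longrightarrow> smooth_on T f \<longrightarrow> t \<in> U \<longrightarrow> \<alpha> t \<in> T \<longrightarrow>
    P f differentiable (at t) \<and> partial j (P f) t = Q f t)"
  using assms(3)
proof (induction rule: jet_op.induct)
  case zero
  show ?case by (rule exI[of _ "\<lambda>f t. 0"]) (auto intro: jet_op.zero simp: partial_def)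
next
  case (monom c K)
  let ?Q = "\<lambda>f t. (\<Sum>i\<in>UNIV. (c t * partial j (\<lambda>t. \<alpha> t $ i) t) * partials (i # K) f (\<alpha> t))
      + partial j c t * partials K f (\<alpha> t)"
  have "jet_op U \<alpha> (Suc n) ?Q"
    using monom assms(1,2)
    by (intro jet_op.add jet_op_sum jet_op.monom smooth_on_mult smooth_on_partial smooth_on_nth) auto
  moreover have "(\<lambda>t. c t * partials K f (\<alpha> t)) differentiable (at t) \<and>
      partial j (\<lambda>t. c t * partials K f (\<alpha> t)) t = ?Q f t"
    if "open T" "smooth_on T f" "t \<in> U" "\<alpha> t \<in> T" for T t and f :: "real^'k \<Rightarrow> real"
  proof -
    have a: "\<alpha> differentiable (at t)" and c: "c differentiable (at t)"
      and p: "partials K f differentiable (at (\<alpha> t))"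
      using assms(2) that monom(1) by (auto intro: smooth_on_differentiable smooth_on_partials)
    have pa: "(\<lambda>t. partials K f (\<alpha> t)) differentiable (at t)"
      by (rule frechet_derivative_compose(2)[OF a p])
    show ?thesis
      using c pa
      by (simp add: partial_linear(3)[OF c pa] partial_compose_vec[OF a p] sum_distrib_left mult_ac)
  qed
  ultimately show ?case by blast
next
  case (add P Q)
  obtain P' where P': "jet_op U \<alpha> (Suc n) P'" and P: "\<forall>T f t. open T \<longrightarrow> smooth_on T f \<longrightarrow> t \<in> U \<longrightarrow> \<alpha> t \<in> T \<longrightarrow>
      P f differentiable (at t) \<and> partial j (P f) t = P' f t"
    using add.IH(1) by blast
  obtain Q' where Q': "jet_op U \<alpha> (Suc n) Q'" and Q: "\<forall>T f t. open T \<longrightarrow> smooth_on T f \<longrightarrow> t \<in> U \<longrightarrow> \<alpha> t \<in> T \<longrightarrow>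
      Q f differentiable (at t) \<and> partial j (Q f) t = Q' f t"
    using add.IH(2) by blast
  show ?case
  proof (intro exI[of _ "\<lambda>f t. P' f t + Q' f t"] conjI jet_op.add P' Q' allI impI)
    fix T t and f :: "real^'k \<Rightarrow> real" assume *: "open T" "smooth_on T f" "t \<in> U" "\<alpha> t \<in> T"
    have p: "P f differentiable (at t)" "partial j (P f) t = P' f t" using P * by blast+
    have q: "Q f differentiable (at t)" "partial j (Q f) t = Q' f t" using Q * by blast+
    show "(\<lambda>t. P f t + Q f t) differentiable (at t)" using p q by simp
    show "partial j (\<lambda>t. P f t + Q f t) t = P' f t + Q' f t"
      using partial_linear(1)[OF p(1) q(1)] p(2) q(2) by simp
  qed
qed

lemma jet_op_partials:
  fixes \<alpha> :: "real^'n::finite \<Rightarrow> real^'k::finite"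
  assumes "open U" "smooth_on U \<alpha>"
  shows "\<exists>P. jet_op U \<alpha> (length J) P \<and> (\<forall>T f t. open T \<longrightarrow> smooth_on T f \<longrightarrow> t \<in> U \<longrightarrow> \<alpha> t \<in> T \<longrightarrow>
    partials J (\<lambda>t. f (\<alpha> t)) t = P f t)"
proof (induction J)
  case Nil
  show ?case
  proof (intro exI conjI allI impI)
    show "jet_op U \<alpha> (length []) (\<lambda>f t. 1 * partials [] f (\<alpha> t))"
      by (intro jet_op.monom smooth_on_const assms) simp
  qed simp
next
  case (Cons j J)
  then obtain P where P: "jet_op U \<alpha> (length J) P"
    "\<forall>T f t. open T \<longrightarrow> smooth_on T f \<longrightarrow> t \<in> U \<longrightarrow> \<alpha> t \<in> T \<longrightarrow> partials J (\<lambda>t. f (\<alpha> t)) t = P f t"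
    by blast
  obtain Q where Q: "jet_op U \<alpha> (Suc (length J)) Q"
    "\<forall>T f t. open T \<longrightarrow> smooth_on T f \<longrightarrow> t \<in> U \<longrightarrow> \<alpha> t \<in> T \<longrightarrow> P f differentiable (at t) \<and> partial j (P f) t = Q f t"
    using jet_op_partial[OF assms P(1)] by blast
  have "partials (j # J) (\<lambda>t. f (\<alpha> t)) t = Q f t"
    if *: "open T" "smooth_on T f" "t \<in> U" "\<alpha> t \<in> T" for T t and f :: "real^'k \<Rightarrow> real"
  proof -
    have "open (U \<inter> \<alpha> -` T)"
      using continuous_open_preimage[OF smooth_on_continuous[OF assms(2)] assms(1) *(1)] .
    then have "partial j (partials J (\<lambda>t. f (\<alpha> t))) t = partial j (P f) t"
      using * P(2) by (intro partial_cong[of "U \<inter> \<alpha> -` T"]) auto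
    then show ?thesis using Q(2) * by simp
  qed
  with Q(1) show ?case by (metis length_Cons)
qed

lemma jet_op_linear:
  fixes \<alpha> :: "real^'n::{finite,linorder} \<Rightarrow> real^'n::{finite,linorder}"
  assumes "jet_op U \<alpha> n P" "n \<le> CARD('s)"
  shows "\<exists>L :: real^('a::finite \<times> ('n, 's) midx) \<Rightarrow> real. linear L \<and>
    (\<forall>g T. open T \<longrightarrow> smooth_on T g \<longrightarrow> \<alpha> t \<in> T \<longrightarrow> P (\<lambda>x. g x $ A) t = L (jet_coords g (\<alpha> t)))"
  using assms(1)
proof (induction rule: jet_op.induct)
  case zero
  show ?case by (rule exI[of _ "\<lambda>_. 0"]) (simp add: linear_zero)
next
  case (monom c K)
  let ?L = "\<lambda>z :: real^('a \<times> ('n, 's) midx). c t * z $ (A, midx_of K)"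
  have "linear ?L"
    by (rule linearI) (auto simp: algebra_simps)
  moreover have "partials K (\<lambda>x. g x $ A) (\<alpha> t) = jet_coords g (\<alpha> t) $ (A, midx_of K :: ('n, 's) midx)"
    if "open T" "smooth_on T g" "\<alpha> t \<in> T" for g T
    using monom(2) assms(2) by (intro jet_coords_nth[OF that, symmetric]) (simp add: Rep_midx_of)
  ultimately show ?case by (intro exI[of _ ?L]) auto
next
  case (add P Q)
  obtain L where L: "linear (L :: real^('a::finite \<times> ('n, 's) midx) \<Rightarrow> real)"
    "\<forall>g T. open T \<longrightarrow> smooth_on T g \<longrightarrow> \<alpha> t \<in> T \<longrightarrow> P (\<lambda>x. g x $ A) t = L (jet_coords g (\<alpha> t))"
    using add.IH(1) by blast
  obtain M where M: "linear (M :: real^('a::finite \<times> ('n, 's) midx) \<Rightarrow> real)"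
    "\<forall>g T. open T \<longrightarrow> smooth_on T g \<longrightarrow> \<alpha> t \<in> T \<longrightarrow> Q (\<lambda>x. g x $ A) t = M (jet_coords g (\<alpha> t))"
    using add.IH(2) by blast
  have "linear (\<lambda>z. L z + M z)" using L(1) M(1) by (rule linear_compose_add)
  moreover have "P (\<lambda>x. g x $ A) t + Q (\<lambda>x. g x $ A) t = L (jet_coords g (\<alpha> t)) + M (jet_coords g (\<alpha> t))"
    if "open T" "smooth_on T g" "\<alpha> t \<in> T" for g T
    using L(2) M(2) that by metis
  ultimately show ?case by blast
qed

text \<open>For fixed \<alpha> and \<open>t\<close> one linear map \<open>M\<close> serves all maps
  \<open>g\<close>. Hence the differential group acts linearly in the coordinates x^A_J, and the
  action of an element is its own derivative.\<close>

lemma jet_coords_reparam: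
  fixes \<alpha> :: "real^'n::{finite,linorder} \<Rightarrow> real^'n::{finite,linorder}"
  assumes "open U" "smooth_on U \<alpha>" "t \<in> U"
  obtains M :: "real^('a::finite \<times> ('n, 's) midx) \<Rightarrow> real^('a \<times> ('n, 's) midx)" where "linear M"
    "\<And>g T. open T \<Longrightarrow> smooth_on T g \<Longrightarrow> \<alpha> t \<in> T \<Longrightarrow> jet_coords (\<lambda>t. g (\<alpha> t)) t = M (jet_coords g (\<alpha> t))"
proof -
  define Q where "Q k L \<longleftrightarrow> linear L \<and> (\<forall>g T. open T \<longrightarrow> smooth_on T g \<longrightarrow> \<alpha> t \<in> T \<longrightarrow>
      partials (midx_list (snd k)) (\<lambda>t. g (\<alpha> t) $ fst k) t = L (jet_coords g (\<alpha> t)))"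
    for k :: "'a \<times> ('n, 's) midx" and L :: "real^('a \<times> ('n, 's) midx) \<Rightarrow> real"
  have "\<exists>L. Q k L" for k
    unfolding Q_def
  proof -
    obtain P where P: "jet_op U \<alpha> (length (midx_list (snd k))) P"
      "\<forall>T f t. open T \<longrightarrow> smooth_on T f \<longrightarrow> t \<in> U \<longrightarrow> \<alpha> t \<in> T \<longrightarrow>
        partials (midx_list (snd k)) (\<lambda>t. f (\<alpha> t)) t = P f t"
      using jet_op_partials[OF assms(1,2)] by blast
    obtain L where L: "linear (L :: real^('a::finite \<times> ('n, 's) midx) \<Rightarrow> real)"
      "\<forall>g T. open T \<longrightarrow> smooth_on T g \<longrightarrow> \<alpha> t \<in> T \<longrightarrow> P (\<lambda>x. g x $ fst k) t = L (jet_coords g (\<alpha> t))"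
      using jet_op_linear[OF P(1)] midx_size_le length_midx_list by metis
    have "partials (midx_list (snd k)) (\<lambda>t. g (\<alpha> t) $ fst k) t = L (jet_coords g (\<alpha> t))"
      if "open T" "smooth_on T g" "\<alpha> t \<in> T" for g T
      using P(2)[rule_format, OF that(1) smooth_on_nth[OF that(1,2)] assms(3) that(3)]
        L(2)[rule_format, OF that] by simp
    with L(1) show "\<exists>L :: real^('a \<times> ('n, 's) midx) \<Rightarrow> real. linear L \<and> (\<forall>g T. open T \<longrightarrow> smooth_on T g \<longrightarrow> \<alpha> t \<in> T \<longrightarrow>
      partials (midx_list (snd k)) (\<lambda>t. g (\<alpha> t) $ fst k) t = L (jet_coords g (\<alpha> t)))"
      by (intro exI[of _ L]) simp
  qed
  then obtain L where Q: "\<And>k. Q k (L k)" by metis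
  have L: "linear (L k)" "open T \<Longrightarrow> smooth_on T g \<Longrightarrow> \<alpha> t \<in> T \<Longrightarrow>
      partials (midx_list (snd k)) (\<lambda>t. g (\<alpha> t) $ fst k) t = L k (jet_coords g (\<alpha> t))" for k g T
    using Q[of k] unfolding Q_def by auto
  show thesis
  proof (rule that)
    show "linear (\<lambda>z. \<chi> k. L k z)"
      using L(1) by (intro linearI) (auto simp: vec_eq_iff linear_add linear_cmul)
    show "jet_coords (\<lambda>t. g (\<alpha> t)) t = (\<chi> k. L k (jet_coords g (\<alpha> t)))"
      if "open T" "smooth_on T g" "\<alpha> t \<in> T" for g T
      using L(2)[OF that] by (simp add: jet_coords_def)
  qed
qed

subsection \<open>The invariant coordinates\<close>

definition x_regular :: "(real^(('n::finite + 'm::finite) \<times> ('n, 's) midx)) set" where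
  "x_regular = {z. det (x_matrix z) \<noteq> 0}"

lemma smooth_x_matrix: "open S \<Longrightarrow> smooth_on S (\<lambda>z. x_matrix z $ i $ j)"
  by (simp add: x_matrix_def smooth_on_component)

lemma open_x_regular: "open x_regular"
  using open_nonzero[OF open_UNIV smooth_on_continuous[OF smooth_on_det[OF open_UNIV smooth_x_matrix[OF open_UNIV]]]]
  by (simp add: x_regular_def)

lemma low_order_x_inv:
  "low_order (Suc 0) x_regular
    (\<lambda>z :: real^(('n::finite + 'm::finite) \<times> ('n, 's::finite) midx). matrix_inv (x_matrix z) $ k $ l)"
  unfolding low_order_def
proof (intro ballI allI impI partial_invariant)
  fix z :: "real^(('n + 'm) \<times> ('n, 's) midx)" and A h and J :: "('n, 's) midx"
  assume z: "z \<in> x_regular" "Suc 0 < midx_size J"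
  show "(\<lambda>z. matrix_inv (x_matrix z) $ k $ l) differentiable at z"
    by (rule smooth_on_differentiable[OF smooth_on_matrix_inv[OF open_x_regular smooth_x_matrix[OF open_x_regular]] z(1)])
      (simp add: x_regular_def)
  have "midx_size (midx_add j midx_empty :: ('n, 's) midx) = Suc 0" for j
    by (subst midx_size_add) (auto simp: midx_size_empty)
  then have "midx_add j midx_empty \<noteq> J" for j using z(2) by auto
  then have "x_matrix (z + h *\<^sub>R axis (A, J) 1) = x_matrix z"
    by (simp add: x_matrix_def vec_eq_iff axis_def)
  then show "matrix_inv (x_matrix (z + h *\<^sub>R axis (A, J) 1)) $ k $ l = matrix_inv (x_matrix z) $ k $ l"
    by simp
qed

text \<open>Each step of the recursion takes one formal derivative and multiplies by entries of the
  inverse matrix, which have order one. So y_I has order at most the length of \<open>I\<close>, and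
  up to length \<open>s\<close> every formal derivative in the recursion is applied to a function of
  order below \<open>s\<close>.\<close>

lemma y_coord_smooth_low_order:
  fixes \<sigma> :: "'m::finite" and I :: "'n::finite list"
  shows "smooth_on x_regular (y_coord \<sigma> I :: real^(('n + 'm) \<times> ('n, 's::finite) midx) \<Rightarrow> real)
    \<and> low_order (length I) x_regular (y_coord \<sigma> I :: real^(('n + 'm) \<times> ('n, 's::finite) midx) \<Rightarrow> real)"
proof (induction I)
  case Nil
  show ?case
    by (auto simp: low_order_def partial_component midx_size_empty intro: smooth_on_component open_x_regular)
next
  case (Cons i I)
  let ?f = "\<lambda>j. formal_deriv j (y_coord \<sigma> I) :: real^(('n + 'm) \<times> ('n, 's) midx) \<Rightarrow> real"
  have f: "smooth_on x_regular (?f j)" "low_order (Suc (length I)) x_regular (?f j)" for j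
    using Cons smooth_formal_deriv low_order_formal_deriv open_x_regular by blast+
  have g: "smooth_on x_regular (\<lambda>z :: real^(('n + 'm) \<times> ('n, 's) midx). matrix_inv (x_matrix z) $ j $ i)" for j
    by (rule smooth_on_matrix_inv[OF open_x_regular smooth_x_matrix[OF open_x_regular]])
      (simp add: x_regular_def)
  have g': "low_order (Suc (length I)) x_regular
      (\<lambda>z :: real^(('n + 'm) \<times> ('n, 's) midx). matrix_inv (x_matrix z) $ j $ i)" for j
    by (rule low_order_mono[OF low_order_x_inv]) simp
  show ?case
  proof
    show "smooth_on x_regular (y_coord \<sigma> (i # I) :: real^(('n + 'm) \<times> ('n, 's) midx) \<Rightarrow> real)"
      unfolding y_coord.simps by (intro smooth_on_sum smooth_on_mult g f(1) open_x_regular)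
    show "low_order (length (i # I)) x_regular (y_coord \<sigma> (i # I) :: real^(('n + 'm) \<times> ('n, 's) midx) \<Rightarrow> real)"
      unfolding y_coord.simps length_Cons
      by (intro low_order_sum low_order_mult smooth_on_mult g g' f open_x_regular)
  qed
qed

lemmas smooth_y_coord = y_coord_smooth_low_order[THEN conjunct1]
lemmas low_order_y_coord = y_coord_smooth_low_order[THEN conjunct2]

lemma x_matrix_jet_coords:
  "x_matrix (jet_coords g t :: real^(('n::{finite,linorder} + 'm::finite) \<times> ('n, 's::finite) midx)) $ i $ j
    = partial j (\<lambda>t. g t $ Inl i) t"
  by (simp add: x_matrix_def jet_coords_single)

text \<open>On a prolongation the operator z^j_i d_j is differentiation with the x^i taken as
  independent variables, so the y_I are the derivatives of the y^\<sigma> as functions of the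
  x^i.\<close>

lemma y_coord_jet_coords_Cons:
  fixes \<sigma> :: "'m::finite" and g :: "real^'n::{finite,linorder} \<Rightarrow> real^('n + 'm)"
  defines "Y I t \<equiv> y_coord \<sigma> I (jet_coords g t :: real^(('n + 'm) \<times> ('n, 's::finite) midx))"
  assumes U: "open U" "smooth_on U g" "t \<in> U"
    and "det (x_matrix (jet_coords g t :: real^(('n + 'm) \<times> ('n, 's::finite) midx))) \<noteq> 0"
    and "length I < CARD('s)"
  shows "Y (i # I) t = (\<Sum>j\<in>UNIV. matrix_inv (x_matrix (jet_coords g t
    :: real^(('n + 'm) \<times> ('n, 's) midx))) $ j $ i * partial j (Y I) t)"
proof -
  let ?z = "jet_coords g t :: real^(('n + 'm) \<times> ('n, 's) midx)"
  have z: "?z \<in> x_regular" using assms by (simp add: x_regular_def)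
  have "partial j (Y I) t = formal_deriv j (y_coord \<sigma> I) ?z" for j
    unfolding Y_def
  proof (rule formal_deriv_chain[OF U])
    show "y_coord \<sigma> I differentiable at ?z"
      by (rule smooth_on_differentiable[OF smooth_y_coord z])
    show "partial (A, J) (y_coord \<sigma> I) ?z = 0" if "midx_size J = CARD('s)" for A and J :: "('n, 's) midx"
      using low_order_y_coord z that \<open>length I < CARD('s)\<close> unfolding low_order_def by metis
  qed
  then show ?thesis by (simp add: Y_def)
qed

lemma x_matrix_reparam:
  fixes \<alpha> :: "real^'n::{finite,linorder} \<Rightarrow> real^'n::{finite,linorder}" and g :: "real^'n::{finite,linorder} \<Rightarrow> real^('n + 'm::finite)"
  assumes "open U" "smooth_on U \<alpha>" "t \<in> U" "open V" "smooth_on V g" "\<alpha> t \<in> V"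
  shows "x_matrix (jet_coords (\<lambda>t. g (\<alpha> t)) t :: real^(('n + 'm) \<times> ('n, 's::finite) midx))
    = x_matrix (jet_coords g (\<alpha> t) :: real^(('n + 'm) \<times> ('n, 's::finite) midx)) ** (\<chi> k j. partial j (\<lambda>t. \<alpha> t $ k) t)"
  using smooth_on_differentiable[OF assms(2,3)]
    smooth_on_differentiable[OF smooth_on_nth[OF assms(4,5)] assms(6)]
  by (simp add: vec_eq_iff x_matrix_jet_coords matrix_matrix_mult_def partial_compose_vec[of \<alpha> t "\<lambda>x. g x $ _"] mult.commute)

text \<open>Invariance of the y_I. Passing to g \<circ> \<alpha> multiplies the derivatives by the
  Jacobi matrix \<open>A\<close> and replaces the inverse of \<open>X\<close> by that of
  \<open>X ** A\<close>; the two changes cancel. The identity is proved on all of \<open>U\<close>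
  because the induction differentiates it.\<close>

lemma y_coord_reparam:
  fixes \<alpha> :: "real^'n::{finite,linorder} \<Rightarrow> real^'n::{finite,linorder}" and g :: "real^'n::{finite,linorder} \<Rightarrow> real^('n + 'm::finite)"
  assumes U: "open U" "smooth_on U \<alpha>" "\<alpha> ` U \<subseteq> V" and V: "open V" "smooth_on V g"
    and det\<alpha>: "\<And>t. t \<in> U \<Longrightarrow> det (\<chi> k j. partial j (\<lambda>t. \<alpha> t $ k) t) \<noteq> 0"
    and detg: "\<And>v. v \<in> V \<Longrightarrow> det (x_matrix (jet_coords g v :: real^(('n + 'm) \<times> ('n, 's::finite) midx))) \<noteq> 0"
    and "length I \<le> CARD('s)" "t \<in> U"
  shows "y_coord \<sigma> I (jet_coords (\<lambda>t. g (\<alpha> t)) t :: real^(('n + 'm) \<times> ('n, 's) midx))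
    = y_coord \<sigma> I (jet_coords g (\<alpha> t) :: real^(('n + 'm) \<times> ('n, 's) midx))"
  using assms(8,9)
proof (induction I arbitrary: t)
  case Nil
  then show ?case by (simp add: jet_coords_empty)
next
  case (Cons i I)
  let ?j = "jet_coords :: _ \<Rightarrow> _ \<Rightarrow> real^(('n + 'm) \<times> ('n, 's) midx)"
  define A where "A = (\<chi> k j. partial j (\<lambda>t. \<alpha> t $ k) t)"
  define X where "X = x_matrix (?j g (\<alpha> t))"
  have inV: "\<alpha> t \<in> V" using U Cons.prems by auto
  have sm: "smooth_on U (\<lambda>t. g (\<alpha> t))" by (rule smooth_on_compose[OF U(1) V(1) U(3) U(2) V(2)])
  have X': "x_matrix (?j (\<lambda>t. g (\<alpha> t)) t) = X ** A"
    unfolding X_def A_def by (rule x_matrix_reparam[OF U(1,2) Cons.prems(2) V inV])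
  have dX: "det X \<noteq> 0" and dA: "det A \<noteq> 0"
    using detg[OF inV] det\<alpha>[OF Cons.prems(2)] by (auto simp: X_def A_def)
  then have dXA: "det (X ** A) \<noteq> 0" by (simp add: det_mul)
  have "A ** matrix_inv (X ** A) = matrix_inv X ** (X ** (A ** matrix_inv (X ** A)))"
    using matrix_inv_mult(2)[OF dX] by (simp add: matrix_mul_assoc)
  also have "\<dots> = matrix_inv X"
    using matrix_inv_mult(1)[OF dXA] by (simp add: matrix_mul_assoc)
  finally have inv: "A ** matrix_inv (X ** A) = matrix_inv X" .
  let ?Y = "\<lambda>v. y_coord \<sigma> I (?j g v)"
  have dY: "?Y differentiable (at (\<alpha> t))"
    using frechet_derivative_compose(2)[OF smooth_on_differentiable[OF smooth_jet_coords[OF V] inV]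
      smooth_on_differentiable[OF smooth_y_coord]] detg[OF inV] by (simp add: x_regular_def)
  have d\<alpha>: "\<alpha> differentiable (at t)" using smooth_on_differentiable[OF U(2) Cons.prems(2)] .
  have "partial j (\<lambda>t. y_coord \<sigma> I (?j (\<lambda>t. g (\<alpha> t)) t)) t = (\<Sum>k\<in>UNIV. A $ k $ j * partial k ?Y (\<alpha> t))" for j
  proof -
    have "partial j (\<lambda>t. y_coord \<sigma> I (?j (\<lambda>t. g (\<alpha> t)) t)) t = partial j (\<lambda>t. ?Y (\<alpha> t)) t"
      by (rule partial_cong[OF U(1) Cons.prems(2)]) (use Cons in auto)
    also have "\<dots> = (\<Sum>k\<in>UNIV. A $ k $ j * partial k ?Y (\<alpha> t))"
      unfolding A_def by (simp add: partial_compose_vec[OF d\<alpha> dY])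
    finally show ?thesis .
  qed
  then have "y_coord \<sigma> (i # I) (?j (\<lambda>t. g (\<alpha> t)) t)
      = (\<Sum>j\<in>UNIV. matrix_inv (X ** A) $ j $ i * (\<Sum>k\<in>UNIV. A $ k $ j * partial k ?Y (\<alpha> t)))"
    using y_coord_jet_coords_Cons[OF U(1) sm Cons.prems(2), where 's = 's and I = I and \<sigma> = \<sigma> and i = i]
      X' dXA Cons.prems(1) by simp
  also have "\<dots> = (\<Sum>k\<in>UNIV. (A ** matrix_inv (X ** A)) $ k $ i * partial k ?Y (\<alpha> t))"
    by (simp add: matrix_matrix_mult_def sum_distrib_left sum_distrib_right mult_ac) (rule sum.swap)
  also have "\<dots> = y_coord \<sigma> (i # I) (?j g (\<alpha> t))"
    using y_coord_jet_coords_Cons[OF V inV, where 's = 's and I = I and \<sigma> = \<sigma> and i = i]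
      inv dX Cons.prems(1) by (simp add: X_def)
  finally show ?case .
qed

subsection \<open>Graphs\<close>

text \<open>The graph over the x-coordinates with base point and Taylor coefficients prescribed by
  \<open>q\<close>. As its x-block is a translation of the parameter, its \<open>x_matrix\<close> is
  the identity; it serves as the distinguished representative of the orbit with coordinates
  \<open>q\<close>.\<close>

definition graph_map ::
    "real^('n::finite + 'm::finite \<times> ('n, 's) midx) \<Rightarrow> real^'n \<Rightarrow> real^('n + 'm)" where
  "graph_map q t = (\<chi> k. case k of Inl i \<Rightarrow> q $ Inl i + t $ i
     | Inr \<sigma> \<Rightarrow> \<Sum>J\<in>UNIV. q $ Inr (\<sigma>, J) * monomial (Rep_midx J) t)"

definition graph_jet ::
    "real^('n::{finite,linorder} + 'm::finite \<times> ('n, 's) midx) \<Rightarrow> real^(('n + 'm) \<times> ('n, 's) midx)" where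
  "graph_jet q = jet_coords (graph_map q) 0"

lemma smooth_graph_map: "smooth_on UNIV (graph_map q)"
proof (subst smooth_on_vec_iff[OF open_UNIV], intro allI)
  fix k :: "'a + 'b"
  show "smooth_on UNIV (\<lambda>t. graph_map q t $ k)"
    by (cases k) (auto simp: graph_map_def
        intro!: smooth_on_add smooth_on_const smooth_on_component smooth_on_sum smooth_on_mult smooth_monomial)
qed

lemma graph_jet_Inr:
  fixes q :: "real^('n::{finite,linorder} + 'm::finite \<times> ('n, 's) midx)"
  assumes "length J \<le> CARD('s)"
  shows "partials J (\<lambda>t. graph_map q t $ Inr \<sigma>) 0 = q $ Inr (\<sigma>, midx_of J)"
proof -
  have "partials J (\<lambda>t. graph_map q t $ Inr \<sigma>) 0
      = (\<Sum>K\<in>UNIV. q $ Inr (\<sigma>, K) * partials J (monomial (Rep_midx K)) 0)"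
    unfolding graph_map_def
    using partials_lincomb[of UNIV UNIV "\<lambda>K. monomial (Rep_midx K)" 0 J "\<lambda>K. q $ Inr (\<sigma>, K)"]
    by (simp add: smooth_monomial)
  also have "\<dots> = (\<Sum>K\<in>UNIV. if K = midx_of J then q $ Inr (\<sigma>, K) else 0)"
  proof (rule sum.cong)
    fix K :: "('n, 's) midx"
    have "mset J = Rep_midx K \<longleftrightarrow> K = midx_of J"
      using assms by (metis Rep_midx_of Rep_midx_inject)
    then show "q $ Inr (\<sigma>, K) * partials J (monomial (Rep_midx K)) 0
        = (if K = midx_of J then q $ Inr (\<sigma>, K) else 0)"
      by (simp add: partials_monomial_zero)
  qed simp
  finally show ?thesis by simp
qed

lemma x_matrix_graph_map:
  "x_matrix (jet_coords (graph_map q) t :: real^(('n::{finite,linorder} + 'm::finite) \<times> ('n, 's::finite) midx)) = mat 1"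
proof -
  have "partial j (\<lambda>t. q $ Inl i + t $ i) t = (if j = i then 1 else 0)" for i j
    using smooth_on_differentiable[OF smooth_on_component[OF open_UNIV] UNIV_I]
      smooth_on_differentiable[OF smooth_on_const[OF open_UNIV] UNIV_I]
    by (subst partial_linear(1)) (auto simp: partial_component, auto simp: partial_def)
  then show ?thesis
    by (simp add: vec_eq_iff x_matrix_jet_coords mat_def) (simp add: graph_map_def)
qed

lemma matrix_inv_one: "matrix_inv (mat 1 :: real^'k::finite^'k) = mat 1"
  using matrix_inv_mult(1)[of "mat 1 :: real^'k^'k"] by (simp add: det_I)

text \<open>For a map parametrised by the x-coordinates, up to a constant, the invariant coordinates
  are plain derivatives. The assumption is made on a neighbourhood because the recursion for the y_I
  differentiates.\<close>

lemma y_coord_of_graph: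
  fixes g :: "real^'n::{finite,linorder} \<Rightarrow> real^('n + 'm::finite)"
  assumes U: "open U" "smooth_on U g"
    and one: "\<And>t. t \<in> U \<Longrightarrow> x_matrix (jet_coords g t :: real^(('n + 'm) \<times> ('n, 's::finite) midx)) = mat 1"
    and "length I \<le> CARD('s)" "t \<in> U"
  shows "y_coord \<sigma> I (jet_coords g t :: real^(('n + 'm) \<times> ('n, 's) midx)) = partials I (\<lambda>t. g t $ Inr \<sigma>) t"
  using assms(4,5)
proof (induction I arbitrary: t)
  case Nil
  then show ?case by (simp add: jet_coords_empty)
next
  case (Cons i I)
  have "y_coord \<sigma> (i # I) (jet_coords g t :: real^(('n + 'm) \<times> ('n, 's) midx))
      = partial i (\<lambda>t. y_coord \<sigma> I (jet_coords g t :: real^(('n + 'm) \<times> ('n, 's) midx))) t"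
    using y_coord_jet_coords_Cons[OF U Cons.prems(2), where 's = 's and I = I and \<sigma> = \<sigma> and i = i]
      Cons.prems
    by (simp add: one det_I matrix_inv_one)
      (simp add: mat_def if_distrib[of "\<lambda>c. c * _"] cong: if_cong)
  also have "\<dots> = partials (i # I) (\<lambda>t. g t $ Inr \<sigma>) t"
    using partial_cong[OF U(1) Cons.prems(2), of "\<lambda>t. y_coord \<sigma> I (jet_coords g t :: real^(('n + 'm) \<times> ('n, 's) midx))"] Cons
    by simp
  finally show ?case .
qed

lemma y_coord_graph_jet:
  fixes q :: "real^('n::{finite,linorder} + 'm::finite \<times> ('n, 's::finite) midx)"
  shows "length I \<le> CARD('s) \<Longrightarrow> y_coord \<sigma> I (graph_jet q) = q $ Inr (\<sigma>, midx_of I)"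
  by (simp add: graph_jet_def y_coord_of_graph[OF open_UNIV smooth_graph_map x_matrix_graph_map] graph_jet_Inr)

lemma midx_of_midx_list: "midx_of (midx_list J) = J"
  by (simp add: midx_of_def mset_midx_list Rep_midx_inverse)

section \<open>Alternating forms\<close>

definition alt_map :: "nat \<Rightarrow> ((nat \<Rightarrow> 'e::euclidean_space) \<Rightarrow> real) \<Rightarrow> bool" where
  "alt_map q \<beta> \<longleftrightarrow> (\<forall>v w. (\<forall>i<q. v i = w i) \<longrightarrow> \<beta> v = \<beta> w) \<and>
     (\<forall>i<q. \<forall>v. linear (\<lambda>x. \<beta> (v(i := x)))) \<and>
     (\<forall>i<q. \<forall>j<q. \<forall>v. i \<noteq> j \<and> v i = v j \<longrightarrow> \<beta> v = 0)"

lemma smooth_form_iff: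
  "smooth_form q S \<omega> \<longleftrightarrow> (\<forall>z\<in>S. alt_map q (\<omega> z)) \<and> (\<forall>v. smooth_on S (\<lambda>z. \<omega> z v))"
  by (simp add: smooth_form_def alt_map_def)

lemma alt_map_cong: "alt_map q \<beta> \<Longrightarrow> (\<And>i. i < q \<Longrightarrow> v i = w i) \<Longrightarrow> \<beta> v = \<beta> w"
  by (simp add: alt_map_def)

lemma alt_map_linear: "alt_map q \<beta> \<Longrightarrow> i < q \<Longrightarrow> linear (\<lambda>x. \<beta> (v(i := x)))"
  by (simp add: alt_map_def)

lemma alt_map_eq: "alt_map q \<beta> \<Longrightarrow> i < q \<Longrightarrow> j < q \<Longrightarrow> i \<noteq> j \<Longrightarrow> v i = v j \<Longrightarrow> \<beta> v = 0"
  unfolding alt_map_def by blast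

lemma alt_map_update_diff:
  assumes "alt_map q \<beta>" "i < q"
  shows "\<beta> (v(i := x - c *\<^sub>R y)) = \<beta> (v(i := x)) - c * \<beta> (v(i := y))"
proof -
  interpret linear "\<lambda>x. \<beta> (v(i := x))" by (rule alt_map_linear[OF assms])
  show ?thesis by (simp add: diff scaleR)
qed

lemma alt_map_transpose:
  assumes "alt_map q \<beta>" "i < q" "j < q" "i \<noteq> j"
  shows "\<beta> (\<lambda>k. v (Transposition.transpose i j k)) = - \<beta> v"
proof -
  let ?g = "\<lambda>x y. \<beta> (v(i := x, j := y))"
  have add1: "?g (x + x') y = ?g x y + ?g x' y" for x x' y
    using linear_add[OF alt_map_linear[OF assms(1,2)], of "v(j := y)" x x'] \<open>i \<noteq> j\<close>
    by (simp add: fun_upd_twist)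
  have add2: "?g x (y + y') = ?g x y + ?g x y'" for x y y'
    using linear_add[OF alt_map_linear[OF assms(1,3)], of "v(i := x)" y y'] by simp
  have diag: "?g x x = 0" for x
    using alt_map_eq[OF assms, of "v(i := x, j := x)"] \<open>i \<noteq> j\<close> by simp
  have "0 = ?g (v i + v j) (v i + v j)" using diag by simp
  also have "\<dots> = ?g (v i) (v j) + ?g (v j) (v i)"
    unfolding add1 add2 by (simp only: diag add_0_left add_0_right)
  finally have "0 = ?g (v i) (v j) + ?g (v j) (v i)" .
  moreover have "?g (v i) (v j) = \<beta> v" by simp
  ultimately have "?g (v j) (v i) = - \<beta> v" by linarith
  moreover have "(\<lambda>k. v (Transposition.transpose i j k)) = v(i := v j, j := v i)"
    using \<open>i \<noteq> j\<close> by (auto simp: Transposition.transpose_def fun_eq_iff)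
  ultimately show ?thesis by simp
qed

lemma alt_map_permute:
  assumes "alt_map q \<beta>" "\<pi> permutes {..<q}"
  shows "\<beta> (\<lambda>k. v (\<pi> k)) = of_int (sign \<pi>) * \<beta> v"
  using assms(2) finite_lessThan
proof (induction \<pi> arbitrary: v rule: permutes_induct)
  case id
  then show ?case by simp
next
  case (swap a b p)
  have "\<beta> (\<lambda>k. v ((Transposition.transpose a b \<circ> p) k))
      = of_int (sign p) * \<beta> (\<lambda>k. v (Transposition.transpose a b k))"
    using swap.IH[of "\<lambda>k. v (Transposition.transpose a b k)"] by simp
  also have "\<dots> = of_int (sign (Transposition.transpose a b \<circ> p)) * \<beta> v"
    using swap alt_map_transpose[OF assms(1), of a b v]
      permutes_imp_permutation[OF finite_lessThan swap.hyps(4)]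
    by (simp add: sign_compose permutation_swap_id sign_swap_id)
  finally show ?case .
qed

subsection \<open>Wedge products as sums over permutations\<close>

text \<open>In an iterated wedge product the inner sum over permutations \<tau> of the last
  \<open>q\<close> arguments is absorbed by the outer sum through composition of \<pi> with \<tau>.
  Every \<tau> contributes the same amount, which yields the factor \<open>fact q\<close> that
  \<open>wedge\<close> divides by.\<close>

lemma antisymmetrize_right:
  fixes v :: "nat \<Rightarrow> 'v"
  assumes A: "\<And>w w'. (\<And>i. i < p \<Longrightarrow> w i = w' i) \<Longrightarrow> A w = A w'"
    and B: "\<And>w w'. (\<And>i. i < q \<Longrightarrow> w i = w' i) \<Longrightarrow> B w = B w'"
  shows "(\<Sum>\<pi> | \<pi> permutes {..<p + q}. of_int (sign \<pi>) * A (\<lambda>i. v (\<pi> i)) *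
      (\<Sum>\<tau> | \<tau> permutes {..<q}. of_int (sign \<tau>) * B (\<lambda>i. v (\<pi> (p + \<tau> i)))))
    = fact q * (\<Sum>\<pi> | \<pi> permutes {..<p + q}. of_int (sign \<pi>) * A (\<lambda>i. v (\<pi> i)) * B (\<lambda>i. v (\<pi> (p + i)))
      :: real)"
proof -
  let ?P = "{\<pi>. \<pi> permutes {..<p + q}}" and ?Q = "{\<tau>. \<tau> permutes {..<q}}"
  let ?g = "\<lambda>\<pi>. of_int (sign \<pi>) * A (\<lambda>i. v (\<pi> i)) * B (\<lambda>i. v (\<pi> (p + i))) :: real"
  have inner: "(\<Sum>\<pi>\<in>?P. of_int (sign \<pi>) * A (\<lambda>i. v (\<pi> i)) * (of_int (sign \<tau>) * B (\<lambda>i. v (\<pi> (p + \<tau> i)))))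
      = sum ?g ?P" if "\<tau> \<in> ?Q" for \<tau>
  proof -
    \<comment> \<open>The permutation \<tau> moved to the last \<open>q\<close> of the
      \<open>p + q\<close> positions, fixing the first \<open>p\<close>.\<close>
    define \<tau>' where "\<tau>' = map_permutation {..<q} ((+) p) \<tau>"
    have \<tau>: "\<tau> permutes {..<q}" using that by simp
    have img: "(+) p ` {..<q} = {p..<p + q}"
      by (auto simp: image_iff Bex_def) presburger
    have "\<tau>' permutes {p..<p + q}"
      unfolding \<tau>'_def img[symmetric] by (rule map_permutation_permutes[OF _ \<tau>]) simp
    then have perm: "\<tau>' permutes {..<p + q}" and fx: "\<tau>' i = i" if "i < p" for i
      using that by (auto intro: permutes_subset simp: permutes_not_in)
    have sg: "sign \<tau>' = sign \<tau>"
      unfolding \<tau>'_def by (rule sign_map_permutation) (use \<tau> in auto)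
    have app: "\<tau>' (p + i) = p + \<tau> i" if "i < q" for i
      unfolding \<tau>'_def using that by (subst map_permutation_apply) auto
    have perm': "\<tau>' permutes {..<p + q}"
      using \<open>\<tau>' permutes {p..<p + q}\<close> by (rule permutes_subset) auto
    have "sum ?g ?P = (\<Sum>\<pi>\<in>?P. ?g (\<pi> \<circ> \<tau>'))"
      by (rule sum_permutations_compose_right[OF perm'])
    also have "\<dots> = (\<Sum>\<pi>\<in>?P. of_int (sign \<pi>) * A (\<lambda>i. v (\<pi> i)) * (of_int (sign \<tau>) * B (\<lambda>i. v (\<pi> (p + \<tau> i)))))"
    proof (rule sum.cong)
      fix \<pi> assume "\<pi> \<in> ?P"
      then have "sign (\<pi> \<circ> \<tau>') = sign \<pi> * sign \<tau>"
        using perm' sg by (simp add: sign_compose permutes_imp_permutation[OF finite_lessThan])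
      moreover have "A (\<lambda>i. v ((\<pi> \<circ> \<tau>') i)) = A (\<lambda>i. v (\<pi> i))" by (rule A) (simp add: fx)
      moreover have "B (\<lambda>i. v ((\<pi> \<circ> \<tau>') (p + i))) = B (\<lambda>i. v (\<pi> (p + \<tau> i)))" by (rule B) (simp add: app)
      ultimately show "?g (\<pi> \<circ> \<tau>') = of_int (sign \<pi>) * A (\<lambda>i. v (\<pi> i)) *
          (of_int (sign \<tau>) * B (\<lambda>i. v (\<pi> (p + \<tau> i))))"
        by simp
    qed simp
    finally show ?thesis by simp
  qed
  have "(\<Sum>\<pi>\<in>?P. of_int (sign \<pi>) * A (\<lambda>i. v (\<pi> i)) *
      (\<Sum>\<tau>\<in>?Q. of_int (sign \<tau>) * B (\<lambda>i. v (\<pi> (p + \<tau> i))))) = (\<Sum>\<tau>\<in>?Q. sum ?g ?P)"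
    unfolding sum_distrib_left by (subst sum.swap) (rule sum.cong[OF refl inner])
  then show ?thesis by (simp add: card_permutations)
qed

lemma antisymmetrize_left:
  fixes v :: "nat \<Rightarrow> 'v"
  shows "(\<Sum>\<pi> | \<pi> permutes {..<p + q}.
      of_int (sign \<pi>) * (\<Sum>\<tau> | \<tau> permutes {..<p}. of_int (sign \<tau>) * A (\<lambda>i. v (\<pi> (\<tau> i)))) * B (\<lambda>i. v (\<pi> (p + i))))
    = fact p * (\<Sum>\<pi> | \<pi> permutes {..<p + q}. of_int (sign \<pi>) * A (\<lambda>i. v (\<pi> i)) * B (\<lambda>i. v (\<pi> (p + i)))
      :: real)"
proof -
  let ?P = "{\<pi>. \<pi> permutes {..<p + q}}" and ?Q = "{\<tau>. \<tau> permutes {..<p}}"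
  let ?g = "\<lambda>\<pi>. of_int (sign \<pi>) * A (\<lambda>i. v (\<pi> i)) * B (\<lambda>i. v (\<pi> (p + i))) :: real"
  have inner: "(\<Sum>\<pi>\<in>?P. of_int (sign \<pi>) * (of_int (sign \<tau>) * A (\<lambda>i. v (\<pi> (\<tau> i)))) * B (\<lambda>i. v (\<pi> (p + i))))
      = sum ?g ?P" if "\<tau> \<in> ?Q" for \<tau>
  proof -
    have perm: "\<tau> permutes {..<p + q}"
      using that permutes_subset[of \<tau> "{..<p}" "{..<p + q}"] by auto
    have fx: "\<tau> (p + i) = p + i" for i
      using that permutes_not_in[of \<tau> "{..<p}" "p + i"] by simp
    have "sum ?g ?P = (\<Sum>\<pi>\<in>?P. ?g (\<pi> \<circ> \<tau>))"
      by (rule sum_permutations_compose_right[OF perm])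
    also have "\<dots> = (\<Sum>\<pi>\<in>?P. of_int (sign \<pi>) * (of_int (sign \<tau>) * A (\<lambda>i. v (\<pi> (\<tau> i)))) * B (\<lambda>i. v (\<pi> (p + i))))"
    proof (rule sum.cong)
      fix \<pi> assume "\<pi> \<in> ?P"
      then have "sign (\<pi> \<circ> \<tau>) = sign \<pi> * sign \<tau>"
        using perm by (simp add: sign_compose permutes_imp_permutation[OF finite_lessThan])
      then show "?g (\<pi> \<circ> \<tau>) = of_int (sign \<pi>) * (of_int (sign \<tau>) * A (\<lambda>i. v (\<pi> (\<tau> i)))) * B (\<lambda>i. v (\<pi> (p + i)))"
        by (simp add: fx)
    qed simp
    finally show ?thesis by simp
  qed
  have "(\<Sum>\<pi>\<in>?P. of_int (sign \<pi>) * (\<Sum>\<tau>\<in>?Q. of_int (sign \<tau>) * A (\<lambda>i. v (\<pi> (\<tau> i)))) * B (\<lambda>i. v (\<pi> (p + i))))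
      = (\<Sum>\<tau>\<in>?Q. sum ?g ?P)"
    unfolding sum_distrib_left sum_distrib_right by (subst sum.swap) (rule sum.cong[OF refl inner])
  then show ?thesis by (simp add: card_permutations)
qed

text \<open>The factorials in \<open>wedge\<close> cancel one after another; what remains is the
  permutation expansion of the determinant of the matrix of values.\<close>

lemma wedge_list_one:
  assumes "\<And>\<alpha> v w. \<alpha> \<in> set \<alpha>s \<Longrightarrow> v 0 = w 0 \<Longrightarrow> \<alpha> z v = \<alpha> z w"
  shows "wedge_list 1 \<alpha>s z v = (\<Sum>\<pi> | \<pi> permutes {..<length \<alpha>s}.
    of_int (sign \<pi>) * (\<Prod>i<length \<alpha>s. (\<alpha>s ! i) z (\<lambda>_. v (\<pi> i))))"
  using assms
proof (induction \<alpha>s arbitrary: v)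
  case Nil
  then show ?case by simp
next
  case (Cons \<alpha> \<alpha>s)
  let ?n = "length \<alpha>s"
  let ?A = "\<alpha> z" and ?B = "\<lambda>w. \<Prod>i<?n. (\<alpha>s ! i) z (\<lambda>_. w i)"
  have IH: "wedge_list 1 \<alpha>s z w = (\<Sum>\<pi> | \<pi> permutes {..<?n}. of_int (sign \<pi>) * ?B (\<lambda>i. w (\<pi> i)))" for w
    using Cons by simp
  have \<alpha>: "\<alpha> z w = \<alpha> z w'" if "w 0 = w' 0" for w w' using Cons.prems[of \<alpha> w w'] that by simp
  have "wedge_list 1 (\<alpha> # \<alpha>s) z v = (\<Sum>\<pi> | \<pi> permutes {..<1 + ?n}. of_int (sign \<pi>) * ?A (\<lambda>i. v (\<pi> i)) *
      (\<Sum>\<tau> | \<tau> permutes {..<?n}. of_int (sign \<tau>) * ?B (\<lambda>i. v (\<pi> (1 + \<tau> i))))) / (fact 1 * fact ?n)"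
    by (simp only: wedge_list.simps wedge_def mult_1 IH)
  also have "\<dots> = (\<Sum>\<pi> | \<pi> permutes {..<1 + ?n}. of_int (sign \<pi>) * ?A (\<lambda>i. v (\<pi> i)) * ?B (\<lambda>i. v (\<pi> (1 + i))))"
    by (subst antisymmetrize_right) (auto intro!: prod.cong \<alpha>)
  also have "\<dots> = (\<Sum>\<pi> | \<pi> permutes {..<length (\<alpha> # \<alpha>s)}.
    of_int (sign \<pi>) * (\<Prod>i<length (\<alpha> # \<alpha>s). ((\<alpha> # \<alpha>s) ! i) z (\<lambda>_. v (\<pi> i))))"
  proof (rule sum.cong)
    fix \<pi>
    have "\<alpha> z (\<lambda>i. v (\<pi> i)) = \<alpha> z (\<lambda>_. v (\<pi> 0))" by (rule \<alpha>) simp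
    then show "of_int (sign \<pi>) * ?A (\<lambda>i. v (\<pi> i)) * ?B (\<lambda>i. v (\<pi> (1 + i)))
      = of_int (sign \<pi>) * (\<Prod>i<length (\<alpha> # \<alpha>s). ((\<alpha> # \<alpha>s) ! i) z (\<lambda>_. v (\<pi> i)))"
      by (simp add: prod.lessThan_Suc_shift mult.assoc del: prod.lessThan_Suc)
  qed simp
  finally show ?case .
qed

text \<open>The expansion \<open>wedge_list_one\<close> lives on the positions 0, ..., n - 1 and
  \<open>det\<close> on the index type; the enumeration \<open>L\<close> carries permutations of the
  one to permutations of the other. As a determinant the product becomes accessible to
  \<open>det_mul\<close>.\<close>

lemma wedge_list_one_det:
  fixes \<beta> :: "'n::finite \<Rightarrow> 'e eform"
  assumes \<beta>: "\<And>i v w. v 0 = w 0 \<Longrightarrow> \<beta> i z v = \<beta> i z w" and L: "distinct L" "set L = (UNIV :: 'n set)"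
  shows "wedge_list 1 (map \<beta> L) z v
    = det (\<chi> i j. \<beta> i z (\<lambda>_. v (inv_into {..<CARD('n)} ((!) L) j)))"
proof -
  let ?n = "CARD('n)" and ?f = "\<lambda>k. L ! k"
  let ?idx = "inv_into {..<?n} ?f"
  have len: "length L = ?n" using L by (metis distinct_card)
  have bij: "bij_betw ?f {..<?n} UNIV" using bij_betw_nth[OF L(1)] L(2) len by auto
  then have inj: "inj_on ?f {..<?n}" and img: "?f ` {..<?n} = UNIV" by (auto simp: bij_betw_def)
  have idx: "?idx (L ! k) = k" if "k < ?n" for k using inj that by simp
  have map_bij: "bij_betw (map_permutation {..<?n} ?f) {\<pi>. \<pi> permutes {..<?n}} {p. p permutes UNIV}"
    using bij_betw_permutations[OF bij] img by (simp add: map_permutation_def[abs_def] restrict_id_def[abs_def] o_def)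
  have "det (\<chi> i j. \<beta> i z (\<lambda>_. v (?idx j)))
      = (\<Sum>p | p permutes UNIV. of_int (sign p) * (\<Prod>i\<in>UNIV. \<beta> i z (\<lambda>_. v (?idx (p i)))))"
    by (simp add: det_def)
  also have "\<dots> = (\<Sum>\<pi> | \<pi> permutes {..<?n}. of_int (sign (map_permutation {..<?n} ?f \<pi>)) *
      (\<Prod>i\<in>UNIV. \<beta> i z (\<lambda>_. v (?idx (map_permutation {..<?n} ?f \<pi> i)))))"
    by (rule sum.reindex_bij_betw[OF map_bij, symmetric])
  also have "\<dots> = (\<Sum>\<pi> | \<pi> permutes {..<?n}. of_int (sign \<pi>) * (\<Prod>k<?n. (map \<beta> L ! k) z (\<lambda>_. v (\<pi> k))))"
  proof (rule sum.cong)
    fix \<pi> assume "\<pi> \<in> {\<pi>. \<pi> permutes {..<?n}}"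
    then have \<pi>: "\<pi> permutes {..<?n}" by simp
    have "(\<Prod>i\<in>UNIV. \<beta> i z (\<lambda>_. v (?idx (map_permutation {..<?n} ?f \<pi> i))))
        = (\<Prod>k<?n. \<beta> (L ! k) z (\<lambda>_. v (?idx (map_permutation {..<?n} ?f \<pi> (L ! k)))))"
      by (rule prod.reindex_bij_betw[OF bij, symmetric])
    also have "\<dots> = (\<Prod>k<?n. (map \<beta> L ! k) z (\<lambda>_. v (\<pi> k)))"
      using permutes_in_image[OF \<pi>] by (intro prod.cong) (auto simp: map_permutation_apply[OF inj] idx len)
    finally show "of_int (sign (map_permutation {..<?n} ?f \<pi>)) *
        (\<Prod>i\<in>UNIV. \<beta> i z (\<lambda>_. v (?idx (map_permutation {..<?n} ?f \<pi> i))))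
      = of_int (sign \<pi>) * (\<Prod>k<?n. (map \<beta> L ! k) z (\<lambda>_. v (\<pi> k)))"
      using sign_map_permutation[OF inj \<pi>] by simp
  qed simp
  also have "\<dots> = wedge_list 1 (map \<beta> L) z v"
    by (subst wedge_list_one) (auto simp: len intro: \<beta>)
  finally show ?thesis ..
qed

lemma smooth_form_wedge_list_one:
  assumes "open S" and \<alpha>s: "\<And>\<alpha>. \<alpha> \<in> set \<alpha>s \<Longrightarrow> smooth_form 1 S \<alpha>"
  shows "smooth_form (length \<alpha>s) S (wedge_list 1 \<alpha>s)"
proof -
  let ?n = "length \<alpha>s"
  let ?W = "\<lambda>z v. \<Sum>\<pi> | \<pi> permutes {..<?n}. of_int (sign \<pi>) * (\<Prod>i<?n. (\<alpha>s ! i) z (\<lambda>_. v (\<pi> i)))"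
  have W: "wedge_list 1 \<alpha>s z v = ?W z v" if "z \<in> S" for z v
    using \<alpha>s that by (intro wedge_list_one) (auto simp: smooth_form_iff intro: alt_map_cong)
  have "alt_map ?n (?W z)" if z: "z \<in> S" for z
    unfolding alt_map_def
  proof (intro conjI allI impI)
    fix v w :: "nat \<Rightarrow> 'a" assume "\<forall>i<?n. v i = w i"
    then have "v (\<pi> i) = w (\<pi> i)" if "\<pi> permutes {..<?n}" "i < ?n" for \<pi> i
      using permutes_in_image[OF that(1), of i] that(2) by auto
    then show "?W z v = ?W z w" by (intro sum.cong refl arg_cong2[where f = "(*)"] prod.cong) auto
  next
    fix k and v :: "nat \<Rightarrow> 'a" assume k: "k < ?n"
    have "linear (\<lambda>x. of_int (sign \<pi>) * (\<Prod>i<?n. (\<alpha>s ! i) z (\<lambda>_. (v(k := x)) (\<pi> i))))"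
      if "\<pi> permutes {..<?n}" for \<pi>
    proof -
      have "k \<in> \<pi> ` {..<?n}" using permutes_image[OF that] k by simp
      then obtain j where j: "j < ?n" "\<pi> j = k" by auto
      have ne: "\<pi> i \<noteq> k" if "i \<noteq> j" for i
        using permutes_inj[OF \<open>\<pi> permutes _\<close>] j that by (auto dest: injD)
      have lin: "linear (\<lambda>x. (\<alpha>s ! j) z (\<lambda>_. x))"
      proof -
        have a: "alt_map 1 ((\<alpha>s ! j) z)" using \<alpha>s[of "\<alpha>s ! j"] j z by (simp add: smooth_form_iff)
        have "(\<alpha>s ! j) z (\<lambda>_. x) = (\<alpha>s ! j) z ((\<lambda>_. 0)(0 := x))" for x by (rule alt_map_cong[OF a]) simp
        then show ?thesis using alt_map_linear[OF a, of 0 "\<lambda>_. 0"] by simp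
      qed
      have "(\<Prod>i<?n. (\<alpha>s ! i) z (\<lambda>_. (v(k := x)) (\<pi> i)))
          = (\<alpha>s ! j) z (\<lambda>_. x) * (\<Prod>i\<in>{..<?n} - {j}. (\<alpha>s ! i) z (\<lambda>_. v (\<pi> i)))" for x
        using j ne by (subst prod.remove[of _ j]) (auto intro!: prod.cong)
      then show ?thesis
        by (intro linearI) (simp_all add: linear_add[OF lin] linear_cmul[OF lin] algebra_simps)
    qed
    then show "linear (\<lambda>x. ?W z (v(k := x)))"
      by (intro linear_compose_sum) auto
  next
    fix i j and v :: "nat \<Rightarrow> 'a" assume i: "i < ?n" and j: "j < ?n" and ij: "i \<noteq> j \<and> v i = v j"
    let ?t = "Transposition.transpose i j"
    let ?g = "\<lambda>\<pi>. of_int (sign \<pi>) * (\<Prod>i<?n. (\<alpha>s ! i) z (\<lambda>_. v (\<pi> i)))"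
    have vt: "v (?t k) = v k" for k using ij by (auto simp: Transposition.transpose_def)
    have t: "?t permutes {..<?n}" using i j by (auto intro: permutes_swap_id)
    \<comment> \<open>Composing with the transposition of the two equal arguments leaves the
      products alone and flips every sign.\<close>
    have "?W z v = (\<Sum>\<pi> | \<pi> permutes {..<?n}. ?g (?t \<circ> \<pi>))"
      by (rule setum_permutations_compose_left[OF t])
    also have "\<dots> = - ?W z v"
      unfolding sum_negf[symmetric] using ij
      by (intro sum.cong) (auto simp: sign_compose permutation_swap_id sign_swap_id vt
          permutes_imp_permutation[OF finite_lessThan])
    finally show "?W z v = 0" by simp
  qed
  moreover have "alt_map ?n (wedge_list 1 \<alpha>s z) \<longleftrightarrow> alt_map ?n (?W z)" if "z \<in> S" for z
    using W[OF that] by presburger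
  moreover have "smooth_on S (\<lambda>z. ?W z v)" for v
    using \<alpha>s by (intro smooth_on_sum smooth_on_mult smooth_on_prod smooth_on_const \<open>open S\<close>)
      (auto simp: smooth_form_iff)
  then have "smooth_on S (\<lambda>z. wedge_list 1 \<alpha>s z v)" for v
    by (rule smooth_on_cong[OF \<open>open S\<close> _ W[symmetric]])
  ultimately show ?thesis by (simp add: smooth_form_iff)
qed

subsection \<open>Contractions\<close>

lemma alt_map_contract:
  assumes "alt_map (Suc q) \<beta>"
  shows "alt_map q (\<lambda>v. \<beta> (case_nat e v))"
  unfolding alt_map_def
proof (intro conjI allI impI)
  fix v w :: "nat \<Rightarrow> 'a" assume "\<forall>i<q. v i = w i"
  then show "\<beta> (case_nat e v) = \<beta> (case_nat e w)"
    by (intro alt_map_cong[OF assms]) (auto split: nat.split)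
next
  fix i and v :: "nat \<Rightarrow> 'a" assume "i < q"
  moreover have "case_nat e (v(i := x)) = (case_nat e v)(Suc i := x)" for x
    by (auto simp: fun_eq_iff split: nat.split)
  ultimately show "linear (\<lambda>x. \<beta> (case_nat e (v(i := x))))"
    using alt_map_linear[OF assms, of "Suc i" "case_nat e v"] by simp
next
  fix i j and v :: "nat \<Rightarrow> 'a" assume "i < q" "j < q" "i \<noteq> j \<and> v i = v j"
  then show "\<beta> (case_nat e v) = 0"
    by (intro alt_map_eq[OF assms, of "Suc i" "Suc j"]) auto
qed

lemma sum_permutes_at_0:
  fixes f :: "nat \<Rightarrow> real"
  shows "(\<Sum>\<pi> | \<pi> permutes {..<Suc q}. f (\<pi> 0)) = fact q * (\<Sum>b\<le>q. f b)"
proof -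
  have S: "{..<Suc q} = insert 0 {1..q}" by auto
  have "(\<Sum>\<pi> | \<pi> permutes {..<Suc q}. f (\<pi> 0))
      = (\<Sum>b\<in>insert 0 {1..q}. \<Sum>p | p permutes {1..q}. f ((Transposition.transpose 0 b \<circ> p) 0))"
    unfolding S by (rule sum_over_permutations_insert) auto
  also have "\<dots> = (\<Sum>b\<in>insert 0 {1..q}. \<Sum>p | p permutes {1..q}. f b)"
    by (intro sum.cong refl) (auto simp: permutes_not_in)
  also have "\<dots> = fact q * (\<Sum>b\<in>insert 0 {1..q}. f b)"
    by (simp only: sum_constant card_permutations[of "{1..q}" q] sum_distrib_left) (simp add: card_permutations)
  also have "insert 0 {1..q} = {..q}" by auto
  finally show ?thesis .
qed

text \<open>Recognises the sum of single insertions of \<open>e\<close>, which is the correction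
  term in \<open>alt_map_project\<close>, as the product of \<open>a\<close> with a contraction.
  Putting \<open>e\<close> in front instead of in place \<pi> 0 costs the sign of \<pi>, which
  cancels the sign in \<open>wedge\<close>.\<close>

lemma wedge_contract:
  assumes "alt_map (Suc q) (\<alpha> z)" "\<And>v w. v 0 = w 0 \<Longrightarrow> a z v = a z w"
  shows "wedge 1 q a (\<lambda>z v. \<alpha> z (case_nat e v)) z v = (\<Sum>b\<le>q. a z (\<lambda>_. v b) * \<alpha> z (v(b := e)))"
proof -
  have "of_int (sign \<pi>) * a z (\<lambda>i. v (\<pi> i)) * \<alpha> z (case_nat e (\<lambda>i. v (\<pi> (1 + i))))
      = a z (\<lambda>_. v (\<pi> 0)) * \<alpha> z (v(\<pi> 0 := e))" if "\<pi> permutes {..<Suc q}" for \<pi>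
  proof -
    have eq: "case_nat e (\<lambda>i. v (\<pi> (1 + i))) = (\<lambda>k. (v(\<pi> 0 := e)) (\<pi> k))"
      using permutes_inj[OF that] by (auto simp: fun_eq_iff dest: injD split: nat.split)
    have "\<alpha> z (case_nat e (\<lambda>i. v (\<pi> (1 + i)))) = of_int (sign \<pi>) * \<alpha> z (v(\<pi> 0 := e))"
      unfolding eq by (rule alt_map_permute[OF assms(1) that])
    moreover have "a z (\<lambda>i. v (\<pi> i)) = a z (\<lambda>_. v (\<pi> 0))" by (rule assms(2)) simp
    moreover have "of_int (sign \<pi>) * of_int (sign \<pi>) = (1 :: real)"
      by (metis of_int_mult of_int_1 sign_idempotent)
    ultimately show ?thesis by (simp add: mult_ac)
  qed
  then have "wedge 1 q a (\<lambda>z v. \<alpha> z (case_nat e v)) z v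
      = (\<Sum>\<pi> | \<pi> permutes {..<Suc q}. a z (\<lambda>_. v (\<pi> 0)) * \<alpha> z (v(\<pi> 0 := e))) / fact q"
    unfolding wedge_def by simp
  also have "\<dots> = (\<Sum>b\<le>q. a z (\<lambda>_. v b) * \<alpha> z (v(b := e)))"
    by (subst sum_permutes_at_0) simp
  finally show ?thesis .
qed

text \<open>Multilinear expansion along the map x - a(x) e, replacing the arguments one after
  another. Terms with \<open>e\<close> in two places vanish, so only single insertions
  remain.\<close>

lemma alt_map_project:
  assumes \<alpha>: "alt_map (Suc q) \<alpha>" and ae: "a e = 1"
  shows "\<alpha> v - \<alpha> (\<lambda>i. v i - a (v i) *\<^sub>R e) = (\<Sum>b\<le>q. a (v b) * \<alpha> (v(b := e)))"
proof -
  let ?w = "\<lambda>k i. if i < k then v i - a (v i) *\<^sub>R e else v i"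
  have same: "\<alpha> ((?w k)(b := e)) = \<alpha> (v(b := e))" if "k \<le> b" "b \<le> q" for k b
    using that(1)
  proof (induction k)
    case (Suc k)
    have "(?w (Suc k))(b := e) = ((?w k)(b := e))(k := v k - a (v k) *\<^sub>R e)"
      using Suc.prems by (auto simp: fun_eq_iff)
    then have "\<alpha> ((?w (Suc k))(b := e)) = \<alpha> (((?w k)(b := e))(k := v k)) - a (v k) * \<alpha> (((?w k)(b := e))(k := e))"
      using alt_map_update_diff[OF \<alpha>, of k] Suc.prems that(2) by simp
    also have "\<alpha> (((?w k)(b := e))(k := e)) = 0"
      using Suc.prems that(2) by (intro alt_map_eq[OF \<alpha>, of k b]) auto
    also have "((?w k)(b := e))(k := v k) = (?w k)(b := e)"
      using Suc.prems by (auto simp: fun_eq_iff)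
    finally show ?case using Suc by simp
  qed simp
  have "\<alpha> v - \<alpha> (?w k) = (\<Sum>b<k. a (v b) * \<alpha> (v(b := e)))" if "k \<le> Suc q" for k
    using that
  proof (induction k)
    case (Suc k)
    have "?w (Suc k) = (?w k)(k := v k - a (v k) *\<^sub>R e)" by (auto simp: fun_eq_iff)
    then have "\<alpha> (?w (Suc k)) = \<alpha> ((?w k)(k := v k)) - a (v k) * \<alpha> ((?w k)(k := e))"
      using alt_map_update_diff[OF \<alpha>, of k] Suc.prems by simp
    also have "(?w k)(k := v k) = ?w k" by auto
    also have "\<alpha> ((?w k)(k := e)) = \<alpha> (v(k := e))" by (rule same) (use Suc.prems in auto)
    finally have "\<alpha> (?w (Suc k)) = \<alpha> (?w k) - a (v k) * \<alpha> (v(k := e))" .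
    moreover have "\<alpha> v - \<alpha> (?w k) = (\<Sum>b<k. a (v b) * \<alpha> (v(b := e)))"
      by (rule Suc.IH) (use Suc.prems in simp)
    ultimately show ?case unfolding sum.lessThan_Suc by linarith
  qed simp
  from this[of "Suc q"] have "\<alpha> v - \<alpha> (?w (Suc q)) = (\<Sum>b\<le>q. a (v b) * \<alpha> (v(b := e)))"
    by (simp add: lessThan_Suc_atMost)
  moreover have "\<alpha> (?w (Suc q)) = \<alpha> (\<lambda>i. v i - a (v i) *\<^sub>R e)"
    by (rule alt_map_cong[OF \<alpha>]) simp
  ultimately show ?thesis by simp
qed

subsection \<open>Smooth forms\<close>

text \<open>\<open>smooth_form\<close> asks for smoothness with constant arguments only. Here the
  arguments move with the point; they are expanded in the basis one at a time, beginning with the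
  last, until all are constant.\<close>

lemma smooth_form_eval:
  fixes w :: "nat \<Rightarrow> 'e::euclidean_space \<Rightarrow> 'e"
  assumes "open S" and \<alpha>: "smooth_form q S \<alpha>" and w: "\<And>i. smooth_on S (w i)"
  shows "smooth_on S (\<lambda>z. \<alpha> z (\<lambda>i. w i z))"
proof -
  have alt: "alt_map q (\<alpha> z)" if "z \<in> S" for z using \<alpha> that by (simp add: smooth_form_iff)
  have step: "smooth_on S (\<lambda>z. \<alpha> z (\<lambda>i. w i z))"
    if "k \<le> q" "\<And>i. smooth_on S (w i)" "\<And>i. i \<ge> k \<Longrightarrow> w i = (\<lambda>_. c i)" for k w c
    using that
  proof (induction k arbitrary: w c)
    case 0
    then have "(\<lambda>z. \<alpha> z (\<lambda>i. w i z)) = (\<lambda>z. \<alpha> z c)" by auto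
    then show ?case using \<alpha> by (simp add: smooth_form_iff)
  next
    case (Suc k)
    let ?w = "\<lambda>b. w(k := \<lambda>_. b)"
    have "smooth_on S (\<lambda>z. \<alpha> z (\<lambda>i. ?w b i z))" for b
    proof (rule Suc.IH[of _ "c(k := b)"])
      show "smooth_on S (?w b i)" for i
        using Suc.prems(2) smooth_on_const[OF \<open>open S\<close>, of b] by simp
      show "?w b i = (\<lambda>_. (c(k := b)) i)" if "i \<ge> k" for i
        using Suc.prems(3)[of i] that by auto
    qed (use Suc.prems in simp)
    then have "smooth_on S (\<lambda>z. \<Sum>b\<in>Basis. (w k z \<bullet> b) * \<alpha> z (\<lambda>i. ?w b i z))"
      using Suc.prems(2)
      by (intro smooth_on_sum smooth_on_mult smooth_on_inner smooth_on_const \<open>open S\<close>)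
    moreover have "(\<Sum>b\<in>Basis. (w k z \<bullet> b) * \<alpha> z (\<lambda>i. ?w b i z)) = \<alpha> z (\<lambda>i. w i z)" if "z \<in> S" for z
    proof -
      interpret L: linear "\<lambda>x. \<alpha> z ((\<lambda>i. w i z)(k := x))"
        using alt_map_linear[OF alt[OF that]] Suc.prems(1) by simp
      have "\<alpha> z (\<lambda>i. w i z) = \<alpha> z ((\<lambda>i. w i z)(k := \<Sum>b\<in>Basis. (w k z \<bullet> b) *\<^sub>R b))"
        by (simp add: euclidean_representation fun_upd_idem)
      also have "\<dots> = (\<Sum>b\<in>Basis. (w k z \<bullet> b) * \<alpha> z ((\<lambda>i. w i z)(k := b)))"
        by (simp add: L.sum L.scaleR)
      also have "\<dots> = (\<Sum>b\<in>Basis. (w k z \<bullet> b) * \<alpha> z (\<lambda>i. ?w b i z))"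
        by (intro sum.cong refl arg_cong2[where f = "(*)"] arg_cong[where f = "\<alpha> z"]) auto
      finally show ?thesis by simp
    qed
    ultimately show ?case by (rule smooth_on_cong[OF \<open>open S\<close>])
  qed
  have "smooth_on S (\<lambda>z. \<alpha> z (\<lambda>i. (if i < q then w i else (\<lambda>_. 0)) z))"
    by (rule step[where k = q and c = "\<lambda>_. 0"]) (use w in \<open>auto intro: smooth_on_const[OF \<open>open S\<close>]\<close>)
  then show ?thesis
  proof (rule smooth_on_cong[OF \<open>open S\<close>])
    fix z assume "z \<in> S"
    then show "\<alpha> z (\<lambda>i. (if i < q then w i else (\<lambda>_. 0)) z) = \<alpha> z (\<lambda>i. w i z)"
      by (intro alt_map_cong[OF alt]) auto
  qed
qed

lemma smooth_form_linear_fields: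
  fixes H :: "'e::euclidean_space \<Rightarrow> 'e \<Rightarrow> 'e"
  assumes "open S" and \<alpha>: "smooth_form q S \<alpha>" and lin: "\<And>z. z \<in> S \<Longrightarrow> linear (H z)"
    and sm: "\<And>v. smooth_on S (\<lambda>z. H z v)"
  shows "smooth_form q S (\<lambda>z v. \<alpha> z (\<lambda>i. H z (v i)))"
  unfolding smooth_form_iff
proof (intro conjI ballI allI)
  show "smooth_on S (\<lambda>z. \<alpha> z (\<lambda>i. H z (v i)))" for v
    by (rule smooth_form_eval[OF assms(1,2) sm])
  fix z assume z: "z \<in> S"
  have a: "alt_map q (\<alpha> z)" using \<alpha> z by (simp add: smooth_form_iff)
  show "alt_map q (\<lambda>v. \<alpha> z (\<lambda>i. H z (v i)))"
    unfolding alt_map_def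
  proof (intro conjI allI impI)
    fix i and v :: "nat \<Rightarrow> 'e" assume "i < q"
    have "(\<lambda>k. H z ((v(i := x)) k)) = (\<lambda>k. H z (v k))(i := H z x)" for x by auto
    then show "linear (\<lambda>x. \<alpha> z (\<lambda>k. H z ((v(i := x)) k)))"
      using linear_compose[OF lin[OF z] alt_map_linear[OF a \<open>i < q\<close>]] by (simp add: o_def)
  qed (auto intro: alt_map_cong[OF a] alt_map_eq[OF a])
qed

lemma smooth_form_contract:
  "smooth_form (Suc q) S \<alpha> \<Longrightarrow> smooth_form q S (\<lambda>z v. \<alpha> z (case_nat e v))"
  by (simp add: smooth_form_iff alt_map_contract)

lemma smooth_form_add:
  assumes "open S" "smooth_form q S \<alpha>" "smooth_form q S \<beta>"
  shows "smooth_form q S (\<lambda>z v. \<alpha> z v + \<beta> z v)"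
  using assms unfolding smooth_form_iff alt_map_def
  by (auto intro!: smooth_on_add linear_compose_add) metis

lemma smooth_form_scale:
  assumes "open S" "smooth_on S f" "smooth_form q S \<alpha>"
  shows "smooth_form q S (\<lambda>z v. f z * \<alpha> z v)"
proof -
  have "linear (\<lambda>x. f z * \<alpha> z (v(i := x)))" if "z \<in> S" "i < q" for z v i
    using linear_compose_scale_right[of "\<lambda>x. \<alpha> z (v(i := x))" "f z"] assms(3) that
    by (simp add: smooth_form_iff alt_map_def)
  then show ?thesis
    using assms unfolding smooth_form_iff alt_map_def
    by (auto intro!: smooth_on_mult)
qed

lemma smooth_form_minus:
  assumes "open S" "smooth_form q S \<alpha>"
  shows "smooth_form q S (\<lambda>z v. - \<alpha> z v)"
  using smooth_form_scale[OF assms(1) smooth_on_const[OF assms(1), of "-1"] assms(2)] by simp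

lemma smooth_form_diff:
  assumes "open S" "smooth_form q S \<alpha>" "smooth_form q S \<beta>"
  shows "smooth_form q S (\<lambda>z v. \<alpha> z v - \<beta> z v)"
  using smooth_form_add[OF assms(1,2) smooth_form_minus[OF assms(1,3)]] by simp

lemma smooth_form_one:
  assumes "open S" "\<And>z. z \<in> S \<Longrightarrow> linear (a z)" "\<And>v. smooth_on S (\<lambda>z. a z v)"
  shows "smooth_form 1 S (\<lambda>z v. a z (v 0))"
  using assms by (simp add: smooth_form_iff alt_map_def)

lemma smooth_form_cong:
  assumes "open S" "smooth_form q S \<alpha>" "\<And>z v. z \<in> S \<Longrightarrow> \<alpha> z v = \<beta> z v"
  shows "smooth_form q S \<beta>"
proof -
  have "alt_map q (\<beta> z)" if "z \<in> S" for z
  proof -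
    have "\<alpha> z = \<beta> z" using assms(3)[OF that] by auto
    then show ?thesis using assms(2) that unfolding smooth_form_iff by (metis (full_types))
  qed
  moreover have "smooth_on S (\<lambda>z. \<beta> z v)" for v
  proof (rule smooth_on_cong[OF \<open>open S\<close> _ assms(3)])
    show "smooth_on S (\<lambda>z. \<alpha> z v)" using assms(2) by (simp add: smooth_form_iff)
  qed
  ultimately show ?thesis by (simp add: smooth_form_iff)
qed

subsection \<open>A criterion for strongly contact forms\<close>

definition cform ::
    "'m::finite \<Rightarrow> real^('n::finite + 'm \<times> ('n, 's) midx) \<Rightarrow> real^('n + 'm \<times> ('n, 's) midx) \<Rightarrow> real" where
  "cform \<sigma> z x = x $ Inr (\<sigma>, midx_empty) - (\<Sum>i\<in>UNIV. y_first z \<sigma> i * x $ Inl i)"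

lemma contact_empty: "contact \<sigma> midx_empty z v = cform \<sigma> z (v 0)"
  by (simp add: contact_def dcoord_def cform_def y_first_def)

lemma linear_cform: "linear (cform \<sigma> z)"
  by (rule linearI) (auto simp: cform_def algebra_simps sum.distrib sum_distrib_left)

lemma smooth_on_y_first: "open S \<Longrightarrow> smooth_on S (\<lambda>z. y_first z \<sigma> i)"
  unfolding y_first_def by (rule smooth_on_component)

lemma smooth_on_cform: "open S \<Longrightarrow> smooth_on S (\<lambda>z. cform \<sigma> z x)"
  unfolding cform_def
  by (intro smooth_on_diff smooth_on_const smooth_on_sum smooth_on_mult smooth_on_y_first)

definition vert :: "'m::finite \<Rightarrow> real^('n::finite + 'm \<times> ('n, 's) midx)" where
  "vert \<sigma> = axis (Inr (\<sigma>, midx_empty)) 1"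

lemma cform_vert: "cform \<sigma> z (vert \<tau>) = (if \<sigma> = \<tau> then 1 else 0)"
  by (auto simp: cform_def vert_def axis_def)

text \<open>The vectors \<open>vert\<close> are dual to the forms \<open>cform\<close>, so this
  projects along them onto the common kernel of the \<omega>^\<sigma> with \<sigma> in \<Sigma>. For
  all indices together the image consists of the vectors called horizontal below.\<close>

definition cproj ::
    "'m::finite set \<Rightarrow> real^('n::finite + 'm \<times> ('n, 's) midx) \<Rightarrow> real^('n + 'm \<times> ('n, 's) midx) \<Rightarrow>
     real^('n + 'm \<times> ('n, 's) midx)" where
  "cproj \<Sigma> z x = x - (\<Sum>\<sigma>\<in>\<Sigma>. cform \<sigma> z x *\<^sub>R vert \<sigma>)"

lemma linear_cproj: "linear (cproj \<Sigma> z)"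
  unfolding cproj_def
  by (intro linear_compose_sub linear_compose_sum linear_id[unfolded id_def] ballI linear_scaleR_left linear_compose[OF linear_cform, unfolded o_def])

lemma smooth_on_cproj: "open S \<Longrightarrow> smooth_on S (\<lambda>z. cproj \<Sigma> z x)"
  unfolding cproj_def
  by (intro smooth_on_diff smooth_on_const smooth_on_sum smooth_on_scaleR smooth_on_cform)

lemma cform_cproj_UNIV: "cform \<sigma> z (cproj UNIV z x) = 0"
proof -
  interpret linear "cform \<sigma> z" by (rule linear_cform)
  show ?thesis by (simp add: cproj_def diff sum scaleR cform_vert if_distrib cong: if_cong)
qed

lemma cproj_horizontal: "(\<And>\<sigma>. cform \<sigma> z x = 0) \<Longrightarrow> cproj \<Sigma> z x = x"
  by (simp add: cproj_def)

text \<open>One contact form is split off at a time by \<open>alt_map_project\<close>. The second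
  conjunct records that each cofactor is \<alpha> itself with one extra vector in front and
  projected arguments: through it a vanishing property of \<alpha> is handed down to the
  cofactors.\<close>

lemma contact_decomposition:
  fixes \<alpha> :: "(real^('n::finite + 'm::finite \<times> ('n, 's) midx)) eform"
  assumes "open S" and \<alpha>: "smooth_form (Suc q) S \<alpha>"
    and "finite \<Sigma>"
  shows "\<exists>\<Phi>. (\<forall>\<sigma>\<in>\<Sigma>. smooth_form q S (\<Phi> \<sigma>))
    \<and> (\<forall>\<sigma>\<in>\<Sigma>. \<exists>\<Gamma> e. \<forall>z v. \<Phi> \<sigma> z v = \<alpha> z (case_nat (e z) (\<lambda>i. cproj \<Gamma> z (v i))))
    \<and> (\<forall>z\<in>S. \<forall>v. \<alpha> z v = \<alpha> z (\<lambda>i. cproj \<Sigma> z (v i)) + (\<Sum>\<sigma>\<in>\<Sigma>. wedge 1 q (contact \<sigma> midx_empty) (\<Phi> \<sigma>) z v))"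
  using assms(3)
proof (induction \<Sigma> rule: finite_induct)
  case empty
  then show ?case by (auto simp: cproj_def)
next
  case (insert \<sigma> \<Sigma>)
  obtain \<Phi> where \<Phi>: "\<And>\<tau>. \<tau> \<in> \<Sigma> \<Longrightarrow> smooth_form q S (\<Phi> \<tau>)"
    "\<And>\<tau>. \<tau> \<in> \<Sigma> \<Longrightarrow> \<exists>\<Gamma> e. \<forall>z v. \<Phi> \<tau> z v = \<alpha> z (case_nat (e z) (\<lambda>i. cproj \<Gamma> z (v i)))"
    "\<And>z v. z \<in> S \<Longrightarrow> \<alpha> z v = \<alpha> z (\<lambda>i. cproj \<Sigma> z (v i)) + (\<Sum>\<tau>\<in>\<Sigma>. wedge 1 q (contact \<tau> midx_empty) (\<Phi> \<tau>) z v)"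
    using insert.IH by blast
  define \<alpha>' where "\<alpha>' z v = \<alpha> z (\<lambda>i. cproj \<Sigma> z (v i))" for z and v :: "nat \<Rightarrow> real^('n + 'm \<times> ('n, 's) midx)"
  have \<alpha>': "smooth_form (Suc q) S \<alpha>'"
    unfolding \<alpha>'_def[abs_def]
    by (rule smooth_form_linear_fields[OF assms(1,2) linear_cproj smooth_on_cproj[OF assms(1)]])
  define \<Psi> where "\<Psi> z v = \<alpha>' z (case_nat (vert \<sigma>) v)" for z v
  have \<Psi>: "smooth_form q S \<Psi>"
    unfolding \<Psi>_def[abs_def] by (rule smooth_form_contract[OF \<alpha>'])
  have proj: "cproj \<Sigma> z (x - cform \<sigma> z x *\<^sub>R vert \<sigma>) = cproj (insert \<sigma> \<Sigma>) z x"
    for z x :: "real^('n + 'm \<times> ('n, 's) midx)"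
  proof -
    have "cform \<tau> z (x - cform \<sigma> z x *\<^sub>R vert \<sigma>) = cform \<tau> z x" if "\<tau> \<in> \<Sigma>" for \<tau>
    proof -
      interpret linear "cform \<tau> z" by (rule linear_cform)
      show ?thesis using that insert.hyps(2) by (auto simp: diff scaleR cform_vert)
    qed
    then show ?thesis using insert.hyps by (simp add: cproj_def)
  qed
  have \<Psi>_eq: "\<alpha>' z v = \<alpha> z (\<lambda>i. cproj (insert \<sigma> \<Sigma>) z (v i)) + wedge 1 q (contact \<sigma> midx_empty) \<Psi> z v"
    if "z \<in> S" for z v
  proof -
    have alt: "alt_map (Suc q) (\<alpha>' z)" using \<alpha>' that by (simp add: smooth_form_iff)
    have "wedge 1 q (contact \<sigma> midx_empty) \<Psi> z v
        = (\<Sum>b\<le>q. cform \<sigma> z (v b) * \<alpha>' z (v(b := vert \<sigma>)))"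
      unfolding \<Psi>_def[abs_def] by (subst wedge_contract[where \<alpha> = \<alpha>' and z = z, OF alt]) (simp_all add: contact_empty)
    also have "\<dots> = \<alpha>' z v - \<alpha>' z (\<lambda>i. v i - cform \<sigma> z (v i) *\<^sub>R vert \<sigma>)"
      by (rule alt_map_project[OF alt, symmetric]) (simp add: cform_vert)
    finally show ?thesis by (simp add: \<alpha>'_def proj)
  qed
  let ?\<Phi> = "\<Phi>(\<sigma> := \<Psi>)"
  show ?case
  proof (intro exI[of _ ?\<Phi>] conjI ballI allI)
    fix \<tau> assume \<tau>: "\<tau> \<in> insert \<sigma> \<Sigma>"
    show "smooth_form q S (?\<Phi> \<tau>)" using \<Phi>(1) \<Psi> \<tau> by auto
    show "\<exists>\<Gamma> e. \<forall>z v. ?\<Phi> \<tau> z v = \<alpha> z (case_nat (e z) (\<lambda>i. cproj \<Gamma> z (v i)))"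
    proof (cases "\<tau> = \<sigma>")
      case True
      have "(\<lambda>i. cproj \<Sigma> z (case i of 0 \<Rightarrow> vert \<sigma> | Suc k \<Rightarrow> v k))
          = case_nat (cproj \<Sigma> z (vert \<sigma>)) (\<lambda>i. cproj \<Sigma> z (v i))"
        for z :: "real^('n + 'm \<times> ('n, 's) midx)" and v
        by (auto simp: fun_eq_iff split: nat.split)
      with True show ?thesis
        by (intro exI[of _ \<Sigma>] exI[of _ "\<lambda>z. cproj \<Sigma> z (vert \<sigma>)"]) (simp add: \<Psi>_def \<alpha>'_def)
    qed (use \<Phi>(2) \<tau> in auto)
  next
    fix z v assume z: "z \<in> S"
    have "(\<Sum>\<tau>\<in>\<Sigma>. wedge 1 q (contact \<tau> midx_empty) (?\<Phi> \<tau>) z v)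
        = (\<Sum>\<tau>\<in>\<Sigma>. wedge 1 q (contact \<tau> midx_empty) (\<Phi> \<tau>) z v)"
      using insert.hyps by (intro sum.cong) auto
    then show "\<alpha> z v = \<alpha> z (\<lambda>i. cproj (insert \<sigma> \<Sigma>) z (v i))
        + (\<Sum>\<tau>\<in>insert \<sigma> \<Sigma>. wedge 1 q (contact \<tau> midx_empty) (?\<Phi> \<tau>) z v)"
      using \<Phi>(3)[OF z, of v] \<Psi>_eq[OF z, of v] insert.hyps by (simp add: \<alpha>'_def)
  qed
qed

text \<open>Converts the nested products that arise from two successive decompositions into the
  bracketing prescribed by \<open>contact_term\<close>, where an empty list of factors d\<omega>
  leaves a product with the constant 1.\<close>

lemma wedge_pair:
  assumes \<Phi>: "alt_map r (\<Phi> z)"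
    and a: "\<And>v w. v 0 = w 0 \<Longrightarrow> a z v = a z w" and b: "\<And>v w. v 0 = w 0 \<Longrightarrow> b z v = b z w"
  shows "wedge 2 r (wedge_list 1 [a, b]) (wedge 0 r (\<lambda>z v. 1) \<Phi>) z v
    = wedge 1 (Suc r) a (wedge 1 r b \<Phi>) z v"
proof -
  let ?b = "\<lambda>w. b z (\<lambda>_. w 0)"
  let ?S = "\<Sum>\<pi> | \<pi> permutes {..<2 + r}. of_int (sign \<pi>) * (a z (\<lambda>i. v (\<pi> i)) * b z (\<lambda>_. v (\<pi> 1))) *
    \<Phi> z (\<lambda>i. v (\<pi> (2 + i)))"
  have one: "of_int (sign \<pi>) * (of_int (sign \<pi>) * x) = (x :: real)" for \<pi> x
    by (metis mult.assoc mult_1 of_int_1 of_int_mult sign_idempotent)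
  have W0: "wedge 0 r (\<lambda>z v. 1) \<Phi> z w = \<Phi> z w" for w
  proof -
    have "wedge 0 r (\<lambda>z v. 1) \<Phi> z w = (\<Sum>\<pi> | \<pi> permutes {..<r}. \<Phi> z w) / fact r"
      unfolding wedge_def by (simp add: alt_map_permute[OF \<Phi>] one)
    then show ?thesis by (simp add: card_permutations)
  qed
  have W1: "wedge_list 1 [a, b] z w = (\<Sum>\<tau> | \<tau> permutes {..<2}. of_int (sign \<tau>) *
      (a z (\<lambda>i. w (\<tau> i)) * b z (\<lambda>_. w (\<tau> 1))))" for w
  proof -
    have "a z (\<lambda>_. w (\<tau> 0)) = a z (\<lambda>i. w (\<tau> i))" for \<tau> by (rule a) simp
    then show ?thesis
      by (subst wedge_list_one) (auto simp: numeral_2_eq_2 intro: a b)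
  qed
  have "wedge 2 r (wedge_list 1 [a, b]) (wedge 0 r (\<lambda>z v. 1) \<Phi>) z v
      = (\<Sum>\<pi> | \<pi> permutes {..<2 + r}. of_int (sign \<pi>) *
      (\<Sum>\<tau> | \<tau> permutes {..<2}. of_int (sign \<tau>) * (a z (\<lambda>i. v (\<pi> (\<tau> i))) * b z (\<lambda>_. v (\<pi> (\<tau> 1)))))
      * \<Phi> z (\<lambda>i. v (\<pi> (2 + i)))) / (fact 2 * fact r)"
    by (simp only: wedge_def[of 2] W0 W1)
  also have "\<dots> = ?S / fact r"
    using antisymmetrize_left[where p = 2 and q = r and A = "\<lambda>w. a z w * b z (\<lambda>_. w 1)" and v = v and B = "\<Phi> z"] by simp
  finally have L: "wedge 2 r (wedge_list 1 [a, b]) (wedge 0 r (\<lambda>z v. 1) \<Phi>) z v = ?S / fact r" .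
  have W2: "wedge 1 r b \<Phi> z w = (\<Sum>\<tau> | \<tau> permutes {..<Suc r}. of_int (sign \<tau>) *
      ((\<lambda>w. b z (\<lambda>_. w 0) * \<Phi> z (\<lambda>i. w (Suc i))) (\<lambda>i. w (\<tau> i)))) / fact r" for w
  proof -
    have "b z (\<lambda>i. w (\<tau> i)) = b z (\<lambda>_. w (\<tau> 0))" for \<tau> by (rule b) simp
    then show ?thesis by (simp add: wedge_def mult.assoc)
  qed
  have "wedge 1 (Suc r) a (wedge 1 r b \<Phi>) z v = (\<Sum>\<pi> | \<pi> permutes {..<1 + Suc r}. of_int (sign \<pi>) * a z (\<lambda>i. v (\<pi> i)) *
      (\<Sum>\<tau> | \<tau> permutes {..<Suc r}. of_int (sign \<tau>) *
        ((\<lambda>w. b z (\<lambda>_. w 0) * \<Phi> z (\<lambda>i. w (Suc i))) (\<lambda>i. v (\<pi> (1 + \<tau> i)))))) / (fact r * fact (Suc r))"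
    by (simp only: wedge_def[of 1 "Suc r"] W2 times_divide_eq_right sum_divide_distrib[symmetric]
        divide_divide_eq_left fact_1 mult_1_left)
  also have "\<dots> = ?S / fact r"
    by (subst antisymmetrize_right)
      (auto intro: a arg_cong2[where f = "(*)"] b alt_map_cong[OF \<Phi>] simp: mult.assoc simp del: fact_Suc)
  finally show ?thesis using L by simp
qed

text \<open>In degree n + 1 a strongly contact term has p + l = 2 factors. A first decomposition
  leaves only the products of \<omega>^\<sigma> with \<Phi>_\<sigma>, since \<eta> vanishes on
  horizontal vectors. On horizontal vectors \<Phi>_\<sigma> is \<eta> with all arguments after the
  first horizontal, so it vanishes as well, and a second decomposition produces the pairs.\<close>

lemma strongly_contact_criterion:
  fixes \<eta> :: "(real^('n::{finite,linorder} + 'm::finite \<times> ('n, 's) midx)) eform"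
  assumes "open S" and \<eta>: "smooth_form (CARD('n) + 1) S \<eta>"
    and hor: "\<And>z v. z \<in> S \<Longrightarrow> (\<And>i \<sigma>. 0 < i \<Longrightarrow> cform \<sigma> z (v i) = 0) \<Longrightarrow> \<eta> z v = 0"
  shows "strongly_contact (CARD('n) + 1) S \<eta>"
proof -
  \<comment> \<open>\<open>r = n - 1\<close> is the degree that remains beside two contact forms of
    degree one.\<close>
  obtain r where n: "CARD('n) = Suc r" by (metis not0_implies_Suc zero_less_card_finite neq0_conv)
  let ?\<omega> = "\<lambda>\<sigma>. contact \<sigma> midx_empty :: (real^('n + 'm \<times> ('n, 's) midx)) eform"
  have \<eta>': "smooth_form (Suc (Suc r)) S \<eta>" using \<eta> n by simp
  obtain \<Phi> where \<Phi>: "\<And>\<sigma>. smooth_form (Suc r) S (\<Phi> \<sigma>)"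
    "\<And>\<sigma>. \<exists>\<Gamma> e. \<forall>z v. \<Phi> \<sigma> z v = \<eta> z (case_nat (e z) (\<lambda>i. cproj \<Gamma> z (v i)))"
    "\<And>z v. z \<in> S \<Longrightarrow> \<eta> z v = \<eta> z (\<lambda>i. cproj UNIV z (v i)) + (\<Sum>\<sigma>\<in>UNIV. wedge 1 (Suc r) (?\<omega> \<sigma>) (\<Phi> \<sigma>) z v)"
    using contact_decomposition[OF \<open>open S\<close> \<eta>' finite[of UNIV]] by blast
  have \<Phi>0: "\<Phi> \<sigma> z (\<lambda>i. cproj UNIV z (v i)) = 0" if "z \<in> S" for \<sigma> z v
  proof -
    obtain \<Gamma> e where "\<Phi> \<sigma> z w = \<eta> z (case_nat (e z) (\<lambda>i. cproj \<Gamma> z (w i)))" for z w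
      using \<Phi>(2) by blast
    then show ?thesis
      using hor[OF that] by (simp add: cproj_horizontal cform_cproj_UNIV split: nat.split)
  qed
  define Q where "Q \<sigma> \<Psi> \<longleftrightarrow> (\<forall>\<tau>. smooth_form r S (\<Psi> \<tau>)) \<and>
      (\<forall>z\<in>S. \<forall>v. \<Phi> \<sigma> z v = (\<Sum>\<tau>\<in>UNIV. wedge 1 r (?\<omega> \<tau>) (\<Psi> \<tau>) z v))" for \<sigma> \<Psi>
  have "\<exists>\<Psi>. Q \<sigma> \<Psi>" for \<sigma>
  proof -
    obtain \<Psi> where "\<And>\<tau>. smooth_form r S (\<Psi> \<tau>)"
      "\<And>z v. z \<in> S \<Longrightarrow> \<Phi> \<sigma> z v = \<Phi> \<sigma> z (\<lambda>i. cproj UNIV z (v i)) + (\<Sum>\<tau>\<in>UNIV. wedge 1 r (?\<omega> \<tau>) (\<Psi> \<tau>) z v)"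
      using contact_decomposition[OF \<open>open S\<close> \<Phi>(1)[of \<sigma>] finite[of UNIV]] by blast
    then show ?thesis using \<Phi>0 unfolding Q_def by (intro exI[of _ \<Psi>]) simp
  qed
  then obtain \<Psi> where Q: "\<And>\<sigma>. Q \<sigma> (\<Psi> \<sigma>)" by metis
  have \<Psi>: "smooth_form r S (\<Psi> \<sigma> \<tau>)"
    "z \<in> S \<Longrightarrow> \<Phi> \<sigma> z v = (\<Sum>\<tau>\<in>UNIV. wedge 1 r (?\<omega> \<tau>) (\<Psi> \<sigma> \<tau>) z v)" for \<sigma> z v \<tau>
    using Q unfolding Q_def by auto
  define t where "t = (\<lambda>(\<sigma>, \<tau>). wedge 2 r (wedge_list 1 [?\<omega> \<sigma>, ?\<omega> \<tau>]) (wedge 0 r (\<lambda>z v. 1) (\<Psi> \<sigma> \<tau>)))"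
  have eq: "\<eta> z v = (\<Sum>p\<in>UNIV. t p z v)" if z: "z \<in> S" for z v
  proof -
    have "\<eta> z v = (\<Sum>\<sigma>\<in>UNIV. wedge 1 (Suc r) (?\<omega> \<sigma>) (\<Phi> \<sigma>) z v)"
    proof -
      have "\<eta> z (\<lambda>i. cproj UNIV z (v i)) = 0" by (rule hor[OF z]) (rule cform_cproj_UNIV)
      then show ?thesis using \<Phi>(3)[OF z, of v] by simp
    qed
    also have "\<dots> = (\<Sum>\<sigma>\<in>UNIV. \<Sum>\<tau>\<in>UNIV. wedge 1 (Suc r) (?\<omega> \<sigma>) (wedge 1 r (?\<omega> \<tau>) (\<Psi> \<sigma> \<tau>)) z v)"
    proof (rule sum.cong[OF refl])
      fix \<sigma>
      have "wedge 1 (Suc r) (?\<omega> \<sigma>) (\<Phi> \<sigma>) z v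
          = wedge 1 (Suc r) (?\<omega> \<sigma>) (\<lambda>z v. \<Sum>\<tau>\<in>UNIV. wedge 1 r (?\<omega> \<tau>) (\<Psi> \<sigma> \<tau>) z v) z v"
        unfolding wedge_def[of 1 "Suc r"] by (simp add: \<Psi>(2)[OF z])
      also have "\<dots> = (\<Sum>\<tau>\<in>UNIV. wedge 1 (Suc r) (?\<omega> \<sigma>) (wedge 1 r (?\<omega> \<tau>) (\<Psi> \<sigma> \<tau>)) z v)"
        unfolding wedge_def[of 1 "Suc r"] sum_distrib_left sum_divide_distrib by (rule sum.swap)
      finally show "wedge 1 (Suc r) (?\<omega> \<sigma>) (\<Phi> \<sigma>) z v
          = (\<Sum>\<tau>\<in>UNIV. wedge 1 (Suc r) (?\<omega> \<sigma>) (wedge 1 r (?\<omega> \<tau>) (\<Psi> \<sigma> \<tau>)) z v)" .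
    qed
    also have "\<dots> = (\<Sum>\<sigma>\<in>UNIV. \<Sum>\<tau>\<in>UNIV. t (\<sigma>, \<tau>) z v)"
      using \<Psi>(1) z unfolding t_def prod.case
      by (intro sum.cong refl wedge_pair[symmetric]) (auto simp: smooth_form_iff contact_empty)
    also have "\<dots> = (\<Sum>p\<in>UNIV. t p z v)"
      by (simp add: sum.cartesian_product)
    finally show ?thesis .
  qed
  have ct: "contact_term (CARD('n) + 1) S (t (\<sigma>, \<tau>))" for \<sigma> \<tau>
    unfolding contact_term_def
    by (rule exI[of _ "[(\<sigma>, midx_empty), (\<tau>, midx_empty)]"], rule exI[of _ "[]"], rule exI[of _ r],
        rule exI[of _ "\<Psi> \<sigma> \<tau>"]) (use \<Psi>(1) in \<open>simp add: n t_def midx_size_empty numeral_2_eq_2\<close>)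
  obtain xs where xs: "set xs = (UNIV :: ('m \<times> 'm) set)" "distinct xs"
    using finite_distinct_list[OF finite] by blast
  show ?thesis
    unfolding strongly_contact_def
  proof (intro exI[of _ "map t xs"] conjI ballI allI)
    show "contact_term (CARD('n) + 1) S \<theta>" if "\<theta> \<in> set (map t xs)" for \<theta>
      using that ct by auto
    show "\<eta> z v = (\<Sum>\<theta>\<leftarrow>map t xs. \<theta> z v)" if "z \<in> S" for z v
      using xs eq[OF that] sum_list_distinct_conv_sum_set[OF xs(2), of "\<lambda>p. t p z v"] by (simp add: o_def)
  qed
qed

lemma strongly_contact_zero: "strongly_contact q S (\<lambda>z v. 0)"
  unfolding strongly_contact_def by (rule exI[of _ "[]"]) simp

lemma strongly_contact_cong:
  "strongly_contact q S \<omega> \<Longrightarrow> (\<And>z v. z \<in> S \<Longrightarrow> \<omega> z v = \<eta> z v) \<Longrightarrow> strongly_contact q S \<eta>"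
  unfolding strongly_contact_def by metis

lemma strongly_contact_add:
  assumes "strongly_contact q S \<omega>" "strongly_contact q S \<eta>"
  shows "strongly_contact q S (\<lambda>z v. \<omega> z v + \<eta> z v)"
proof -
  obtain ts us where "\<forall>\<theta>\<in>set ts. contact_term q S \<theta>" "\<forall>z\<in>S. \<forall>v. \<omega> z v = (\<Sum>\<theta>\<leftarrow>ts. \<theta> z v)"
    "\<forall>\<theta>\<in>set us. contact_term q S \<theta>" "\<forall>z\<in>S. \<forall>v. \<eta> z v = (\<Sum>\<theta>\<leftarrow>us. \<theta> z v)"
    using assms unfolding strongly_contact_def by blast
  then show ?thesis unfolding strongly_contact_def by (intro exI[of _ "ts @ us"]) auto
qed

lemma wedge_minus_right: "wedge p q \<alpha> (\<lambda>z v. - \<beta> z v) = (\<lambda>z v. - wedge p q \<alpha> \<beta> z v)"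
  by (simp add: wedge_def fun_eq_iff sum_negf)

lemma contact_term_minus:
  fixes \<theta> :: "(real^('n::finite + 'm::finite \<times> ('n, 's) midx)) eform"
  assumes "open S" "contact_term q S \<theta>"
  shows "contact_term q S (\<lambda>z v. - \<theta> z v)"
proof -
  obtain Js Is r \<Phi> where *: "length Js + length Is + CARD('n) = q + 1 \<and> length Js + 2 * length Is + r = q \<and>
        (\<forall>(\<sigma>, J)\<in>set Js. midx_size J \<le> CARD('s) - 1) \<and> (\<forall>(\<nu>, I)\<in>set Is. midx_size I = CARD('s) - 1)"
    and \<Phi>: "smooth_form r S \<Phi>"
    and \<theta>: "\<theta> = wedge (length Js) (2 * length Is + r) (wedge_list 1 (map (\<lambda>(\<sigma>, J). contact \<sigma> J) Js))
      (wedge (2 * length Is) r (wedge_list 2 (map (\<lambda>(\<nu>, I). ext_d 1 (contact \<nu> I)) Is)) \<Phi>)"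
    using assms(2) unfolding contact_term_def by blast
  show ?thesis
    unfolding contact_term_def
    by (rule exI[of _ Js], rule exI[of _ Is], rule exI[of _ r], rule exI[of _ "\<lambda>z v. - \<Phi> z v"])
      (use * smooth_form_minus[OF assms(1) \<Phi>] in \<open>simp add: \<theta> wedge_minus_right\<close>)
qed

lemma strongly_contact_minus:
  assumes "open S" "strongly_contact q S \<omega>"
  shows "strongly_contact q S (\<lambda>z v. - \<omega> z v)"
proof -
  obtain ts where ts: "\<forall>\<theta>\<in>set ts. contact_term q S \<theta>" "\<forall>z\<in>S. \<forall>v. \<omega> z v = (\<Sum>\<theta>\<leftarrow>ts. \<theta> z v)"
    using assms unfolding strongly_contact_def by blast
  have "(\<Sum>\<theta>\<leftarrow>map (\<lambda>\<theta> z v. - \<theta> z v) ts. \<theta> z v) = - (\<Sum>\<theta>\<leftarrow>ts. \<theta> z v)" for z v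
    by (induction ts) auto
  with ts show ?thesis
    unfolding strongly_contact_def
    by (intro exI[of _ "map (\<lambda>\<theta> z v. - \<theta> z v) ts"]) (auto intro: contact_term_minus[OF assms(1)])
qed

section \<open>A Riemannian metric\<close>

abbreviation (input) chart_inv :: "('p, 'e) chart \<Rightarrow> 'e \<Rightarrow> 'p" where
  "chart_inv c \<equiv> inv_into (fst c) (snd c)"

abbreviation (input) chart_dom :: "('p, 'e) chart \<Rightarrow> 'e set" where
  "chart_dom c \<equiv> snd c ` fst c"

locale smooth_manifold =
  fixes \<A> :: "('x::{t2_space,second_countable_topology}, real^'a::finite) chart set"
  assumes smooth_structure: "smooth_structure \<A>"
begin

lemma chart: "c \<in> \<A> \<Longrightarrow> is_chart c"
  using smooth_structure by (simp add: smooth_structure_def)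

lemma open_chart: "c \<in> \<A> \<Longrightarrow> open (fst c)" and open_chart_dom: "c \<in> \<A> \<Longrightarrow> open (chart_dom c)"
  using chart by (auto simp: is_chart_def)

lemma chart_inv_chart: "c \<in> \<A> \<Longrightarrow> p \<in> fst c \<Longrightarrow> chart_inv c (snd c p) = p"
  and chart_chart_inv: "c \<in> \<A> \<Longrightarrow> u \<in> chart_dom c \<Longrightarrow> snd c (chart_inv c u) = u"
  and continuous_on_chart: "c \<in> \<A> \<Longrightarrow> continuous_on (fst c) (snd c)"
  and continuous_on_chart_inv: "c \<in> \<A> \<Longrightarrow> continuous_on (chart_dom c) (chart_inv c)"
  using chart unfolding is_chart_def homeomorphism_def by blast+

lemma chart_inv_in: "c \<in> \<A> \<Longrightarrow> u \<in> chart_dom c \<Longrightarrow> chart_inv c u \<in> fst c"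
  by (rule inv_into_into)

lemma chart_cover: "\<exists>c\<in>\<A>. p \<in> fst c"
  using smooth_structure unfolding smooth_structure_def by blast

lemma chart_image_eq: "c \<in> \<A> \<Longrightarrow> snd c ` (fst c \<inter> W) = chart_dom c \<inter> chart_inv c -` W"
  by (auto simp: chart_inv_chart)

lemma open_chart_image:
  assumes "c \<in> \<A>" "open W"
  shows "open (snd c ` (fst c \<inter> W))"
  unfolding chart_image_eq[OF assms(1)]
  by (rule continuous_open_preimage[OF continuous_on_chart_inv[OF assms(1)] open_chart_dom[OF assms(1)] assms(2)])

lemma open_overlap: "c \<in> \<A> \<Longrightarrow> c' \<in> \<A> \<Longrightarrow> open (snd c ` (fst c \<inter> fst c'))"
  by (intro open_chart_image open_chart)

lemma transition_chart: "c \<in> \<A> \<Longrightarrow> p \<in> fst c \<Longrightarrow> transition c c' (snd c p) = snd c' p"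
  by (simp add: transition_def chart_inv_chart)

lemma smooth_transition: "c \<in> \<A> \<Longrightarrow> c' \<in> \<A> \<Longrightarrow> smooth_on (snd c ` (fst c \<inter> fst c')) (transition c c')"
  using smooth_structure unfolding smooth_structure_def smoothly_compatible_def by blast

definition dtrans :: "('x, real^'a) chart \<Rightarrow> ('x, real^'a) chart \<Rightarrow> 'x \<Rightarrow> real^'a \<Rightarrow> real^'a" where
  "dtrans c c' p = frechet_derivative (transition c c') (at (snd c p))"

lemma has_derivative_transition:
  assumes "c \<in> \<A>" "c' \<in> \<A>" "p \<in> fst c" "p \<in> fst c'"
  shows "(transition c c' has_derivative dtrans c c' p) (at (snd c p))"
  unfolding dtrans_def
  by (rule smooth_on_has_derivative[OF smooth_transition[OF assms(1,2)]]) (use assms in auto)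

lemma linear_dtrans:
  assumes "c \<in> \<A>" "c' \<in> \<A>" "p \<in> fst c" "p \<in> fst c'"
  shows "linear (dtrans c c' p)"
  by (rule has_derivative_linear[OF has_derivative_transition[OF assms]])

lemma dtrans_inverse:
  assumes "c \<in> \<A>" "c' \<in> \<A>" "p \<in> fst c" "p \<in> fst c'"
  shows "dtrans c' c p (dtrans c c' p \<xi>) = \<xi>"
proof -
  have "((\<lambda>u. transition c' c (transition c c' u)) has_derivative (\<lambda>\<xi>. dtrans c' c p (dtrans c c' p \<xi>))) (at (snd c p))"
    by (rule has_derivative_compose[OF has_derivative_transition[OF assms]])
      (simp add: transition_chart has_derivative_transition assms)
  moreover have "((\<lambda>u. transition c' c (transition c c' u)) has_derivative (\<lambda>\<xi>. \<xi>)) (at (snd c p))"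
    by (rule has_derivative_transform_within_open[OF has_derivative_ident open_overlap[OF assms(1,2)]])
      (use assms in \<open>auto simp: transition_chart\<close>)
  ultimately show ?thesis using has_derivative_unique by (metis (no_types))
qed

definition smooth_global :: "('x \<Rightarrow> real) \<Rightarrow> bool" where
  "smooth_global f \<longleftrightarrow> (\<forall>c\<in>\<A>. smooth_fun_on c f)"

lemma smooth_global_chart: "smooth_global f \<Longrightarrow> c \<in> \<A> \<Longrightarrow> smooth_on (chart_dom c) (\<lambda>u. f (chart_inv c u))"
  by (simp add: smooth_global_def smooth_fun_on_def o_def)

lemma smooth_global_continuous:
  assumes "smooth_global f"
  shows "continuous_on UNIV f"
proof -
  have "isCont f p" for p
  proof -
    obtain c where c: "c \<in> \<A>" "p \<in> fst c" using chart_cover by blast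
    have "continuous_on (fst c) (\<lambda>q. f (chart_inv c (snd c q)))"
      using continuous_on_compose2[OF smooth_on_continuous[OF smooth_global_chart[OF assms c(1)]] continuous_on_chart[OF c(1)]]
      by simp
    then have "continuous_on (fst c) f"
      using chart_inv_chart[OF c(1)] by (simp cong: continuous_on_cong)
    then show ?thesis using c open_chart continuous_on_eq_continuous_at by blast
  qed
  then show ?thesis by (simp add: continuous_at_imp_continuous_on)
qed

lemma smooth_global_mult: "smooth_global f \<Longrightarrow> smooth_global g \<Longrightarrow> smooth_global (\<lambda>p. f p * g p)"
  unfolding smooth_global_def smooth_fun_on_def o_def
  by (intro ballI smooth_on_mult open_chart_dom) auto

lemma smooth_global_const: "smooth_global (\<lambda>_. a)"
  unfolding smooth_global_def smooth_fun_on_def o_def by (intro ballI smooth_on_const open_chart_dom)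

lemma smooth_global_prod:
  "(\<And>i. i \<in> I \<Longrightarrow> smooth_global (f i)) \<Longrightarrow> smooth_global (\<lambda>p. \<Prod>i\<in>I. f i p)"
  by (induction I rule: infinite_finite_induct) (auto intro: smooth_global_mult smooth_global_const)

lemma smooth_global_compose:
  assumes "smooth_global f" "smooth_on UNIV (\<phi> :: real \<Rightarrow> real)"
  shows "smooth_global (\<lambda>p. \<phi> (f p))"
  unfolding smooth_global_def smooth_fun_on_def o_def
proof
  fix c assume "c \<in> \<A>"
  show "smooth_on (chart_dom c) (\<lambda>u. \<phi> (f (chart_inv c u)))"
    by (rule smooth_on_compose[OF open_chart_dom[OF \<open>c \<in> \<A>\<close>] open_UNIV subset_UNIV
        smooth_global_chart[OF assms(1) \<open>c \<in> \<A>\<close>] assms(2)])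
qed

lemma smooth_global_diff_const: "smooth_global f \<Longrightarrow> smooth_global (\<lambda>p. a - f p)"
  unfolding smooth_global_def smooth_fun_on_def o_def
  by (auto intro!: smooth_on_diff smooth_on_const open_chart_dom)

text \<open>Extension by zero. Around a point outside the chart the complement of \<open>K\<close>
  is a neighbourhood on which the function is zero; this is where closedness of \<open>K\<close> in
  all of \<open>X\<close> enters.\<close>

lemma smooth_global_extend:
  assumes c: "c \<in> \<A>" and "closed K" "K \<subseteq> fst c"
    and \<phi>: "smooth_on (chart_dom c) \<phi>" "\<And>p. p \<in> fst c - K \<Longrightarrow> \<phi> (snd c p) = 0"
  shows "smooth_global (\<lambda>p. if p \<in> fst c then \<phi> (snd c p) else 0)"
  unfolding smooth_global_def smooth_fun_on_def o_def
proof (intro ballI smooth_on_local)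
  fix c' u assume c': "c' \<in> \<A>" and "u \<in> chart_dom c'"
  let ?f = "\<lambda>u. if chart_inv c' u \<in> fst c then \<phi> (snd c (chart_inv c' u)) else 0"
  obtain p where p: "p \<in> fst c'" "u = snd c' p" using \<open>u \<in> chart_dom c'\<close> by blast
  show "\<exists>T. open T \<and> u \<in> T \<and> smooth_on T ?f"
  proof (cases "p \<in> fst c")
    case True
    let ?T = "snd c' ` (fst c' \<inter> fst c)"
    have "smooth_on ?T (\<lambda>u. \<phi> (transition c' c u))"
      by (rule smooth_on_compose[OF open_overlap[OF c' c] open_chart_dom[OF c] _ smooth_transition[OF c' c] \<phi>(1)])
        (auto simp: transition_chart c')
    then have "smooth_on ?T ?f"
      by (rule smooth_on_cong[OF open_overlap[OF c' c]]) (auto simp: transition_chart c' chart_inv_chart)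
    then show ?thesis using True p open_overlap[OF c' c] by blast
  next
    case False
    let ?T = "snd c' ` (fst c' \<inter> - K)"
    have T: "open ?T" using open_chart_image[OF c', of "- K"] \<open>closed K\<close> by (simp add: open_Compl)
    have "smooth_on ?T ?f"
      by (rule smooth_on_cong[OF T smooth_on_const[OF T, of 0]]) (use \<phi>(2) in \<open>auto simp: c' chart_inv_chart\<close>)
    moreover have "u \<in> ?T" using False p \<open>K \<subseteq> fst c\<close> by auto
    ultimately show ?thesis using T by blast
  qed
qed

text \<open>Besides \<open>g\<close> also its products with the coordinates have to extend smoothly
  by zero, because the metric is built from the differentials of all these functions.\<close>

definition chart_bump :: "('x, real^'a) chart \<Rightarrow> ('x \<Rightarrow> real) \<Rightarrow> bool" where
  "chart_bump c g \<longleftrightarrow> c \<in> \<A> \<and> smooth_global g \<and> (\<forall>p. 0 \<le> g p) \<and> (\<forall>p. g p \<noteq> 0 \<longrightarrow> p \<in> fst c) \<and>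
    (\<forall>A. smooth_global (\<lambda>p. if p \<in> fst c then g p * snd c p $ A else 0))"

text \<open>The flat function of r^2 - |u - u0|^2 vanishes outside a closed ball in the chart. The
  ball corresponds to a compact subset of \<open>X\<close>, which is closed as \<open>X\<close> is
  Hausdorff.\<close>

lemma chart_bump_exists: "\<exists>c g. chart_bump c g \<and> g p > 0"
proof -
  obtain c where c: "c \<in> \<A>" "p \<in> fst c" using chart_cover by blast
  obtain r where r: "r > 0" "cball (snd c p) r \<subseteq> chart_dom c"
    using open_contains_cball[THEN iffD1, OF open_chart_dom[OF c(1)]] c(2) by blast
  define \<phi> where "\<phi> u = flat_fn 0 (r\<^sup>2 - (u - snd c p) \<bullet> (u - snd c p))" for u
  define K where "K = chart_inv c ` cball (snd c p) r"
  have "compact K"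
    unfolding K_def
    by (rule compact_continuous_image[OF continuous_on_subset[OF continuous_on_chart_inv[OF c(1)] r(2)] compact_cball])
  then have K: "closed K" by (rule compact_imp_closed)
  have Kc: "K \<subseteq> fst c" using r(2) chart_inv_in[OF c(1)] by (auto simp: K_def)
  have "smooth_on UNIV (\<lambda>u. r\<^sup>2 - (u - snd c p) \<bullet> (u - snd c p))"
    by (intro smooth_on_diff smooth_on_inner smooth_on_const smooth_on_ident) auto
  then have "smooth_on UNIV \<phi>"
    unfolding \<phi>_def[abs_def] by (rule smooth_on_compose[OF open_UNIV open_UNIV subset_UNIV _ smooth_flat_fn])
  then have sm: "smooth_on (chart_dom c) \<phi>" by (rule smooth_on_subset) simp
  have zero: "\<phi> (snd c q) = 0" if q: "q \<in> fst c - K" for q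
  proof -
    have "snd c q \<notin> cball (snd c p) r"
      using q chart_inv_chart[OF c(1), of q] unfolding K_def by (metis DiffD1 DiffD2 image_eqI)
    then have "r < norm (snd c q - snd c p)" by (simp add: dist_norm norm_minus_commute)
    then have "r\<^sup>2 < (norm (snd c q - snd c p))\<^sup>2" using r(1) by (simp add: power_strict_mono)
    then show ?thesis by (simp add: \<phi>_def flat_fn_def power2_norm_eq_inner)
  qed
  let ?g = "\<lambda>p. if p \<in> fst c then \<phi> (snd c p) else 0"
  have "smooth_global (\<lambda>p. if p \<in> fst c then ?g p * snd c p $ A else 0)" for A
  proof -
    have "smooth_on (chart_dom c) (\<lambda>u. \<phi> u * u $ A)"
      by (intro smooth_on_mult sm smooth_on_component open_chart_dom c(1))
    then have "smooth_global (\<lambda>p. if p \<in> fst c then (\<lambda>u. \<phi> u * u $ A) (snd c p) else 0)"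
      by (rule smooth_global_extend[OF c(1) K Kc]) (simp add: zero)
    then show ?thesis by (simp cong: if_cong)
  qed
  moreover have "smooth_global ?g" by (rule smooth_global_extend[OF c(1) K Kc sm zero])
  moreover have "?g p > 0" using c(2) r(1) by (simp add: \<phi>_def flat_fn_pos_iff)
  moreover have "0 \<le> ?g q" for q by (simp add: \<phi>_def flat_fn_nonneg)
  ultimately show ?thesis using c(1) unfolding chart_bump_def by (intro exI[of _ c] exI[of _ ?g]) auto
qed

text \<open>Second countability enters here, through the Lindelof property.\<close>

lemma chart_bump_sequence: "\<exists>c g. (\<forall>k::nat. chart_bump (c k) (g k)) \<and> (\<forall>p. \<exists>k. g k p > 0)"
proof -
  obtain c g where cg: "\<And>p. chart_bump (c p) (g p)" "\<And>p. g p p > (0::real)"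
    using chart_bump_exists by metis
  let ?U = "\<lambda>p. {q. g p q > 0}"
  have op: "open (?U p)" for p
    using cg(1)[of p] smooth_global_continuous[of "g p"]
    by (intro open_Collect_less continuous_on_const) (auto simp: chart_bump_def)
  obtain \<F> where \<F>: "\<F> \<subseteq> range ?U" "countable \<F>" "\<Union>\<F> = \<Union>(range ?U)"
    using Lindelof[of "range ?U"] op by blast
  obtain P where P: "countable P" "\<F> = ?U ` P"
    using countable_subset_image[of \<F> ?U UNIV] \<F>(1,2) by blast
  have cover: "\<exists>p\<in>P. g p q > 0" for q
    using \<F>(3) cg(2)[of q] unfolding P(2) by blast
  then have "P \<noteq> {}" by blast
  show ?thesis
  proof (intro exI[of _ "\<lambda>k. c (from_nat_into P k)"] exI[of _ "\<lambda>k. g (from_nat_into P k)"] conjI allI cg(1))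
    fix q
    obtain p where "p \<in> P" "g p q > 0" using cover by blast
    then show "\<exists>k. g (from_nat_into P k) q > 0"
      using range_from_nat_into[OF \<open>P \<noteq> {}\<close> P(1)] by (metis imageE)
  qed
qed

text \<open>
  Replacing \<open>g k\<close> by \<open>h k = g k \<cdot> (\<Prod>j<k. flat_fn 0 (1 / (k + 1) - g j))\<close> makes the family locally finite
  without shrinking the union of the sets \<open>{g k > 0}\<close>: near a point with \<open>g j > 0\<close> all \<open>h k\<close> with
  \<open>k\<close> large vanish, and \<open>h k > 0\<close> for the first \<open>k\<close> with \<open>g k > 0\<close>.
\<close>

lemma locally_finite_bumps:
  "\<exists>c h. (\<forall>k::nat. chart_bump (c k) (h k)) \<and> (\<forall>p. \<exists>k. h k p > 0) \<and>
    (\<forall>p. \<exists>W N. open W \<and> p \<in> W \<and> (\<forall>k\<ge>N. \<forall>q\<in>W. h k q = 0))"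
proof -
  obtain c g where cg: "\<And>k::nat. chart_bump (c k) (g k)" and pos: "\<And>p. \<exists>k. g k p > (0::real)"
    using chart_bump_sequence by blast
  define m where "m k p = (\<Prod>j<k. flat_fn 0 (1 / real (Suc k) - g j p))" for k p
  define h where "h k p = g k p * m k p" for k p
  have sg: "smooth_global (g k)" and nonneg: "0 \<le> g k p" and dom: "g k p \<noteq> 0 \<Longrightarrow> p \<in> fst (c k)"
    and sgA: "smooth_global (\<lambda>p. if p \<in> fst (c k) then g k p * snd (c k) p $ A else 0)" for k p A
    using cg[of k] by (auto simp: chart_bump_def)
  have sm: "smooth_global (m k)" for k
    unfolding m_def[abs_def]
    by (intro smooth_global_prod smooth_global_compose[OF smooth_global_diff_const[OF sg] smooth_flat_fn])
  have "chart_bump (c k) (h k)" for k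
    unfolding chart_bump_def
  proof (intro conjI allI impI)
    show "c k \<in> \<A>" using cg[of k] by (simp add: chart_bump_def)
    show "smooth_global (h k)" unfolding h_def[abs_def] by (intro smooth_global_mult sg sm)
    show "0 \<le> h k p" for p by (auto simp: h_def m_def nonneg flat_fn_nonneg intro!: mult_nonneg_nonneg prod_nonneg)
    show "p \<in> fst (c k)" if "h k p \<noteq> 0" for p using that dom by (auto simp: h_def)
    show "smooth_global (\<lambda>p. if p \<in> fst (c k) then h k p * snd (c k) p $ A else 0)" for A
    proof -
      have "(\<lambda>p. if p \<in> fst (c k) then h k p * snd (c k) p $ A else 0)
          = (\<lambda>p. m k p * (if p \<in> fst (c k) then g k p * snd (c k) p $ A else 0))"
        by (auto simp: h_def)
      then show ?thesis using smooth_global_mult[OF sm sgA] by simp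
    qed
  qed
  moreover have "\<exists>k. h k p > 0" for p
  proof -
    define k where "k = (LEAST k. g k p > 0)"
    have k: "g k p > 0" unfolding k_def using pos[of p] by (metis LeastI)
    have "g j p = 0" if "j < k" for j
      using not_less_Least[of j "\<lambda>k. g k p > 0"] that nonneg[of j p] by (simp add: k_def)
    then have "m k p > 0" by (auto simp: m_def flat_fn_pos_iff intro!: prod_pos)
    with k show ?thesis unfolding h_def by (intro exI[of _ k] mult_pos_pos)
  qed
  moreover have "\<exists>W N. open W \<and> p \<in> W \<and> (\<forall>k\<ge>N. \<forall>q\<in>W. h k q = 0)" for p
  proof -
    obtain j where j: "g j p > 0" using pos by blast
    obtain N where N: "inverse (real (Suc N)) < g j p / 2"
      using reals_Archimedean[of "g j p / 2"] j by auto
    let ?W = "{q. g j p / 2 < g j q}"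
    have "open ?W"
      using smooth_global_continuous[OF sg[of j]] by (intro open_Collect_less continuous_on_const)
    moreover have "h k q = 0" if k: "k \<ge> max N (Suc j)" and q: "q \<in> ?W" for k q
    proof -
      have "1 / real (Suc k) \<le> 1 / real (Suc N)" using k by (simp add: frac_le)
      then have "1 / real (Suc k) - g j q \<le> 0" using N q by (simp add: inverse_eq_divide)
      then have "flat_fn 0 (1 / real (Suc k) - g j q) = 0" by (simp add: flat_fn_def)
      then have "m k q = 0" using k unfolding m_def by (intro prod_zero) auto
      then show ?thesis by (simp add: h_def)
    qed
    ultimately show ?thesis using j by (intro exI[of _ ?W] exI[of _ "max N (Suc j)"]) auto
  qed
  ultimately show ?thesis by (intro exI[of _ c] exI[of _ h]) blast
qed

text \<open>The metric is the sum of the squares of the differentials of the functions h_k and h_k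
  x^A, formally the pull-back of the Euclidean metric under the map with these components. As the
  functions are global, invariance under a change of chart is automatic; near each point the sum is
  finite.\<close>

lemma metric_exists:
  "\<exists>g :: ('x, real^'a) chart \<Rightarrow> real^'a \<Rightarrow> real^'a \<Rightarrow> real^'a \<Rightarrow> real.
    (\<forall>c\<in>\<A>. \<forall>u\<in>chart_dom c. (\<forall>\<xi>. linear (g c u \<xi>)) \<and> (\<forall>\<xi> \<zeta>. g c u \<xi> \<zeta> = g c u \<zeta> \<xi>) \<and>
      (\<forall>\<xi>. \<xi> \<noteq> 0 \<longrightarrow> g c u \<xi> \<xi> > 0)) \<and>
    (\<forall>c\<in>\<A>. \<forall>\<xi> \<zeta>. smooth_on (chart_dom c) (\<lambda>u. g c u \<xi> \<zeta>)) \<and>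
    (\<forall>c\<in>\<A>. \<forall>c'\<in>\<A>. \<forall>p\<in>fst c \<inter> fst c'. \<forall>\<xi> \<zeta>.
      g c (snd c p) \<xi> \<zeta> = g c' (snd c' p) (dtrans c c' p \<xi>) (dtrans c c' p \<zeta>))"
proof -
  obtain b h where bh: "\<And>k::nat. chart_bump (b k) (h k)" and pos: "\<And>p. \<exists>k. h k p > (0::real)"
    and fin: "\<And>p. \<exists>W N. open W \<and> p \<in> W \<and> (\<forall>k\<ge>N. \<forall>q\<in>W. h k q = 0)"
    using locally_finite_bumps by blast
  have b: "b k \<in> \<A>" and sgh: "smooth_global (h k)"
    and dom: "h k p \<noteq> 0 \<Longrightarrow> p \<in> fst (b k)" for k p
    using bh[of k] by (auto simp: chart_bump_def)
  define f where "f k a p = (case a of None \<Rightarrow> h k p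
    | Some A \<Rightarrow> if p \<in> fst (b k) then h k p * snd (b k) p $ A else 0)" for k a p
  have sg: "smooth_global (f k a)" for k a
    unfolding f_def[abs_def] using bh[of k] by (cases a) (auto simp: chart_bump_def)
  have f0: "f k a p = 0" if "h k p = 0" for k a p
    using that by (auto simp: f_def split: option.split)
  define d where "d c u k a = frechet_derivative (\<lambda>u. f k a (chart_inv c u)) (at u)" for c :: "('x, real^'a) chart" and u k a
  define S where "S c u \<xi> \<zeta> k = (\<Sum>a\<in>UNIV. d c u k a \<xi> * d c u k a \<zeta>)" for c :: "('x, real^'a) chart" and u \<xi> \<zeta> k
  define g where "g c u \<xi> \<zeta> = suminf (S c u \<xi> \<zeta>)" for c :: "('x, real^'a) chart" and u \<xi> \<zeta>
  have der: "((\<lambda>u. f k a (chart_inv c u)) has_derivative d c u k a) (at u)" if "c \<in> \<A>" "u \<in> chart_dom c" for c u k a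
    unfolding d_def by (rule smooth_on_has_derivative[OF smooth_global_chart[OF sg that(1)] that(2)])
  have lin_d: "linear (d c u k a)" if "c \<in> \<A>" "u \<in> chart_dom c" for c u k a
    by (rule has_derivative_linear[OF der[OF that]])
  have smooth_d: "smooth_on (chart_dom c) (\<lambda>u. d c u k a \<xi>)" if "c \<in> \<A>" for c k a \<xi>
    unfolding d_def by (rule smooth_on_deriv[OF smooth_global_chart[OF sg that]])
  have loc: "\<exists>T N. open T \<and> u0 \<in> T \<and> T \<subseteq> chart_dom c \<and> (\<forall>k\<ge>N. \<forall>u\<in>T. \<forall>a \<xi>. d c u k a \<xi> = 0)"
    if c: "c \<in> \<A>" and u0: "u0 \<in> chart_dom c" for c u0
  proof -
    obtain W N where W: "open W" "chart_inv c u0 \<in> W" "\<forall>k\<ge>N. \<forall>q\<in>W. h k q = 0" using fin by blast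
    let ?T = "snd c ` (fst c \<inter> W)"
    have T: "open ?T" by (rule open_chart_image[OF c W(1)])
    have "d c u k a \<xi> = 0" if "k \<ge> N" "u \<in> ?T" for k u a \<xi>
    proof -
      have "((\<lambda>u. f k a (chart_inv c u)) has_derivative (\<lambda>_. 0)) (at u)"
        by (rule has_derivative_transform_within_open[OF has_derivative_const[of 0] T that(2)])
          (use W(3) that(1) f0 c in \<open>auto simp: chart_inv_chart\<close>)
      then show ?thesis using frechet_derivative_at unfolding d_def by metis
    qed
    moreover have "u0 \<in> ?T" using W(2) u0 c by (auto simp: chart_inv_chart)
    ultimately show ?thesis using T by (intro exI[of _ ?T] exI[of _ N]) auto
  qed
  have g_sum: "g c u \<xi> \<zeta> = (\<Sum>k<N. S c u \<xi> \<zeta> k)" if "\<And>k a \<xi>. k \<ge> N \<Longrightarrow> d c u k a \<xi> = 0" for c u \<xi> \<zeta> N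
    unfolding g_def by (rule suminf_finite) (auto simp: S_def that)
  have 1: "linear (g c u \<xi>) \<and> g c u \<xi> \<zeta> = g c u \<zeta> \<xi> \<and> (\<xi> \<noteq> 0 \<longrightarrow> g c u \<xi> \<xi> > 0)"
    if c: "c \<in> \<A>" and u: "u \<in> chart_dom c" for c u \<xi> \<zeta>
  proof -
    obtain N where N: "\<And>k a \<xi>. k \<ge> N \<Longrightarrow> d c u k a \<xi> = 0" using loc[OF c u] by blast
    have lin: "linear (g c u \<xi>)"
    proof -
      have "linear (\<lambda>\<zeta>. \<Sum>k<N. \<Sum>a\<in>UNIV. d c u k a \<xi> * d c u k a \<zeta>)"
        by (intro linear_compose_sum ballI linear_compose_scale_right[OF lin_d[OF that], unfolded real_scaleR_def])
      moreover have "g c u \<xi> = (\<lambda>\<zeta>. \<Sum>k<N. \<Sum>a\<in>UNIV. d c u k a \<xi> * d c u k a \<zeta>)"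
        by (rule ext) (simp add: g_sum[OF N] S_def)
      ultimately show ?thesis by simp
    qed
    have sym: "g c u \<xi> \<zeta> = g c u \<zeta> \<xi>" by (simp add: g_def S_def[abs_def] mult.commute)
    have "g c u \<xi> \<xi> > 0" if "\<xi> \<noteq> 0"
    proof -
      have nonneg: "g c u \<xi> \<xi> \<ge> 0" by (simp add: g_sum[OF N] S_def sum_nonneg)
      have "g c u \<xi> \<xi> \<noteq> 0"
      proof
        assume "g c u \<xi> \<xi> = 0"
        then have z: "d c u k a \<xi> = 0" if "k < N" for k a
          using that by (simp add: g_sum[OF N] S_def sum_nonneg_eq_0_iff sum_nonneg)
        have z: "d c u k a \<xi> = 0" for k a using z[of k a] N[of k a \<xi>] by (cases "k < N") auto
        define p where "p = chart_inv c u"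
        have p: "p \<in> fst c" "snd c p = u" using c u by (auto simp: p_def chart_inv_in chart_chart_inv)
        obtain k where k: "h k p > 0" using pos by blast
        then have pk: "p \<in> fst (b k)" using dom by force
        have trans: "(transition c (b k) has_derivative dtrans c (b k) p) (at u)"
          using has_derivative_transition[OF c b p(1) pk] p(2) by simp
        have "dtrans c (b k) p \<xi> $ A = 0" for A
        proof -
          \<comment> \<open>From d(h x^A) = h dx^A + x^A dh: the differentials of h and of h x^A
            vanish on \<xi> and h is positive at \<open>p\<close>, so dx^A vanishes on \<xi>
            too.\<close>
          have "((\<lambda>u. h k (chart_inv c u) * transition c (b k) u $ A) has_derivative
              (\<lambda>v. h k (chart_inv c u) * dtrans c (b k) p v $ A + d c u k None v * transition c (b k) u $ A)) (at u)"
            using der[OF c u, of k None]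
            by (intro has_derivative_mult bounded_linear.has_derivative[OF bounded_linear_vec_nth trans]) (simp add: f_def)
          moreover have "((\<lambda>u. h k (chart_inv c u) * transition c (b k) u $ A) has_derivative d c u k (Some A)) (at u)"
            by (rule has_derivative_transform_within_open[OF der[OF c u] open_overlap[OF c b[of k]]])
              (use p pk c in \<open>auto simp: f_def chart_inv_chart transition_chart\<close>)
          ultimately have "h k (chart_inv c u) * dtrans c (b k) p \<xi> $ A + d c u k None \<xi> * transition c (b k) u $ A
              = d c u k (Some A) \<xi>"
            using has_derivative_unique by (metis (no_types, lifting))
          then show ?thesis using z k by (simp add: p_def[symmetric])
        qed
        then have "dtrans c (b k) p \<xi> = 0" by (simp add: vec_eq_iff)
        then have "\<xi> = 0"
          using dtrans_inverse[OF c b p(1) pk, of \<xi>] linear_0[OF linear_dtrans[OF b c pk p(1)]] by simp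
        then show False using \<open>\<xi> \<noteq> 0\<close> by simp
      qed
      with nonneg show ?thesis by linarith
    qed
    with lin sym show ?thesis by blast
  qed
  have 2: "smooth_on (chart_dom c) (\<lambda>u. g c u \<xi> \<zeta>)" if c: "c \<in> \<A>" for c \<xi> \<zeta>
  proof (rule smooth_on_local)
    fix u0 assume u0: "u0 \<in> chart_dom c"
    obtain T N where T: "open T" "u0 \<in> T" "T \<subseteq> chart_dom c" "\<And>k u a \<xi>. k \<ge> N \<Longrightarrow> u \<in> T \<Longrightarrow> d c u k a \<xi> = 0"
      using loc[OF c u0] by blast
    have "smooth_on T (\<lambda>u. \<Sum>k<N. S c u \<xi> \<zeta> k)"
      unfolding S_def using smooth_on_subset[OF smooth_d[OF c] T(3)]
      by (intro smooth_on_sum smooth_on_mult T(1))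
    then have "smooth_on T (\<lambda>u. g c u \<xi> \<zeta>)"
      by (rule smooth_on_cong[OF T(1)]) (rule g_sum[symmetric], rule T(4))
    then show "\<exists>T. open T \<and> u0 \<in> T \<and> smooth_on T (\<lambda>u. g c u \<xi> \<zeta>)" using T by blast
  qed
  have 3: "g c (snd c p) \<xi> \<zeta> = g c' (snd c' p) (dtrans c c' p \<xi>) (dtrans c c' p \<zeta>)"
    if c: "c \<in> \<A>" and c': "c' \<in> \<A>" and p: "p \<in> fst c" "p \<in> fst c'" for c c' p \<xi> \<zeta>
  proof -
    have "d c (snd c p) k a v = d c' (snd c' p) k a (dtrans c c' p v)" for k a v
    proof -
      have "((\<lambda>u. f k a (chart_inv c' (transition c c' u))) has_derivative
          (\<lambda>v. d c' (snd c' p) k a (dtrans c c' p v))) (at (snd c p))"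
        by (rule has_derivative_compose[OF has_derivative_transition[OF c c' p]])
          (use c c' p der in \<open>simp add: transition_chart\<close>)
      then have "((\<lambda>u. f k a (chart_inv c u)) has_derivative
          (\<lambda>v. d c' (snd c' p) k a (dtrans c c' p v))) (at (snd c p))"
        by (rule has_derivative_transform_within_open[OF _ open_overlap[OF c c']])
          (use c c' p in \<open>auto simp: transition_chart chart_inv_chart\<close>)
      then show ?thesis using frechet_derivative_at unfolding d_def by metis
    qed
    then show ?thesis by (simp add: g_def S_def[abs_def])
  qed
  show ?thesis
    using 1 2 3 by (intro exI[of _ g]) blast
qed

end

section \<open>Local diffeomorphisms\<close>

definition jacobi_matrix :: "(real^'n::finite \<Rightarrow> real^'n::finite) \<Rightarrow> real^'n::finite \<Rightarrow> real^'n::finite^'n::finite" where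
  "jacobi_matrix \<alpha> t = (\<chi> k j. partial j (\<lambda>t. \<alpha> t $ k) t)"

lemma jacobi_matrix_eq:
  assumes "\<alpha> differentiable (at t)"
  shows "jacobi_matrix \<alpha> t = matrix (frechet_derivative \<alpha> (at t))"
  by (simp add: jacobi_matrix_def matrix_def partial_def frechet_derivative_nth[OF assms])

lemma jacobi_matrix_compose:
  assumes "\<beta> differentiable (at t)" "\<alpha> differentiable (at (\<beta> t))"
  shows "jacobi_matrix (\<lambda>t. \<alpha> (\<beta> t)) t = jacobi_matrix \<alpha> (\<beta> t) ** jacobi_matrix \<beta> t"
  using frechet_derivative_nth(2)[OF assms(2)]
  by (simp add: vec_eq_iff jacobi_matrix_def matrix_matrix_mult_def partial_compose_vec[OF assms(1), of "\<lambda>x. \<alpha> x $ _"] mult.commute)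

lemma jacobi_matrix_cong:
  assumes "open U" "t \<in> U" "\<And>t. t \<in> U \<Longrightarrow> \<alpha> t = \<beta> t"
  shows "jacobi_matrix \<alpha> t = jacobi_matrix \<beta> t"
  unfolding jacobi_matrix_def using assms by (auto simp: vec_eq_iff intro!: partial_cong[OF assms(1,2)])

lemma jacobi_matrix_ident: "jacobi_matrix (\<lambda>t. t) t = mat 1"
  by (auto simp: jacobi_matrix_def mat_def vec_eq_iff partial_component)

lemma smooth_jacobi_matrix:
  "open U \<Longrightarrow> smooth_on U \<alpha> \<Longrightarrow> smooth_on U (\<lambda>t. jacobi_matrix \<alpha> t $ k $ j)"
  by (simp add: jacobi_matrix_def smooth_on_partial smooth_on_nth)

lemma local_diffeoI:
  assumes "open U" "0 \<in> U" "smooth_on U \<alpha>" "\<alpha> 0 = 0" "det (jacobi_matrix \<alpha> 0) \<noteq> 0"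
  shows "local_diffeo \<alpha>"
proof -
  have "det (matrix (frechet_derivative \<alpha> (at 0))) \<noteq> 0"
    using jacobi_matrix_eq[OF smooth_on_differentiable[OF assms(3,2)]] assms(5) by simp
  then obtain U' V g where g: "open U'" "0 \<in> U'" "U' \<subseteq> U" "open V" "\<alpha> 0 \<in> V" "homeomorphism U' V \<alpha> g" "smooth_on V g"
    by (rule smooth_inverse_function[OF assms(1,3,2)])
  have img: "\<alpha> ` U' = V" and inv: "\<And>t. t \<in> U' \<Longrightarrow> g (\<alpha> t) = t" "\<And>y. y \<in> V \<Longrightarrow> \<alpha> (g y) = y"
    using g(6) by (auto simp: homeomorphism_def)
  have inj: "inj_on \<alpha> U'" using inv(1) by (metis inj_on_inverseI)
  have "smooth_on (\<alpha> ` U') (inv_into U' \<alpha>)"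
    unfolding img using inj inv img
    by (intro smooth_on_cong[OF g(4,7)]) (metis inv_into_f_f imageE)
  then show ?thesis
    unfolding local_diffeo_def using g img inj assms(3,4) smooth_on_subset by blast
qed

lemma local_diffeoD:
  assumes "local_diffeo \<alpha>"
  obtains U \<beta> W where "open U" "0 \<in> U" "smooth_on U \<alpha>" "\<alpha> 0 = 0"
    "open W" "0 \<in> W" "smooth_on W \<beta>" "\<beta> 0 = 0" "\<And>t. t \<in> U \<Longrightarrow> \<alpha> t \<in> W \<and> \<beta> (\<alpha> t) = t"
    "\<And>t. t \<in> W \<Longrightarrow> \<beta> t \<in> U \<and> \<alpha> (\<beta> t) = t"
    "det (jacobi_matrix \<alpha> 0) \<noteq> 0" "local_diffeo \<beta>"
proof -
  obtain U where U: "open U" "0 \<in> U" "open (\<alpha> ` U)" "inj_on \<alpha> U" "smooth_on U \<alpha>"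
      "smooth_on (\<alpha> ` U) (inv_into U \<alpha>)" and \<alpha>0: "\<alpha> 0 = 0"
    using assms unfolding local_diffeo_def by blast
  let ?\<beta> = "inv_into U \<alpha>" and ?W = "\<alpha> ` U"
  have W: "0 \<in> ?W" using U(2) \<alpha>0 by force
  have inv: "t \<in> U \<Longrightarrow> \<alpha> t \<in> ?W \<and> ?\<beta> (\<alpha> t) = t" "t \<in> ?W \<Longrightarrow> ?\<beta> t \<in> U \<and> \<alpha> (?\<beta> t) = t" for t
    using U(4) by auto
  have \<beta>0: "?\<beta> 0 = 0" using inv(1)[OF U(2)] \<alpha>0 by simp
  have "jacobi_matrix (\<lambda>t. ?\<beta> (\<alpha> t)) 0 = jacobi_matrix (\<lambda>t. t) 0"
    by (rule jacobi_matrix_cong[OF U(1,2)]) (simp add: inv)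
  moreover have "jacobi_matrix (\<lambda>t. ?\<beta> (\<alpha> t)) 0 = jacobi_matrix ?\<beta> (\<alpha> 0) ** jacobi_matrix \<alpha> 0"
    by (rule jacobi_matrix_compose) (use U W \<alpha>0 in \<open>auto intro: smooth_on_differentiable\<close>)
  ultimately have "det (jacobi_matrix ?\<beta> (\<alpha> 0)) * det (jacobi_matrix \<alpha> 0) = 1"
    by (metis det_mul jacobi_matrix_ident det_I)
  then have d: "det (jacobi_matrix \<alpha> 0) \<noteq> 0" "det (jacobi_matrix ?\<beta> 0) \<noteq> 0" using \<alpha>0 by auto
  have "local_diffeo ?\<beta>" by (rule local_diffeoI[OF U(3) W U(6) \<beta>0 d(2)])
  then show thesis using that[OF U(1,2,5) \<alpha>0 U(3) W U(6) \<beta>0 inv d(1)] by blast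
qed

lemma local_diffeo_compose:
  assumes "local_diffeo \<alpha>" "local_diffeo \<beta>"
  shows "local_diffeo (\<lambda>t. \<alpha> (\<beta> t))"
proof -
  obtain U where U: "open U" "0 \<in> U" "smooth_on U \<alpha>" "\<alpha> 0 = 0" "det (jacobi_matrix \<alpha> 0) \<noteq> 0"
    using local_diffeoD[OF assms(1)] by metis
  obtain V where V: "open V" "0 \<in> V" "smooth_on V \<beta>" "\<beta> 0 = 0" "det (jacobi_matrix \<beta> 0) \<noteq> 0"
    using local_diffeoD[OF assms(2)] by metis
  have op: "open (V \<inter> \<beta> -` U)"
    by (rule continuous_open_preimage[OF smooth_on_continuous[OF V(3)] V(1) U(1)])
  show ?thesis
  proof (rule local_diffeoI[OF op])
    show "smooth_on (V \<inter> \<beta> -` U) (\<lambda>t. \<alpha> (\<beta> t))"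
      by (rule smooth_on_compose[OF op U(1) _ smooth_on_subset[OF V(3)] U(3)]) auto
    show "det (jacobi_matrix (\<lambda>t. \<alpha> (\<beta> t)) 0) \<noteq> 0"
      using U V by (subst jacobi_matrix_compose) (auto simp: det_mul intro: smooth_on_differentiable)
  qed (use U V in auto)
qed

lemma local_diffeo_id: "local_diffeo (\<lambda>t. t)"
  by (rule local_diffeoI[OF open_UNIV UNIV_I smooth_on_ident]) (auto simp: jacobi_matrix_ident)

section \<open>Velocities\<close>

text \<open>The parameter \<open>S\<close> carries the type \<open>'s\<close>, whose cardinality is
  the order of the jets.\<close>

locale velocities = smooth_manifold \<A>
  for \<A> :: "('x::{t2_space,second_countable_topology}, real^('n::{finite,linorder} + 'm::finite)) chart set" +
  fixes S :: "'s::finite itself"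
begin

definition crd :: "('x, real^('n + 'm)) chart \<Rightarrow> (real^'n::{finite,linorder} \<Rightarrow> 'x) \<Rightarrow> real^'n::{finite,linorder} \<Rightarrow>
    real^(('n + 'm) \<times> ('n, 's) midx)" where
  "crd c \<gamma> = jet_coords (\<lambda>t. snd c (\<gamma> t))"

text \<open>A velocity is a set of maps, and \<open>jet\<close> quantifies over all charts. A
  representative that stays inside one chart near 0 reduces every statement to a smooth map between
  Euclidean spaces.\<close>

definition rep :: "('x, real^('n + 'm)) chart \<Rightarrow> (real^'n::{finite,linorder} \<Rightarrow> 'x) \<Rightarrow> (real^'n::{finite,linorder}) set \<Rightarrow> bool" where
  "rep c \<gamma> U \<longleftrightarrow> c \<in> \<A> \<and> open U \<and> 0 \<in> U \<and> \<gamma> ` U \<subseteq> fst c \<and> smooth_on U (\<lambda>t. snd c (\<gamma> t))"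

definition germ :: "(real^'n::{finite,linorder} \<Rightarrow> 'x) \<Rightarrow> bool" where
  "germ \<gamma> \<longleftrightarrow> (\<exists>U. 0 \<in> U \<and> smooth_map_on \<A> U \<gamma>)"

lemma repD:
  assumes "rep c \<gamma> U"
  shows "c \<in> \<A>" "open U" "0 \<in> U" "\<And>t. t \<in> U \<Longrightarrow> \<gamma> t \<in> fst c" "smooth_on U (\<lambda>t. snd c (\<gamma> t))" "\<gamma> 0 \<in> fst c"
  using assms by (auto simp: rep_def)

lemma rep_subset: "rep c \<gamma> U \<Longrightarrow> open V \<Longrightarrow> 0 \<in> V \<Longrightarrow> V \<subseteq> U \<Longrightarrow> rep c \<gamma> V"
  unfolding rep_def using smooth_on_subset by blast

lemma rep_continuous:
  assumes "rep c \<gamma> U"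
  shows "continuous_on U \<gamma>"
proof -
  have "continuous_on U (\<lambda>t. chart_inv c (snd c (\<gamma> t)))"
    by (rule continuous_on_compose2[OF continuous_on_chart_inv smooth_on_continuous])
      (use repD[OF assms] in auto)
  then show ?thesis using repD[OF assms] chart_inv_chart by (simp cong: continuous_on_cong)
qed

lemma rep_change_chart:
  assumes "rep c \<gamma> U" "c' \<in> \<A>"
  shows "open {t \<in> U. \<gamma> t \<in> fst c'}" "smooth_on {t \<in> U. \<gamma> t \<in> fst c'} (\<lambda>t. snd c' (\<gamma> t))"
proof -
  note r = repD[OF assms(1)]
  have "{t \<in> U. \<gamma> t \<in> fst c'} = U \<inter> \<gamma> -` fst c'" by auto
  then show op: "open {t \<in> U. \<gamma> t \<in> fst c'}"
    using continuous_open_preimage[OF rep_continuous[OF assms(1)] r(2) open_chart[OF assms(2)]] by simp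
  have "smooth_on {t \<in> U. \<gamma> t \<in> fst c'} (\<lambda>t. transition c c' (snd c (\<gamma> t)))"
    by (rule smooth_on_compose[OF op open_overlap[OF r(1) assms(2)] _ smooth_on_subset[OF r(5)]
        smooth_transition[OF r(1) assms(2)]]) (use r(4) in auto)
  then show "smooth_on {t \<in> U. \<gamma> t \<in> fst c'} (\<lambda>t. snd c' (\<gamma> t))"
    by (rule smooth_on_cong[OF op]) (use r in \<open>auto simp: transition_chart\<close>)
qed

lemma rep_smooth_map_on: "rep c \<gamma> U \<Longrightarrow> smooth_map_on \<A> U \<gamma>"
  unfolding smooth_map_on_def o_def
  using repD(2) rep_continuous rep_change_chart(2) by blast

lemma rep_germ: "rep c \<gamma> U \<Longrightarrow> germ \<gamma>"
  unfolding germ_def using rep_smooth_map_on repD(3) by blast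

lemma smooth_map_on_rep:
  assumes "smooth_map_on \<A> U \<gamma>" "0 \<in> U" "c \<in> \<A>" "\<gamma> 0 \<in> fst c"
  shows "rep c \<gamma> {t \<in> U. \<gamma> t \<in> fst c}"
proof -
  have "{t \<in> U. \<gamma> t \<in> fst c} = U \<inter> \<gamma> -` fst c" by auto
  moreover have "open (U \<inter> \<gamma> -` fst c)"
    using assms open_chart by (intro continuous_open_preimage) (auto simp: smooth_map_on_def)
  ultimately show ?thesis
    using assms by (auto simp: rep_def smooth_map_on_def o_def)
qed

lemma germ_rep:
  assumes "germ \<gamma>" "c \<in> \<A>" "\<gamma> 0 \<in> fst c"
  obtains U where "rep c \<gamma> U"
  using assms smooth_map_on_rep unfolding germ_def by blast

lemma crd_base: "crd c \<gamma> t $ (A, midx_empty) = snd c (\<gamma> t) $ A"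
  by (simp add: crd_def jet_coords_empty)

lemma base_coords_crd: "base_coords (crd c \<gamma> t) = snd c (\<gamma> t)"
  by (simp add: crd_def base_coords_jet_coords)

lemma crd_cong:
  assumes "open U" "\<And>t. t \<in> U \<Longrightarrow> \<gamma> t = \<delta> t" "t \<in> U"
  shows "crd c \<gamma> t = crd c \<delta> t"
  unfolding crd_def by (rule jet_coords_cong[OF assms(1) _ assms(3)]) (simp add: assms(2))

text \<open>The velocity coordinates of the chart \<open>c'\<close> as functions of those of \<open>c\<close>.\<close>

definition vel_trans :: "('x, real^('n + 'm)) chart \<Rightarrow> ('x, real^('n + 'm)) chart \<Rightarrow>
    real^(('n + 'm) \<times> ('n, 's) midx) \<Rightarrow> real^(('n + 'm) \<times> ('n, 's) midx)" where
  "vel_trans c c' z = (\<chi> k. formal_derivs (midx_list (snd k)) (\<lambda>z. transition c c' (base_coords z) $ fst k) z)"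

lemma partials_change_chart:
  assumes "rep c \<gamma> U" "c' \<in> \<A>" "\<gamma> 0 \<in> fst c'" "length L \<le> CARD('s)"
  shows "partials L (\<lambda>t. snd c' (\<gamma> t) $ A) 0
    = formal_derivs L (\<lambda>z. transition c c' (base_coords z) $ A) (crd c \<gamma> 0)"
proof -
  note r = repD[OF assms(1)]
  let ?U = "{t \<in> U. \<gamma> t \<in> fst c'}"
  have op: "open ?U" by (rule rep_change_chart[OF assms(1,2)])
  have 0: "0 \<in> ?U" using r assms(3) by simp
  have "partials L (\<lambda>t. snd c' (\<gamma> t) $ A) 0 = partials L (\<lambda>t. transition c c' (snd c (\<gamma> t)) $ A) 0"
    by (rule partials_cong[OF op _ 0]) (use r in \<open>auto simp: transition_chart\<close>)
  also have "\<dots> = formal_derivs L (\<lambda>z. transition c c' (base_coords z) $ A) (crd c \<gamma> 0)"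
    unfolding crd_def
    by (rule partials_compose[OF open_overlap[OF r(1) assms(2)]
          smooth_on_nth[OF open_overlap[OF r(1) assms(2)] smooth_transition[OF r(1) assms(2)]]
          op smooth_on_subset[OF r(5)] _ assms(4) 0]) (use r in auto)
  finally show ?thesis .
qed

lemma crd_change_chart:
  assumes "rep c \<gamma> U" "c' \<in> \<A>" "\<gamma> 0 \<in> fst c'"
  shows "crd c' \<gamma> 0 = vel_trans c c' (crd c \<gamma> 0)"
  using partials_change_chart[OF assms]
  by (simp add: midx_size_le vec_eq_iff vel_trans_def crd_def[of c'] jet_coords_def length_midx_list)

lemma smooth_vel_trans:
  assumes "c \<in> \<A>" "c' \<in> \<A>"
  shows "smooth_on (base_coords -` (snd c ` (fst c \<inter> fst c'))) (vel_trans c c')"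
proof -
  let ?T = "snd c ` (fst c \<inter> fst c')"
  have op: "open (base_coords -` ?T :: (real^(('n + 'm) \<times> ('n, 's) midx)) set)"
    by (rule open_base_coords[OF open_overlap[OF assms]])
  show ?thesis
    unfolding smooth_on_vec_iff[OF op] vel_trans_def[abs_def]
    using smooth_formal_derivs[OF op smooth_base_coords_compose[OF open_overlap[OF assms]
          smooth_on_nth[OF open_overlap[OF assms] smooth_transition[OF assms]]]]
    by simp
qed

section \<open>Jets and their coordinates\<close>

lemma jet_refl: "germ \<gamma> \<Longrightarrow> \<gamma> \<in> jet \<A> CARD('s) \<gamma>"
  by (auto simp: jet_def germ_def)

lemma jetD:
  assumes "\<delta> \<in> jet \<A> CARD('s) \<gamma>"
  shows "germ \<delta>" "\<delta> 0 = \<gamma> 0"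
    "c \<in> \<A> \<Longrightarrow> \<gamma> 0 \<in> fst c \<Longrightarrow> length L \<le> CARD('s) \<Longrightarrow>
      partials L (\<lambda>t. snd c (\<delta> t) $ A) 0 = partials L (\<lambda>t. snd c (\<gamma> t) $ A) 0"
  using assms by (auto simp: jet_def germ_def)

lemma jetD_crd:
  assumes "\<delta> \<in> jet \<A> CARD('s) \<gamma>" "c \<in> \<A>" "\<gamma> 0 \<in> fst c"
  shows "crd c \<delta> 0 = crd c \<gamma> 0"
  using jetD(3)[OF assms]
  by (simp add: midx_size_le vec_eq_iff crd_def jet_coords_def length_midx_list)

text \<open>Agreement in one chart is enough although \<open>jet\<close> asks for all of them: by
  \<open>partials_change_chart\<close> the derivatives in another chart are functions of those in
  \<open>c\<close>.\<close>

lemma jet_eqI: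
  assumes "rep c \<gamma> U" "rep c \<delta> V" "crd c \<gamma> 0 = crd c \<delta> 0"
  shows "jet \<A> CARD('s) \<gamma> = jet \<A> CARD('s) \<delta>"
proof -
  note r = repD[OF assms(1)] and r' = repD[OF assms(2)]
  have "snd c (\<gamma> 0) = snd c (\<delta> 0)" using assms(3) base_coords_crd by metis
  then have 0: "\<gamma> 0 = \<delta> 0" using chart_inv_chart[OF r(1) r(6)] chart_inv_chart[OF r(1) r'(6)] by metis
  have "partials L (\<lambda>t. snd c' (\<gamma> t) $ A) 0 = partials L (\<lambda>t. snd c' (\<delta> t) $ A) 0"
    if "c' \<in> \<A>" "\<gamma> 0 \<in> fst c'" "length L \<le> CARD('s)" for c' L A
    using partials_change_chart[OF assms(1) that] partials_change_chart[OF assms(2) that(1) _ that(3)] that(2) 0 assms(3)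
    by simp
  then show ?thesis unfolding jet_def using 0 by auto
qed

text \<open>\<open>base_point\<close> and \<open>vel_coord\<close> pick an arbitrary element of a
  jet; this allows them to be evaluated on the representative at hand.\<close>

lemma some_jet:
  assumes "germ \<gamma>"
  shows "(SOME \<delta>. \<delta> \<in> jet \<A> CARD('s) \<gamma>) \<in> jet \<A> CARD('s) \<gamma>"
  by (rule someI[of "\<lambda>\<delta>. \<delta> \<in> jet \<A> CARD('s) \<gamma>"]) (rule jet_refl[OF assms])

lemma base_point_jet: "germ \<gamma> \<Longrightarrow> base_point (jet \<A> CARD('s) \<gamma>) = \<gamma> 0"
  unfolding base_point_def using some_jet jetD(2) by blast

lemma vel_coord_jet:
  assumes "germ \<gamma>" "c \<in> \<A>" "\<gamma> 0 \<in> fst c" "length L \<le> CARD('s)"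
  shows "vel_coord (snd c) A L (jet \<A> CARD('s) \<gamma>) = partials L (\<lambda>t. snd c (\<gamma> t) $ A) 0"
  unfolding vel_coord_def by (rule jetD(3)[OF some_jet[OF assms(1)] assms(2-4)])

lemma vel_chart_jet:
  assumes "germ \<gamma>" "c \<in> \<A>" "\<gamma> 0 \<in> fst c"
  shows "snd (vel_chart \<A> c) (jet \<A> CARD('s) \<gamma>) = crd c \<gamma> 0"
  using vel_coord_jet[OF assms]
  by (simp add: midx_size_le vel_chart_def vec_eq_iff crd_def jet_coords_def length_midx_list)

lemma det_x_jet:
  assumes "germ \<gamma>" "c \<in> \<A>" "\<gamma> 0 \<in> fst c"
  shows "det_x (snd c) (jet \<A> CARD('s) \<gamma>) = det (x_matrix (crd c \<gamma> 0))"
proof -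
  have "(\<chi> i j. vel_coord (snd c) (Inl i) [j] (jet \<A> CARD('s) \<gamma>)) = x_matrix (crd c \<gamma> 0)"
    using vel_coord_jet[OF assms, of "[_]"]
    by (simp add: vec_eq_iff crd_def x_matrix_jet_coords Suc_le_eq)
  then show ?thesis by (simp add: det_x_def)
qed

text \<open>Regularity is required on a neighbourhood and not only at 0, because the recursion for
  the invariant coordinates differentiates along \<gamma> and because homogeneity is applied to
  immersions.\<close>

definition adapted_rep :: "('x, real^('n + 'm)) chart \<Rightarrow> (real^'n::{finite,linorder} \<Rightarrow> 'x) \<Rightarrow> (real^'n::{finite,linorder}) set \<Rightarrow> bool" where
  "adapted_rep c \<gamma> U \<longleftrightarrow> rep c \<gamma> U \<and> (\<forall>t\<in>U. crd c \<gamma> t \<in> x_regular)"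

lemma adapted_shrink:
  assumes "rep c \<gamma> U" "crd c \<gamma> 0 \<in> x_regular"
  obtains V where "V \<subseteq> U" "adapted_rep c \<gamma> V"
proof -
  note r = repD[OF assms(1)]
  let ?V = "{t \<in> U. det (x_matrix (crd c \<gamma> t)) \<noteq> 0}"
  have "smooth_on U (\<lambda>t. x_matrix (crd c \<gamma> t) $ i $ j)" for i j
    unfolding x_matrix_def crd_def using smooth_on_nth[OF r(2) smooth_jet_coords[OF r(2,5)]] by simp
  then have "open ?V"
    by (intro open_nonzero[OF r(2)] smooth_on_continuous smooth_on_det r(2))
  then have "adapted_rep c \<gamma> ?V"
    unfolding adapted_rep_def using rep_subset[OF assms(1)] assms(2) r(3) by (auto simp: x_regular_def)
  then show thesis using that[of ?V] by blast
qed

lemma adapted_repD: "adapted_rep c \<gamma> U \<Longrightarrow> rep c \<gamma> U" "adapted_rep c \<gamma> U \<Longrightarrow> crd c \<gamma> 0 \<in> x_regular"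
  by (auto simp: adapted_rep_def rep_def)

text \<open>Invertibility of the x-block makes the differential injective in \<open>c\<close>; in
  any other chart it is composed with an injective \<open>dtrans\<close>.\<close>

lemma adapted_rep_immersion:
  assumes "adapted_rep c \<gamma> U"
  shows "immersion_on \<A> U \<gamma>"
  unfolding immersion_on_def
proof (intro conjI ballI impI)
  note rep = adapted_repD(1)[OF assms]
  note r = repD[OF rep]
  show "smooth_map_on \<A> U \<gamma>" by (rule rep_smooth_map_on[OF rep])
  fix t c' assume t: "t \<in> U" and c': "c' \<in> \<A>" "\<gamma> t \<in> fst c'"
  let ?f = "\<lambda>t. snd c (\<gamma> t)"
  let ?D = "frechet_derivative ?f (at t)"
  have df: "?f differentiable (at t)" by (rule smooth_on_differentiable[OF r(5) t])
  have "inj ?D"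
  proof (rule linear_injective_0[THEN iffD2, OF linear_frechet_derivative[OF df]], intro allI impI)
    fix v assume v: "?D v = 0"
    have "(x_matrix (crd c \<gamma> t) *v v) $ i = ?D v $ Inl i" for i
      unfolding frechet_derivative_nth(1)[OF df] frechet_derivative_axes[OF frechet_derivative_nth(2)[OF df]]
      by (simp add: matrix_vector_mult_def crd_def x_matrix_jet_coords mult.commute)
    then have "x_matrix (crd c \<gamma> t) *v v = 0" using v by (simp add: vec_eq_iff)
    moreover have "det (x_matrix (crd c \<gamma> t)) \<noteq> 0" using assms t by (auto simp: adapted_rep_def x_regular_def)
    ultimately have "matrix_inv (x_matrix (crd c \<gamma> t)) *v (x_matrix (crd c \<gamma> t) *v v) = 0" by simp
    then show "v = 0"
      using matrix_inv_mult(2)[OF \<open>det (x_matrix (crd c \<gamma> t)) \<noteq> 0\<close>] by (simp add: matrix_vector_mul_assoc)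
  qed
  have "((\<lambda>t. transition c c' (?f t)) has_derivative (\<lambda>v. dtrans c c' (\<gamma> t) (?D v))) (at t)"
    by (rule has_derivative_compose[OF df[unfolded frechet_derivative_works]])
      (rule has_derivative_transition[OF r(1) c'(1) r(4)[OF t] c'(2)])
  then have "((snd c' \<circ> \<gamma>) has_derivative (\<lambda>v. dtrans c c' (\<gamma> t) (?D v))) (at t)"
    by (rule has_derivative_transform_within_open[OF _ rep_change_chart(1)[OF rep c'(1)]])
      (use t c' r in \<open>auto simp: transition_chart\<close>)
  then have "frechet_derivative (snd c' \<circ> \<gamma>) (at t) = (\<lambda>v. dtrans c c' (\<gamma> t) (?D v))"
    using frechet_derivative_at by metis
  moreover have "inj (dtrans c c' (\<gamma> t))"
    using dtrans_inverse[OF r(1) c'(1) r(4)[OF t] c'(2)] by (rule inj_on_inverseI)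
  ultimately show "inj (frechet_derivative (snd c' \<circ> \<gamma>) (at t))"
    using \<open>inj ?D\<close> by (auto simp: inj_def)
qed

lemma adapted_rep_jet:
  assumes "adapted_rep c \<gamma> U"
  shows "jet \<A> CARD('s) \<gamma> \<in> adapted \<A> CARD('s) c"
proof -
  note rep = adapted_repD(1)[OF assms]
  note r = repD[OF rep] and g = rep_germ[OF rep]
  have "jet \<A> CARD('s) \<gamma> \<in> regular_velocities \<A> CARD('s)"
    unfolding regular_velocities_def using adapted_rep_immersion[OF assms] r(3) by blast
  then show ?thesis
    using adapted_repD(2)[OF assms] base_point_jet[OF g] det_x_jet[OF g r(1,6)] r(6)
    by (simp add: adapted_def x_regular_def)
qed

lemma adaptedE:
  assumes "v \<in> adapted \<A> CARD('s) c" "c \<in> \<A>"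
  obtains \<gamma> U where "v = jet \<A> CARD('s) \<gamma>" "adapted_rep c \<gamma> U"
proof -
  obtain \<gamma> U0 where \<gamma>: "v = jet \<A> CARD('s) \<gamma>" "0 \<in> U0" "immersion_on \<A> U0 \<gamma>"
    using assms(1) unfolding adapted_def regular_velocities_def by blast
  have sm: "smooth_map_on \<A> U0 \<gamma>" using \<gamma>(3) by (simp add: immersion_on_def)
  then have g: "germ \<gamma>" using \<gamma>(2) by (auto simp: germ_def)
  have "\<gamma> 0 \<in> fst c" using assms(1) base_point_jet[OF g] \<gamma>(1) by (simp add: adapted_def)
  then have "rep c \<gamma> {t \<in> U0. \<gamma> t \<in> fst c}" using smooth_map_on_rep[OF sm \<gamma>(2) assms(2)] by blast
  moreover have "crd c \<gamma> 0 \<in> x_regular"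
    using assms det_x_jet[OF g assms(2) \<open>\<gamma> 0 \<in> fst c\<close>] \<gamma>(1) by (simp add: adapted_def x_regular_def)
  ultimately obtain V where "adapted_rep c \<gamma> V" using adapted_shrink by blast
  then show thesis using that \<gamma>(1) by blast
qed

lemma adapted_rep_change_chart:
  assumes "adapted_rep c \<gamma> U" "c' \<in> \<A>" "jet \<A> CARD('s) \<gamma> \<in> adapted \<A> CARD('s) c'"
  obtains V where "adapted_rep c' \<gamma> V"
proof -
  note rep = adapted_repD(1)[OF assms(1)]
  note r = repD[OF rep] and g = rep_germ[OF rep]
  have 0: "\<gamma> 0 \<in> fst c'" using assms(3) base_point_jet[OF g] by (simp add: adapted_def)
  obtain W where W: "rep c' \<gamma> W" using germ_rep[OF g assms(2) 0] .
  have "crd c' \<gamma> 0 \<in> x_regular"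
    using assms(3) det_x_jet[OF g assms(2) 0] by (simp add: adapted_def x_regular_def)
  then show thesis using adapted_shrink[OF W] that by blast
qed

lemma jet_cong:
  assumes "rep c \<gamma> U" "open V" "0 \<in> V" "\<And>t. t \<in> V \<Longrightarrow> \<gamma> t = \<delta> t"
  shows "jet \<A> CARD('s) \<gamma> = jet \<A> CARD('s) \<delta>"
proof (rule jet_eqI[OF assms(1)])
  note r = repD[OF assms(1)]
  have op: "open (U \<inter> V)" by (rule open_Int[OF r(2) assms(2)])
  have "smooth_on (U \<inter> V) (\<lambda>t. snd c (\<delta> t))"
    by (rule smooth_on_cong[OF op smooth_on_subset[OF r(5)]]) (auto simp: assms(4))
  then show "rep c \<delta> (U \<inter> V)"
    using r op assms(3,4) unfolding rep_def by (metis IntD1 IntD2 IntI image_subsetI)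
  show "crd c \<gamma> 0 = crd c \<delta> 0" by (rule crd_cong[OF assms(2,4,3)])
qed

subsection \<open>The action of the differential group\<close>

lemma rep_reparam:
  assumes "rep c \<gamma> U" "open V" "0 \<in> V" "smooth_on V \<alpha>" "\<alpha> 0 = 0"
  shows "rep c (\<lambda>t. \<gamma> (\<alpha> t)) (V \<inter> \<alpha> -` U)"
proof -
  note r = repD[OF assms(1)]
  have op: "open (V \<inter> \<alpha> -` U)"
    by (rule continuous_open_preimage[OF smooth_on_continuous[OF assms(4)] assms(2) r(2)])
  have "smooth_on (V \<inter> \<alpha> -` U) (\<lambda>t. snd c (\<gamma> (\<alpha> t)))"
    by (rule smooth_on_compose[OF op r(2) _ smooth_on_subset[OF assms(4)] r(5)]) auto
  then show ?thesis using r assms op by (auto simp: rep_def)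
qed

lemma crd_reparam:
  assumes "open V" "0 \<in> V" "smooth_on V \<alpha>" "\<alpha> 0 = 0"
  obtains M where "linear M" "\<And>c \<gamma> U. rep c \<gamma> U \<Longrightarrow> crd c (\<lambda>t. \<gamma> (\<alpha> t)) 0 = M (crd c \<gamma> 0)"
proof -
  obtain M :: "real^(('n + 'm) \<times> ('n, 's) midx) \<Rightarrow> real^(('n + 'm) \<times> ('n, 's) midx)" where M: "linear M"
    "\<And>g T. open T \<Longrightarrow> smooth_on T g \<Longrightarrow> \<alpha> 0 \<in> T \<Longrightarrow> jet_coords (\<lambda>t. g (\<alpha> t)) 0 = M (jet_coords g (\<alpha> 0))"
    using jet_coords_reparam[OF assms(1,3,2)] by blast
  have "crd c (\<lambda>t. \<gamma> (\<alpha> t)) 0 = M (crd c \<gamma> 0)" if "rep c \<gamma> U" for c \<gamma> U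
    using M(2)[OF repD(2,5)[OF that]] repD(3)[OF that] assms(4) by (simp add: crd_def)
  with M(1) show thesis using that by blast
qed

lemma crd_reparam_cong:
  assumes r: "rep c \<gamma> U" and V: "open V" "0 \<in> V" "smooth_on V \<alpha>" "\<alpha> 0 = 0"
    and V': "open V'" "0 \<in> V'" "smooth_on V' \<alpha>'" "\<alpha>' 0 = 0"
    and eq: "jet_coords \<alpha> 0 = (jet_coords \<alpha>' 0 :: real^('n \<times> ('n, 's) midx))"
  shows "crd c (\<lambda>t. \<gamma> (\<alpha> t)) 0 = crd c (\<lambda>t. \<gamma> (\<alpha>' t)) 0"
proof -
  have "partials L (\<lambda>t. snd c (\<gamma> (\<alpha> t)) $ A) 0
      = formal_derivs L (\<lambda>z. snd c (\<gamma> (base_coords z)) $ A) (jet_coords \<alpha> 0 :: real^('n \<times> ('n, 's) midx))"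
    if V: "open V" "0 \<in> V" "smooth_on V \<alpha>" "\<alpha> 0 = 0" and "length L \<le> CARD('s)" for V \<alpha> L A
  proof -
    have op: "open (V \<inter> \<alpha> -` U)" using repD(2)[OF rep_reparam[OF r V]] .
    show ?thesis
      by (rule partials_compose[OF repD(2)[OF r] smooth_on_nth[OF repD(2,5)[OF r]] op
          smooth_on_subset[OF V(3)] _ \<open>length L \<le> CARD('s)\<close>])
        (use V repD(3)[OF r] in auto)
  qed
  then have "partials L (\<lambda>t. snd c (\<gamma> (\<alpha> t)) $ A) 0 = partials L (\<lambda>t. snd c (\<gamma> (\<alpha>' t)) $ A) 0"
    if "length L \<le> CARD('s)" for L A
    using V V' eq that by metis
  then show ?thesis
    by (simp add: vec_eq_iff crd_def jet_coords_def length_midx_list midx_size_le)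
qed

lemma group_jetD:
  assumes "local_diffeo \<alpha>" "\<alpha>' \<in> group_jet CARD('s) \<alpha>"
  obtains V where "open V" "0 \<in> V" "smooth_on V \<alpha>'" "\<alpha>' 0 = 0"
    "jet_coords \<alpha>' 0 = (jet_coords \<alpha> 0 :: real^('n \<times> ('n, 's) midx))" "jacobi_matrix \<alpha>' 0 = jacobi_matrix \<alpha> 0"
proof -
  obtain V where V: "open V" "0 \<in> V" "smooth_on V \<alpha>'"
    using assms(2) unfolding group_jet_def by blast
  have p: "partials J (\<lambda>t. \<alpha>' t $ i) 0 = partials J (\<lambda>t. \<alpha> t $ i) 0" if "length J \<le> CARD('s)" for J i
    using assms(2) that unfolding group_jet_def by blast
  have "\<alpha>' 0 = \<alpha> 0" using p[of "[]"] by (simp add: vec_eq_iff)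
  then have 0: "\<alpha>' 0 = 0" using assms(1) by (simp add: local_diffeo_def)
  have "jet_coords \<alpha>' 0 = (jet_coords \<alpha> 0 :: real^('n \<times> ('n, 's) midx))"
    by (simp add: vec_eq_iff jet_coords_def p length_midx_list midx_size_le)
  moreover have "jacobi_matrix \<alpha>' 0 = jacobi_matrix \<alpha> 0"
    using p[of "[_]"] by (simp add: jacobi_matrix_def vec_eq_iff Suc_le_eq)
  ultimately show thesis using that V 0 by blast
qed

lemma group_jet_refl: "local_diffeo \<alpha> \<Longrightarrow> \<alpha> \<in> group_jet CARD('s) \<alpha>"
  unfolding group_jet_def local_diffeo_def by blast

lemma jet_det_group_jet:
  fixes \<alpha> :: "real^'n::{finite,linorder} \<Rightarrow> real^'n::{finite,linorder}"
  assumes "local_diffeo \<alpha>"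
  shows "jet_det (group_jet CARD('s) \<alpha>) = det (jacobi_matrix \<alpha> 0)"
proof -
  let ?\<alpha> = "SOME \<alpha>'. \<alpha>' \<in> group_jet CARD('s) \<alpha>"
  have "?\<alpha> \<in> group_jet CARD('s) \<alpha>"
    by (rule someI[of "\<lambda>\<alpha>'. \<alpha>' \<in> group_jet CARD('s) \<alpha>"]) (rule group_jet_refl[OF assms])
  then obtain V where V: "open V" "0 \<in> V" "smooth_on V ?\<alpha>" "jacobi_matrix ?\<alpha> 0 = jacobi_matrix \<alpha> 0"
    by (rule group_jetD[OF assms]) blast
  then show ?thesis
    using jacobi_matrix_eq[OF smooth_on_differentiable[OF V(3,2)]] by (simp add: jet_det_def)
qed

text \<open>The union in \<open>act\<close> runs over representatives of both jets. Replacing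
  \<gamma> is harmless because the reparametrised jet is a function of the coordinates of \<gamma>
  (\<open>crd_reparam\<close>), replacing \<alpha> because it depends only on the jet of \<alpha>
  (\<open>crd_reparam_cong\<close>).\<close>

lemma act_jet:
  assumes "germ \<gamma>" "local_diffeo \<alpha>"
  shows "act \<A> CARD('s) (group_jet CARD('s) \<alpha>) (jet \<A> CARD('s) \<gamma>) = jet \<A> CARD('s) (\<lambda>t. \<gamma> (\<alpha> t))"
proof -
  obtain c where c: "c \<in> \<A>" "\<gamma> 0 \<in> fst c" using chart_cover by blast
  obtain U where U: "rep c \<gamma> U" using germ_rep[OF assms(1) c] .
  obtain V where V: "open V" "0 \<in> V" "smooth_on V \<alpha>" "\<alpha> 0 = 0" using local_diffeoD[OF assms(2)] by metis
  have "jet \<A> CARD('s) (\<gamma>' \<circ> \<alpha>') = jet \<A> CARD('s) (\<lambda>t. \<gamma> (\<alpha> t))"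
    if \<gamma>': "\<gamma>' \<in> jet \<A> CARD('s) \<gamma>" and \<alpha>': "\<alpha>' \<in> group_jet CARD('s) \<alpha>" for \<gamma>' \<alpha>'
  proof -
    have "\<gamma>' 0 \<in> fst c" using jetD(2)[OF \<gamma>'] c(2) by simp
    then obtain U' where U': "rep c \<gamma>' U'" using germ_rep[OF jetD(1)[OF \<gamma>'] c(1)] by blast
    obtain V' where V': "open V'" "0 \<in> V'" "smooth_on V' \<alpha>'" "\<alpha>' 0 = 0"
      "jet_coords \<alpha>' 0 = (jet_coords \<alpha> 0 :: real^('n \<times> ('n, 's) midx))"
      using group_jetD[OF assms(2) \<alpha>'] by metis
    obtain M where M: "\<And>c \<gamma> U. rep c \<gamma> U \<Longrightarrow> crd c (\<lambda>t. \<gamma> (\<alpha>' t)) 0 = M (crd c \<gamma> 0)"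
      using crd_reparam[OF V'(1-4)] by metis
    have "crd c (\<lambda>t. \<gamma>' (\<alpha>' t)) 0 = crd c (\<lambda>t. \<gamma> (\<alpha>' t)) 0"
      using M[OF U] M[OF U'] jetD_crd[OF \<gamma>' c] by simp
    also have "\<dots> = crd c (\<lambda>t. \<gamma> (\<alpha> t)) 0"
      by (rule crd_reparam_cong[OF U V'(1-4) V V'(5)])
    finally show ?thesis
      using jet_eqI[OF rep_reparam[OF U' V'(1-4)] rep_reparam[OF U V]] by (simp add: o_def)
  qed
  then show ?thesis
    unfolding act_def using jet_refl[OF assms(1)] group_jet_refl[OF assms(2)] by blast
qed

lemma germ_reparam: "germ \<gamma> \<Longrightarrow> local_diffeo \<alpha> \<Longrightarrow> germ (\<lambda>t. \<gamma> (\<alpha> t))"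
proof -
  assume "germ \<gamma>" "local_diffeo \<alpha>"
  obtain c where c: "c \<in> \<A>" "\<gamma> 0 \<in> fst c" using chart_cover by blast
  obtain U where U: "rep c \<gamma> U" using germ_rep[OF \<open>germ \<gamma>\<close> c] .
  obtain V where V: "open V" "0 \<in> V" "smooth_on V \<alpha>" "\<alpha> 0 = 0" using local_diffeoD[OF \<open>local_diffeo \<alpha>\<close>] by metis
  show ?thesis by (rule rep_germ[OF rep_reparam[OF U V]])
qed

lemma rho_jet:
  assumes "germ \<gamma>"
  shows "rho \<A> CARD('s) (jet \<A> CARD('s) \<gamma>) = {jet \<A> CARD('s) (\<lambda>t. \<gamma> (\<alpha> t)) |\<alpha>. local_diffeo \<alpha>}"
  unfolding rho_def diff_group_def using act_jet[OF assms] by (auto simp: image_iff)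

text \<open>Reparametrising by \<alpha> amounts to reparametrising by \<beta> and then by the local
  inverse of \<beta> composed with \<alpha>. The inverse is one only near 0, so the jets coincide
  although the maps may not.\<close>

lemma rho_reparam:
  assumes "germ \<gamma>" "local_diffeo \<beta>"
  shows "rho \<A> CARD('s) (jet \<A> CARD('s) (\<lambda>t. \<gamma> (\<beta> t))) = rho \<A> CARD('s) (jet \<A> CARD('s) \<gamma>)"
proof -
  obtain \<beta>' W where \<beta>': "open W" "0 \<in> W" "\<And>t. t \<in> W \<Longrightarrow> \<beta> (\<beta>' t) = t" "local_diffeo \<beta>'"
    using local_diffeoD[OF assms(2)] by metis
  have "\<exists>\<alpha>'. local_diffeo \<alpha>' \<and> jet \<A> CARD('s) (\<lambda>t. \<gamma> (\<alpha> t)) = jet \<A> CARD('s) (\<lambda>t. \<gamma> (\<beta> (\<alpha>' t)))"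
    if \<alpha>: "local_diffeo \<alpha>" for \<alpha>
  proof (intro exI conjI)
    show "local_diffeo (\<lambda>t. \<beta>' (\<alpha> t))" by (rule local_diffeo_compose[OF \<beta>'(4) \<alpha>])
    obtain V where V: "open V" "0 \<in> V" "smooth_on V \<alpha>" "\<alpha> 0 = 0" using local_diffeoD[OF \<alpha>] by metis
    have op: "open (V \<inter> \<alpha> -` W)"
      by (rule continuous_open_preimage[OF smooth_on_continuous[OF V(3)] V(1) \<beta>'(1)])
    obtain c where c: "c \<in> \<A>" "\<gamma> 0 \<in> fst c" using chart_cover by blast
    obtain U where U: "rep c \<gamma> U" using germ_rep[OF assms(1) c] .
    show "jet \<A> CARD('s) (\<lambda>t. \<gamma> (\<alpha> t)) = jet \<A> CARD('s) (\<lambda>t. \<gamma> (\<beta> (\<beta>' (\<alpha> t))))"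
      by (rule jet_cong[OF rep_reparam[OF U V] op]) (use V \<beta>' in auto)
  qed
  note ex = this
  show ?thesis
    unfolding rho_jet[OF assms(1)] rho_jet[OF germ_reparam[OF assms]]
  proof (intro equalityI subsetI)
    fix w assume "w \<in> {jet \<A> CARD('s) (\<lambda>t. \<gamma> (\<beta> (\<alpha> t))) |\<alpha>. local_diffeo \<alpha>}"
    then obtain \<alpha> where "w = jet \<A> CARD('s) (\<lambda>t. \<gamma> (\<beta> (\<alpha> t)))" "local_diffeo \<alpha>" by blast
    then show "w \<in> {jet \<A> CARD('s) (\<lambda>t. \<gamma> (\<alpha> t)) |\<alpha>. local_diffeo \<alpha>}"
      using local_diffeo_compose[OF assms(2)] by (intro CollectI exI[of _ "\<lambda>t. \<beta> (\<alpha> t)"]) simp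
  next
    fix w assume "w \<in> {jet \<A> CARD('s) (\<lambda>t. \<gamma> (\<alpha> t)) |\<alpha>. local_diffeo \<alpha>}"
    then obtain \<alpha> where \<alpha>: "w = jet \<A> CARD('s) (\<lambda>t. \<gamma> (\<alpha> t))" "local_diffeo \<alpha>" by blast
    obtain \<alpha>' where "local_diffeo \<alpha>'" "w = jet \<A> CARD('s) (\<lambda>t. \<gamma> (\<beta> (\<alpha>' t)))"
      using ex[OF \<alpha>(2)] \<alpha>(1) by auto
    then show "w \<in> {jet \<A> CARD('s) (\<lambda>t. \<gamma> (\<beta> (\<alpha> t))) |\<alpha>. local_diffeo \<alpha>}" by (intro CollectI exI[of _ \<alpha>']) simp
  qed
qed

end

section \<open>Invariant coordinates of a velocity and the normal form of an orbit\<close>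

definition qcoords :: "real^(('n::{finite,linorder} + 'm::finite) \<times> ('n, 's) midx) \<Rightarrow>
    real^('n + 'm \<times> ('n, 's) midx)" where
  "qcoords z = (\<chi> k. case k of Inl i \<Rightarrow> z $ (Inl i, midx_empty) | Inr (\<sigma>, I) \<Rightarrow> y_coord \<sigma> (midx_list I) z)"

lemma qcoords_nth:
  "qcoords z $ Inl i = z $ (Inl i, midx_empty)"
  "qcoords z $ Inr (\<sigma>, I) = y_coord \<sigma> (midx_list I) z"
  by (simp_all add: qcoords_def)

text \<open>Realises an arbitrary coordinate vector as a jet, so that identities proved for
  velocities hold on open sets of coordinate vectors and may be differentiated.\<close>

definition poly_map :: "real^('a::finite \<times> ('n::finite, 's) midx) \<Rightarrow> real^'n::finite \<Rightarrow> real^'a::finite" where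
  "poly_map z t = (\<chi> A. \<Sum>J\<in>UNIV. z $ (A, J) * monomial (Rep_midx J) t)"

lemma smooth_poly_map: "smooth_on UNIV (poly_map z)"
  by (subst smooth_on_vec_iff[OF open_UNIV])
    (auto simp: poly_map_def intro!: smooth_on_sum smooth_on_mult smooth_on_const smooth_monomial)

lemma jet_coords_poly_map:
  "jet_coords (poly_map z) 0 = (z :: real^('a::finite \<times> ('n::{finite,linorder}, 's) midx))"
proof -
  have "partials (midx_list J) (\<lambda>t. poly_map z t $ A) 0 = z $ (A, J)" for A and J :: "('n, 's) midx"
  proof -
    have "partials (midx_list J) (\<lambda>t. poly_map z t $ A) 0
        = (\<Sum>K\<in>UNIV. z $ (A, K) * partials (midx_list J) (monomial (Rep_midx K)) 0)"
      unfolding poly_map_def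
      using partials_lincomb[of UNIV UNIV "\<lambda>K. monomial (Rep_midx K)" 0 "midx_list J" "\<lambda>K. z $ (A, K)"]
      by (simp add: smooth_monomial)
    also have "\<dots> = (\<Sum>K\<in>UNIV. if K = J then z $ (A, K) else 0)"
      by (intro sum.cong refl) (auto simp: partials_monomial_zero mset_midx_list Rep_midx_inject)
    finally show ?thesis by simp
  qed
  then show ?thesis by (simp add: jet_coords_def vec_eq_iff)
qed

lemma graph_jet_nth:
  fixes q :: "real^('n::{finite,linorder} + 'm::finite \<times> ('n, 's::finite) midx)"
  shows "graph_jet q $ (Inr \<sigma>, J) = q $ Inr (\<sigma>, J)" "graph_jet q $ (Inl i, midx_empty) = q $ Inl i"
    "graph_map q 0 = xy_part q"
proof -
  show 1: "graph_jet q $ (Inr \<sigma>, J) = q $ Inr (\<sigma>, J)" for \<sigma> J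
    by (simp add: graph_jet_def jet_coords_def graph_jet_Inr length_midx_list midx_size_le midx_of_midx_list)
  show 2: "graph_jet q $ (Inl i, midx_empty) = q $ Inl i" for i
    by (simp add: graph_jet_def jet_coords_empty graph_map_def)
  have "graph_map q 0 $ k = xy_part q $ k" for k
    using 1[of _ midx_empty] 2
    by (cases k) (auto simp: graph_jet_def jet_coords_empty xy_part_def)
  then show "graph_map q 0 = xy_part q" by (simp add: vec_eq_iff)
qed

lemma graph_jet_regular: "(graph_jet q :: real^(('n::{finite,linorder} + 'm::finite) \<times> ('n, 's::finite) midx)) \<in> x_regular"
  by (simp add: x_regular_def graph_jet_def x_matrix_graph_map det_I)

lemma qcoords_graph_jet: "qcoords (graph_jet q) = (q :: real^('n::{finite,linorder} + 'm::finite \<times> ('n, 's::finite) midx))"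
proof -
  have "qcoords (graph_jet q) $ k = q $ k" for k
    by (cases k) (auto simp: qcoords_nth graph_jet_nth y_coord_graph_jet length_midx_list midx_size_le midx_of_midx_list)
  then show ?thesis by (simp add: vec_eq_iff)
qed

context velocities
begin

lemma param_rep:
  assumes "c \<in> \<A>" "smooth_on UNIV g" "g 0 \<in> chart_dom c"
  shows "rep c (\<lambda>t. chart_inv c (g t)) (g -` chart_dom c)" "crd c (\<lambda>t. chart_inv c (g t)) 0 = jet_coords g 0"
proof -
  have op: "open (g -` chart_dom c)"
    using continuous_open_preimage[OF smooth_on_continuous[OF assms(2)] open_UNIV open_chart_dom[OF assms(1)]] by simp
  have "smooth_on (g -` chart_dom c) (\<lambda>t. snd c (chart_inv c (g t)))"
    by (rule smooth_on_cong[OF op smooth_on_subset[OF assms(2)]]) (auto simp: chart_chart_inv assms(1))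
  then show "rep c (\<lambda>t. chart_inv c (g t)) (g -` chart_dom c)"
    using assms op chart_inv_in[OF assms(1)] by (auto simp: rep_def)
  show "crd c (\<lambda>t. chart_inv c (g t)) 0 = jet_coords g 0"
    unfolding crd_def by (rule jet_coords_cong[OF op]) (use assms in \<open>auto simp: chart_chart_inv\<close>)
qed

lemma velocity_exists:
  assumes "c \<in> \<A>" "z \<in> x_regular" "base_coords z \<in> chart_dom c"
  obtains \<gamma> U where "adapted_rep c \<gamma> U" "crd c \<gamma> 0 = z"
proof -
  have "poly_map z 0 = base_coords z" by (metis base_coords_jet_coords jet_coords_poly_map)
  then have *: "rep c (\<lambda>t. chart_inv c (poly_map z t)) (poly_map z -` chart_dom c)"
    "crd c (\<lambda>t. chart_inv c (poly_map z t)) 0 = z"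
    using param_rep[OF assms(1) smooth_poly_map, of z] assms(3) jet_coords_poly_map[of z] by auto
  then show thesis using adapted_shrink[OF *(1)] assms(2) that by metis
qed

text \<open>Its jets at 0 form a section of the projection to the quotient over the chart,
  parametrised by \<open>q\<close>.\<close>

definition gvel :: "('x, real^('n + 'm)) chart \<Rightarrow> real^('n + 'm \<times> ('n, 's) midx) \<Rightarrow> real^'n::{finite,linorder} \<Rightarrow> 'x" where
  "gvel c q t = chart_inv c (graph_map q t)"

lemma gvel_rep:
  assumes "c \<in> \<A>" "xy_part q \<in> chart_dom c"
  obtains U where "adapted_rep c (gvel c q) U" "crd c (gvel c q) 0 = graph_jet q"
proof -
  have "graph_map q 0 \<in> chart_dom c" using assms(2) graph_jet_nth(3)[of q] by simp
  from param_rep[OF assms(1) smooth_graph_map this]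
  have *: "rep c (gvel c q) (graph_map q -` chart_dom c)" "crd c (gvel c q) 0 = graph_jet q"
    by (simp_all add: gvel_def[abs_def] graph_jet_def)
  then show thesis using adapted_shrink[OF *(1)] graph_jet_regular[of q] that by metis
qed

lemma x_matrix_crd_reparam:
  assumes "rep c \<gamma> U" "open V" "t \<in> V" "smooth_on V \<alpha>" "\<alpha> t \<in> U"
  shows "x_matrix (crd c (\<lambda>t. \<gamma> (\<alpha> t)) t) = x_matrix (crd c \<gamma> (\<alpha> t)) ** jacobi_matrix \<alpha> t"
  unfolding crd_def jacobi_matrix_def
  by (rule x_matrix_reparam[OF assms(2,4,3) repD(2,5)[OF assms(1)] assms(5)])

text \<open>Supplies the neighbourhood on which \<open>y_coord_reparam\<close> requires invertible
  Jacobi matrices.\<close>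

lemma local_diffeo_regular:
  assumes "local_diffeo \<alpha>" "open U" "0 \<in> U"
  obtains V where "open V" "0 \<in> V" "smooth_on V \<alpha>" "\<alpha> 0 = 0" "\<alpha> ` V \<subseteq> U" "\<And>t. t \<in> V \<Longrightarrow> det (jacobi_matrix \<alpha> t) \<noteq> 0"
proof -
  obtain W where W: "open W" "0 \<in> W" "smooth_on W \<alpha>" "\<alpha> 0 = 0" "det (jacobi_matrix \<alpha> 0) \<noteq> 0"
    using local_diffeoD[OF assms(1)] by metis
  let ?V = "{t \<in> W \<inter> \<alpha> -` U. det (jacobi_matrix \<alpha> t) \<noteq> 0}"
  have op: "open (W \<inter> \<alpha> -` U)"
    by (rule continuous_open_preimage[OF smooth_on_continuous[OF W(3)] W(1) assms(2)])
  have "open ?V"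
    by (rule open_nonzero[OF op]) (rule continuous_on_subset[OF smooth_on_continuous[OF
        smooth_on_det[OF W(1) smooth_jacobi_matrix[OF W(1,3)]]]], blast)
  moreover have "0 \<in> ?V" using W assms(3) by simp
  moreover have "smooth_on ?V \<alpha>" by (rule smooth_on_subset[OF W(3)]) blast
  ultimately show thesis by (rule that[of ?V]) (use W assms(3) in auto)
qed

lemma adapted_rep_reparam:
  assumes "adapted_rep c \<gamma> U" "local_diffeo \<alpha>"
  obtains V where "adapted_rep c (\<lambda>t. \<gamma> (\<alpha> t)) V" "qcoords (crd c (\<lambda>t. \<gamma> (\<alpha> t)) 0) = qcoords (crd c \<gamma> 0)"
    "x_matrix (crd c (\<lambda>t. \<gamma> (\<alpha> t)) 0) = x_matrix (crd c \<gamma> 0) ** jacobi_matrix \<alpha> 0"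
proof -
  note rep = adapted_repD(1)[OF assms(1)]
  note r = repD[OF rep]
  obtain V where V: "open V" "0 \<in> V" "smooth_on V \<alpha>" "\<alpha> 0 = 0" "\<alpha> ` V \<subseteq> U" "\<And>t. t \<in> V \<Longrightarrow> det (jacobi_matrix \<alpha> t) \<noteq> 0"
    using local_diffeo_regular[OF assms(2) r(2,3)] by metis
  have VU: "V \<inter> \<alpha> -` U = V" using V(5) by auto
  have rep': "rep c (\<lambda>t. \<gamma> (\<alpha> t)) V" using rep_reparam[OF rep V(1-4)] VU by simp
  have X: "x_matrix (crd c (\<lambda>t. \<gamma> (\<alpha> t)) t) = x_matrix (crd c \<gamma> (\<alpha> t)) ** jacobi_matrix \<alpha> t" if "t \<in> V" for t
    by (rule x_matrix_crd_reparam[OF rep V(1) that V(3)]) (use V(5) that in auto)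
  have det: "det (x_matrix (crd c \<gamma> u)) \<noteq> 0" if "u \<in> U" for u
    using assms(1) that by (simp add: adapted_rep_def x_regular_def)
  have "adapted_rep c (\<lambda>t. \<gamma> (\<alpha> t)) V"
    unfolding adapted_rep_def x_regular_def using rep' V(5,6) det by (auto simp: X det_mul)
  moreover have "y_coord \<sigma> I (crd c (\<lambda>t. \<gamma> (\<alpha> t)) 0) = y_coord \<sigma> I (crd c \<gamma> 0)" if "length I \<le> CARD('s)" for \<sigma> I
    unfolding crd_def
    using y_coord_reparam[OF V(1,3,5) r(2,5) _ _ that V(2)] V(4,6) det
    by (simp add: jacobi_matrix_def crd_def)
  then have "qcoords (crd c (\<lambda>t. \<gamma> (\<alpha> t)) 0) = qcoords (crd c \<gamma> 0)"
    unfolding qcoords_def by (simp add: vec_eq_iff crd_base V(4) length_midx_list midx_size_le split: sum.split)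
  ultimately show thesis using X[OF V(2)] V(4) by (intro that) auto
qed

text \<open>The x-coordinates of \<gamma>, shifted to vanish at 0, form a local diffeomorphism;
  composing \<gamma> with its inverse yields a graph over the x-coordinates. The derivatives of a
  graph are its invariant coordinates, which the reparametrisation did not change, so they determine
  the jet. Consequently \<open>qcoords\<close> separates orbits.\<close>

lemma normal_form:
  assumes "adapted_rep c \<gamma> U"
  obtains \<alpha> where "local_diffeo \<alpha>" "jet \<A> CARD('s) (\<lambda>t. \<gamma> (\<alpha> t)) = jet \<A> CARD('s) (gvel c (qcoords (crd c \<gamma> 0)))"
proof -
  note rep = adapted_repD(1)[OF assms]
  note r = repD[OF rep]
  let ?q = "qcoords (crd c \<gamma> 0)"
  define x where "x t = (\<chi> i. snd c (\<gamma> t) $ Inl i - snd c (\<gamma> 0) $ Inl i)" for t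
  have sx: "smooth_on U x"
    unfolding x_def[abs_def]
    unfolding smooth_on_vec_iff[OF r(2)] vec_lambda_beta
    by (intro allI smooth_on_diff smooth_on_nth smooth_on_const r(2,5))
  have x0: "x 0 = 0" by (simp add: x_def vec_eq_iff)
  have "jacobi_matrix x 0 = x_matrix (crd c \<gamma> 0)"
  proof -
    have "partial j (\<lambda>t. snd c (\<gamma> t) $ Inl i - snd c (\<gamma> 0) $ Inl i) 0 = partial j (\<lambda>t. snd c (\<gamma> t) $ Inl i) 0" for i j
      using partial_linear(1)[OF smooth_on_differentiable[OF smooth_on_nth[OF r(2,5)] r(3)]
          smooth_on_differentiable[OF smooth_on_const[OF open_UNIV] UNIV_I], of j "Inl i" "- snd c (\<gamma> 0) $ Inl i"]
      by (simp add: partial_def)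
    then show ?thesis by (simp add: vec_eq_iff jacobi_matrix_def x_def crd_def x_matrix_jet_coords)
  qed
  then have "det (jacobi_matrix x 0) \<noteq> 0" using adapted_repD(2)[OF assms] by (simp add: x_regular_def)
  then have "local_diffeo x" by (rule local_diffeoI[OF r(2,3) sx x0])
  then obtain \<alpha> W where \<alpha>: "open W" "0 \<in> W" "\<And>t. t \<in> W \<Longrightarrow> x (\<alpha> t) = t" "local_diffeo \<alpha>" "\<alpha> 0 = 0"
    using local_diffeoD[of x] by metis
  obtain V0 where V0: "adapted_rep c (\<lambda>t. \<gamma> (\<alpha> t)) V0" "qcoords (crd c (\<lambda>t. \<gamma> (\<alpha> t)) 0) = ?q"
    using adapted_rep_reparam[OF assms \<alpha>(4)] by metis
  have V: "rep c (\<lambda>t. \<gamma> (\<alpha> t)) (V0 \<inter> W)"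
    using rep_subset[OF adapted_repD(1)[OF V0(1)]] repD(2,3)[OF adapted_repD(1)[OF V0(1)]] \<alpha>(1,2) by auto
  note rv = repD[OF V]
  let ?g = "\<lambda>t. snd c (\<gamma> (\<alpha> t))"
  have gI: "?g t $ Inl i = snd c (\<gamma> 0) $ Inl i + t $ i" if "t \<in> V0 \<inter> W" for t i
    using \<alpha>(3)[of t] that by (auto simp: x_def vec_eq_iff diff_eq_eq add.commute)
  have one: "x_matrix (crd c (\<lambda>t. \<gamma> (\<alpha> t)) t) = mat 1" if t: "t \<in> V0 \<inter> W" for t
  proof -
    have "partial j (\<lambda>t. ?g t $ Inl i) t = partial j (\<lambda>t. graph_map ?q t $ Inl i) t" for i j
      by (rule partial_cong[OF rv(2) t]) (simp add: gI graph_map_def qcoords_nth crd_base)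
    then show ?thesis
      using x_matrix_graph_map[of ?q t, where 's = 's] by (simp add: vec_eq_iff crd_def x_matrix_jet_coords)
  qed
  have y: "partials I (\<lambda>t. ?g t $ Inr \<sigma>) 0 = y_coord \<sigma> I (crd c (\<lambda>t. \<gamma> (\<alpha> t)) 0)" if "length I \<le> CARD('s)" for \<sigma> I
    using y_coord_of_graph[OF rv(2,5) _ that rv(3)] one by (simp add: crd_def)
  have "xy_part ?q = snd c (\<gamma> 0)"
    by (simp add: vec_eq_iff xy_part_def qcoords_nth crd_base midx_list_empty split: sum.split)
  then have "xy_part ?q \<in> chart_dom c" using r(6) by simp
  then obtain U' where U': "adapted_rep c (gvel c ?q) U'" "crd c (gvel c ?q) 0 = graph_jet ?q"
    using gvel_rep[OF r(1)] by metis
  have "crd c (\<lambda>t. \<gamma> (\<alpha> t)) 0 $ (k, J) = graph_jet ?q $ (k, J)" for k J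
  proof (cases k)
    case (Inl i)
    have "partials (midx_list J) (\<lambda>t. ?g t $ Inl i) 0 = partials (midx_list J) (\<lambda>t. graph_map ?q t $ Inl i) 0"
      by (rule partials_cong[OF rv(2) _ rv(3)]) (simp add: gI graph_map_def qcoords_nth crd_base)
    then show ?thesis by (simp add: Inl crd_def graph_jet_def jet_coords_def)
  next
    case (Inr \<sigma>)
    have "crd c (\<lambda>t. \<gamma> (\<alpha> t)) 0 $ (Inr \<sigma>, J) = y_coord \<sigma> (midx_list J) (crd c (\<lambda>t. \<gamma> (\<alpha> t)) 0)"
      using y[of "midx_list J" \<sigma>] by (simp add: crd_def jet_coords_def length_midx_list midx_size_le)
    also have "\<dots> = ?q $ Inr (\<sigma>, J)" using V0(2) by (metis qcoords_nth(2))
    finally show ?thesis by (simp add: Inr graph_jet_nth)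
  qed
  then have "crd c (\<lambda>t. \<gamma> (\<alpha> t)) 0 = crd c (gvel c ?q) 0" by (simp add: U'(2) vec_eq_iff)
  then have "jet \<A> CARD('s) (\<lambda>t. \<gamma> (\<alpha> t)) = jet \<A> CARD('s) (gvel c ?q)"
    by (rule jet_eqI[OF V adapted_repD(1)[OF U'(1)]])
  then show thesis using that \<alpha>(4) by blast
qed

subsection \<open>Components of a homogeneous differential equation\<close>

definition vchart :: "('x, real^('n + 'm)) chart \<Rightarrow>
    (('n, 'x) velocity, real^(('n + 'm) \<times> ('n, 's) midx)) chart" where
  "vchart c = vel_chart \<A> c"

lemma fst_vchart: "fst (vchart c) = {v \<in> regular_velocities \<A> CARD('s). base_point v \<in> fst c}"
  by (simp add: vchart_def vel_chart_def)

lemma snd_vchart: "germ \<gamma> \<Longrightarrow> c \<in> \<A> \<Longrightarrow> \<gamma> 0 \<in> fst c \<Longrightarrow> snd (vchart c) (jet \<A> CARD('s) \<gamma>) = crd c \<gamma> 0"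
  by (simp add: vchart_def vel_chart_jet)

lemma inj_on_vchart:
  assumes "c \<in> \<A>"
  shows "inj_on (snd (vchart c)) (fst (vchart c))"
proof (rule inj_onI)
  have *: "\<exists>\<gamma> U. v = jet \<A> CARD('s) \<gamma> \<and> rep c \<gamma> U" if v: "v \<in> fst (vchart c)" for v
  proof -
    obtain \<gamma> U0 where \<gamma>: "v = jet \<A> CARD('s) \<gamma>" "0 \<in> U0" "immersion_on \<A> U0 \<gamma>"
      using v unfolding fst_vchart regular_velocities_def by blast
    have g: "germ \<gamma>" using \<gamma>(2,3) by (auto simp: germ_def immersion_on_def)
    then have "\<gamma> 0 \<in> fst c" using v base_point_jet[OF g] \<gamma>(1) by (simp add: fst_vchart)
    then show ?thesis using germ_rep[OF g assms] \<gamma>(1) by metis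
  qed
  fix v w assume vw: "v \<in> fst (vchart c)" "w \<in> fst (vchart c)" "snd (vchart c) v = snd (vchart c) w"
  obtain \<gamma> U where \<gamma>: "v = jet \<A> CARD('s) \<gamma>" "rep c \<gamma> U" using *[OF vw(1)] by blast
  obtain \<delta> V where \<delta>: "w = jet \<A> CARD('s) \<delta>" "rep c \<delta> V" using *[OF vw(2)] by blast
  have "crd c \<gamma> 0 = crd c \<delta> 0"
    using vw(3) snd_vchart[OF rep_germ[OF \<gamma>(2)] repD(1,6)[OF \<gamma>(2)]]
      snd_vchart[OF rep_germ[OF \<delta>(2)] repD(1,6)[OF \<delta>(2)]] by (simp add: \<gamma>(1) \<delta>(1))
  then show "v = w" using jet_eqI[OF \<gamma>(2) \<delta>(2)] \<gamma>(1) \<delta>(1) by simp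
qed

lemma vchart_adapted:
  assumes "adapted_rep c \<gamma> U"
  shows "jet \<A> CARD('s) \<gamma> \<in> fst (vchart c)" "snd (vchart c) (jet \<A> CARD('s) \<gamma>) = crd c \<gamma> 0"
    "chart_inv (vchart c) (crd c \<gamma> 0) = jet \<A> CARD('s) \<gamma>"
    "crd c \<gamma> 0 \<in> chart_dom (vchart c)"
proof -
  note rep = adapted_repD(1)[OF assms]
  show 1: "jet \<A> CARD('s) \<gamma> \<in> fst (vchart c)"
    using adapted_rep_jet[OF assms] by (simp add: fst_vchart adapted_def)
  show 2: "snd (vchart c) (jet \<A> CARD('s) \<gamma>) = crd c \<gamma> 0"
    by (rule snd_vchart[OF rep_germ[OF rep] repD(1,6)[OF rep]])
  show "chart_inv (vchart c) (crd c \<gamma> 0) = jet \<A> CARD('s) \<gamma>"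
    using inv_into_f_f[OF inj_on_vchart[OF repD(1)[OF rep]] 1] 2 by simp
  show "crd c \<gamma> 0 \<in> chart_dom (vchart c)" using 1 2 by (metis imageI)
qed

definition comp ::
    "(('n, 'x) velocity, real^(('n + 'm) \<times> ('n, 's) midx)) mform \<Rightarrow> ('x, real^('n + 'm)) chart \<Rightarrow> 'n + 'm \<Rightarrow>
     real^(('n + 'm) \<times> ('n, 's) midx) \<Rightarrow> real" where
  "comp \<T> c A z = component \<T> (vchart c) A z"

lemma vchart_atlas: "c \<in> \<A> \<Longrightarrow> vchart c \<in> vel_atlas \<A>"
  by (auto simp: vchart_def vel_atlas_def)

lemma form_eval:
  assumes "differential_equation \<A> \<T>" "c \<in> \<A>" "z \<in> chart_dom (vchart c)"
  shows "\<T> (vchart c) z v = (\<Sum>A\<in>UNIV. comp \<T> c A z * v 0 $ (A, midx_empty))"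
  using assms vchart_atlas[OF assms(2)] unfolding differential_equation_def comp_def dcoord_def by blast

lemma smooth_comp:
  assumes "differential_equation \<A> \<T>" "c \<in> \<A>"
  shows "smooth_on (chart_dom (vchart c)) (comp \<T> c A)"
  using assms vchart_atlas[OF assms(2)] unfolding differential_equation_def comp_def[abs_def] by simp

lemma open_adapted_domain:
  "open W \<Longrightarrow> open (x_regular \<inter> base_coords -` W :: (real^(('n + 'm) \<times> ('n, 's) midx)) set)"
  by (intro open_Int open_x_regular open_base_coords)

lemma sum_axis_mult: "(\<Sum>A\<in>UNIV. f A * (axis B (1::real) :: real^'k::finite) $ A) = f B"
  by (simp add: axis_def if_distrib cong: if_cong)

lemma base_axis: "(axis (A, midx_empty) (1::real) :: real^(('n + 'm) \<times> ('n, 's) midx)) $ (B, midx_empty) = axis A 1 $ B"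
  by (simp add: axis_def)

text \<open>In coordinates the action is a linear map \<open>M\<close> that leaves the x^A
  untouched, so its derivative preserves the base components of a vector. As \<T> sees only base
  components, homogeneity becomes a relation between values of a single component.\<close>

lemma comp_reparam:
  fixes \<T> :: "(('n, 'x) velocity, real^(('n + 'm) \<times> ('n, 's) midx)) mform"
  assumes de: "differential_equation \<A> \<T>" and hom: "homogeneous \<A> \<T>"
    and ad: "adapted_rep c \<gamma> U" and \<alpha>: "local_diffeo \<alpha>"
  shows "comp \<T> c A (crd c (\<lambda>t. \<gamma> (\<alpha> t)) 0) = det (jacobi_matrix \<alpha> 0) * comp \<T> c A (crd c \<gamma> 0)"
proof -
  note rep = adapted_repD(1)[OF ad]
  note r = repD[OF rep]
  let ?d = "vchart c" and ?a = "group_jet CARD('s) \<alpha>" and ?p = "jet \<A> CARD('s) \<gamma>" and ?z = "crd c \<gamma> 0"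
  let ?F = "snd ?d \<circ> act \<A> CARD('s) ?a \<circ> inv_into (fst ?d) (snd ?d)"
  \<comment> \<open>\<open>?F\<close> involves the inverse of a chart and is meaningful only on the
    image of that chart; \<open>?N\<close> is an open set of coordinate vectors on which it agrees
    with \<open>M\<close>.\<close>
  let ?N = "x_regular \<inter> base_coords -` chart_dom c :: (real^(('n + 'm) \<times> ('n, 's) midx)) set"
  obtain V where V: "open V" "0 \<in> V" "smooth_on V \<alpha>" "\<alpha> 0 = 0" using local_diffeoD[OF \<alpha>] by metis
  obtain M where M: "linear M" "\<And>c \<gamma> U. rep c \<gamma> U \<Longrightarrow> crd c (\<lambda>t. \<gamma> (\<alpha> t)) 0 = M (crd c \<gamma> 0)"
    using crd_reparam[OF V] by metis
  have N: "open ?N" by (rule open_adapted_domain[OF open_chart_dom[OF r(1)]])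
  have zN: "?z \<in> ?N" using adapted_repD(2)[OF ad] r(6) by (simp add: base_coords_crd)
  have F: "?F z = M z \<and> M z $ (B, midx_empty) = z $ (B, midx_empty)" if z: "z \<in> ?N" for z B
  proof -
    obtain \<delta> W where \<delta>: "adapted_rep c \<delta> W" "crd c \<delta> 0 = z" using velocity_exists[OF r(1), of z] z by blast
    obtain W' where W': "adapted_rep c (\<lambda>t. \<delta> (\<alpha> t)) W'" using adapted_rep_reparam[OF \<delta>(1) \<alpha>] by metis
    have "?F z = crd c (\<lambda>t. \<delta> (\<alpha> t)) 0"
      using vchart_adapted(3)[OF \<delta>(1)] vchart_adapted(2)[OF W'] act_jet[OF rep_germ[OF adapted_repD(1)[OF \<delta>(1)]] \<alpha>]
      by (simp add: \<delta>(2))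
    moreover have "crd c (\<lambda>t. \<delta> (\<alpha> t)) 0 = M z" using M(2)[OF adapted_repD(1)[OF \<delta>(1)]] \<delta>(2) by simp
    moreover have "crd c (\<lambda>t. \<delta> (\<alpha> t)) 0 $ (B, midx_empty) = z $ (B, midx_empty)"
      using \<delta>(2) V(4) by (metis crd_base)
    ultimately show ?thesis by simp
  qed
  have M': "(M has_derivative M) (at ?z)"
    using M(1) by (simp add: linear_conv_bounded_linear bounded_linear_imp_has_derivative)
  then have "(?F has_derivative M) (at ?z)"
    by (rule has_derivative_transform_within_open[OF _ N zN]) (use F in simp)
  then have dF: "frechet_derivative ?F (at ?z) = M" using frechet_derivative_at by metis
  \<comment> \<open>That \<open>M\<close> fixes base components is known on \<open>?N\<close> only;
    differentiating at a point extends it to all vectors.\<close>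
  have MB: "M w $ (B, midx_empty) = w $ (B, midx_empty)" for w B
  proof -
    have "((\<lambda>z. M z $ (B, midx_empty)) has_derivative (\<lambda>w. M w $ (B, midx_empty))) (at ?z)"
      by (rule bounded_linear.has_derivative[OF bounded_linear_vec_nth M'])
    then have "((\<lambda>z. z $ (B, midx_empty)) has_derivative (\<lambda>w. M w $ (B, midx_empty))) (at ?z)"
      by (rule has_derivative_transform_within_open[OF _ N zN]) (use F in simp)
    from has_derivative_unique[OF this bounded_linear_imp_has_derivative[OF bounded_linear_vec_nth]]
    show ?thesis by metis
  qed
  obtain W' where W': "adapted_rep c (\<lambda>t. \<gamma> (\<alpha> t)) W'" using adapted_rep_reparam[OF ad \<alpha>] by metis
  have act: "act \<A> CARD('s) ?a ?p = jet \<A> CARD('s) (\<lambda>t. \<gamma> (\<alpha> t))" by (rule act_jet[OF rep_germ[OF rep] \<alpha>])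
  have "?a \<in> diff_group CARD('s)" using \<alpha> by (auto simp: diff_group_def)
  then have pb: "is_pullback (vel_atlas \<A>) (vel_atlas \<A>) (act \<A> CARD('s) ?a) (\<lambda>d z v. jet_det ?a * \<T> d z v) \<T>"
    using hom by (simp add: homogeneous_def)
  have "act \<A> CARD('s) ?a ?p \<in> fst ?d" using vchart_adapted(1)[OF W'] act by simp
  then have "(\<lambda>v. jet_det ?a * \<T> ?d (snd ?d ?p) v) = pull_form ?F (\<T> ?d) (snd ?d ?p)"
    using pb vchart_atlas[OF r(1)] vchart_adapted(1)[OF ad] unfolding is_pullback_def by blast
  from fun_cong[OF this, of "\<lambda>_. axis (A, midx_empty) 1"]
  have "jet_det ?a * \<T> ?d ?z (\<lambda>_. axis (A, midx_empty) 1) = \<T> ?d (?F ?z) (\<lambda>_. M (axis (A, midx_empty) 1))"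
    by (simp add: vchart_adapted(2)[OF ad] pull_form_def dF)
  moreover have "?F ?z = crd c (\<lambda>t. \<gamma> (\<alpha> t)) 0" using F[OF zN] M(2)[OF rep] by simp
  ultimately have "jet_det ?a * comp \<T> c A ?z = comp \<T> c A (crd c (\<lambda>t. \<gamma> (\<alpha> t)) 0)"
    using vchart_adapted(4)[OF ad] vchart_adapted(4)[OF W']
    by (simp add: form_eval[OF de r(1)] MB base_axis sum_axis_mult)
  then show ?thesis by (simp add: jet_det_group_jet[OF \<alpha>])
qed

text \<open>In coordinates the prolongation of \<gamma> is \<open>crd c \<gamma>\<close>, with base
  components those of \<gamma> itself; so the pull-back of \<T> pairs the components with the
  tangent vectors of \<gamma>.\<close>

lemma comp_tangent:
  fixes \<T> :: "(('n, 'x) velocity, real^(('n + 'm) \<times> ('n, 's) midx)) mform"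
  assumes de: "differential_equation \<A> \<T>" and hom: "homogeneous \<A> \<T>" and ad: "adapted_rep c \<gamma> U"
  shows "(\<Sum>A\<in>UNIV. comp \<T> c A (crd c \<gamma> 0) * partial j (\<lambda>t. snd c (\<gamma> t) $ A) 0) = 0"
proof -
  note rep = adapted_repD(1)[OF ad]
  note r = repD[OF rep]
  let ?d = "vchart c" and ?p = "jet \<A> CARD('s) \<gamma>" and ?z = "crd c \<gamma> 0"
  let ?G = "snd ?d \<circ> prolong \<A> CARD('s) \<gamma> \<circ> inv_into U id"
  \<comment> \<open>Translating the parameter and taking the jet at 0 amounts to taking derivatives
    at \<open>t\<close>. This is shown on all of \<open>U\<close>, since \<open>?G\<close> is to be
    differentiated.\<close>
  have G: "?G t = crd c \<gamma> t" if t: "t \<in> U" for t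
  proof -
    let ?V = "(+) t -` U"
    have op: "open ?V" using r(2) by (intro open_vimage continuous_intros)
    have "smooth_on ?V (\<lambda>u. snd c (\<gamma> (t + u)))"
      by (rule smooth_on_compose[OF op r(2) _ _ r(5)])
        (auto intro!: smooth_on_add smooth_on_const smooth_on_ident op)
    then have rV: "rep c (\<lambda>u. \<gamma> (t + u)) ?V" using r t op by (auto simp: rep_def)
    have "?G t = crd c (\<lambda>u. \<gamma> (t + u)) 0"
      using t snd_vchart[OF rep_germ[OF rV] r(1)] r(4)[OF t] by (simp add: prolong_def)
    also have "\<dots> = crd c \<gamma> t"
      using partials_translate[OF r(2) smooth_on_nth[OF r(2,5)], of t 0] t
      by (simp add: crd_def jet_coords_def)
    finally show ?thesis .
  qed
  have dcrd: "crd c \<gamma> differentiable (at 0)"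
    unfolding crd_def by (rule smooth_on_differentiable[OF smooth_jet_coords[OF r(2,5)] r(3)])
  have "(?G has_derivative frechet_derivative (crd c \<gamma>) (at 0)) (at 0)"
    by (rule has_derivative_transform_within_open[OF dcrd[unfolded frechet_derivative_works] r(2,3)]) (simp only: G)
  then have dG: "frechet_derivative ?G (at 0) = frechet_derivative (crd c \<gamma>) (at 0)"
    using frechet_derivative_at by metis
  have "is_pullback {(U, id)} (vel_atlas \<A>) (prolong \<A> CARD('s) \<gamma>) (\<lambda>d z v. 0) \<T>"
    using hom adapted_rep_immersion[OF ad] unfolding homogeneous_def by blast
  moreover have "prolong \<A> CARD('s) \<gamma> 0 = ?p" by (simp add: prolong_def)
  ultimately have "(\<lambda>v. 0) = pull_form ?G (\<T> ?d) 0"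
    using vchart_atlas[OF r(1)] vchart_adapted(1)[OF ad] r(3) unfolding is_pullback_def
    by (metis (no_types, lifting) fst_conv id_apply insertI1 snd_conv)
  from fun_cong[OF this, of "\<lambda>_. axis j 1"]
  have "0 = \<T> ?d (?G 0) (\<lambda>_. frechet_derivative (crd c \<gamma>) (at 0) (axis j 1))"
    by (simp only: pull_form_def dG)
  also have "\<dots> = (\<Sum>A\<in>UNIV. comp \<T> c A ?z * frechet_derivative (crd c \<gamma>) (at 0) (axis j 1) $ (A, midx_empty))"
    unfolding G[OF r(3)] by (rule form_eval[OF de r(1) vchart_adapted(4)[OF ad]])
  also have "\<dots> = (\<Sum>A\<in>UNIV. comp \<T> c A ?z * partial j (\<lambda>t. snd c (\<gamma> t) $ A) 0)"
    unfolding frechet_derivative_nth(1)[OF dcrd] crd_base partial_def ..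
  finally show ?thesis by simp
qed

text \<open>The base block of the change of velocity coordinates is the change of charts on
  \<open>X\<close>, so the components transform like those of a covector on
  \<open>X\<close>.\<close>

lemma comp_change_chart:
  fixes \<T> :: "(('n, 'x) velocity, real^(('n + 'm) \<times> ('n, 's) midx)) mform"
  assumes de: "differential_equation \<A> \<T>" and ad: "adapted_rep c \<gamma> U" and ad': "adapted_rep c' \<gamma> U'"
  shows "comp \<T> c A (crd c \<gamma> 0)
    = (\<Sum>B\<in>UNIV. comp \<T> c' B (crd c' \<gamma> 0) * dtrans c c' (\<gamma> 0) (axis A 1) $ B)"
proof -
  note rep = adapted_repD(1)[OF ad] and rep' = adapted_repD(1)[OF ad']
  note r = repD[OF rep] and r' = repD[OF rep']
  let ?d = "vchart c" and ?d' = "vchart c'" and ?p = "jet \<A> CARD('s) \<gamma>" and ?z = "crd c \<gamma> 0"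
  let ?F = "snd ?d' \<circ> id \<circ> inv_into (fst ?d) (snd ?d)"
  let ?O = "snd c ` (fst c \<inter> fst c')"
  let ?N = "x_regular \<inter> base_coords -` ?O :: (real^(('n + 'm) \<times> ('n, 's) midx)) set"
  let ?D = "frechet_derivative (vel_trans c c') (at ?z)"
  have N: "open ?N" by (rule open_adapted_domain[OF open_overlap[OF r(1) r'(1)]])
  have zN: "?z \<in> ?N" using adapted_repD(2)[OF ad] r(6) r'(6) by (simp add: base_coords_crd)
  have F: "?F z = vel_trans c c' z" and F0: "vel_trans c c' z $ (B, midx_empty) = transition c c' (base_coords z) $ B"
    if z: "z \<in> ?N" for z B
  proof -
    obtain \<delta> W where \<delta>: "adapted_rep c \<delta> W" "crd c \<delta> 0 = z" using velocity_exists[OF r(1), of z] z by blast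
    note rd = adapted_repD(1)[OF \<delta>(1)]
    have "snd c (\<delta> 0) \<in> ?O" using z base_coords_crd[of c \<delta> 0] \<delta>(2) by simp
    then obtain p where p: "p \<in> fst c" "p \<in> fst c'" "snd c (\<delta> 0) = snd c p" by blast
    have "\<delta> 0 = chart_inv c (snd c (\<delta> 0))" by (rule chart_inv_chart[OF r(1) repD(6)[OF rd], symmetric])
    also have "\<dots> = p" unfolding p(3) by (rule chart_inv_chart[OF r(1) p(1)])
    finally have "\<delta> 0 \<in> fst c'" using p(2) by simp
    then show "?F z = vel_trans c c' z"
      using vchart_adapted(3)[OF \<delta>(1)] snd_vchart[OF rep_germ[OF rd] r'(1)] crd_change_chart[OF rd r'(1)] \<delta>(2)
      by simp
    show "vel_trans c c' z $ (B, midx_empty) = transition c c' (base_coords z) $ B"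
      by (simp add: vel_trans_def midx_list_empty)
  qed
  have dv: "vel_trans c c' differentiable (at ?z)"
    by (rule smooth_on_differentiable[OF smooth_vel_trans[OF r(1) r'(1)]]) (use zN in simp)
  have "(?F has_derivative ?D) (at ?z)"
    by (rule has_derivative_transform_within_open[OF dv[unfolded frechet_derivative_works] N zN]) (simp only: F)
  then have dF: "frechet_derivative ?F (at ?z) = ?D" using frechet_derivative_at by metis
  have DB: "?D w $ (B, midx_empty) = dtrans c c' (\<gamma> 0) (base_coords w) $ B" for w B
  proof -
    have tr: "(transition c c' has_derivative dtrans c c' (\<gamma> 0)) (at (base_coords ?z))"
      unfolding base_coords_crd by (rule has_derivative_transition[OF r(1) r'(1) r(6) r'(6)])
    have "((\<lambda>z. transition c c' (base_coords z)) has_derivative (\<lambda>w. dtrans c c' (\<gamma> 0) (base_coords w))) (at ?z)"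
      by (rule has_derivative_compose[OF bounded_linear_imp_has_derivative[OF bounded_linear_base_coords] tr])
    then have "((\<lambda>z. transition c c' (base_coords z) $ B) has_derivative (\<lambda>w. dtrans c c' (\<gamma> 0) (base_coords w) $ B)) (at ?z)"
      by (rule bounded_linear.has_derivative[OF bounded_linear_vec_nth])
    moreover have "(\<lambda>z. vel_trans c c' z $ (B, midx_empty)) = (\<lambda>z. transition c c' (base_coords z) $ B)"
      by (simp add: vel_trans_def midx_list_empty fun_eq_iff)
    ultimately show ?thesis
      unfolding frechet_derivative_nth(1)[OF dv] using frechet_derivative_at by metis
  qed
  have "is_pullback (vel_atlas \<A>) (vel_atlas \<A>) id \<T> \<T>"
    using de unfolding differential_equation_def mforms_def by blast
  moreover have "id ?p \<in> fst ?d'" using vchart_adapted(1)[OF ad'] by simp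
  ultimately have "\<T> ?d (snd ?d ?p) = pull_form ?F (\<T> ?d') (snd ?d ?p)"
    using vchart_atlas[OF r(1)] vchart_atlas[OF r'(1)] vchart_adapted(1)[OF ad]
    unfolding is_pullback_def by blast
  from fun_cong[OF this, of "\<lambda>_. axis (A, midx_empty) 1"]
  have "\<T> ?d ?z (\<lambda>_. axis (A, midx_empty) 1) = \<T> ?d' (?F ?z) (\<lambda>_. ?D (axis (A, midx_empty) 1))"
    by (simp only: vchart_adapted(2)[OF ad] pull_form_def dF)
  moreover have "?F ?z = crd c' \<gamma> 0" using F[OF zN] crd_change_chart[OF rep r'(1) r'(6)] by simp
  moreover have "base_coords (axis (A, midx_empty) 1 :: real^(('n + 'm) \<times> ('n, 's) midx)) = axis A 1"
    by (simp add: base_coords_def vec_eq_iff base_axis)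
  ultimately show ?thesis
    using vchart_adapted(4)[OF ad] vchart_adapted(4)[OF ad']
    by (simp add: form_eval[OF de r(1)] form_eval[OF de r'(1)] DB base_axis sum_axis_mult del: o_apply)
qed

end

subsection \<open>Wedge products evaluated on horizontal vectors\<close>

text \<open>Only permutations that fix 0 contribute, since otherwise \<open>a\<close> receives an
  argument on which it vanishes; the remaining ones permute the arguments of the alternating
  \<open>B\<close>.\<close>

lemma wedge_horizontal:
  assumes B: "alt_map n (B z)" and a: "\<And>v w. v 0 = w 0 \<Longrightarrow> a z v = a z w"
    and hor: "\<And>i. 0 < i \<Longrightarrow> a z (\<lambda>_. v i) = 0"
  shows "wedge 1 n a B z v = a z (\<lambda>_. v 0) * B z (\<lambda>i. v (Suc i))"
proof -
  let ?f = "\<lambda>\<pi>. of_int (sign \<pi>) * a z (\<lambda>i. v (\<pi> i)) * B z (\<lambda>i. v (\<pi> (Suc i)))"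
  have S: "{..<1 + n} = insert 0 {1..n}" by auto
  have bij: "bij_betw Suc {..<n} {1..n}" by (auto simp: bij_betw_def image_iff Bex_def) presburger
  have img: "Suc ` {..<n} = {1..n}" using bij by (simp add: bij_betw_def)
  have map_bij: "bij_betw (map_permutation {..<n} Suc) {\<pi>. \<pi> permutes {..<n}} {p. p permutes {1..n}}"
    using bij_betw_permutations[OF bij] img
    by (simp add: map_permutation_def[abs_def] restrict_id_def[abs_def] o_def)
  have "(\<Sum>\<pi> | \<pi> permutes {..<1 + n}. ?f \<pi>)
      = (\<Sum>b\<in>insert 0 {1..n}. \<Sum>p | p permutes {1..n}. ?f (Transposition.transpose 0 b \<circ> p))"
    unfolding S by (rule sum_over_permutations_insert) auto
  also have "\<dots> = (\<Sum>p | p permutes {1..n}. ?f (Transposition.transpose 0 0 \<circ> p))"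
  proof -
    define G where "G b = (\<Sum>p | p permutes {1..n}. ?f (Transposition.transpose 0 b \<circ> p))" for b
    have zero: "?f (Transposition.transpose 0 b \<circ> p) = 0" if "b \<in> {1..n}" "p permutes {1..n}" for b p
    proof -
      have "a z (\<lambda>i. v ((Transposition.transpose 0 b \<circ> p) i)) = a z (\<lambda>_. v b)"
        by (rule a) (use that in \<open>simp add: permutes_not_in\<close>)
      then show ?thesis using hor[of b] that by (simp del: o_apply)
    qed
    have "G b = 0" if "b \<in> {1..n}" for b
      unfolding G_def by (rule sum.neutral) (use zero that in blast)
    then have "sum G {1..n} = 0" by (intro sum.neutral) blast
    moreover have "sum G (insert 0 {1..n}) = G 0 + sum G {1..n}" by (rule sum.insert) auto
    ultimately have "sum G (insert 0 {1..n}) = G 0" by simp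
    then show ?thesis unfolding G_def .
  qed
  also have "\<dots> = (\<Sum>p | p permutes {1..n}. ?f p)" by simp
  also have "\<dots> = (\<Sum>\<tau> | \<tau> permutes {..<n}. ?f (map_permutation {..<n} Suc \<tau>))"
    by (rule sum.reindex_bij_betw[OF map_bij, symmetric])
  also have "\<dots> = (\<Sum>\<tau> | \<tau> permutes {..<n}. a z (\<lambda>_. v 0) * B z (\<lambda>i. v (Suc i)))"
  proof (rule sum.cong)
    fix \<tau> assume "\<tau> \<in> {\<tau>. \<tau> permutes {..<n}}"
    then have \<tau>: "\<tau> permutes {..<n}" by simp
    let ?p = "map_permutation {..<n} Suc \<tau>"
    have p: "?p permutes {1..n}" using map_permutation_permutes[OF _ \<tau>, of Suc] img by simp
    have "B z (\<lambda>i. v (?p (Suc i))) = B z (\<lambda>i. v (Suc (\<tau> i)))"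
      by (rule alt_map_cong[OF B]) (simp add: map_permutation_apply)
    also have "\<dots> = of_int (sign \<tau>) * B z (\<lambda>i. v (Suc i))"
      using alt_map_permute[OF B \<tau>, of "\<lambda>i. v (Suc i)"] .
    finally have "B z (\<lambda>i. v (?p (Suc i))) = of_int (sign \<tau>) * B z (\<lambda>i. v (Suc i))" .
    moreover have "sign ?p = sign \<tau>" by (rule sign_map_permutation) (use \<tau> in auto)
    moreover have "of_int (sign \<tau>) * of_int (sign \<tau>) = (1 :: real)"
      by (metis of_int_mult of_int_1 sign_idempotent)
    moreover have "a z (\<lambda>i. v (?p i)) = a z (\<lambda>_. v 0)"
      by (rule a) (use p in \<open>simp add: permutes_not_in\<close>)
    ultimately show "?f ?p = a z (\<lambda>_. v 0) * B z (\<lambda>i. v (Suc i))"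
      by (simp add: mult_ac)
  qed simp
  finally show ?thesis by (simp add: wedge_def card_permutations)
qed

text \<open>Multiplicativity of the determinant. The two sides may live at different points and on
  different vectors, so that the lemma covers pull-backs as well as relations between one-forms at
  one point.\<close>

lemma wedge_list_one_change:
  fixes \<beta> :: "'n::finite \<Rightarrow> 'e eform" and \<beta>' :: "'n \<Rightarrow> 'f eform" and M :: "real^'n::finite^'n::finite"
  assumes L: "distinct L" "set L = (UNIV :: 'n set)"
    and \<beta>: "\<And>i v w. v 0 = w 0 \<Longrightarrow> \<beta> i z v = \<beta> i z w"
    and \<beta>': "\<And>i v w. v 0 = w 0 \<Longrightarrow> \<beta>' i z' v = \<beta>' i z' w"
    and eq: "\<And>j k. \<beta>' j z' (\<lambda>_. v' k) = (\<Sum>i\<in>UNIV. M $ i $ j * \<beta> i z (\<lambda>_. v k))"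
  shows "wedge_list 1 (map \<beta>' L) z' v' = det M * wedge_list 1 (map \<beta> L) z v"
proof -
  let ?k = "inv_into {..<CARD('n)} ((!) L)"
  have "(\<chi> j k. \<beta>' j z' (\<lambda>_. v' (?k k))) = transpose M ** (\<chi> i k. \<beta> i z (\<lambda>_. v (?k k)))"
    by (simp add: vec_eq_iff eq matrix_matrix_mult_def transpose_def)
  moreover have "wedge_list 1 (map \<beta>' L) z' v' = det (\<chi> j k. \<beta>' j z' (\<lambda>_. v' (?k k)))"
    by (rule wedge_list_one_det[where \<beta> = \<beta>' and z = z', OF \<beta>' L])
  moreover have "wedge_list 1 (map \<beta> L) z v = det (\<chi> j k. \<beta> j z (\<lambda>_. v (?k k)))"
    by (rule wedge_list_one_det[where \<beta> = \<beta> and z = z, OF \<beta> L])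
  ultimately show ?thesis by (simp only: det_mul det_transpose)
qed

lemma wedge_list_one_eq:
  fixes \<beta> :: "'n::finite \<Rightarrow> 'e eform" and \<beta>' :: "'n \<Rightarrow> 'e eform"
  assumes L: "distinct L" "set L = (UNIV :: 'n set)"
    and \<beta>: "\<And>i v w. v 0 = w 0 \<Longrightarrow> \<beta> i z v = \<beta> i z w"
    and \<beta>': "\<And>i v w. v 0 = w 0 \<Longrightarrow> \<beta>' i z v = \<beta>' i z w"
    and eq: "\<And>j k. \<beta>' j z (\<lambda>_. v k) = \<beta> j z (\<lambda>_. v k)"
  shows "wedge_list 1 (map \<beta>' L) z v = wedge_list 1 (map \<beta> L) z v"
proof -
  have "(\<Sum>i\<in>UNIV. (mat 1 :: real^'n^'n) $ i $ j * \<beta> i z (\<lambda>_. v k)) = \<beta> j z (\<lambda>_. v k)" for j k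
    by (simp add: mat_def if_distrib[of "\<lambda>c. c * _"] cong: if_cong)
  then have "\<beta>' j z (\<lambda>_. v k) = (\<Sum>i\<in>UNIV. (mat 1 :: real^'n^'n) $ i $ j * \<beta> i z (\<lambda>_. v k))" for j k
    by (simp only: eq)
  then have "wedge_list 1 (map \<beta>' L) z v = det (mat 1 :: real^'n^'n) * wedge_list 1 (map \<beta> L) z v"
    using wedge_list_one_change[where \<beta> = \<beta> and \<beta>' = \<beta>' and z = z and z' = z and v = v and v' = v
        and M = "mat 1", OF L] \<beta> \<beta>' by blast
  then show ?thesis by (simp only: det_I mult_1_left)
qed

lemma bounded_linear_xy_part: "bounded_linear xy_part"
proof (intro linear_conv_bounded_linear[THEN iffD1] linearI)
  show "xy_part (x + y) = xy_part x + xy_part y" for x y :: "real^('a::finite + 'b::finite \<times> ('a, 'c) midx)"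
    by (simp add: vec_eq_iff xy_part_def split: sum.split)
  show "xy_part (r *\<^sub>R x) = r *\<^sub>R xy_part x" for r and x :: "real^('a::finite + 'b::finite \<times> ('a, 'c) midx)"
    by (simp add: vec_eq_iff xy_part_def split: sum.split)
qed

lemma xy_part_nth: "xy_part q $ Inl i = q $ Inl i" "xy_part q $ Inr \<sigma> = q $ Inr (\<sigma>, midx_empty)"
  by (simp_all add: xy_part_def)

lemma linear_xy_part: "linear xy_part"
  using bounded_linear_xy_part bounded_linear.linear by blast

subsection \<open>Contact elements\<close>

text \<open>The vectors D_i on \<open>X\<close>, with components 1 along x^i and y^\<sigma>_i along
  x^\<sigma>: a basis of the contact element described by \<open>q\<close>.\<close>

definition frame :: "real^('n::finite + 'm::finite \<times> ('n, 's) midx) \<Rightarrow> 'n::finite \<Rightarrow> real^('n + 'm)" where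
  "frame q i = (\<chi> k. case k of Inl j \<Rightarrow> if i = j then 1 else 0 | Inr \<sigma> \<Rightarrow> y_first q \<sigma> i)"

lemma frame_nth: "frame q i $ Inl j = (if i = j then 1 else 0)" "frame q i $ Inr \<sigma> = y_first q \<sigma> i"
  by (simp_all add: frame_def)

lemma sum_sum_UNIV: "(\<Sum>k\<in>UNIV. f k) = (\<Sum>i\<in>UNIV. f (Inl i)) + (\<Sum>\<sigma>\<in>UNIV. f (Inr \<sigma>))"
  for f :: "'a::finite + 'b::finite \<Rightarrow> real"
  by (simp add: UNIV_Plus_UNIV[symmetric] sum.Plus del: UNIV_Plus_UNIV)

lemma horizontal_xy_part:
  assumes "\<And>\<sigma>. cform \<sigma> q x = 0"
  shows "xy_part x = (\<Sum>i\<in>UNIV. x $ Inl i *\<^sub>R frame q i)"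
proof -
  have "xy_part x $ k = (\<Sum>i\<in>UNIV. x $ Inl i *\<^sub>R frame q i) $ k" for k
  proof (cases k)
    case (Inl j)
    have "(\<Sum>i\<in>UNIV. x $ Inl i * (if i = j then 1 else 0)) = x $ Inl j"
      by (simp add: if_distrib cong: if_cong)
    then show ?thesis by (simp add: Inl xy_part_nth frame_nth)
  next
    case (Inr \<sigma>)
    then show ?thesis using assms[of \<sigma>] by (simp add: xy_part_nth frame_nth cform_def mult.commute)
  qed
  then show ?thesis by (simp add: vec_eq_iff)
qed

lemma y_first_qcoords:
  fixes z :: "real^(('n::{finite,linorder} + 'm::finite) \<times> ('n, 's::finite) midx)"
  shows "y_first (qcoords z) \<sigma> i = y_coord \<sigma> [i] z"
  by (simp add: y_first_def qcoords_nth midx_list_single)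

lemma matrix_inv_sum:
  fixes X :: "real^'k::finite^'k::finite"
  assumes "det X \<noteq> 0"
  shows "(\<Sum>j\<in>UNIV. X $ i $ j * matrix_inv X $ j $ k) = (if i = k then 1 else 0)"
    and "(\<Sum>j\<in>UNIV. matrix_inv X $ i $ j * X $ j $ k) = (if i = k then 1 else 0)"
proof -
  have "(X ** matrix_inv X) $ i $ k = mat 1 $ i $ k" "(matrix_inv X ** X) $ i $ k = mat 1 $ i $ k"
    by (simp_all only: matrix_inv_mult[OF assms])
  then show "(\<Sum>j\<in>UNIV. X $ i $ j * matrix_inv X $ j $ k) = (if i = k then 1 else 0)"
    and "(\<Sum>j\<in>UNIV. matrix_inv X $ i $ j * X $ j $ k) = (if i = k then 1 else 0)"
    by (simp_all add: matrix_matrix_mult_def mat_def)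
qed

lemma linear_axes:
  fixes f :: "real^'k::finite \<Rightarrow> real^'l::finite"
  assumes "linear f"
  shows "f \<xi> = (\<Sum>A\<in>UNIV. \<xi> $ A *\<^sub>R f (axis A 1))"
proof -
  have "f \<xi> = f (\<Sum>A\<in>UNIV. \<xi> $ A *\<^sub>R axis A 1)"
    by (rule arg_cong[where f = f]) (simp add: vec_eq_iff axis_def if_distrib cong: if_cong)
  then show ?thesis by (simp add: linear_sum[OF assms] linear_cmul[OF assms])
qed

lemma frame_axes: "frame q i = axis (Inl i) 1 + (\<Sum>\<sigma>\<in>UNIV. y_first q \<sigma> i *\<^sub>R axis (Inr \<sigma>) 1)"
proof -
  have "frame q i $ A = (axis (Inl i) 1 + (\<Sum>\<sigma>\<in>UNIV. y_first q \<sigma> i *\<^sub>R axis (Inr \<sigma>) 1)) $ A" for A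
    by (cases A) (auto simp: frame_nth axis_def if_distrib cong: if_cong)
  then show ?thesis by (simp add: vec_eq_iff)
qed

section \<open>The charts of the quotient\<close>

context velocities
begin

definition qchart :: "('x, real^('n + 'm)) chart \<Rightarrow>
    (('n, 'x) velocity set, real^('n + 'm \<times> ('n, 's) midx)) chart" where
  "qchart c = quot_chart TYPE('s) \<A> c"

text \<open>By \<open>qdom_eq\<close> this is the image of the chart: the coordinates of positive
  order are unrestricted, since every value of them is attained by a graph.\<close>

definition qdom :: "('x, real^('n + 'm)) chart \<Rightarrow> (real^('n + 'm \<times> ('n, 's) midx)) set" where
  "qdom c = xy_part -` chart_dom c"

lemma open_qdom: "c \<in> \<A> \<Longrightarrow> open (qdom c)"
  unfolding qdom_def by (intro open_vimage linear_continuous_on bounded_linear_xy_part open_chart_dom)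

definition pt :: "('x, real^('n + 'm)) chart \<Rightarrow> real^('n + 'm \<times> ('n, 's) midx) \<Rightarrow> ('n, 'x) velocity set" where
  "pt c q = rho \<A> CARD('s) (jet \<A> CARD('s) (gvel c q))"

lemma fst_qchart: "fst (qchart c) = rho \<A> CARD('s) ` adapted \<A> CARD('s) c"
  by (simp add: qchart_def quot_chart_def)

text \<open>\<open>quot_chart\<close> computes coordinates from an arbitrary element of the orbit;
  that element is again a reparametrisation of \<gamma>, with the same invariant
  coordinates.\<close>

lemma some_rho:
  assumes "adapted_rep c \<gamma> U"
  obtains \<alpha> V where "local_diffeo \<alpha>" "(SOME v. v \<in> rho \<A> CARD('s) (jet \<A> CARD('s) \<gamma>)) = jet \<A> CARD('s) (\<lambda>t. \<gamma> (\<alpha> t))"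
    "adapted_rep c (\<lambda>t. \<gamma> (\<alpha> t)) V" "qcoords (crd c (\<lambda>t. \<gamma> (\<alpha> t)) 0) = qcoords (crd c \<gamma> 0)"
    "x_matrix (crd c (\<lambda>t. \<gamma> (\<alpha> t)) 0) = x_matrix (crd c \<gamma> 0) ** jacobi_matrix \<alpha> 0"
proof -
  note rho = rho_jet[OF rep_germ[OF adapted_repD(1)[OF assms]]]
  have "jet \<A> CARD('s) \<gamma> \<in> rho \<A> CARD('s) (jet \<A> CARD('s) \<gamma>)"
    unfolding rho by (intro CollectI exI[of _ "\<lambda>t. t"]) (simp add: local_diffeo_id)
  then have "(SOME v. v \<in> rho \<A> CARD('s) (jet \<A> CARD('s) \<gamma>)) \<in> rho \<A> CARD('s) (jet \<A> CARD('s) \<gamma>)"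
    by (rule someI[of "\<lambda>v. v \<in> rho \<A> CARD('s) (jet \<A> CARD('s) \<gamma>)"])
  then obtain \<alpha> where \<alpha>: "local_diffeo \<alpha>"
    "(SOME v. v \<in> rho \<A> CARD('s) (jet \<A> CARD('s) \<gamma>)) = jet \<A> CARD('s) (\<lambda>t. \<gamma> (\<alpha> t))"
    unfolding rho by blast
  from adapted_rep_reparam[OF assms \<alpha>(1)] show thesis using that \<alpha> by metis
qed

lemma snd_qchart_rho:
  assumes "adapted_rep c \<gamma> U"
  shows "snd (qchart c) (rho \<A> CARD('s) (jet \<A> CARD('s) \<gamma>)) = qcoords (crd c \<gamma> 0)"
proof -
  obtain \<alpha> V where \<alpha>: "(SOME v. v \<in> rho \<A> CARD('s) (jet \<A> CARD('s) \<gamma>)) = jet \<A> CARD('s) (\<lambda>t. \<gamma> (\<alpha> t))"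
    "adapted_rep c (\<lambda>t. \<gamma> (\<alpha> t)) V" "qcoords (crd c (\<lambda>t. \<gamma> (\<alpha> t)) 0) = qcoords (crd c \<gamma> 0)"
    using some_rho[OF assms] by metis
  have "(\<chi> k. vel_coord (snd c) (fst k) (midx_list (snd k)) (jet \<A> CARD('s) (\<lambda>t. \<gamma> (\<alpha> t)))) = crd c (\<lambda>t. \<gamma> (\<alpha> t)) 0"
    using vchart_adapted(2)[OF \<alpha>(2)] by (simp add: vchart_def vel_chart_def)
  then show ?thesis
    by (simp add: qchart_def quot_chart_def Let_def \<alpha>(1) qcoords_def[symmetric] \<alpha>(3))
qed

lemma rho_in_qchart: "adapted_rep c \<gamma> U \<Longrightarrow> rho \<A> CARD('s) (jet \<A> CARD('s) \<gamma>) \<in> fst (qchart c)"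
  by (simp add: fst_qchart adapted_rep_jet)

lemma rho_eq_pt:
  assumes "adapted_rep c \<gamma> U"
  shows "rho \<A> CARD('s) (jet \<A> CARD('s) \<gamma>) = pt c (qcoords (crd c \<gamma> 0))"
proof -
  obtain \<alpha> where "local_diffeo \<alpha>"
    "jet \<A> CARD('s) (\<lambda>t. \<gamma> (\<alpha> t)) = jet \<A> CARD('s) (gvel c (qcoords (crd c \<gamma> 0)))"
    using normal_form[OF assms] .
  then show ?thesis using rho_reparam[OF rep_germ[OF adapted_repD(1)[OF assms]]] by (metis pt_def)
qed

lemma xy_part_qcoords: "xy_part (qcoords (crd c \<gamma> 0)) = snd c (\<gamma> 0)"
  by (simp add: vec_eq_iff xy_part_def qcoords_nth crd_base midx_list_empty split: sum.split)

lemma gvelE: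
  assumes "c \<in> \<A>" "q \<in> qdom c"
  obtains U where "adapted_rep c (gvel c q) U" "crd c (gvel c q) 0 = graph_jet q"
    "qcoords (crd c (gvel c q) 0) = q" "snd c (gvel c q 0) = xy_part q"
proof -
  obtain U where U: "adapted_rep c (gvel c q) U" "crd c (gvel c q) 0 = graph_jet q"
    using gvel_rep[OF assms(1)] assms(2) unfolding qdom_def by blast
  then have "qcoords (crd c (gvel c q) 0) = q" by (simp add: qcoords_graph_jet)
  then show thesis using that U xy_part_qcoords[of c "gvel c q"] by metis
qed

lemma inj_on_qchart:
  assumes "c \<in> \<A>"
  shows "inj_on (snd (qchart c)) (fst (qchart c))"
  unfolding fst_qchart
proof (rule inj_onI)
  fix p p' assume p: "p \<in> rho \<A> CARD('s) ` adapted \<A> CARD('s) c" "p' \<in> rho \<A> CARD('s) ` adapted \<A> CARD('s) c"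
    and eq: "snd (qchart c) p = snd (qchart c) p'"
  have "p = pt c (snd (qchart c) p)" if pr: "p \<in> rho \<A> CARD('s) ` adapted \<A> CARD('s) c" for p
  proof -
    obtain v where v: "p = rho \<A> CARD('s) v" "v \<in> adapted \<A> CARD('s) c" using pr by blast
    obtain \<gamma> U where \<gamma>: "v = jet \<A> CARD('s) \<gamma>" "adapted_rep c \<gamma> U" using adaptedE[OF v(2) assms] .
    show ?thesis unfolding v(1) \<gamma>(1) snd_qchart_rho[OF \<gamma>(2)] by (rule rho_eq_pt[OF \<gamma>(2)])
  qed
  from this[OF p(1)] this[OF p(2)] show "p = p'" unfolding eq by simp
qed

lemma qchart_pt:
  assumes "c \<in> \<A>" "q \<in> qdom c"
  shows "pt c q \<in> fst (qchart c)" "snd (qchart c) (pt c q) = q" "inv_into (fst (qchart c)) (snd (qchart c)) q = pt c q"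
proof -
  obtain U where U: "adapted_rep c (gvel c q) U" "qcoords (crd c (gvel c q) 0) = q" using gvelE[OF assms] by metis
  show 1: "pt c q \<in> fst (qchart c)" unfolding pt_def by (rule rho_in_qchart[OF U(1)])
  show 2: "snd (qchart c) (pt c q) = q" unfolding pt_def using snd_qchart_rho[OF U(1)] U(2) by simp
  show "inv_into (fst (qchart c)) (snd (qchart c)) q = pt c q"
    using inv_into_f_f[OF inj_on_qchart[OF assms(1)] 1] 2 by simp
qed

lemma qdom_eq:
  assumes "c \<in> \<A>"
  shows "snd (qchart c) ` fst (qchart c) = qdom c"
proof (intro equalityI subsetI)
  fix q assume "q \<in> snd (qchart c) ` fst (qchart c)"
  then obtain v where v: "v \<in> adapted \<A> CARD('s) c" "q = snd (qchart c) (rho \<A> CARD('s) v)" by (auto simp: fst_qchart)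
  obtain \<gamma> U where \<gamma>: "v = jet \<A> CARD('s) \<gamma>" "adapted_rep c \<gamma> U" using adaptedE[OF v(1) assms] .
  then have "xy_part q = snd c (\<gamma> 0)" using v(2) by (simp add: snd_qchart_rho xy_part_qcoords)
  then show "q \<in> qdom c" using repD(6)[OF adapted_repD(1)[OF \<gamma>(2)]] by (simp add: qdom_def)
next
  fix q assume "q \<in> qdom c"
  then show "q \<in> snd (qchart c) ` fst (qchart c)" using qchart_pt[OF assms] by (metis image_eqI)
qed

section \<open>Contact elements under a change of chart\<close>

lemma tangent_x_matrix: "x_matrix (crd c \<gamma> t) $ i $ j = partial j (\<lambda>t. snd c (\<gamma> t) $ Inl i) t"
  unfolding crd_def by (rule x_matrix_jet_coords)

lemma y_first_crd:
  assumes "adapted_rep c \<gamma> U"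
  shows "y_first (qcoords (crd c \<gamma> 0)) \<sigma> i
    = (\<Sum>j\<in>UNIV. matrix_inv (x_matrix (crd c \<gamma> 0)) $ j $ i * partial j (\<lambda>t. snd c (\<gamma> t) $ Inr \<sigma>) 0)"
proof -
  note r = repD[OF adapted_repD(1)[OF assms]]
  show ?thesis
    unfolding y_first_qcoords crd_def
    using y_coord_jet_coords_Cons[OF r(2,5,3), where 's = 's and I = "[]" and \<sigma> = \<sigma> and i = i] adapted_repD(2)[OF assms]
    by (simp add: jet_coords_empty x_regular_def crd_def)
qed

definition tangent :: "('x, real^('n + 'm)) chart \<Rightarrow> (real^'n::{finite,linorder} \<Rightarrow> 'x) \<Rightarrow> 'n \<Rightarrow> real^('n + 'm)" where
  "tangent c \<gamma> j = (\<chi> A. partial j (\<lambda>t. snd c (\<gamma> t) $ A) 0)"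

text \<open>The tangent vectors of \<gamma> and the \<open>frame\<close> span the same contact
  element; as the frame is normalised in the x-directions, the matrix between the two bases is the
  x-block of the tangent vectors.\<close>

lemma tangent_frame:
  assumes "adapted_rep c \<gamma> U"
  shows "tangent c \<gamma> j = (\<Sum>k\<in>UNIV. x_matrix (crd c \<gamma> 0) $ k $ j *\<^sub>R frame (qcoords (crd c \<gamma> 0)) k)"
proof -
  let ?X = "x_matrix (crd c \<gamma> 0)"
  have X: "det ?X \<noteq> 0" using adapted_repD(2)[OF assms] by (simp add: x_regular_def)
  have "tangent c \<gamma> j $ A = (\<Sum>k\<in>UNIV. ?X $ k $ j *\<^sub>R frame (qcoords (crd c \<gamma> 0)) k) $ A" for A
  proof (cases A)
    case (Inl i)
    have "(\<Sum>k\<in>UNIV. ?X $ k $ j * (if k = i then 1 else 0)) = ?X $ i $ j"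
      by (simp add: if_distrib cong: if_cong)
    then show ?thesis by (simp add: Inl tangent_def frame_nth tangent_x_matrix)
  next
    case (Inr \<sigma>)
    let ?p = "\<lambda>l. partial l (\<lambda>t. snd c (\<gamma> t) $ Inr \<sigma>) 0"
    have "(\<Sum>k\<in>UNIV. ?X $ k $ j * (\<Sum>l\<in>UNIV. matrix_inv ?X $ l $ k * ?p l))
        = (\<Sum>l\<in>UNIV. (\<Sum>k\<in>UNIV. matrix_inv ?X $ l $ k * ?X $ k $ j) * ?p l)"
      unfolding sum_distrib_left sum_distrib_right by (subst sum.swap) (simp add: mult_ac)
    also have "\<dots> = ?p j" unfolding matrix_inv_sum(2)[OF X] by (simp add: if_distrib[of "\<lambda>c. c * _"] cong: if_cong)
    finally show ?thesis by (simp add: Inr tangent_def frame_nth y_first_crd[OF assms])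
  qed
  then show ?thesis by (simp add: vec_eq_iff)
qed

lemma tangent_change_chart:
  assumes "rep c \<gamma> U" "rep c' \<gamma> U'"
  shows "tangent c' \<gamma> j = dtrans c c' (\<gamma> 0) (tangent c \<gamma> j)"
proof -
  note r = repD[OF assms(1)] and r' = repD[OF assms(2)]
  let ?f = "\<lambda>t. snd c (\<gamma> t)" and ?f' = "\<lambda>t. snd c' (\<gamma> t)"
  have df: "?f differentiable (at 0)" by (rule smooth_on_differentiable[OF r(5,3)])
  have df': "?f' differentiable (at 0)" by (rule smooth_on_differentiable[OF r'(5,3)])
  have op: "open (U \<inter> U')" and 0: "0 \<in> U \<inter> U'" using r(2,3) r'(2,3) by auto
  have "((\<lambda>t. transition c c' (?f t)) has_derivative (\<lambda>v. dtrans c c' (\<gamma> 0) (frechet_derivative ?f (at 0) v))) (at 0)"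
    by (rule has_derivative_compose[OF df[unfolded frechet_derivative_works]])
      (rule has_derivative_transition[OF r(1) r'(1) r(6) r'(6)])
  then have "(?f' has_derivative (\<lambda>v. dtrans c c' (\<gamma> 0) (frechet_derivative ?f (at 0) v))) (at 0)"
    by (rule has_derivative_transform_within_open[OF _ op 0]) (use r in \<open>auto simp: transition_chart\<close>)
  then have D: "frechet_derivative ?f' (at 0) = (\<lambda>v. dtrans c c' (\<gamma> 0) (frechet_derivative ?f (at 0) v))"
    using frechet_derivative_at by metis
  have "tangent c \<gamma> j = frechet_derivative ?f (at 0) (axis j 1)"
    by (simp add: tangent_def vec_eq_iff frechet_derivative_nth(1)[OF df] partial_def)
  moreover have "tangent c' \<gamma> j = frechet_derivative ?f' (at 0) (axis j 1)"
    by (simp add: tangent_def vec_eq_iff frechet_derivative_nth(1)[OF df'] partial_def)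
  ultimately show ?thesis by (simp only: D)
qed

lemma partial_transition:
  assumes "c \<in> \<A>" "c' \<in> \<A>" "p \<in> fst c" "p \<in> fst c'"
  shows "partial A (\<lambda>u. transition c c' u $ B) (snd c p) = dtrans c c' p (axis A 1) $ B"
  by (rule partial_eqI[OF bounded_linear.has_derivative[OF bounded_linear_vec_nth has_derivative_transition[OF assms]]])

lemma Dtot_transition:
  assumes "c \<in> \<A>" "c' \<in> \<A>" "p \<in> fst c" "p \<in> fst c'" "xy_part q = snd c p"
  shows "Dtot i (\<lambda>u. transition c c' u $ B) q = dtrans c c' p (frame q i) $ B"
  using partial_transition[OF assms(1-4)] linear_dtrans[OF assms(1-4)]
  by (simp add: Dtot_def Delta_def assms(5) frame_axes linear_add linear_sum linear_cmul)

text \<open>The tangent vectors of \<gamma> are combinations of the D_i with matrix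
  \<open>x_matrix\<close>, so the new x-matrix is the transpose of (D_i x'^j) times the old
  one.\<close>

lemma det_x_matrix_change:
  assumes ad: "adapted_rep c \<gamma> U" and rep': "rep c' \<gamma> U'"
  defines "q \<equiv> qcoords (crd c \<gamma> 0)"
  shows "det (x_matrix (crd c' \<gamma> 0)) = jac_factor c c' q * det (x_matrix (crd c \<gamma> 0))"
proof -
  note r = repD[OF adapted_repD(1)[OF ad]] and r' = repD[OF rep']
  let ?X = "x_matrix (crd c \<gamma> 0)" and ?M = "\<chi> i j. dtrans c c' (\<gamma> 0) (frame q i) $ Inl j"
  have lin: "linear (dtrans c c' (\<gamma> 0))" by (rule linear_dtrans[OF r(1) r'(1) r(6) r'(6)])
  have "x_matrix (crd c' \<gamma> 0) $ k $ j = (transpose ?M ** ?X) $ k $ j" for k j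
  proof -
    have "x_matrix (crd c' \<gamma> 0) $ k $ j = tangent c' \<gamma> j $ Inl k" by (simp add: tangent_def tangent_x_matrix)
    also have "\<dots> = dtrans c c' (\<gamma> 0) (tangent c \<gamma> j) $ Inl k"
      by (simp only: tangent_change_chart[OF adapted_repD(1)[OF ad] rep'])
    also have "\<dots> = (\<Sum>i\<in>UNIV. ?X $ i $ j * dtrans c c' (\<gamma> 0) (frame q i) $ Inl k)"
      unfolding tangent_frame[OF ad] q_def[symmetric] by (simp add: linear_sum[OF lin] linear_cmul[OF lin])
    finally show ?thesis by (simp add: matrix_matrix_mult_def transpose_def mult.commute)
  qed
  then have "x_matrix (crd c' \<gamma> 0) = transpose ?M ** ?X" by (simp add: vec_eq_iff)
  moreover have "jac_factor c c' q = det ?M"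
    unfolding jac_factor_def q_def
    by (simp add: Dtot_transition[OF r(1) r'(1) r(6) r'(6) xy_part_qcoords[of c \<gamma>]])
  ultimately show ?thesis by (simp add: det_mul det_transpose)
qed

end

section \<open>The functions T_\<sigma> and their transformation law\<close>

locale homogeneous_equation = velocities \<A> S
  for \<A> :: "('x::{t2_space,second_countable_topology}, real^('n::{finite,linorder} + 'm::finite)) chart set"
    and S :: "'s::finite itself" +
  fixes \<T> :: "(('n, 'x) velocity, real^(('n + 'm) \<times> ('n, 's) midx)) mform"
  assumes de: "differential_equation \<A> \<T>" and hom: "homogeneous \<A> \<T>"
begin

abbreviation cmp where "cmp \<equiv> comp \<T>"

text \<open>Independent of the chosen element, since numerator and denominator acquire the same
  factor det (a) along the orbit.\<close>

definition Tfun :: "('x, real^('n + 'm)) chart \<Rightarrow> 'm \<Rightarrow> ('n, 'x) velocity set \<Rightarrow> real" where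
  "Tfun c \<sigma> p = (let v = (SOME v. v \<in> p) in cmp c (Inr \<sigma>) (snd (vchart c) v) / det_x (snd c) v)"

lemma Tfun_rho:
  assumes "adapted_rep c \<gamma> U"
  shows "Tfun c \<sigma> (rho \<A> CARD('s) (jet \<A> CARD('s) \<gamma>)) = cmp c (Inr \<sigma>) (crd c \<gamma> 0) / det (x_matrix (crd c \<gamma> 0))"
proof -
  obtain \<alpha> V where \<alpha>: "local_diffeo \<alpha>"
    "(SOME v. v \<in> rho \<A> CARD('s) (jet \<A> CARD('s) \<gamma>)) = jet \<A> CARD('s) (\<lambda>t. \<gamma> (\<alpha> t))"
    "adapted_rep c (\<lambda>t. \<gamma> (\<alpha> t)) V"
    "x_matrix (crd c (\<lambda>t. \<gamma> (\<alpha> t)) 0) = x_matrix (crd c \<gamma> 0) ** jacobi_matrix \<alpha> 0"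
    using some_rho[OF assms] by metis
  note rep = adapted_repD(1)[OF \<alpha>(3)]
  have "det (jacobi_matrix \<alpha> 0) \<noteq> 0" using adapted_repD(2)[OF \<alpha>(3)] by (auto simp: x_regular_def \<alpha>(4) det_mul)
  then show ?thesis
    unfolding Tfun_def \<alpha>(2) Let_def vchart_adapted(2)[OF \<alpha>(3)] det_x_jet[OF rep_germ[OF rep] repD(1,6)[OF rep]]
      comp_reparam[OF de hom assms \<alpha>(1)] \<alpha>(4) det_mul
    by simp
qed

text \<open>Contracting the relation \<T>_A x^A_j = 0 with the inverse matrix z^j_i turns x^k_j into
  the identity and x^\<sigma>_j into y^\<sigma>_i.\<close>

lemma comp_Inl:
  assumes ad: "adapted_rep c \<gamma> U"
  shows "cmp c (Inl i) (crd c \<gamma> 0) = - (\<Sum>\<sigma>\<in>UNIV. y_first (qcoords (crd c \<gamma> 0)) \<sigma> i * cmp c (Inr \<sigma>) (crd c \<gamma> 0))"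
proof -
  let ?z = "crd c \<gamma> 0"
  let ?X = "x_matrix ?z" and ?p = "\<lambda>\<sigma> j. partial j (\<lambda>t. snd c (\<gamma> t) $ Inr \<sigma>) 0"
  have X: "det ?X \<noteq> 0" using adapted_repD(2)[OF ad] by (simp add: x_regular_def)
  have t: "(\<Sum>k\<in>UNIV. cmp c (Inl k) ?z * ?X $ k $ j) + (\<Sum>\<sigma>\<in>UNIV. cmp c (Inr \<sigma>) ?z * ?p \<sigma> j) = 0" for j
    using comp_tangent[OF de hom ad, of j] by (simp add: sum_sum_UNIV tangent_x_matrix)
  have "(\<Sum>j\<in>UNIV. matrix_inv ?X $ j $ i * (\<Sum>k\<in>UNIV. cmp c (Inl k) ?z * ?X $ k $ j))
      = (\<Sum>k\<in>UNIV. cmp c (Inl k) ?z * (\<Sum>j\<in>UNIV. ?X $ k $ j * matrix_inv ?X $ j $ i))"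
    unfolding sum_distrib_left by (subst sum.swap) (simp add: mult_ac)
  also have "\<dots> = cmp c (Inl i) ?z"
    unfolding matrix_inv_sum(1)[OF X] by (simp add: if_distrib cong: if_cong)
  finally have 1: "(\<Sum>j\<in>UNIV. matrix_inv ?X $ j $ i * (\<Sum>k\<in>UNIV. cmp c (Inl k) ?z * ?X $ k $ j)) = cmp c (Inl i) ?z" .
  have 2: "(\<Sum>j\<in>UNIV. matrix_inv ?X $ j $ i * (\<Sum>\<sigma>\<in>UNIV. cmp c (Inr \<sigma>) ?z * ?p \<sigma> j))
      = (\<Sum>\<sigma>\<in>UNIV. y_first (qcoords ?z) \<sigma> i * cmp c (Inr \<sigma>) ?z)"
    unfolding y_first_crd[OF ad] sum_distrib_left sum_distrib_right by (subst sum.swap) (simp add: mult_ac)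
  have "0 = (\<Sum>j\<in>UNIV. matrix_inv ?X $ j $ i * ((\<Sum>k\<in>UNIV. cmp c (Inl k) ?z * ?X $ k $ j)
      + (\<Sum>\<sigma>\<in>UNIV. cmp c (Inr \<sigma>) ?z * ?p \<sigma> j)))"
    by (simp only: t mult_zero_right sum.neutral_const)
  also have "\<dots> = cmp c (Inl i) ?z + (\<Sum>\<sigma>\<in>UNIV. y_first (qcoords ?z) \<sigma> i * cmp c (Inr \<sigma>) ?z)"
    unfolding distrib_left sum.distrib 1 2 ..
  finally show ?thesis by linarith
qed

text \<open>Rewrites \<T>_\<sigma> \<omega>^\<sigma> as \<T>_A dx^A, which changes under charts like
  a covector on \<open>X\<close>; a separate transformation law for the \<omega>^\<sigma> is thereby
  avoided.\<close>

lemma sum_cform: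
  fixes x :: "real^('n + 'm \<times> ('n, 's) midx)"
  assumes ad: "adapted_rep c \<gamma> U"
  shows "(\<Sum>\<sigma>\<in>UNIV. cmp c (Inr \<sigma>) (crd c \<gamma> 0) * cform \<sigma> (qcoords (crd c \<gamma> 0)) x)
    = (\<Sum>A\<in>UNIV. cmp c A (crd c \<gamma> 0) * xy_part x $ A)"
proof -
  let ?z = "crd c \<gamma> 0"
  have "(\<Sum>i\<in>UNIV. cmp c (Inl i) ?z * x $ Inl i)
      = - (\<Sum>\<sigma>\<in>UNIV. cmp c (Inr \<sigma>) ?z * (\<Sum>i\<in>UNIV. y_first (qcoords ?z) \<sigma> i * x $ Inl i))"
    unfolding comp_Inl[OF ad] sum_distrib_left sum_distrib_right sum_negf[symmetric]
    by (subst sum.swap) (simp add: mult_ac sum_distrib_left sum_negf)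
  then show ?thesis
    by (simp add: sum_sum_UNIV xy_part_nth cform_def right_diff_distrib sum_subtractf)
qed

text \<open>Eliminating the components with index \<open>Inl\<close> in the second chart through
  \<open>comp_Inl\<close> is what produces \<open>P_factor\<close>.\<close>

lemma Tfun_change_chart:
  assumes ad: "adapted_rep c \<gamma> U" and ad': "adapted_rep c' \<gamma> U'"
  defines "p \<equiv> rho \<A> CARD('s) (jet \<A> CARD('s) \<gamma>)"
  shows "Tfun c \<sigma> p = jac_factor c c' (snd (qchart c) p) *
    (\<Sum>\<nu>\<in>UNIV. P_factor c c' \<nu> \<sigma> (snd (qchart c) p) (snd (qchart c') p) * Tfun c' \<nu> p)"
proof -
  note r = repD[OF adapted_repD(1)[OF ad]] and r' = repD[OF adapted_repD(1)[OF ad']]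
  let ?z = "crd c \<gamma> 0" and ?z' = "crd c' \<gamma> 0"
  let ?q = "qcoords ?z" and ?q' = "qcoords ?z'" and ?D = "\<lambda>B. dtrans c c' (\<gamma> 0) (axis (Inr \<sigma>) 1) $ B"
  have q: "snd (qchart c) p = ?q" "snd (qchart c') p = ?q'"
    unfolding p_def by (rule snd_qchart_rho[OF ad], rule snd_qchart_rho[OF ad'])
  have X: "det (x_matrix ?z) \<noteq> 0" and X': "det (x_matrix ?z') \<noteq> 0"
    using adapted_repD(2)[OF ad] adapted_repD(2)[OF ad'] by (auto simp: x_regular_def)
  have P: "P_factor c c' \<nu> \<sigma> ?q ?q' = ?D (Inr \<nu>) - (\<Sum>i\<in>UNIV. y_first ?q' \<nu> i * ?D (Inl i))" for \<nu>
    unfolding P_factor_def Delta_def xy_part_qcoords partial_transition[OF r(1) r'(1) r(6) r'(6)] ..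
  have "(\<Sum>i\<in>UNIV. cmp c' (Inl i) ?z' * ?D (Inl i))
      = - (\<Sum>\<nu>\<in>UNIV. cmp c' (Inr \<nu>) ?z' * (\<Sum>i\<in>UNIV. y_first ?q' \<nu> i * ?D (Inl i)))"
    unfolding comp_Inl[OF ad'] sum_distrib_left sum_distrib_right sum_negf[symmetric]
    by (subst sum.swap) (simp add: mult_ac sum_distrib_left sum_negf)
  then have "cmp c (Inr \<sigma>) ?z = (\<Sum>\<nu>\<in>UNIV. P_factor c c' \<nu> \<sigma> ?q ?q' * cmp c' (Inr \<nu>) ?z')"
    unfolding comp_change_chart[OF de ad ad'] sum_sum_UNIV P
    by (simp add: right_diff_distrib left_diff_distrib sum_subtractf mult.commute)
  moreover have "Tfun c \<sigma> p * det (x_matrix ?z) = cmp c (Inr \<sigma>) ?z"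
    using X by (simp add: p_def Tfun_rho[OF ad])
  moreover have "Tfun c' \<nu> p * det (x_matrix ?z') = cmp c' (Inr \<nu>) ?z'" for \<nu>
    using X' by (simp add: p_def Tfun_rho[OF ad'])
  ultimately have "Tfun c \<sigma> p * det (x_matrix ?z) = (\<Sum>\<nu>\<in>UNIV. P_factor c c' \<nu> \<sigma> ?q ?q' * Tfun c' \<nu> p) * det (x_matrix ?z')"
    by (simp add: sum_distrib_right mult.assoc)
  then show ?thesis
    unfolding q det_x_matrix_change[OF ad adapted_repD(1)[OF ad']] using X by (simp add: mult_ac)
qed

end

subsection \<open>Orthogonal projection onto a contact element\<close>

definition inner_prod :: "(real^'k::finite \<Rightarrow> real^'k::finite \<Rightarrow> real) \<Rightarrow> bool" where
  "inner_prod b \<longleftrightarrow> (\<forall>\<xi>. linear (b \<xi>)) \<and> (\<forall>\<xi> \<zeta>. b \<xi> \<zeta> = b \<zeta> \<xi>) \<and> (\<forall>\<xi>. \<xi> \<noteq> 0 \<longrightarrow> b \<xi> \<xi> > 0)"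

definition gram :: "(real^('n::finite + 'm::finite) \<Rightarrow> real^('n + 'm) \<Rightarrow> real) \<Rightarrow>
    real^('n + 'm \<times> ('n, 's) midx) \<Rightarrow> real^'n::finite^'n::finite" where
  "gram b q = (\<chi> i j. b (frame q i) (frame q j))"

text \<open>\<open>frame_coord b q i \<xi>\<close> is the \<open>i\<close>-th coordinate, in the basis \<open>frame q\<close>, of the projection of \<open>\<xi>\<close>
  that is orthogonal with respect to \<open>b\<close>.\<close>

definition frame_coord :: "(real^('n::finite + 'm::finite) \<Rightarrow> real^('n + 'm) \<Rightarrow> real) \<Rightarrow>
    real^('n + 'm \<times> ('n, 's) midx) \<Rightarrow> 'n::finite \<Rightarrow> real^('n + 'm) \<Rightarrow> real" where
  "frame_coord b q i \<xi> = (\<Sum>j\<in>UNIV. matrix_inv (gram b q) $ i $ j * b (frame q j) \<xi>)"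

lemma inner_prodD:
  assumes "inner_prod b"
  shows "linear (b \<xi>)" "b \<xi> \<zeta> = b \<zeta> \<xi>" "\<xi> \<noteq> 0 \<Longrightarrow> b \<xi> \<xi> > 0"
  using assms by (auto simp: inner_prod_def)

lemma frame_sum_Inl: "(\<Sum>i\<in>UNIV. a i *\<^sub>R frame q i) $ Inl j = a j"
  by (simp add: frame_nth if_distrib cong: if_cong)

lemma gram_sum:
  assumes "inner_prod b"
  shows "b (frame q k) (\<Sum>i\<in>UNIV. a i *\<^sub>R frame q i) = (\<Sum>i\<in>UNIV. gram b q $ k $ i * a i)"
  by (simp add: linear_sum[OF inner_prodD(1)[OF assms]] linear_cmul[OF inner_prodD(1)[OF assms]] gram_def mult.commute)

text \<open>If the matrix annihilates \<open>a\<close>, the combination of the D_i with coefficients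
  \<open>a\<close> has norm zero and hence vanishes; but its x-coordinates are the entries of
  \<open>a\<close>.\<close>

lemma det_gram:
  fixes q :: "real^('n::finite + 'm::finite \<times> ('n, 's) midx)"
  assumes "inner_prod b"
  shows "det (gram b q) \<noteq> 0"
proof -
  have "a = 0" if a: "gram b q *v a = 0" for a
  proof -
    let ?\<xi> = "\<Sum>i\<in>UNIV. a $ i *\<^sub>R frame q i"
    have k: "b (frame q k) ?\<xi> = 0" for k
      using a unfolding gram_sum[OF assms] by (simp add: vec_eq_iff matrix_vector_mult_def)
    have "b ?\<xi> ?\<xi> = (\<Sum>i\<in>UNIV. a $ i * b ?\<xi> (frame q i))"
      by (simp add: linear_sum[OF inner_prodD(1)[OF assms]] linear_cmul[OF inner_prodD(1)[OF assms]])
    also have "\<dots> = 0"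
      using k inner_prodD(2)[OF assms, of ?\<xi>] by (intro sum.neutral ballI) (simp only: mult_zero_right)
    finally have "?\<xi> = 0" using inner_prodD(3)[OF assms, of ?\<xi>] by (metis less_irrefl)
    then have "a $ j = 0" for j using frame_sum_Inl[of "\<lambda>i. a $ i" q j] by simp
    then show ?thesis by (simp add: vec_eq_iff)
  qed
  then obtain B where "B ** gram b q = mat 1"
    using matrix_left_invertible_ker[of "gram b q"] by blast
  then have "det B * det (gram b q) = 1" by (metis det_mul det_I)
  then show ?thesis by auto
qed

lemma frame_coord_unique:
  assumes b: "inner_prod b" and "\<And>k. b (frame q k) (\<Sum>i\<in>UNIV. a i *\<^sub>R frame q i) = b (frame q k) \<xi>"
  shows "frame_coord b q i \<xi> = a i"
proof -
  have "frame_coord b q i \<xi> = (\<Sum>j\<in>UNIV. matrix_inv (gram b q) $ i $ j * (\<Sum>l\<in>UNIV. gram b q $ j $ l * a l))"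
    by (simp add: frame_coord_def assms(2)[symmetric] gram_sum[OF b])
  also have "\<dots> = (\<Sum>l\<in>UNIV. (\<Sum>j\<in>UNIV. matrix_inv (gram b q) $ i $ j * gram b q $ j $ l) * a l)"
    unfolding sum_distrib_left sum_distrib_right by (subst sum.swap) (simp add: mult_ac)
  also have "\<dots> = a i"
    unfolding matrix_inv_sum(2)[OF det_gram[OF b]] by (simp add: if_distrib[of "\<lambda>c. c * _"] cong: if_cong)
  finally show ?thesis .
qed

lemma frame_coord_projection:
  assumes b: "inner_prod b"
  shows "b (frame q k) (\<Sum>i\<in>UNIV. frame_coord b q i \<xi> *\<^sub>R frame q i) = b (frame q k) \<xi>"
proof -
  have "b (frame q k) (\<Sum>i\<in>UNIV. frame_coord b q i \<xi> *\<^sub>R frame q i)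
      = (\<Sum>j\<in>UNIV. (\<Sum>i\<in>UNIV. gram b q $ k $ i * matrix_inv (gram b q) $ i $ j) * b (frame q j) \<xi>)"
    unfolding gram_sum[OF b] frame_coord_def sum_distrib_left sum_distrib_right by (subst sum.swap) (simp add: mult_ac)
  also have "\<dots> = b (frame q k) \<xi>"
    unfolding matrix_inv_sum(1)[OF det_gram[OF b]] by (simp add: if_distrib[of "\<lambda>c. c * _"] cong: if_cong)
  finally show ?thesis .
qed

lemma frame_coord_frame: "inner_prod b \<Longrightarrow> frame_coord b q i (\<Sum>j\<in>UNIV. a j *\<^sub>R frame q j) = a i"
  by (rule frame_coord_unique) auto

lemma linear_frame_coord:
  assumes "inner_prod b"
  shows "linear (frame_coord b q i)"
  by (rule linearI) (simp_all add: frame_coord_def linear_add[OF inner_prodD(1)[OF assms]]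
      linear_cmul[OF inner_prodD(1)[OF assms]] distrib_left sum.distrib sum_distrib_left mult_ac)

text \<open>\<open>D\<close> is an isometry that carries one contact element onto the other and so
  commutes with the orthogonal projections; in coordinates it acts through \<open>A\<close>.\<close>

lemma frame_coord_change:
  fixes A :: "real^'n::finite^'n::finite"
    and q :: "real^('n::finite + 'm::finite \<times> ('n, 's) midx)" and q' :: "real^('n::finite + 'm::finite \<times> ('n, 's) midx)"
  assumes b: "inner_prod b" and b': "inner_prod b'" and D: "linear D"
    and iso: "\<And>\<xi> \<zeta>. b \<xi> \<zeta> = b' (D \<xi>) (D \<zeta>)"
    and A: "\<And>i. D (frame q i) = (\<Sum>j\<in>UNIV. A $ i $ j *\<^sub>R frame q' j)" "det A \<noteq> 0"
  shows "frame_coord b' q' j (D \<xi>) = (\<Sum>i\<in>UNIV. A $ i $ j * frame_coord b q i \<xi>)"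
proof (rule frame_coord_unique[OF b'])
  fix k
  let ?P = "\<Sum>i\<in>UNIV. frame_coord b q i \<xi> *\<^sub>R frame q i"
  have "(\<Sum>j\<in>UNIV. (\<Sum>i\<in>UNIV. A $ i $ j * frame_coord b q i \<xi>) *\<^sub>R frame q' j)
      = (\<Sum>i\<in>UNIV. frame_coord b q i \<xi> *\<^sub>R (\<Sum>j\<in>UNIV. A $ i $ j *\<^sub>R frame q' j))"
    unfolding scaleR_sum_left scaleR_sum_right by (subst sum.swap) (simp add: mult.commute)
  also have "\<dots> = D ?P" by (simp add: linear_sum[OF D] linear_cmul[OF D] A(1))
  finally have P: "(\<Sum>j\<in>UNIV. (\<Sum>i\<in>UNIV. A $ i $ j * frame_coord b q i \<xi>) *\<^sub>R frame q' j) = D ?P" .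
  \<comment> \<open>Invertibility of \<open>A\<close> makes the new frame a combination of images of
    the old one, so orthogonality can be tested before applying \<open>D\<close>.\<close>
  have "(\<Sum>i\<in>UNIV. matrix_inv A $ k $ i *\<^sub>R D (frame q i))
      = (\<Sum>j\<in>UNIV. (\<Sum>i\<in>UNIV. matrix_inv A $ k $ i * A $ i $ j) *\<^sub>R frame q' j)"
    unfolding A(1) scaleR_sum_left scaleR_sum_right by (subst sum.swap) simp
  also have "\<dots> = frame q' k"
    unfolding matrix_inv_sum(2)[OF A(2)] by (simp add: if_distrib[of "\<lambda>c. c *\<^sub>R _"] cong: if_cong)
  finally have f: "frame q' k = (\<Sum>i\<in>UNIV. matrix_inv A $ k $ i *\<^sub>R D (frame q i))" by simp
  have "b' (frame q' k) (D \<zeta>) = (\<Sum>i\<in>UNIV. matrix_inv A $ k $ i * b (frame q i) \<zeta>)" for \<zeta>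
  proof -
    have "b' (frame q' k) (D \<zeta>) = b' (D \<zeta>) (\<Sum>i\<in>UNIV. matrix_inv A $ k $ i *\<^sub>R D (frame q i))"
      unfolding f[symmetric] by (rule inner_prodD(2)[OF b'])
    also have "\<dots> = (\<Sum>i\<in>UNIV. matrix_inv A $ k $ i * b \<zeta> (frame q i))"
      by (simp add: linear_sum[OF inner_prodD(1)[OF b']] linear_cmul[OF inner_prodD(1)[OF b']] iso)
    finally show ?thesis by (simp only: inner_prodD(2)[OF b, of \<zeta>])
  qed
  then show "b' (frame q' k) (\<Sum>j\<in>UNIV. (\<Sum>i\<in>UNIV. A $ i $ j * frame_coord b q i \<xi>) *\<^sub>R frame q' j) = b' (frame q' k) (D \<xi>)"
    unfolding P by (simp only: frame_coord_projection[OF b])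
qed

subsection \<open>Wedge products with a one-form\<close>

lemma wedge_sum_left:
  "(\<Sum>\<sigma>\<in>I. k \<sigma> * wedge p r (\<alpha> \<sigma>) \<beta> z v) = wedge p r (\<lambda>z v. \<Sum>\<sigma>\<in>I. k \<sigma> * \<alpha> \<sigma> z v) \<beta> z v"
  unfolding wedge_def sum_distrib_left sum_distrib_right times_divide_eq_right sum_divide_distrib
  by (subst sum.swap) (simp add: mult_ac)

text \<open>Applied with \<open>k\<close> the Jacobian factor: under pull-back the one-form is
  divided by \<open>k\<close> and the n-form multiplied by it, so their product is
  invariant.\<close>

lemma wedge_scaled:
  assumes "\<And>w. \<alpha> z w = k * \<alpha>' z' (\<lambda>i. D (w i))" "\<And>w. \<beta>' z' (\<lambda>i. D (w i)) = k * \<beta> z w"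
  shows "wedge p r \<alpha> \<beta> z v = wedge p r \<alpha>' \<beta>' z' (\<lambda>i. D (v i))"
  unfolding wedge_def by (simp add: assms mult_ac)

lemma smooth_wedge_one:
  assumes "open Q" "smooth_form 1 Q \<alpha>" "\<And>i. smooth_form 1 Q (\<beta> i)" "distinct L" "set L = (UNIV :: 'k::finite set)"
  shows "smooth_form (CARD('k) + 1) Q (wedge 1 CARD('k) \<alpha> (wedge_list 1 (map \<beta> L)))"
    "smooth_form CARD('k) Q (wedge_list 1 (map \<beta> L))"
proof -
  have len: "length L = CARD('k)" using assms(4,5) by (metis distinct_card)
  have "smooth_form (length (\<alpha> # map \<beta> L)) Q (wedge_list 1 (\<alpha> # map \<beta> L))"
    by (rule smooth_form_wedge_list_one[OF assms(1)]) (use assms(2,3) in auto)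
  then show "smooth_form (CARD('k) + 1) Q (wedge 1 CARD('k) \<alpha> (wedge_list 1 (map \<beta> L)))"
    by (simp add: len)
  have "smooth_form (length (map \<beta> L)) Q (wedge_list 1 (map \<beta> L))"
    by (rule smooth_form_wedge_list_one[OF assms(1)]) (use assms(3) in auto)
  then show "smooth_form CARD('k) Q (wedge_list 1 (map \<beta> L))" by (simp add: len)
qed

subsection \<open>Smoothness of the normal form\<close>

lemma partials_add_const:
  fixes f :: "real^'k::finite \<Rightarrow> real"
  assumes "smooth_on UNIV f" "L \<noteq> []"
  shows "partials L (\<lambda>t. a + f t) = partials L f"
proof -
  obtain L0 j where L: "L = L0 @ [j]" using assms(2) by (metis rev_exhaust)
  have "partial j (\<lambda>t. a + f t) = partial j f"
    using partial_linear(1)[OF smooth_on_differentiable[OF smooth_on_const[OF open_UNIV] UNIV_I]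
        smooth_on_differentiable[OF assms(1) UNIV_I]]
    by (simp add: fun_eq_iff partial_def)
  then show ?thesis by (simp add: L partials_append)
qed

text \<open>Each coordinate of the jet is either a coordinate of \<open>q\<close> or a constant, the
  derivatives of the x-block of a graph being independent of \<open>q\<close>.\<close>

lemma smooth_graph_jet:
  "smooth_on UNIV (graph_jet :: real^('n::{finite,linorder} + 'm::finite \<times> ('n, 's::finite) midx) \<Rightarrow> _)"
  unfolding smooth_on_vec_iff[OF open_UNIV]
proof
  fix k :: "('n + 'm) \<times> ('n, 's) midx"
  obtain A J where k: "k = (A, J)" by (cases k)
  show "smooth_on UNIV (\<lambda>q :: real^('n + 'm \<times> ('n, 's) midx). graph_jet q $ k)"
  proof (cases A)
    case (Inr \<sigma>)
    then show ?thesis by (simp add: k graph_jet_nth smooth_on_component)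
  next
    case (Inl i)
    show ?thesis
    proof (cases "J = midx_empty")
      case True
      then show ?thesis by (simp add: k Inl graph_jet_nth smooth_on_component)
    next
      case False
      then have "midx_list J \<noteq> []" by (metis length_midx_list list.size(3) midx_size_eq_0_iff)
      then have "graph_jet q $ k = partials (midx_list J) (\<lambda>t. t $ i) 0" for q :: "real^('n + 'm \<times> ('n, 's) midx)"
        by (simp add: k Inl graph_jet_def jet_coords_def graph_map_def partials_add_const[OF smooth_on_component[OF open_UNIV]])
      then show ?thesis by (simp add: smooth_on_const)
    qed
  qed
qed

lemma smooth_qcoords:
  "smooth_on x_regular (qcoords :: real^(('n::{finite,linorder} + 'm::finite) \<times> ('n, 's::finite) midx) \<Rightarrow> _)"
  unfolding smooth_on_vec_iff[OF open_x_regular]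
proof
  fix k :: "'n + 'm \<times> ('n, 's) midx"
  show "smooth_on x_regular (\<lambda>z :: real^(('n + 'm) \<times> ('n, 's) midx). qcoords z $ k)"
    by (cases k) (auto simp: qcoords_nth smooth_on_component open_x_regular smooth_y_coord)
qed

lemma smooth_frame: "open Q \<Longrightarrow> smooth_on Q (\<lambda>q. frame q i $ A)"
  by (cases A) (simp_all add: frame_nth smooth_on_const smooth_on_y_first)

context smooth_manifold
begin

definition is_metric :: "(('x, real^'a) chart \<Rightarrow> real^'a \<Rightarrow> real^'a \<Rightarrow> real^'a \<Rightarrow> real) \<Rightarrow> bool" where
  "is_metric g \<longleftrightarrow> (\<forall>c\<in>\<A>. \<forall>u\<in>chart_dom c. inner_prod (g c u)) \<and>
    (\<forall>c\<in>\<A>. \<forall>\<xi> \<zeta>. smooth_on (chart_dom c) (\<lambda>u. g c u \<xi> \<zeta>)) \<and>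
    (\<forall>c\<in>\<A>. \<forall>c'\<in>\<A>. \<forall>p\<in>fst c \<inter> fst c'. \<forall>\<xi> \<zeta>.
      g c (snd c p) \<xi> \<zeta> = g c' (snd c' p) (dtrans c c' p \<xi>) (dtrans c c' p \<zeta>))"

definition metric :: "('x, real^'a) chart \<Rightarrow> real^'a \<Rightarrow> real^'a \<Rightarrow> real^'a \<Rightarrow> real" where
  "metric = (SOME g. is_metric g)"

lemma is_metric_metric: "is_metric metric"
proof -
  obtain g where "is_metric g"
    using metric_exists unfolding is_metric_def inner_prod_def by blast
  then show ?thesis unfolding metric_def by (rule someI[of is_metric])
qed

lemma inner_prod_metric: "c \<in> \<A> \<Longrightarrow> u \<in> chart_dom c \<Longrightarrow> inner_prod (metric c u)"
  and smooth_metric: "c \<in> \<A> \<Longrightarrow> smooth_on (chart_dom c) (\<lambda>u. metric c u \<xi> \<zeta>)"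
  and metric_change: "c \<in> \<A> \<Longrightarrow> c' \<in> \<A> \<Longrightarrow> p \<in> fst c \<Longrightarrow> p \<in> fst c' \<Longrightarrow>
    metric c (snd c p) \<xi> \<zeta> = metric c' (snd c' p) (dtrans c c' p \<xi>) (dtrans c c' p \<zeta>)"
  using is_metric_metric unfolding is_metric_def by blast+

text \<open>Reduces smoothness of the metric on moving vectors to that of its coefficients.\<close>

lemma metric_axes:
  assumes "c \<in> \<A>" "u \<in> chart_dom c"
  shows "metric c u \<xi> \<zeta> = (\<Sum>A\<in>UNIV. \<Sum>B\<in>UNIV. \<xi> $ A * \<zeta> $ B * metric c u (axis A 1) (axis B 1))"
proof -
  note ip = inner_prod_metric[OF assms]
  have ex: "metric c u \<xi> \<zeta> = (\<Sum>B\<in>UNIV. \<zeta> $ B * metric c u \<xi> (axis B 1))" for \<xi> \<zeta>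
  proof -
    have "\<zeta> = (\<Sum>B\<in>UNIV. \<zeta> $ B *\<^sub>R axis B 1)"
      by (simp add: vec_eq_iff axis_def if_distrib cong: if_cong)
    then have "metric c u \<xi> \<zeta> = metric c u \<xi> (\<Sum>B\<in>UNIV. \<zeta> $ B *\<^sub>R axis B 1)" by simp
    then show ?thesis by (simp add: linear_sum[OF inner_prodD(1)[OF ip]] linear_cmul[OF inner_prodD(1)[OF ip]])
  qed
  have "metric c u \<xi> \<zeta> = (\<Sum>A\<in>UNIV. \<xi> $ A * metric c u \<zeta> (axis A 1))"
    using ex[of \<zeta> \<xi>] inner_prodD(2)[OF ip, of \<xi> \<zeta>] by simp
  also have "\<dots> = (\<Sum>A\<in>UNIV. \<xi> $ A * (\<Sum>B\<in>UNIV. \<zeta> $ B * metric c u (axis A 1) (axis B 1)))"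
    unfolding inner_prodD(2)[OF ip, of \<zeta>] ex[of "axis _ 1" \<zeta>] ..
  finally show ?thesis by (simp add: sum_distrib_left mult.assoc)
qed

end

subsection \<open>The local forms and the global form\<close>

context homogeneous_equation
begin

text \<open>T_\<sigma> in the coordinates of the quotient; on a graph det (x) = 1, so the
  denominator disappears.\<close>

definition Tq :: "('x, real^('n + 'm)) chart \<Rightarrow> 'm \<Rightarrow> real^('n + 'm \<times> ('n, 's) midx) \<Rightarrow> real" where
  "Tq c \<sigma> q = cmp c (Inr \<sigma>) (graph_jet q)"

definition tau :: "('x, real^('n + 'm)) chart \<Rightarrow> real^('n + 'm \<times> ('n, 's) midx) \<Rightarrow> real^('n + 'm \<times> ('n, 's) midx) \<Rightarrow> real" where
  "tau c q x = (\<Sum>\<sigma>\<in>UNIV. Tq c \<sigma> q * cform \<sigma> q x)"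

definition tau_form :: "('x, real^('n + 'm)) chart \<Rightarrow> (real^('n + 'm \<times> ('n, 's) midx)) eform" where
  "tau_form c = (\<lambda>q v. tau c q (v 0))"

definition indices :: "'n list" where
  "indices = sorted_list_of_set UNIV"

definition frame_form :: "('x, real^('n + 'm)) chart \<Rightarrow> 'n \<Rightarrow> (real^('n + 'm \<times> ('n, 's) midx)) eform" where
  "frame_form c i = (\<lambda>q v. frame_coord (metric c (xy_part q)) q i (xy_part (v 0)))"

text \<open>Takes the place of \<open>theta0\<close>. The i-th factor is the i-th coordinate of the
  projection onto the contact element: on horizontal vectors it is dx^i, but under a change of chart
  it transforms by the matrix (D_i x'^j) on all vectors.\<close>

definition Theta :: "('x, real^('n + 'm)) chart \<Rightarrow> (real^('n + 'm \<times> ('n, 's) midx)) eform" where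
  "Theta c = wedge_list 1 (map (frame_form c) indices)"

definition omega :: "('x, real^('n + 'm)) chart \<Rightarrow> (real^('n + 'm \<times> ('n, 's) midx)) eform" where
  "omega c = wedge 1 CARD('n) (tau_form c) (Theta c)"

lemma indices: "distinct indices" "set indices = UNIV"
  by (simp_all add: indices_def)

lemma theta0_indices: "theta0 = wedge_list 1 (map (\<lambda>i. dcoord (Inl i)) indices)"
  by (simp add: theta0_def indices_def)

lemma Tfun_pt:
  assumes "c \<in> \<A>" "q \<in> qdom c"
  shows "Tfun c \<sigma> (pt c q) = Tq c \<sigma> q"
proof -
  obtain U where U: "adapted_rep c (gvel c q) U" "crd c (gvel c q) 0 = graph_jet q"
    using gvelE[OF assms] by metis
  show ?thesis
    unfolding pt_def Tfun_rho[OF U(1)] U(2) Tq_def by (simp add: graph_jet_def x_matrix_graph_map det_I)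
qed

lemma smooth_Tq:
  assumes "c \<in> \<A>"
  shows "smooth_on (qdom c) (Tq c \<sigma>)"
proof -
  let ?N = "x_regular \<inter> base_coords -` chart_dom c :: (real^(('n + 'm) \<times> ('n, 's) midx)) set"
  have "?N \<subseteq> chart_dom (vchart c)"
  proof
    fix z assume "z \<in> ?N"
    then obtain \<gamma> U where "adapted_rep c \<gamma> U" "crd c \<gamma> 0 = z" using velocity_exists[OF assms, of z] by blast
    then show "z \<in> chart_dom (vchart c)" using vchart_adapted(4) by metis
  qed
  then have sm: "smooth_on ?N (cmp c (Inr \<sigma>))" by (rule smooth_on_subset[OF smooth_comp[OF de assms]])
  have "base_coords (graph_jet q) = xy_part q" for q :: "real^('n + 'm \<times> ('n, 's) midx)"
    by (simp add: graph_jet_def base_coords_jet_coords graph_jet_nth)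
  then have "graph_jet ` qdom c \<subseteq> ?N" using graph_jet_regular by (auto simp: qdom_def)
  then show ?thesis
    unfolding Tq_def[abs_def]
    by (intro smooth_on_compose[OF open_qdom[OF assms] open_adapted_domain[OF open_chart_dom[OF assms]] _
          smooth_on_subset[OF smooth_graph_jet subset_UNIV] sm])
qed

lemma linear_tau: "linear (tau c q)"
  by (rule linearI) (simp_all add: tau_def linear_add[OF linear_cform] linear_cmul[OF linear_cform]
      distrib_left sum.distrib sum_distrib_left mult_ac)

lemma smooth_tau_form: "c \<in> \<A> \<Longrightarrow> smooth_form 1 (qdom c) (tau_form c)"
  unfolding tau_form_def
  by (rule smooth_form_one[OF open_qdom linear_tau])
    (auto simp: tau_def intro!: smooth_on_sum smooth_on_mult smooth_Tq smooth_on_cform open_qdom)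

lemma smooth_dcoord: "open Q \<Longrightarrow> smooth_form 1 Q (dcoord k)"
  unfolding dcoord_def[abs_def]
  by (rule smooth_form_one) (auto intro: smooth_on_const bounded_linear.linear[OF bounded_linear_vec_nth])

lemma smooth_metric_xy:
  assumes "c \<in> \<A>" "\<And>A. smooth_on (qdom c) (\<lambda>q. f q $ A)" "\<And>A. smooth_on (qdom c) (\<lambda>q. h q $ A)"
  shows "smooth_on (qdom c) (\<lambda>q. metric c (xy_part q) (f q) (h q))"
proof (rule smooth_on_cong[OF open_qdom[OF assms(1)]])
  have "smooth_on (qdom c) (\<lambda>q. metric c (xy_part q) (axis A 1) (axis B 1))" for A B
    by (rule smooth_on_compose[OF open_qdom[OF assms(1)] open_chart_dom[OF assms(1)] _
          smooth_on_linear[OF open_qdom[OF assms(1)] bounded_linear_xy_part] smooth_metric[OF assms(1)]])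
      (auto simp: qdom_def)
  then show "smooth_on (qdom c) (\<lambda>q. \<Sum>A\<in>UNIV. \<Sum>B\<in>UNIV. f q $ A * h q $ B * metric c (xy_part q) (axis A 1) (axis B 1))"
    by (intro smooth_on_sum smooth_on_mult assms(2,3) open_qdom[OF assms(1)])
  show "(\<Sum>A\<in>UNIV. \<Sum>B\<in>UNIV. f q $ A * h q $ B * metric c (xy_part q) (axis A 1) (axis B 1))
      = metric c (xy_part q) (f q) (h q)" if "q \<in> qdom c" for q
    by (rule metric_axes[OF assms(1), symmetric]) (use that in \<open>simp add: qdom_def\<close>)
qed

lemma inner_prod_xy: "c \<in> \<A> \<Longrightarrow> q \<in> qdom c \<Longrightarrow> inner_prod (metric c (xy_part q))"
  by (rule inner_prod_metric) (simp_all add: qdom_def)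

lemma smooth_frame_form:
  assumes "c \<in> \<A>"
  shows "smooth_form 1 (qdom c) (frame_form c i)"
  unfolding frame_form_def
proof (rule smooth_form_one[OF open_qdom[OF assms]])
  note op = open_qdom[OF assms]
  show "linear (\<lambda>x. frame_coord (metric c (xy_part q)) q i (xy_part x))" if "q \<in> qdom c" for q
    using linear_compose[OF linear_xy_part linear_frame_coord[OF inner_prod_xy[OF assms that]]] by (simp add: o_def)
  have "smooth_on (qdom c) (\<lambda>q. gram (metric c (xy_part q)) q $ k $ l)" for k l
    unfolding gram_def by (simp add: smooth_metric_xy[OF assms smooth_frame[OF op] smooth_frame[OF op]])
  then have "smooth_on (qdom c) (\<lambda>q. matrix_inv (gram (metric c (xy_part q)) q) $ k $ l)" for k l
    by (rule smooth_on_matrix_inv[OF op]) (rule det_gram[OF inner_prod_xy[OF assms]])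
  then show "smooth_on (qdom c) (\<lambda>q. frame_coord (metric c (xy_part q)) q i (xy_part x))" for x
    unfolding frame_coord_def
    by (intro smooth_on_sum smooth_on_mult smooth_metric_xy[OF assms smooth_frame[OF op]] smooth_on_const op)
qed

lemma smooth_omega: "c \<in> \<A> \<Longrightarrow> smooth_form (CARD('n) + 1) (qdom c) (omega c)"
  unfolding omega_def Theta_def
  by (rule smooth_wedge_one(1)[OF open_qdom smooth_tau_form smooth_frame_form indices])

lemma local_T_eq:
  assumes "c \<in> \<A>" "q \<in> qdom c"
  shows "local_T (qchart c) (Tfun c) q v = wedge 1 CARD('n) (tau_form c) theta0 q v"
proof -
  have "local_T (qchart c) (Tfun c) q v
      = wedge 1 CARD('n) (\<lambda>z v. \<Sum>\<sigma>\<in>UNIV. Tq c \<sigma> q * contact \<sigma> midx_empty z v) theta0 q v"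
    unfolding local_T_def qchart_pt(3)[OF assms] Tfun_pt[OF assms] by (rule wedge_sum_left)
  then show ?thesis by (simp add: wedge_def tau_form_def tau_def contact_empty)
qed

lemma tau_horizontal: "(\<And>\<sigma>. cform \<sigma> q x = 0) \<Longrightarrow> tau c q x = 0"
  by (simp add: tau_def)

text \<open>The criterion only tests families whose arguments after the first are horizontal, and on
  such arguments \<open>Theta\<close> and \<open>theta0\<close> coincide.\<close>

lemma omega_local_T:
  assumes "c \<in> \<A>"
  shows "strongly_contact (CARD('n) + 1) (qdom c) (\<lambda>q v. omega c q v - local_T (qchart c) (Tfun c) q v)"
proof -
  note op = open_qdom[OF assms]
  note th0 = smooth_wedge_one[OF op smooth_tau_form[OF assms] smooth_dcoord[OF op] indices, of Inl, folded theta0_indices]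
  have "strongly_contact (CARD('n) + 1) (qdom c) (\<lambda>q v. omega c q v - wedge 1 CARD('n) (tau_form c) theta0 q v)"
  proof (rule strongly_contact_criterion[OF op smooth_form_diff[OF op smooth_omega[OF assms] th0(1)]])
    fix q :: "real^('n + 'm \<times> ('n, 's) midx)" and v :: "nat \<Rightarrow> real^('n + 'm \<times> ('n, 's) midx)"
    assume q: "q \<in> qdom c" and hor: "\<And>i \<sigma>. 0 < i \<Longrightarrow> cform \<sigma> q (v i) = 0"
    have alt: "alt_map CARD('n) (Theta c q)" "alt_map CARD('n) (theta0 q)"
      using smooth_wedge_one(2)[OF op smooth_tau_form[OF assms] smooth_frame_form[OF assms] indices] th0(2) q
      by (simp_all add: smooth_form_iff Theta_def)
    have "Theta c q (\<lambda>i. v (Suc i)) = theta0 q (\<lambda>i. v (Suc i))"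
      unfolding Theta_def theta0_indices
    proof (rule wedge_list_one_eq[OF indices])
      fix j k
      have "xy_part (v (Suc k)) = (\<Sum>i\<in>UNIV. v (Suc k) $ Inl i *\<^sub>R frame q i)"
        by (rule horizontal_xy_part) (simp add: hor)
      then show "frame_form c j q (\<lambda>_. v (Suc k)) = dcoord (Inl j) q (\<lambda>_. v (Suc k))"
        by (simp add: frame_form_def dcoord_def frame_coord_frame[OF inner_prod_xy[OF assms q]])
    qed (simp_all add: frame_form_def dcoord_def)
    moreover have "omega c q v = tau_form c q (\<lambda>_. v 0) * Theta c q (\<lambda>i. v (Suc i))"
      unfolding omega_def by (rule wedge_horizontal[where B = "Theta c", OF alt(1)]) (simp_all add: tau_form_def hor tau_horizontal)
    moreover have "wedge 1 CARD('n) (tau_form c) theta0 q v = tau_form c q (\<lambda>_. v 0) * theta0 q (\<lambda>i. v (Suc i))"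
      by (rule wedge_horizontal[where B = theta0, OF alt(2)]) (simp_all add: tau_form_def hor tau_horizontal)
    ultimately show "omega c q v - wedge 1 CARD('n) (tau_form c) theta0 q v = 0" by simp
  qed
  then show ?thesis by (rule strongly_contact_cong) (simp add: local_T_eq[OF assms])
qed

subsection \<open>Change of chart\<close>

text \<open>The coordinates of the orbits adapted to both charts (\<open>overlap_image\<close>): on
  graphs over \<open>c\<close> the determinant of the second x-matrix is
  \<open>jac_factor\<close>.\<close>

definition overlap :: "('x, real^('n + 'm)) chart \<Rightarrow> ('x, real^('n + 'm)) chart \<Rightarrow> (real^('n + 'm \<times> ('n, 's) midx)) set" where
  "overlap c c' = {q \<in> xy_part -` (snd c ` (fst c \<inter> fst c')). jac_factor c c' q \<noteq> 0}"

lemma overlap_qdom: "overlap c c' \<subseteq> qdom c"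
  by (auto simp: overlap_def qdom_def)

lemma overlapI:
  assumes "c \<in> \<A>" "q \<in> qdom c" "adapted_rep c' (gvel c q) U'"
  shows "q \<in> overlap c c'"
proof -
  obtain U where U: "adapted_rep c (gvel c q) U" "crd c (gvel c q) 0 = graph_jet q"
    "qcoords (crd c (gvel c q) 0) = q" "snd c (gvel c q 0) = xy_part q"
    using gvelE[OF assms(1,2)] by metis
  note r = repD[OF adapted_repD(1)[OF U(1)]] and r' = repD[OF adapted_repD(1)[OF assms(3)]]
  have "det (x_matrix (crd c' (gvel c q) 0)) \<noteq> 0" using adapted_repD(2)[OF assms(3)] by (simp add: x_regular_def)
  then have "jac_factor c c' q \<noteq> 0"
    using det_x_matrix_change[OF U(1) adapted_repD(1)[OF assms(3)]] U(3) by auto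
  moreover have "xy_part q \<in> snd c ` (fst c \<inter> fst c')" unfolding U(4)[symmetric] using r(6) r'(6) by blast
  ultimately show ?thesis by (simp add: overlap_def)
qed

lemma overlapE:
  assumes "c \<in> \<A>" "c' \<in> \<A>" "q \<in> overlap c c'"
  obtains U U' where "adapted_rep c (gvel c q) U" "adapted_rep c' (gvel c q) U'"
    "crd c (gvel c q) 0 = graph_jet q" "qcoords (crd c (gvel c q) 0) = q" "snd c (gvel c q 0) = xy_part q"
proof -
  have q: "q \<in> qdom c" using assms(3) overlap_qdom by blast
  obtain U where U: "adapted_rep c (gvel c q) U" "crd c (gvel c q) 0 = graph_jet q"
    "qcoords (crd c (gvel c q) 0) = q" "snd c (gvel c q 0) = xy_part q"
    using gvelE[OF assms(1) q] by metis
  note rep = adapted_repD(1)[OF U(1)]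
  note r = repD[OF rep]
  obtain p where p: "p \<in> fst c" "p \<in> fst c'" "xy_part q = snd c p" using assms(3) by (auto simp: overlap_def)
  have "gvel c q 0 = chart_inv c (snd c (gvel c q 0))" by (rule chart_inv_chart[OF r(1,6), symmetric])
  also have "\<dots> = p" unfolding U(4) p(3) by (rule chart_inv_chart[OF r(1) p(1)])
  finally have "gvel c q 0 \<in> fst c'" using p(2) by simp
  then obtain W where W: "rep c' (gvel c q) W" using germ_rep[OF rep_germ[OF rep] assms(2)] by blast
  have "det (x_matrix (crd c' (gvel c q) 0)) \<noteq> 0"
    using det_x_matrix_change[OF U(1) W] U(3) adapted_repD(2)[OF U(1)] assms(3)
    by (simp add: overlap_def x_regular_def)
  then obtain U' where "adapted_rep c' (gvel c q) U'" using adapted_shrink[OF W] by (auto simp: x_regular_def)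
  with U show thesis using that by blast
qed

text \<open>A common point yields two velocities in one orbit, each adapted to one of the charts.
  Adaptedness is stable along orbits, so the graph over \<open>c\<close> is adapted to both.\<close>

lemma qchart_common:
  assumes c: "c \<in> \<A>" and c': "c' \<in> \<A>" and p: "p \<in> fst (qchart c)" "p \<in> fst (qchart c')"
  obtains q where "q \<in> overlap c c'" "p = pt c q" "snd (qchart c) p = q"
proof -
  obtain v where v: "p = rho \<A> CARD('s) v" "v \<in> adapted \<A> CARD('s) c" using p(1) by (auto simp: fst_qchart)
  obtain \<gamma> U where \<gamma>: "v = jet \<A> CARD('s) \<gamma>" "adapted_rep c \<gamma> U" using adaptedE[OF v(2) c] .
  let ?q = "qcoords (crd c \<gamma> 0)"
  have pq: "p = pt c ?q" using rho_eq_pt[OF \<gamma>(2)] v(1) \<gamma>(1) by simp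
  have "xy_part ?q \<in> chart_dom c" using repD(6)[OF adapted_repD(1)[OF \<gamma>(2)]] by (simp add: xy_part_qcoords)
  then have q: "?q \<in> qdom c" by (simp add: qdom_def)
  obtain W where W: "adapted_rep c (gvel c ?q) W" using gvelE[OF c q] by metis
  obtain w where w: "p = rho \<A> CARD('s) w" "w \<in> adapted \<A> CARD('s) c'" using p(2) by (auto simp: fst_qchart)
  obtain \<delta> V where \<delta>: "w = jet \<A> CARD('s) \<delta>" "adapted_rep c' \<delta> V" using adaptedE[OF w(2) c'] .
  have "jet \<A> CARD('s) (gvel c ?q) \<in> rho \<A> CARD('s) (jet \<A> CARD('s) (gvel c ?q))"
    unfolding rho_jet[OF rep_germ[OF adapted_repD(1)[OF W]]]
    by (intro CollectI exI[of _ "\<lambda>t. t"]) (simp add: local_diffeo_id)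
  also have "\<dots> = rho \<A> CARD('s) (jet \<A> CARD('s) \<delta>)" using pq w(1) \<delta>(1) by (simp add: pt_def)
  finally obtain \<alpha> where \<alpha>: "local_diffeo \<alpha>" "jet \<A> CARD('s) (gvel c ?q) = jet \<A> CARD('s) (\<lambda>t. \<delta> (\<alpha> t))"
    unfolding rho_jet[OF rep_germ[OF adapted_repD(1)[OF \<delta>(2)]]] by blast
  obtain V' where "adapted_rep c' (\<lambda>t. \<delta> (\<alpha> t)) V'" using adapted_rep_reparam[OF \<delta>(2) \<alpha>(1)] by metis
  then have "jet \<A> CARD('s) (gvel c ?q) \<in> adapted \<A> CARD('s) c'" using adapted_rep_jet \<alpha>(2) by simp
  then obtain U' where "adapted_rep c' (gvel c ?q) U'" using adapted_rep_change_chart[OF W c'] by blast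
  then have "?q \<in> overlap c c'" by (rule overlapI[OF c q])
  then show thesis using that pq qchart_pt(2)[OF c q] by simp
qed

lemma overlap_image:
  assumes c: "c \<in> \<A>" and c': "c' \<in> \<A>"
  shows "snd (qchart c) ` rho \<A> CARD('s) ` (adapted \<A> CARD('s) c \<inter> adapted \<A> CARD('s) c') = overlap c c'"
proof (intro equalityI subsetI)
  fix q assume "q \<in> snd (qchart c) ` rho \<A> CARD('s) ` (adapted \<A> CARD('s) c \<inter> adapted \<A> CARD('s) c')"
  then obtain v where v: "v \<in> adapted \<A> CARD('s) c" "v \<in> adapted \<A> CARD('s) c'" "q = snd (qchart c) (rho \<A> CARD('s) v)" by blast
  show "q \<in> overlap c c'"
    by (rule qchart_common[OF c c', of "rho \<A> CARD('s) v"]) (use v in \<open>auto simp: fst_qchart\<close>)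
next
  fix q assume q: "q \<in> overlap c c'"
  obtain U U' where U: "adapted_rep c (gvel c q) U" "adapted_rep c' (gvel c q) U'" using overlapE[OF c c' q] by metis
  have "q = snd (qchart c) (rho \<A> CARD('s) (jet \<A> CARD('s) (gvel c q)))"
    using qchart_pt(2)[OF c subsetD[OF overlap_qdom q]] unfolding pt_def by (rule sym)
  then show "q \<in> snd (qchart c) ` rho \<A> CARD('s) ` (adapted \<A> CARD('s) c \<inter> adapted \<A> CARD('s) c')"
    by (rule image_eqI) (rule imageI, rule IntI, rule adapted_rep_jet[OF U(1)], rule adapted_rep_jet[OF U(2)])
qed

lemma open_xy_overlap: "c \<in> \<A> \<Longrightarrow> c' \<in> \<A> \<Longrightarrow> open (xy_part -` (snd c ` (fst c \<inter> fst c')) :: (real^('n + 'm \<times> ('n, 's) midx)) set)"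
  by (intro open_vimage linear_continuous_on bounded_linear_xy_part open_overlap)

lemma smooth_dtrans_xy:
  fixes f :: "real^('n + 'm \<times> ('n, 's) midx) \<Rightarrow> real^('n + 'm)"
  assumes c: "c \<in> \<A>" and c': "c' \<in> \<A>" and f: "smooth_on (xy_part -` (snd c ` (fst c \<inter> fst c'))) f"
  shows "smooth_on (xy_part -` (snd c ` (fst c \<inter> fst c'))) (\<lambda>q. frechet_derivative (transition c c') (at (xy_part q)) (f q))"
  by (rule smooth_on_derivative_at[OF open_xy_overlap[OF c c'] open_overlap[OF c c'] _
        smooth_on_linear[OF open_xy_overlap[OF c c'] bounded_linear_xy_part] f smooth_transition[OF c c']]) auto

lemma xy_overlapE:
  assumes "xy_part q \<in> snd c ` (fst c \<inter> fst c')"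
  obtains p where "p \<in> fst c" "p \<in> fst c'" "xy_part q = snd c p"
  using assms by blast

lemma jac_factor_det:
  assumes "c \<in> \<A>" "c' \<in> \<A>" "xy_part q \<in> snd c ` (fst c \<inter> fst c')"
  shows "jac_factor c c' q = det (\<chi> i j. frechet_derivative (transition c c') (at (xy_part q)) (frame q i) $ Inl j)"
proof -
  obtain p where p: "p \<in> fst c" "p \<in> fst c'" "xy_part q = snd c p" using xy_overlapE[OF assms(3)] .
  show ?thesis
    unfolding jac_factor_def Dtot_transition[OF assms(1,2) p] dtrans_def p(3) ..
qed

lemma open_overlap_set:
  assumes c: "c \<in> \<A>" and c': "c' \<in> \<A>"
  shows "smooth_on (xy_part -` (snd c ` (fst c \<inter> fst c'))) (jac_factor c c' :: real^('n + 'm \<times> ('n, 's) midx) \<Rightarrow> real)"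
    "open (overlap c c')"
proof -
  note op = open_xy_overlap[OF c c']
  have fr: "smooth_on (xy_part -` (snd c ` (fst c \<inter> fst c'))) (\<lambda>q :: real^('n + 'm \<times> ('n, 's) midx). frame q i)" for i
    unfolding smooth_on_vec_iff[OF op] using smooth_frame[OF op] by blast
  have "smooth_on (xy_part -` (snd c ` (fst c \<inter> fst c'))) (\<lambda>q :: real^('n + 'm \<times> ('n, 's) midx).
      det (\<chi> i j. frechet_derivative (transition c c') (at (xy_part q)) (frame q i) $ Inl j))"
    by (rule smooth_on_det[OF op]) (simp add: smooth_on_nth[OF op smooth_dtrans_xy[OF c c' fr]])
  then show sm: "smooth_on (xy_part -` (snd c ` (fst c \<inter> fst c'))) (jac_factor c c' :: real^('n + 'm \<times> ('n, 's) midx) \<Rightarrow> real)"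
    by (rule smooth_on_cong[OF op]) (simp add: jac_factor_det[OF c c'])
  show "open (overlap c c')"
    unfolding overlap_def by (rule open_nonzero[OF op smooth_on_continuous[OF sm]])
qed

definition qtrans :: "('x, real^('n + 'm)) chart \<Rightarrow> ('x, real^('n + 'm)) chart \<Rightarrow>
    real^('n + 'm \<times> ('n, 's) midx) \<Rightarrow> real^('n + 'm \<times> ('n, 's) midx)" where
  "qtrans c c' = transition (qchart c) (qchart c')"

text \<open>The second formula is the one that can be differentiated: a composite of the graph
  section, the change of velocity coordinates and the invariant coordinates, all smooth.\<close>

lemma qtrans_eq:
  assumes c: "c \<in> \<A>" and c': "c' \<in> \<A>" and q: "q \<in> overlap c c'"
  shows "qtrans c c' q = qcoords (crd c' (gvel c q) 0)" "qtrans c c' q = qcoords (vel_trans c c' (graph_jet q))"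
    "xy_part (qtrans c c' q) = transition c c' (xy_part q)" "qtrans c c' q \<in> qdom c'" "pt c' (qtrans c c' q) = pt c q"
proof -
  obtain U U' where U: "adapted_rep c (gvel c q) U" "adapted_rep c' (gvel c q) U'"
    "crd c (gvel c q) 0 = graph_jet q" "snd c (gvel c q 0) = xy_part q" using overlapE[OF c c' q] by metis
  note rep = adapted_repD(1)[OF U(1)] and rep' = adapted_repD(1)[OF U(2)]
  have "q \<in> qdom c" using q overlap_qdom by blast
  then have "qtrans c c' q = snd (qchart c') (pt c q)" by (simp add: qtrans_def transition_def qchart_pt[OF c])
  also have "\<dots> = qcoords (crd c' (gvel c q) 0)" unfolding pt_def by (rule snd_qchart_rho[OF U(2)])
  finally show 1: "qtrans c c' q = qcoords (crd c' (gvel c q) 0)" .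
  then show "qtrans c c' q = qcoords (vel_trans c c' (graph_jet q))"
    using crd_change_chart[OF rep c' repD(6)[OF rep']] U(3) by simp
  have xy: "xy_part (qtrans c c' q) = snd c' (gvel c q 0)" unfolding 1 by (rule xy_part_qcoords)
  then show "xy_part (qtrans c c' q) = transition c c' (xy_part q)"
    using transition_chart[OF c repD(6)[OF rep], of c'] U(4) by simp
  show "qtrans c c' q \<in> qdom c'" using xy repD(6)[OF rep'] by (simp add: qdom_def)
  show "pt c' (qtrans c c' q) = pt c q" unfolding 1 using rho_eq_pt[OF U(2)] by (simp add: pt_def)
qed

text \<open>The forms in question see only the projection of a vector to \<open>X\<close>, and on it
  the derivative acts by the change of charts of \<open>X\<close>.\<close>

lemma qtrans_derivative:
  assumes c: "c \<in> \<A>" and c': "c' \<in> \<A>" and q: "q \<in> overlap c c'"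
  shows "xy_part (frechet_derivative (qtrans c c') (at q) x) = dtrans c c' (gvel c q 0) (xy_part x)"
proof -
  obtain U U' where U: "adapted_rep c (gvel c q) U" "adapted_rep c' (gvel c q) U'"
    "crd c (gvel c q) 0 = graph_jet q" "snd c (gvel c q 0) = xy_part q" using overlapE[OF c c' q] by metis
  note rep = adapted_repD(1)[OF U(1)] and rep' = adapted_repD(1)[OF U(2)]
  note op = open_overlap_set(2)[OF c c']
  have "vel_trans c c' (graph_jet q) \<in> x_regular"
    using crd_change_chart[OF rep c' repD(6)[OF rep']] U(3) adapted_repD(2)[OF U(2)] by simp
  then have dq: "qcoords differentiable (at (vel_trans c c' (graph_jet q)))"
    by (rule smooth_on_differentiable[OF smooth_qcoords])
  have "base_coords (graph_jet q) \<in> snd c ` (fst c \<inter> fst c')"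
    using base_coords_crd[of c "gvel c q" 0] U(3) repD(6)[OF rep] repD(6)[OF rep'] by auto
  then have dv: "vel_trans c c' differentiable (at (graph_jet q))"
    by (intro smooth_on_differentiable[OF smooth_vel_trans[OF c c']]) simp
  have dg: "graph_jet differentiable (at q)" by (rule smooth_on_differentiable[OF smooth_graph_jet UNIV_I])
  have "(\<lambda>q. qcoords (vel_trans c c' (graph_jet q))) differentiable (at q)"
    by (rule frechet_derivative_compose(2)[OF frechet_derivative_compose(2)[OF dg dv] dq])
  then have "((\<lambda>q. qcoords (vel_trans c c' (graph_jet q))) has_derivative
      frechet_derivative (\<lambda>q. qcoords (vel_trans c c' (graph_jet q))) (at q)) (at q)"
    by (simp add: frechet_derivative_works)
  then have F: "(qtrans c c' has_derivative frechet_derivative (\<lambda>q. qcoords (vel_trans c c' (graph_jet q))) (at q)) (at q)"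
    by (rule has_derivative_transform_within_open[OF _ op q]) (rule qtrans_eq(2)[OF c c', symmetric])
  then have "(qtrans c c' has_derivative frechet_derivative (qtrans c c') (at q)) (at q)"
    using frechet_derivative_at by metis
  then have 1: "((\<lambda>q. xy_part (qtrans c c' q)) has_derivative (\<lambda>x. xy_part (frechet_derivative (qtrans c c') (at q) x))) (at q)"
    by (rule bounded_linear.has_derivative[OF bounded_linear_xy_part])
  have "(transition c c' has_derivative dtrans c c' (gvel c q 0)) (at (xy_part q))"
    using has_derivative_transition[OF c c' repD(6)[OF rep] repD(6)[OF rep']] U(4) by simp
  then have "((\<lambda>q. transition c c' (xy_part q)) has_derivative (\<lambda>x. dtrans c c' (gvel c q 0) (xy_part x))) (at q)"
    by (rule has_derivative_compose[OF bounded_linear_imp_has_derivative[OF bounded_linear_xy_part]])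
  then have "((\<lambda>q. xy_part (qtrans c c' q)) has_derivative (\<lambda>x. dtrans c c' (gvel c q 0) (xy_part x))) (at q)"
    by (rule has_derivative_transform_within_open[OF _ op q]) (rule qtrans_eq(3)[OF c c', symmetric])
  from has_derivative_unique[OF 1 this] show ?thesis by metis
qed

text \<open>On the graph over \<open>c\<close> the form is \<T>_A dx^A, a covector on
  \<open>X\<close>. In the second chart the same velocity has det (x') equal to
  \<open>jac_factor\<close> instead of 1, and T_\<sigma> involves division by it.\<close>

lemma tau_change:
  assumes c: "c \<in> \<A>" and c': "c' \<in> \<A>" and q: "q \<in> overlap c c'"
    and x': "xy_part x' = dtrans c c' (gvel c q 0) (xy_part x)"
  shows "tau c q x = jac_factor c c' q * tau c' (qtrans c c' q) x'"
proof -
  obtain U U' where U: "adapted_rep c (gvel c q) U" "adapted_rep c' (gvel c q) U'"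
    "crd c (gvel c q) 0 = graph_jet q" "qcoords (crd c (gvel c q) 0) = q" using overlapE[OF c c' q] by metis
  let ?\<gamma> = "gvel c q"
  let ?z = "graph_jet q" and ?z' = "crd c' ?\<gamma> 0" and ?q' = "qtrans c c' q"
  note r = repD[OF adapted_repD(1)[OF U(1)]] and r' = repD[OF adapted_repD(1)[OF U(2)]]
  have lin: "linear (dtrans c c' (?\<gamma> 0))" by (rule linear_dtrans[OF c c' r(6) r'(6)])
  have J: "det (x_matrix ?z') = jac_factor c c' q"
    using det_x_matrix_change[OF U(1) adapted_repD(1)[OF U(2)]] U(4)
    by (simp add: U(3) graph_jet_def x_matrix_graph_map det_I)
  have J0: "jac_factor c c' q \<noteq> 0" using q by (simp add: overlap_def)
  have "Tq c' \<sigma> ?q' = cmp c' (Inr \<sigma>) ?z' / jac_factor c c' q" for \<sigma>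
    using Tfun_pt[OF c' qtrans_eq(4)[OF c c' q], of \<sigma>] qtrans_eq(5)[OF c c' q] Tfun_rho[OF U(2), of \<sigma>] J
    by (simp add: pt_def)
  then have "jac_factor c c' q * tau c' ?q' x' = (\<Sum>\<sigma>\<in>UNIV. cmp c' (Inr \<sigma>) ?z' * cform \<sigma> ?q' x')"
    using J0 by (simp add: tau_def sum_distrib_left)
  also have "\<dots> = (\<Sum>B\<in>UNIV. cmp c' B ?z' * xy_part x' $ B)"
    using sum_cform[OF U(2), of x'] qtrans_eq(1)[OF c c' q] by simp
  also have "\<dots> = (\<Sum>B\<in>UNIV. \<Sum>A\<in>UNIV. cmp c' B ?z' * (xy_part x $ A * dtrans c c' (?\<gamma> 0) (axis A 1) $ B))"
    unfolding x' linear_axes[OF lin, of "xy_part x"] by (simp add: sum_distrib_left)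
  also have "\<dots> = (\<Sum>A\<in>UNIV. cmp c A (crd c ?\<gamma> 0) * xy_part x $ A)"
    unfolding comp_change_chart[OF de U(1,2)] sum_distrib_right by (subst sum.swap) (simp add: mult_ac)
  also have "\<dots> = (\<Sum>\<sigma>\<in>UNIV. cmp c (Inr \<sigma>) ?z * cform \<sigma> q x)"
    using sum_cform[OF U(1), of x] U(3,4) by simp
  finally show ?thesis by (simp add: tau_def Tq_def)
qed

text \<open>In \<open>c\<close> the tangent vectors of the graph are the frame itself, so their
  images in \<open>c'\<close> relate the two frames by the new x-matrix of the same
  velocity.\<close>

lemma frame_form_change:
  assumes c: "c \<in> \<A>" and c': "c' \<in> \<A>" and q: "q \<in> overlap c c'"
    and x': "xy_part x' = dtrans c c' (gvel c q 0) (xy_part x)"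
  shows "frame_form c' j (qtrans c c' q) (\<lambda>_. x')
    = (\<Sum>i\<in>UNIV. (\<chi> i j. x_matrix (crd c' (gvel c q) 0) $ j $ i) $ i $ j * frame_form c i q (\<lambda>_. x))"
proof -
  obtain U U' where U: "adapted_rep c (gvel c q) U" "adapted_rep c' (gvel c q) U'"
    "crd c (gvel c q) 0 = graph_jet q" "qcoords (crd c (gvel c q) 0) = q" "snd c (gvel c q 0) = xy_part q"
    using overlapE[OF c c' q] by metis
  let ?\<gamma> = "gvel c q"
  let ?X = "x_matrix (crd c' ?\<gamma> 0)"
  let ?A = "\<chi> i j. ?X $ j $ i"
  note rep = adapted_repD(1)[OF U(1)] and rep' = adapted_repD(1)[OF U(2)]
  note r = repD[OF rep] and r' = repD[OF rep']
  have q0: "q \<in> qdom c" using q overlap_qdom by blast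
  have xy': "xy_part (qtrans c c' q) = snd c' (?\<gamma> 0)" unfolding qtrans_eq(1)[OF c c' q] by (rule xy_part_qcoords)
  have "det ?A = det (transpose ?X)" by (simp add: transpose_def)
  then have A: "det ?A \<noteq> 0" using adapted_repD(2)[OF U(2)] by (simp add: x_regular_def det_transpose)
  have "tangent c ?\<gamma> i = frame q i" for i
  proof -
    have "x_matrix (crd c ?\<gamma> 0) = mat 1" by (simp add: U(3) graph_jet_def x_matrix_graph_map)
    then show ?thesis
      unfolding tangent_frame[OF U(1)] U(4) by (simp add: mat_def if_distrib[of "\<lambda>c. c *\<^sub>R _"] cong: if_cong)
  qed
  then have D: "dtrans c c' (?\<gamma> 0) (frame q i) = (\<Sum>k\<in>UNIV. ?A $ i $ k *\<^sub>R frame (qtrans c c' q) k)" for i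
    using tangent_change_chart[OF rep rep', of i] tangent_frame[OF U(2), of i] qtrans_eq(1)[OF c c' q] by simp
  show ?thesis
    unfolding frame_form_def x' xy'
    by (rule frame_coord_change[OF inner_prod_xy[OF c q0] inner_prod_metric[OF c'] linear_dtrans[OF c c' r(6) r'(6)] _ D A])
      (use metric_change[OF c c' r(6) r'(6)] U(5) r'(6) in auto)
qed

lemma omega_change:
  assumes c: "c \<in> \<A>" and c': "c' \<in> \<A>" and q: "q \<in> overlap c c'"
  shows "omega c q v = pull_form (qtrans c c') (omega c') q v"
proof -
  obtain U U' where U: "adapted_rep c (gvel c q) U" "adapted_rep c' (gvel c q) U'"
    "crd c (gvel c q) 0 = graph_jet q" "qcoords (crd c (gvel c q) 0) = q"
    using overlapE[OF c c' q] by metis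
  let ?D = "frechet_derivative (qtrans c c') (at q)" and ?A = "\<chi> i j. x_matrix (crd c' (gvel c q) 0) $ j $ i"
  note xy = qtrans_derivative[OF c c' q]
  have "det ?A = det (transpose (x_matrix (crd c' (gvel c q) 0)))" by (simp add: transpose_def)
  also have "\<dots> = jac_factor c c' q"
    using det_x_matrix_change[OF U(1) adapted_repD(1)[OF U(2)]] U(4)
    by (simp add: U(3) graph_jet_def x_matrix_graph_map det_I det_transpose)
  finally have J: "det ?A = jac_factor c c' q" .
  show ?thesis
    unfolding omega_def pull_form_def
  proof (rule wedge_scaled)
    show "tau_form c q w = jac_factor c c' q * tau_form c' (qtrans c c' q) (\<lambda>i. ?D (w i))" for w
      unfolding tau_form_def by (rule tau_change[OF c c' q xy])
    show "Theta c' (qtrans c c' q) (\<lambda>i. ?D (w i)) = jac_factor c c' q * Theta c q w" for w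
      unfolding Theta_def J[symmetric]
      by (rule wedge_list_one_change[OF indices]) (simp add: frame_form_def, simp add: frame_form_def,
          rule frame_form_change[OF c c' q xy])
  qed
qed

end

lemma wedge_scale_right: "wedge p r \<alpha> (\<lambda>z v. k z * \<beta> z v) z v = k z * wedge p r \<alpha> \<beta> z v"
  by (simp add: wedge_def sum_distrib_left mult_ac)

lemma smooth_form_subset: "smooth_form q S \<alpha> \<Longrightarrow> T \<subseteq> S \<Longrightarrow> smooth_form q T \<alpha>"
  unfolding smooth_form_iff using smooth_on_subset by blast

context homogeneous_equation
begin

text \<open>The differential of the i-th x-coordinate of the second chart, in the quotient
  coordinates of the first.\<close>

definition dx_form :: "('x, real^('n + 'm)) chart \<Rightarrow> ('x, real^('n + 'm)) chart \<Rightarrow> 'n \<Rightarrow>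
    (real^('n + 'm \<times> ('n, 's) midx)) eform" where
  "dx_form c c' i = (\<lambda>q v. frechet_derivative (transition c c') (at (xy_part q)) (xy_part (v 0)) $ Inl i)"

lemma linear_transition_derivative:
  assumes c: "c \<in> \<A>" and c': "c' \<in> \<A>" and q: "xy_part q \<in> snd c ` (fst c \<inter> fst c')"
  shows "linear (frechet_derivative (transition c c') (at (xy_part q)))"
proof -
  obtain p where p: "p \<in> fst c" "p \<in> fst c'" "xy_part q = snd c p" using xy_overlapE[OF q] .
  show ?thesis using linear_dtrans[OF c c' p(1,2)] by (simp add: dtrans_def p(3))
qed

lemma smooth_dx_form:
  assumes c: "c \<in> \<A>" and c': "c' \<in> \<A>"
  shows "smooth_form 1 (overlap c c') (dx_form c c' i)"
  unfolding dx_form_def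
proof (rule smooth_form_one[OF open_overlap_set(2)[OF c c']])
  show "linear (\<lambda>x. frechet_derivative (transition c c') (at (xy_part q)) (xy_part x) $ Inl i)"
    if "q \<in> overlap c c'" for q
  proof -
    have "linear (frechet_derivative (transition c c') (at (xy_part q)))"
      by (rule linear_transition_derivative[OF c c']) (use that in \<open>simp add: overlap_def\<close>)
    then have "linear (\<lambda>x. frechet_derivative (transition c c') (at (xy_part q)) (xy_part x))"
      using linear_compose[OF linear_xy_part] by (simp add: o_def)
    then show ?thesis
      using linear_compose[OF _ bounded_linear.linear[OF bounded_linear_vec_nth]] by (simp add: o_def)
  qed
  show "smooth_on (overlap c c') (\<lambda>q. frechet_derivative (transition c c') (at (xy_part q)) (xy_part x) $ Inl i)" for x
  proof (rule smooth_on_subset[OF smooth_on_nth[OF open_xy_overlap[OF c c']]])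
    show "smooth_on (xy_part -` (snd c ` (fst c \<inter> fst c')))
        (\<lambda>q :: real^('n + 'm \<times> ('n, 's) midx). frechet_derivative (transition c c') (at (xy_part q)) (xy_part x))"
      by (rule smooth_dtrans_xy[OF c c']) (rule smooth_on_const[OF open_xy_overlap[OF c c']])
  qed (auto simp: overlap_def)
qed

lemma pull_local_T:
  assumes c: "c \<in> \<A>" and c': "c' \<in> \<A>" and q: "q \<in> overlap c c'"
  shows "pull_form (qtrans c c') (local_T (qchart c') (Tfun c')) q v
    = inverse (jac_factor c c' q) * wedge 1 CARD('n) (tau_form c) (wedge_list 1 (map (dx_form c c') indices)) q v"
proof -
  obtain U where U: "snd c (gvel c q 0) = xy_part q" using overlapE[OF c c' q] by metis
  let ?D = "frechet_derivative (qtrans c c') (at q)" and ?\<Psi> = "wedge_list 1 (map (dx_form c c') indices)"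
  note xy = qtrans_derivative[OF c c' q]
  have J: "jac_factor c c' q \<noteq> 0" using q by (simp add: overlap_def)
  have \<theta>: "theta0 (qtrans c c' q) (\<lambda>i. ?D (w i)) = ?\<Psi> q w" for w
  proof -
    have "theta0 (qtrans c c' q) (\<lambda>i. ?D (w i)) = det (mat 1 :: real^'n::{finite,linorder}^'n::{finite,linorder}) * ?\<Psi> q w"
      unfolding theta0_indices
    proof (rule wedge_list_one_change[OF indices])
      fix j k
      have "?D (w k) $ Inl j = xy_part (?D (w k)) $ Inl j" by (simp add: xy_part_def)
      also have "\<dots> = dx_form c c' j q (\<lambda>_. w k)"
        unfolding xy by (simp add: dx_form_def dtrans_def U)
      finally show "dcoord (Inl j) (qtrans c c' q) (\<lambda>_. ?D (w k))
          = (\<Sum>i\<in>UNIV. (mat 1 :: real^'n::{finite,linorder}^'n::{finite,linorder}) $ i $ j * dx_form c c' i q (\<lambda>_. w k))"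
        by (simp add: dcoord_def mat_def if_distrib[of "\<lambda>c. c * _"] cong: if_cong)
    qed (simp_all add: dx_form_def dcoord_def)
    then show ?thesis by (simp add: det_I)
  qed
  have "pull_form (qtrans c c') (local_T (qchart c') (Tfun c')) q v
      = wedge 1 CARD('n) (tau_form c') theta0 (qtrans c c' q) (\<lambda>i. ?D (v i))"
    unfolding pull_form_def by (rule local_T_eq[OF c' qtrans_eq(4)[OF c c' q]])
  also have "\<dots> = wedge 1 CARD('n) (tau_form c) (\<lambda>q v. inverse (jac_factor c c' q) * ?\<Psi> q v) q v"
  proof (rule wedge_scaled[symmetric])
    show "tau_form c q w = jac_factor c c' q * tau_form c' (qtrans c c' q) (\<lambda>i. ?D (w i))" for w
      unfolding tau_form_def by (rule tau_change[OF c c' q xy])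
    show "theta0 (qtrans c c' q) (\<lambda>i. ?D (w i)) = jac_factor c c' q * (inverse (jac_factor c c' q) * ?\<Psi> q w)" for w
      using J \<theta> by simp
  qed
  finally show ?thesis by (simp only: wedge_scale_right)
qed

text \<open>On horizontal vectors dx'^j = (D_i x'^j) dx^i, so the pulled-back \<open>theta0\<close>
  is \<open>jac_factor\<close> times the original. This cancels the inverse factor that comes with
  T_\<sigma>, and the criterion applies to the difference.\<close>

lemma local_T_overlap:
  assumes c: "c \<in> \<A>" and c': "c' \<in> \<A>"
  shows "strongly_contact (CARD('n) + 1) (overlap c c')
    (\<lambda>q v. local_T (qchart c) (Tfun c) q v - pull_form (qtrans c c') (local_T (qchart c') (Tfun c')) q v)"
proof -
  note op = open_overlap_set(2)[OF c c']
  have tau: "smooth_form 1 (overlap c c') (tau_form c)"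
    by (rule smooth_form_subset[OF smooth_tau_form[OF c] overlap_qdom])
  note th0 = smooth_wedge_one[OF op tau smooth_dcoord[OF op] indices, of Inl, folded theta0_indices]
  let ?\<Psi> = "wedge_list 1 (map (dx_form c c') indices)"
  note th = smooth_wedge_one[OF op tau smooth_dx_form[OF c c'] indices]
  have J0: "jac_factor c c' q \<noteq> 0" if "q \<in> overlap c c'" for q :: "real^('n + 'm \<times> ('n, 's) midx)"
    using that by (simp add: overlap_def)
  have "smooth_on (overlap c c') (jac_factor c c')"
    by (rule smooth_on_subset[OF open_overlap_set(1)[OF c c']]) (auto simp: overlap_def)
  then have "smooth_on (overlap c c') (\<lambda>q. inverse (jac_factor c c' q))"
    by (rule smooth_on_inverse[OF op _ J0])
  note sm = smooth_form_diff[OF op th0(1) smooth_form_scale[OF op this th(1)]]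
  have "strongly_contact (CARD('n) + 1) (overlap c c') (\<lambda>q v. wedge 1 CARD('n) (tau_form c) theta0 q v
      - inverse (jac_factor c c' q) * wedge 1 CARD('n) (tau_form c) ?\<Psi> q v)"
  proof (rule strongly_contact_criterion[OF op sm])
    fix q :: "real^('n + 'm \<times> ('n, 's) midx)" and v :: "nat \<Rightarrow> real^('n + 'm \<times> ('n, 's) midx)"
    assume q: "q \<in> overlap c c'" and hor: "\<And>i \<sigma>. 0 < i \<Longrightarrow> cform \<sigma> q (v i) = 0"
    have alt: "alt_map CARD('n) (?\<Psi> q)" "alt_map CARD('n) (theta0 q)"
      using th(2) th0(2) q by (simp_all add: smooth_form_iff)
    have xy: "xy_part q \<in> snd c ` (fst c \<inter> fst c')" using q by (simp add: overlap_def)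
    let ?L = "frechet_derivative (transition c c') (at (xy_part q))"
    note lin = linear_transition_derivative[OF c c' xy]
    have "?\<Psi> q (\<lambda>i. v (Suc i)) = jac_factor c c' q * theta0 q (\<lambda>i. v (Suc i))"
      unfolding theta0_indices jac_factor_det[OF c c' xy]
    proof (rule wedge_list_one_change[OF indices])
      fix j k
      have "xy_part (v (Suc k)) = (\<Sum>i\<in>UNIV. v (Suc k) $ Inl i *\<^sub>R frame q i)"
        by (rule horizontal_xy_part) (simp add: hor)
      then show "dx_form c c' j q (\<lambda>_. v (Suc k))
          = (\<Sum>i\<in>UNIV. (\<chi> i j. ?L (frame q i) $ Inl j) $ i $ j * dcoord (Inl i) q (\<lambda>_. v (Suc k)))"
        by (simp add: dx_form_def dcoord_def linear_sum[OF lin] linear_cmul[OF lin] mult.commute)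
    qed (simp_all add: dx_form_def dcoord_def)
    moreover have "wedge 1 CARD('n) (tau_form c) ?\<Psi> q v = tau_form c q (\<lambda>_. v 0) * ?\<Psi> q (\<lambda>i. v (Suc i))"
      by (rule wedge_horizontal[where B = ?\<Psi>, OF alt(1)]) (simp_all add: tau_form_def hor tau_horizontal)
    moreover have "wedge 1 CARD('n) (tau_form c) theta0 q v = tau_form c q (\<lambda>_. v 0) * theta0 q (\<lambda>i. v (Suc i))"
      by (rule wedge_horizontal[where B = theta0, OF alt(2)]) (simp_all add: tau_form_def hor tau_horizontal)
    ultimately show "wedge 1 CARD('n) (tau_form c) theta0 q v
        - inverse (jac_factor c c' q) * wedge 1 CARD('n) (tau_form c) ?\<Psi> q v = 0"
      using J0[OF q] by simp
  qed
  then show ?thesis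
  proof (rule strongly_contact_cong)
    fix q :: "real^('n + 'm \<times> ('n, 's) midx)" and v :: "nat \<Rightarrow> real^('n + 'm \<times> ('n, 's) midx)"
    assume q: "q \<in> overlap c c'"
    then show "wedge 1 CARD('n) (tau_form c) theta0 q v
        - inverse (jac_factor c c' q) * wedge 1 CARD('n) (tau_form c) ?\<Psi> q v
        = local_T (qchart c) (Tfun c) q v - pull_form (qtrans c c') (local_T (qchart c') (Tfun c')) q v"
      using local_T_eq[OF c subsetD[OF overlap_qdom q]] pull_local_T[OF c c' q] by simp
  qed
qed

subsection \<open>The class of the global form\<close>

text \<open>Forms are indexed by charts of the quotient, while \<open>omega\<close> depends on a
  chart of \<open>X\<close>; a chart inducing the given one is chosen, and
  \<open>Omega_qchart\<close> removes the choice.\<close>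

definition Omega :: "(('n, 'x) velocity set, real^('n + 'm \<times> ('n, 's) midx)) mform" where
  "Omega d = omega (SOME c. c \<in> \<A> \<and> qchart c = d)"

lemma quot_atlas_eq: "quot_atlas TYPE('s) \<A> = qchart ` \<A>"
  by (simp add: quot_atlas_def qchart_def)

lemma qdom_overlap: "c \<in> \<A> \<Longrightarrow> q \<in> qdom c \<Longrightarrow> pt c q \<in> fst (qchart c') \<Longrightarrow> c' \<in> \<A> \<Longrightarrow> q \<in> overlap c c'"
  using qchart_common[of c c' "pt c q"] qchart_pt(1,2)[of c q] by metis

text \<open>Two charts of \<open>X\<close> that induce the same chart are related by a
  \<open>qtrans\<close> equal to the identity, so \<open>omega_change\<close> equates their
  forms.\<close>

lemma Omega_qchart:
  assumes c: "c \<in> \<A>" and q: "q \<in> qdom c"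
  shows "Omega (qchart c) q v = omega c q v"
proof -
  define c0 where "c0 = (SOME c'. c' \<in> \<A> \<and> qchart c' = qchart c)"
  have "c0 \<in> \<A> \<and> qchart c0 = qchart c"
    unfolding c0_def by (rule someI[of _ c]) (simp add: c)
  then have c0: "c0 \<in> \<A>" "qchart c0 = qchart c" by auto
  have qo: "q \<in> overlap c c0"
    by (rule qdom_overlap[OF c q _ c0(1)]) (simp add: c0(2) qchart_pt[OF c q])
  have id: "qtrans c c0 q = q" if "q \<in> qdom c" for q
    by (simp add: qtrans_def transition_def c0(2) qchart_pt[OF c that])
  have "((\<lambda>q. q) has_derivative (\<lambda>x. x)) (at q)" by simp
  then have "(qtrans c c0 has_derivative (\<lambda>x. x)) (at q)"
    by (rule has_derivative_transform_within_open[OF _ open_qdom[OF c] q]) (rule id[symmetric])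
  then have "frechet_derivative (qtrans c c0) (at q) = (\<lambda>x. x)"
    using frechet_derivative_at by metis
  then have "omega c q v = omega c0 q v"
    unfolding omega_change[OF c c0(1) qo] by (simp add: pull_form_def id[OF q])
  then show ?thesis by (simp add: Omega_def c0_def)
qed

lemma Omega_mform: "Omega \<in> mforms (quot_atlas TYPE('s) \<A>) (CARD('n) + 1)"
  unfolding mforms_def quot_atlas_eq
proof (intro CollectI conjI ballI)
  fix d assume "d \<in> qchart ` \<A>"
  then obtain c where c: "c \<in> \<A>" "d = qchart c" by blast
  show "smooth_form (CARD('n) + 1) (snd d ` fst d) (Omega d)"
    unfolding c(2) qdom_eq[OF c(1)]
    by (rule smooth_form_cong[OF open_qdom smooth_omega]) (simp_all add: c(1) Omega_qchart)
next
  show "is_pullback (qchart ` \<A>) (qchart ` \<A>) id Omega Omega"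
    unfolding is_pullback_def
  proof (intro ballI impI)
    fix d d' p assume "d \<in> qchart ` \<A>" "d' \<in> qchart ` \<A>" and p: "p \<in> fst d" "id p \<in> fst d'"
    then obtain c c' where c: "c \<in> \<A>" "d = qchart c" and c': "c' \<in> \<A>" "d' = qchart c'" by blast
    obtain q where q: "q \<in> overlap c c'" "p = pt c q" "snd (qchart c) p = q"
      by (rule qchart_common[OF c(1) c'(1), of p]) (use p c(2) c'(2) in auto)
    have "snd d' \<circ> id \<circ> inv_into (fst d) (snd d) = qtrans c c'"
      by (simp add: qtrans_def transition_def c(2) c'(2))
    moreover have "Omega d (snd d p) v = pull_form (qtrans c c') (Omega d') (snd d p) v" for v
      unfolding c(2) c'(2) q(3) Omega_qchart[OF c(1) subsetD[OF overlap_qdom q(1)]] omega_change[OF c(1) c'(1) q(1)]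
      by (simp add: pull_form_def Omega_qchart[OF c'(1) qtrans_eq(4)[OF c(1) c'(1) q(1)]])
    ultimately show "Omega d (snd d p) = pull_form (snd d' \<circ> id \<circ> inv_into (fst d) (snd d)) (Omega d') (snd d p)"
      by (intro ext) simp
  qed
qed

lemma open_quot_chart: "d \<in> quot_atlas TYPE('s) \<A> \<Longrightarrow> open (snd d ` fst d)"
  by (auto simp: quot_atlas_eq qdom_eq open_qdom)

lemma mforms_diff:
  assumes "\<omega> \<in> mforms (quot_atlas TYPE('s) \<A>) k" "\<eta> \<in> mforms (quot_atlas TYPE('s) \<A>) k"
  shows "(\<lambda>d z v. \<omega> d z v - \<eta> d z v) \<in> mforms (quot_atlas TYPE('s) \<A>) k"
  unfolding mforms_def
proof (intro CollectI conjI ballI)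
  fix d assume d: "d \<in> quot_atlas TYPE('s) \<A>"
  show "smooth_form k (snd d ` fst d) (\<lambda>z v. \<omega> d z v - \<eta> d z v)"
    by (rule smooth_form_diff[OF open_quot_chart[OF d]]) (use assms d in \<open>auto simp: mforms_def\<close>)
next
  show "is_pullback (quot_atlas TYPE('s) \<A>) (quot_atlas TYPE('s) \<A>) id
      (\<lambda>d z v. \<omega> d z v - \<eta> d z v) (\<lambda>d z v. \<omega> d z v - \<eta> d z v)"
    using assms unfolding mforms_def is_pullback_def by (auto simp: fun_eq_iff pull_form_def)
qed

text \<open>Differences of global forms are global forms, so membership in
  \<open>contact_forms\<close> reduces to a condition in each chart.\<close>

lemma contact_rel_iff:
  "(\<omega>, \<eta>) \<in> contact_rel TYPE('s) \<A> k \<longleftrightarrow>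
    \<omega> \<in> mforms (quot_atlas TYPE('s) \<A>) k \<and> \<eta> \<in> mforms (quot_atlas TYPE('s) \<A>) k \<and>
    (\<forall>d\<in>quot_atlas TYPE('s) \<A>. strongly_contact k (snd d ` fst d) (\<lambda>z v. \<omega> d z v - \<eta> d z v))"
  unfolding contact_rel_def contact_forms_def using mforms_diff by blast

lemma equiv_contact_rel: "equiv (mforms (quot_atlas TYPE('s) \<A>) k) (contact_rel TYPE('s) \<A> k)"
proof (rule equivI)
  show "contact_rel TYPE('s) \<A> k \<subseteq> mforms (quot_atlas TYPE('s) \<A>) k \<times> mforms (quot_atlas TYPE('s) \<A>) k"
    by (auto simp: contact_rel_iff)
  show "refl_on (mforms (quot_atlas TYPE('s) \<A>) k) (contact_rel TYPE('s) \<A> k)"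
    by (auto simp: refl_on_def contact_rel_iff strongly_contact_zero)
  show "sym (contact_rel TYPE('s) \<A> k)"
  proof (rule symI)
    fix \<omega> \<eta> assume r: "(\<omega>, \<eta>) \<in> contact_rel TYPE('s) \<A> k"
    have "strongly_contact k (snd d ` fst d) (\<lambda>z v. \<eta> d z v - \<omega> d z v)" if d: "d \<in> quot_atlas TYPE('s) \<A>" for d
    proof (rule strongly_contact_cong)
      show "strongly_contact k (snd d ` fst d) (\<lambda>z v. - (\<omega> d z v - \<eta> d z v))"
        by (rule strongly_contact_minus[OF open_quot_chart[OF d]]) (use r d in \<open>simp add: contact_rel_iff\<close>)
    qed simp
    then show "(\<eta>, \<omega>) \<in> contact_rel TYPE('s) \<A> k" using r by (simp add: contact_rel_iff)
  qed
  show "trans (contact_rel TYPE('s) \<A> k)"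
  proof (rule transI)
    fix \<omega> \<eta> \<zeta> assume r: "(\<omega>, \<eta>) \<in> contact_rel TYPE('s) \<A> k" "(\<eta>, \<zeta>) \<in> contact_rel TYPE('s) \<A> k"
    have "strongly_contact k (snd d ` fst d) (\<lambda>z v. \<omega> d z v - \<zeta> d z v)" if d: "d \<in> quot_atlas TYPE('s) \<A>" for d
    proof (rule strongly_contact_cong)
      show "strongly_contact k (snd d ` fst d) (\<lambda>z v. (\<omega> d z v - \<eta> d z v) + (\<eta> d z v - \<zeta> d z v))"
        by (rule strongly_contact_add) (use r d in \<open>simp_all add: contact_rel_iff\<close>)
    qed simp
    then show "(\<omega>, \<zeta>) \<in> contact_rel TYPE('s) \<A> k" using r by (simp add: contact_rel_iff)
  qed
qed

definition represents :: "(('n, 'x) velocity set, real^('n + 'm \<times> ('n, 's) midx)) mform \<Rightarrow> bool" where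
  "represents \<omega> \<longleftrightarrow> (\<forall>c\<in>\<A>. strongly_contact (CARD('n) + 1) (snd (qchart c) ` fst (qchart c))
     (\<lambda>z v. \<omega> (qchart c) z v - local_T (qchart c) (Tfun c) z v))"

lemma represents_Omega: "represents Omega"
  unfolding represents_def
proof (intro ballI)
  fix c assume c: "c \<in> \<A>"
  show "strongly_contact (CARD('n) + 1) (snd (qchart c) ` fst (qchart c))
     (\<lambda>z v. Omega (qchart c) z v - local_T (qchart c) (Tfun c) z v)"
    unfolding qdom_eq[OF c]
    by (rule strongly_contact_cong[OF omega_local_T[OF c]]) (simp add: Omega_qchart[OF c])
qed

lemma represents_iff:
  assumes "\<omega> \<in> mforms (quot_atlas TYPE('s) \<A>) (CARD('n) + 1)" "\<eta> \<in> mforms (quot_atlas TYPE('s) \<A>) (CARD('n) + 1)"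
    "represents \<omega>"
  shows "represents \<eta> \<longleftrightarrow> (\<omega>, \<eta>) \<in> contact_rel TYPE('s) \<A> (CARD('n) + 1)"
proof
  assume r: "represents \<eta>"
  have "strongly_contact (CARD('n) + 1) (snd (qchart c) ` fst (qchart c)) (\<lambda>z v. \<omega> (qchart c) z v - \<eta> (qchart c) z v)"
    if c: "c \<in> \<A>" for c
  proof (rule strongly_contact_cong)
    have "open (snd (qchart c) ` fst (qchart c))" by (simp add: qdom_eq[OF c] open_qdom[OF c])
    then show "strongly_contact (CARD('n) + 1) (snd (qchart c) ` fst (qchart c))
       (\<lambda>z v. (\<omega> (qchart c) z v - local_T (qchart c) (Tfun c) z v)
          + - (\<eta> (qchart c) z v - local_T (qchart c) (Tfun c) z v))"
      by (intro strongly_contact_add strongly_contact_minus) (use assms(3) r c in \<open>auto simp: represents_def\<close>)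
  qed simp
  then show "(\<omega>, \<eta>) \<in> contact_rel TYPE('s) \<A> (CARD('n) + 1)"
    using assms(1,2) by (simp add: contact_rel_iff quot_atlas_eq)
next
  assume r: "(\<omega>, \<eta>) \<in> contact_rel TYPE('s) \<A> (CARD('n) + 1)"
  show "represents \<eta>"
    unfolding represents_def
  proof (intro ballI, rule strongly_contact_cong)
    fix c assume c: "c \<in> \<A>"
    have "open (snd (qchart c) ` fst (qchart c))" by (simp add: qdom_eq[OF c] open_qdom[OF c])
    then show "strongly_contact (CARD('n) + 1) (snd (qchart c) ` fst (qchart c))
       (\<lambda>z v. (\<omega> (qchart c) z v - local_T (qchart c) (Tfun c) z v) + - (\<omega> (qchart c) z v - \<eta> (qchart c) z v))"
      by (intro strongly_contact_add strongly_contact_minus)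
        (use assms(3) r c in \<open>auto simp: represents_def contact_rel_iff quot_atlas_eq\<close>)
  qed simp
qed

text \<open>By \<open>represents_iff\<close>, being locally T_\<sigma> \<omega>^\<sigma> \<and>
  \<theta>_0 up to contact forms is a property of classes, and any two forms with it are equivalent;
  \<open>Omega\<close> provides existence.\<close>

lemma global_class:
  "\<exists>!C. C \<in> mforms (quot_atlas TYPE('s) \<A>) (CARD('n) + 1) // contact_rel TYPE('s) \<A> (CARD('n) + 1)
    \<and> (\<forall>\<omega>\<in>C. represents \<omega>)"
proof -
  let ?M = "mforms (quot_atlas TYPE('s) \<A>) (CARD('n) + 1)" and ?R = "contact_rel TYPE('s) \<A> (CARD('n) + 1)"
  note eq = equiv_contact_rel[of "CARD('n) + 1"]
  show ?thesis
  proof (rule ex1I)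
    have "represents \<eta>" if "(Omega, \<eta>) \<in> ?R" for \<eta>
    proof -
      have "\<eta> \<in> ?M" using that unfolding contact_rel_iff by blast
      then show ?thesis using represents_iff[OF Omega_mform _ represents_Omega] that by blast
    qed
    then show "?R `` {Omega} \<in> ?M // ?R \<and> (\<forall>\<omega>\<in>?R `` {Omega}. represents \<omega>)"
      using quotientI[OF Omega_mform] by blast
  next
    fix C assume C: "C \<in> ?M // ?R \<and> (\<forall>\<omega>\<in>C. represents \<omega>)"
    then obtain \<omega> where \<omega>: "\<omega> \<in> ?M" "C = ?R `` {\<omega>}" by (auto elim: quotientE)
    have "represents \<omega>" using C equiv_class_self[OF eq \<omega>(1)] \<omega>(2) by blast
    then have "(Omega, \<omega>) \<in> ?R" using represents_iff[OF Omega_mform \<omega>(1) represents_Omega] by blast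
    then show "C = ?R `` {Omega}" unfolding \<omega>(2) by (rule equiv_class_eq[OF eq, symmetric])
  qed
qed

subsection \<open>The components\<close>

lemma smooth_Tfun:
  assumes "c \<in> \<A>"
  shows "smooth_fun_on (qchart c) (Tfun c \<sigma>)"
  unfolding smooth_fun_on_def qdom_eq[OF assms]
  by (rule smooth_on_cong[OF open_qdom smooth_Tq]) (simp_all add: assms qchart_pt Tfun_pt)

lemma components_Tfun:
  assumes c: "c \<in> \<A>" and v: "v \<in> adapted \<A> CARD('s) c"
  shows "component \<T> (vchart c) (Inr \<sigma>) (snd (vchart c) v) = det_x (snd c) v * Tfun c \<sigma> (rho \<A> CARD('s) v)"
    and "component \<T> (vchart c) (Inl i) (snd (vchart c) v) = - det_x (snd c) v *
      (\<Sum>\<sigma>\<in>UNIV. y_first (snd (qchart c) (rho \<A> CARD('s) v)) \<sigma> i * Tfun c \<sigma> (rho \<A> CARD('s) v))"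
proof -
  obtain \<gamma> U where \<gamma>: "v = jet \<A> CARD('s) \<gamma>" "adapted_rep c \<gamma> U" using adaptedE[OF v c] .
  note rep = adapted_repD(1)[OF \<gamma>(2)]
  have d: "det_x (snd c) v = det (x_matrix (crd c \<gamma> 0))"
    unfolding \<gamma>(1) by (rule det_x_jet[OF rep_germ[OF rep] c repD(6)[OF rep]])
  have d0: "det (x_matrix (crd c \<gamma> 0)) \<noteq> 0" using adapted_repD(2)[OF \<gamma>(2)] by (simp add: x_regular_def)
  have z: "snd (vchart c) v = crd c \<gamma> 0" unfolding \<gamma>(1) by (rule vchart_adapted(2)[OF \<gamma>(2)])
  have T: "det_x (snd c) v * Tfun c \<sigma> (rho \<A> CARD('s) v) = cmp c (Inr \<sigma>) (crd c \<gamma> 0)" for \<sigma>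
    unfolding d unfolding \<gamma>(1) Tfun_rho[OF \<gamma>(2)] using d0 by simp
  then show "component \<T> (vchart c) (Inr \<sigma>) (snd (vchart c) v) = det_x (snd c) v * Tfun c \<sigma> (rho \<A> CARD('s) v)"
    by (simp add: comp_def z)
  have q: "snd (qchart c) (rho \<A> CARD('s) v) = qcoords (crd c \<gamma> 0)"
    unfolding \<gamma>(1) by (rule snd_qchart_rho[OF \<gamma>(2)])
  have "component \<T> (vchart c) (Inl i) (snd (vchart c) v) = cmp c (Inl i) (crd c \<gamma> 0)"
    by (simp add: comp_def z)
  also have "\<dots> = - (\<Sum>\<sigma>\<in>UNIV. y_first (qcoords (crd c \<gamma> 0)) \<sigma> i * (det_x (snd c) v * Tfun c \<sigma> (rho \<A> CARD('s) v)))"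
    unfolding T by (rule comp_Inl[OF \<gamma>(2)])
  finally show "component \<T> (vchart c) (Inl i) (snd (vchart c) v) = - det_x (snd c) v *
      (\<Sum>\<sigma>\<in>UNIV. y_first (snd (qchart c) (rho \<A> CARD('s) v)) \<sigma> i * Tfun c \<sigma> (rho \<A> CARD('s) v))"
    by (simp add: q sum_distrib_left sum_negf mult_ac)
qed

lemma transformation_Tfun:
  assumes c: "c \<in> \<A>" and c': "c' \<in> \<A>"
    and p: "p \<in> rho \<A> CARD('s) ` (adapted \<A> CARD('s) c \<inter> adapted \<A> CARD('s) c')"
  shows "Tfun c \<sigma> p = jac_factor c c' (snd (qchart c) p) *
    (\<Sum>\<nu>\<in>UNIV. P_factor c c' \<nu> \<sigma> (snd (qchart c) p) (snd (qchart c') p) * Tfun c' \<nu> p)"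
proof -
  obtain v where v: "p = rho \<A> CARD('s) v" "v \<in> adapted \<A> CARD('s) c" "v \<in> adapted \<A> CARD('s) c'" using p by blast
  obtain \<gamma> U where \<gamma>: "v = jet \<A> CARD('s) \<gamma>" "adapted_rep c \<gamma> U" using adaptedE[OF v(2) c] .
  obtain V where "adapted_rep c' \<gamma> V"
    using adapted_rep_change_chart[OF \<gamma>(2) c'] v(3) \<gamma>(1) by blast
  then show ?thesis unfolding v(1) \<gamma>(1) by (rule Tfun_change_chart[OF \<gamma>(2)])
qed

end

theorem theorem3p15:
  fixes \<A> :: "('x::{t2_space,second_countable_topology},
                real^('n::{finite,linorder} + 'm::finite)) chart set"
    and \<T> :: "(('n, 'x) velocity, real^(('n + 'm) \<times> ('n, 's::finite) midx)) mform"
  assumes "smooth_structure \<A>"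
    and "differential_equation \<A> \<T>"
    and "homogeneous \<A> \<T>"
  shows
    "\<exists>T :: ('x, real^('n + 'm)) chart \<Rightarrow> 'm \<Rightarrow> ('n, 'x) velocity set \<Rightarrow> real.
       (\<forall>c\<in>\<A>.
          (\<forall>\<sigma>. smooth_fun_on (quot_chart TYPE('s) \<A> c) (T c \<sigma>)) \<and>
          (\<forall>v\<in>adapted \<A> CARD('s) c.
             (\<forall>\<sigma>. component \<T> (vel_chart \<A> c) (Inr \<sigma>) (snd (vel_chart \<A> c) v)
                = det_x (snd c) v * T c \<sigma> (rho \<A> CARD('s) v)) \<and>
             (\<forall>i. component \<T> (vel_chart \<A> c) (Inl i) (snd (vel_chart \<A> c) v)
                = - det_x (snd c) v *
                    (\<Sum>\<sigma>\<in>UNIV. y_first (snd (quot_chart TYPE('s) \<A> c) (rho \<A> CARD('s) v)) \<sigma> i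
                               * T c \<sigma> (rho \<A> CARD('s) v))))) \<and>
       (\<forall>c\<in>\<A>. \<forall>c'\<in>\<A>.
          (\<forall>p\<in>rho \<A> CARD('s) ` (adapted \<A> CARD('s) c \<inter> adapted \<A> CARD('s) c'). \<forall>\<sigma>.
             T c \<sigma> p = jac_factor c c' (snd (quot_chart TYPE('s) \<A> c) p) *
               (\<Sum>\<nu>\<in>UNIV. P_factor c c' \<nu> \<sigma> (snd (quot_chart TYPE('s) \<A> c) p)
                             (snd (quot_chart TYPE('s) \<A> c') p) * T c' \<nu> p)) \<and>
          strongly_contact (CARD('n) + 1)
            (snd (quot_chart TYPE('s) \<A> c) `
               rho \<A> CARD('s) ` (adapted \<A> CARD('s) c \<inter> adapted \<A> CARD('s) c'))
            (\<lambda>z v. local_T (quot_chart TYPE('s) \<A> c) (T c) z v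
               - pull_form (transition (quot_chart TYPE('s) \<A> c) (quot_chart TYPE('s) \<A> c'))
                   (local_T (quot_chart TYPE('s) \<A> c') (T c')) z v)) \<and>
       (\<exists>!C. C \<in> mforms (quot_atlas TYPE('s) \<A>) (CARD('n) + 1)
                   // contact_rel TYPE('s) \<A> (CARD('n) + 1) \<and>
          (\<forall>\<omega>\<in>C. \<forall>c\<in>\<A>. strongly_contact (CARD('n) + 1)
             (snd (quot_chart TYPE('s) \<A> c) ` fst (quot_chart TYPE('s) \<A> c))
             (\<lambda>z v. \<omega> (quot_chart TYPE('s) \<A> c) z v - local_T (quot_chart TYPE('s) \<A> c) (T c) z v)))"
proof -
  interpret homogeneous_equation \<A> "TYPE('s)" \<T>
    using assms by unfold_locales
  show ?thesis
  proof (intro exI[of _ Tfun] conjI ballI allI)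
    fix c assume c: "c \<in> \<A>"
    show "smooth_fun_on (quot_chart TYPE('s) \<A> c) (Tfun c \<sigma>)" for \<sigma>
      using smooth_Tfun[OF c] by (simp add: qchart_def)
    fix v assume v: "v \<in> adapted \<A> CARD('s) c"
    show "component \<T> (vel_chart \<A> c) (Inr \<sigma>) (snd (vel_chart \<A> c) v)
        = det_x (snd c) v * Tfun c \<sigma> (rho \<A> CARD('s) v)" for \<sigma>
      using components_Tfun(1)[OF c v] by (simp add: vchart_def)
    show "component \<T> (vel_chart \<A> c) (Inl i) (snd (vel_chart \<A> c) v)
        = - det_x (snd c) v * (\<Sum>\<sigma>\<in>UNIV. y_first (snd (quot_chart TYPE('s) \<A> c) (rho \<A> CARD('s) v)) \<sigma> i
            * Tfun c \<sigma> (rho \<A> CARD('s) v))" for i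
      using components_Tfun(2)[OF c v] by (simp add: vchart_def qchart_def)
  next
    fix c c' assume c: "c \<in> \<A>" and c': "c' \<in> \<A>"
    show "Tfun c \<sigma> p = jac_factor c c' (snd (quot_chart TYPE('s) \<A> c) p) *
        (\<Sum>\<nu>\<in>UNIV. P_factor c c' \<nu> \<sigma> (snd (quot_chart TYPE('s) \<A> c) p)
          (snd (quot_chart TYPE('s) \<A> c') p) * Tfun c' \<nu> p)"
      if "p \<in> rho \<A> CARD('s) ` (adapted \<A> CARD('s) c \<inter> adapted \<A> CARD('s) c')" for p \<sigma>
      using transformation_Tfun[OF c c' that] by (simp add: qchart_def)
    show "strongly_contact (CARD('n) + 1)
        (snd (quot_chart TYPE('s) \<A> c) ` rho \<A> CARD('s) ` (adapted \<A> CARD('s) c \<inter> adapted \<A> CARD('s) c'))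
        (\<lambda>z v. local_T (quot_chart TYPE('s) \<A> c) (Tfun c) z v
           - pull_form (transition (quot_chart TYPE('s) \<A> c) (quot_chart TYPE('s) \<A> c'))
               (local_T (quot_chart TYPE('s) \<A> c') (Tfun c')) z v)"
      using local_T_overlap[OF c c'] unfolding overlap_image[OF c c', symmetric] qtrans_def qchart_def .
  next
    show "\<exists>!C. C \<in> mforms (quot_atlas TYPE('s) \<A>) (CARD('n) + 1) // contact_rel TYPE('s) \<A> (CARD('n) + 1) \<and>
        (\<forall>\<omega>\<in>C. \<forall>c\<in>\<A>. strongly_contact (CARD('n) + 1)
           (snd (quot_chart TYPE('s) \<A> c) ` fst (quot_chart TYPE('s) \<A> c))
           (\<lambda>z v. \<omega> (quot_chart TYPE('s) \<A> c) z v - local_T (quot_chart TYPE('s) \<A> c) (Tfun c) z v))"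
      using global_class unfolding represents_def qchart_def .
  qed
qed

end
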